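(* Let $\Gamma$ be a graph of girth at least $5$ on $25$ vertices with $57$ edges. Then $(\delta,\Delta)=(3,5)$, $(4,5)$ or $(4,6)$. If $(\delta,\Delta)=(3,5)$ or $(4,5)$, then either $\Gamma$ has an embedded $S_{5,[4,4,4,4,3]}$ star, or $\Gamma$ has no embedded $S_{5,[4,4,4,4,3]}$ star and has an embedded $S_{5,[4,4,4,3,3]}$ star. If $(\delta,\Delta)=(4,6)$, then $1\le deg_6\le 2$ and $\Gamma$ has an embedded $S_{6,[3,3,3,3,3,3]}$ star.
   Context: Graphs are finite and simple. A graph has girth at least $5$ if it contains no $3$-cycle and no $4$-cycle. $\delta$ and $\Delta$ denote the minimum and maximum degree of $\Gamma$, and $deg_i$ denotes the number of vertices of degree $i$. The maximum number of edges of a graph of girth at least $5$ on $25$ vertices is $57$. A graph $\Gamma$ of girth at least $5$ has an embedded $S_{D,[d_0-1,\ldots,d_{D-1}-1]}$ star if $\Gamma$ has a vertex of degree $D$ whose $D$ neighbours have degrees at least $d_0,\ldots,d_{D-1}$ respectively (for some ordering of the neighbours). *)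

theory Defs
  imports Main
begin

definition simple_graph :: "'a set \<Rightarrow> 'a set set \<Rightarrow> bool" where
  "simple_graph V E \<longleftrightarrow> finite V \<and> (\<forall>e\<in>E. e \<subseteq> V \<and> card e = 2)"

definition neighbours :: "'a set set \<Rightarrow> 'a \<Rightarrow> 'a set" where
  "neighbours E v = {w. {v, w} \<in> E}"

definition degree :: "'a set set \<Rightarrow> 'a \<Rightarrow> nat" where
  "degree E v = card (neighbours E v)"

definition min_degree :: "'a set \<Rightarrow> 'a set set \<Rightarrow> nat" where
  "min_degree V E = Min (degree E ` V)"

definition max_degree :: "'a set \<Rightarrow> 'a set set \<Rightarrow> nat" where
  "max_degree V E = Max (degree E ` V)"

definition deg_count :: "'a set \<Rightarrow> 'a set set \<Rightarrow> nat \<Rightarrow> nat" where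
  "deg_count V E i = card {v \<in> V. degree E v = i}"

text \<open>A cycle is given by the list of its vertices in cyclic order. The graph has no loops and
  no multiple edges, so a cycle has at least three vertices.\<close>

definition is_cycle :: "'a set set \<Rightarrow> 'a list \<Rightarrow> bool" where
  "is_cycle E c \<longleftrightarrow> length c \<ge> 3 \<and> distinct c \<and>
     (\<forall>i < length c. {c ! i, c ! (Suc i mod length c)} \<in> E)"

definition girth_at_least_5 :: "'a set set \<Rightarrow> bool" where
  "girth_at_least_5 E \<longleftrightarrow> \<not> (\<exists>c. is_cycle E c \<and> (length c = 3 \<or> length c = 4))"

text \<open>The entries of \<open>ks\<close> are the numbers \<open>d\<^sub>i - 1\<close>, so the required lower bound on the degree of
  the corresponding neighbour is one more than the entry. The list \<open>ns\<close> is the ordering of the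
  neighbours of the centre \<open>v\<close>, whose degree is exactly \<open>D\<close>.\<close>

definition has_star :: "'a set \<Rightarrow> 'a set set \<Rightarrow> nat \<Rightarrow> nat list \<Rightarrow> bool" where
  "has_star V E D ks \<longleftrightarrow> length ks = D \<and>
     (\<exists>v\<in>V. degree E v = D \<and>
       (\<exists>ns. distinct ns \<and> set ns = neighbours E v \<and>
         list_all2 (\<lambda>k w. degree E w \<ge> k + 1) ks ns))"

end

theory Submission
  imports Defs
begin

text \<open>In a graph of girth at least five the neighbourhoods of the neighbours of a vertex meet only in
  that vertex, so on \<open>n\<close> vertices the degrees of the neighbours sum to at most \<open>n - 1\<close>. Since graphs on
  fewer vertices have few edges (at most 54 on 24 vertices, 50 on 23 and so on), no set of vertices
  of small total degree can be deleted from a graph with 25 vertices and 57 edges. Both facts confine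
  the degrees to 3, 4, 5 and 6, and the hard part is to see that 3 and 6 do not occur together.

  Let \<open>v\<close> have degree three and \<open>x\<close> degree six. Then \<open>x\<close> is adjacent to \<open>v\<close>, and the other neighbours of
  \<open>x\<close> have degree four except for at most one vertex \<open>a\<close> of degree five. If \<open>a\<close> exists, then the 18
  vertices at distance two from \<open>x\<close> are the four children of \<open>a\<close> and a grid of 14 vertices, which the
  children of \<open>a\<close> colour. The degrees leave 22 colourings up to symmetry, and for each of them the
  conditions on the edges inside the grid are propositionally unsatisfiable. If no vertex of degree
  six has such a neighbour \<open>a\<close>, then exactly one vertex has distance three from \<open>x\<close>, and the number of
  vertices that are far from each other in the second neighbourhood of \<open>x\<close> is too restricted.

  The stars come from the vertices of degree four: if every vertex of degree five had at most two
  neighbours of degree five, then too many pairs of vertices of degree four would have a common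
  neighbour.\<close>

section \<open>Counting in graphs of girth five\<close>

text \<open>Every deletion argument is one inequality: \<open>es V + es S\<close> is at most twice
  the edge bound of the remaining graph plus twice the degree sum of \<open>S\<close>. It needs
  sharp bounds for fewer vertices. Averaging over single deletions yields many of them; for 11, 12,
  14, 16 and 20 to 23 vertices the graph with one edge more has to be excluded by its structure. The
  costly case is 51 edges on 23 vertices. There the 13 vertices of degree four induce a forest whose
  components are single vertices, edges, paths with three or four vertices and stars with three
  leaves, and the larger components cut the ten vertices of degree five into independent classes.

  For degrees three and six together such inequalities alone give no contradiction. In the case with
  a vertex at distance three, the 18 vertices outside \<open>x\<close> and its neighbours span 34
  edges, exactly the maximum; when no degree among them exceeds four, a single unit of slack
  remains, and its possible places are examined in turn.\<close>

locale girth5 =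
  fixes A :: "'a \<Rightarrow> 'a \<Rightarrow> bool"
  assumes adj_sym: "A x y \<Longrightarrow> A y x"
    and adj_irrefl: "\<not> A x x"
    and no_triangle: "A x y \<Longrightarrow> A y z \<Longrightarrow> A z x \<Longrightarrow> False"
    and common_unique: "A x u \<Longrightarrow> A x w \<Longrightarrow> A y u \<Longrightarrow> A y w \<Longrightarrow> x \<noteq> y \<Longrightarrow> u = w"
begin

definition nb :: "'a set \<Rightarrow> 'a \<Rightarrow> 'a set" where
  "nb S v = {w \<in> S. A v w}"

definition dg :: "'a set \<Rightarrow> 'a \<Rightarrow> nat" where
  "dg S v = card (nb S v)"

text \<open>\<open>es S\<close> counts every edge inside \<open>S\<close> twice, hence the factor 2 in \<open>bound\<close>.\<close>

definition es :: "'a set \<Rightarrow> nat" where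
  "es S = (\<Sum>v\<in>S. dg S v)"

definition far :: "'a set \<Rightarrow> 'a \<Rightarrow> 'a set" where
  "far S v = {w \<in> S. w \<noteq> v \<and> \<not> A v w \<and> (\<forall>u\<in>S. \<not> (A v u \<and> A u w))}"

definition bound :: "nat \<Rightarrow> nat \<Rightarrow> bool" where
  "bound n m \<longleftrightarrow> (\<forall>S. finite S \<longrightarrow> card S = n \<longrightarrow> es S \<le> 2 * m)"

lemma in_nb [simp]: "w \<in> nb S v \<longleftrightarrow> w \<in> S \<and> A v w"
  by (simp add: nb_def)

lemma adj_commute: "A x y \<longleftrightarrow> A y x"
  using adj_sym by blast

lemma adj_neq: "A x y \<Longrightarrow> x \<noteq> y"
  using adj_irrefl by auto

lemma nbs_nonadj: "A v x \<Longrightarrow> A v y \<Longrightarrow> \<not> A x y"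
  using no_triangle[of v x y] adj_sym by blast

lemma nbs_meet: "A v x \<Longrightarrow> A v y \<Longrightarrow> x \<noteq> y \<Longrightarrow> A x z \<Longrightarrow> A y z \<Longrightarrow> z = v"
  using common_unique[of x z v y] adj_sym by blast

lemma nb_subset: "nb S v \<subseteq> S"
  by auto

lemma finite_nb [simp]: "finite S \<Longrightarrow> finite (nb S v)"
  by (simp add: nb_def)

lemma nb_Un: "nb (S \<union> T) v = nb S v \<union> nb T v"
  by auto

lemma dg_Un: "finite S \<Longrightarrow> finite T \<Longrightarrow> S \<inter> T = {} \<Longrightarrow> dg (S \<union> T) v = dg S v + dg T v"
  unfolding dg_def nb_Un by (rule card_Un_disjoint) auto

lemma dg_split: "finite S \<Longrightarrow> T \<subseteq> S \<Longrightarrow> dg S v = dg T v + dg (S - T) v"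
  using dg_Un[of T "S - T" v] finite_subset[of T S] by (simp add: Un_absorb1)

lemma dg_mono: "finite T \<Longrightarrow> S \<subseteq> T \<Longrightarrow> dg S v \<le> dg T v"
  unfolding dg_def by (rule card_mono) auto

lemma dg_le: "finite S \<Longrightarrow> dg S v \<le> card S"
  unfolding dg_def by (rule card_mono) auto

lemma dg_empty [simp]: "dg {} v = 0"
  by (simp add: dg_def nb_def)

lemma dg_insert: "finite S \<Longrightarrow> x \<notin> S \<Longrightarrow> dg (insert x S) v = (if A v x then 1 else 0) + dg S v"
proof -
  assume f: "finite S" "x \<notin> S"
  have "nb (insert x S) v = (if A v x then insert x (nb S v) else nb S v)" by auto
  then show ?thesis using f by (simp add: dg_def)
qed

lemma dg_pos: "finite S \<Longrightarrow> 0 < dg S v \<longleftrightarrow> (\<exists>w\<in>S. A v w)"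
  by (auto simp: dg_def card_gt_0_iff)

lemma dg_eq_0: "finite S \<Longrightarrow> dg S v = 0 \<longleftrightarrow> (\<forall>w\<in>S. \<not> A v w)"
  by (auto simp: dg_def)

lemma dg_two: "w1 \<in> S \<Longrightarrow> w2 \<in> S \<Longrightarrow> w1 \<noteq> w2 \<Longrightarrow> A v w1 \<Longrightarrow> A v w2 \<Longrightarrow> finite S \<Longrightarrow> 2 \<le> dg S v"
proof -
  assume a: "w1 \<in> S" "w2 \<in> S" "w1 \<noteq> w2" "A v w1" "A v w2" "finite S"
  have "card {w1, w2} \<le> dg S v" unfolding dg_def using a by (intro card_mono) auto
  then show ?thesis using a by simp
qed

lemma dg_le_1: "finite S \<Longrightarrow> (\<And>w1 w2. w1 \<in> S \<Longrightarrow> w2 \<in> S \<Longrightarrow> A v w1 \<Longrightarrow> A v w2 \<Longrightarrow> w1 = w2) \<Longrightarrow> dg S v \<le> 1"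
  unfolding dg_def using card_le_Suc0_iff_eq[of "nb S v"] by auto

lemma dg_self: "dg (S - {v}) v = dg S v"
proof -
  have "nb (S - {v}) v = nb S v" using adj_irrefl by auto
  then show ?thesis by (simp add: dg_def)
qed

lemma dg_eq_sum: "finite S \<Longrightarrow> dg S v = (\<Sum>w\<in>S. if A v w then 1 else 0)"
  by (simp add: dg_def nb_def sum.If_cases Int_def)

lemma cross_count:
  assumes "finite S" "finite T"
  shows "(\<Sum>v\<in>S. dg T v) = (\<Sum>v\<in>T. dg S v)"
proof -
  have "(\<Sum>v\<in>S. dg T v) = (\<Sum>v\<in>S. \<Sum>w\<in>T. if A v w then 1 else 0)"
    using assms by (simp add: dg_eq_sum)
  also have "\<dots> = (\<Sum>w\<in>T. \<Sum>v\<in>S. if A w v then 1 else 0)"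
    by (subst sum.swap) (simp add: adj_commute)
  finally show ?thesis using assms by (simp add: dg_eq_sum)
qed

lemma es_Un:
  assumes "finite S" "finite T" "S \<inter> T = {}"
  shows "es (S \<union> T) = es S + es T + 2 * (\<Sum>v\<in>S. dg T v)"
proof -
  have "es (S \<union> T) = (\<Sum>v\<in>S. dg S v + dg T v) + (\<Sum>v\<in>T. dg S v + dg T v)"
    using assms by (simp add: es_def sum.union_disjoint dg_Un)
  then show ?thesis
    using cross_count[OF assms(1,2)] by (simp add: es_def sum.distrib)
qed

text \<open>The degree sum of \<open>S\<close> counts the edges leaving \<open>S\<close> once and
  those inside \<open>S\<close> twice; after doubling, the surplus is \<open>es S\<close>, which
  therefore stands beside \<open>es V\<close>.\<close>

lemma deletion:
  assumes "finite V" "S \<subseteq> V"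
  shows "es V + es S = es (V - S) + 2 * (\<Sum>v\<in>S. dg V v)"
proof -
  have fS: "finite S" using assms finite_subset by blast
  have "es V = es S + es (V - S) + 2 * (\<Sum>v\<in>S. dg (V - S) v)"
    using es_Un[of S "V - S"] assms fS by (simp add: Un_absorb1)
  moreover have "(\<Sum>v\<in>S. dg V v) = (\<Sum>v\<in>S. dg S v) + (\<Sum>v\<in>S. dg (V - S) v)"
    using dg_split[OF assms] by (simp add: sum.distrib)
  ultimately show ?thesis by (simp add: es_def)
qed

lemma es_empty [simp]: "es {} = 0"
  by (simp add: es_def)

lemma es_insert:
  assumes "finite S" "x \<notin> S"
  shows "es (insert x S) = es S + 2 * dg S x"
  using es_Un[of "{x}" S] assms adj_irrefl
  by (simp add: es_def dg_insert)

lemma even_es: "finite S \<Longrightarrow> even (es S)"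
  by (induction S rule: finite_induct) (auto simp: es_insert)

lemma es_delete: "finite V \<Longrightarrow> v \<in> V \<Longrightarrow> es V = es (V - {v}) + 2 * dg V v"
  using es_insert[of "V - {v}" v] by (simp add: insert_absorb dg_self)

lemma dg_cut: "finite S \<Longrightarrow> v \<in> S \<Longrightarrow> dg S u = dg (S - {v}) u + (if A u v then 1 else 0)"
  using dg_insert[of "S - {v}" v u] by (simp add: insert_absorb)

text \<open>The neighbourhoods of the neighbours of \<open>v\<close> meet only in \<open>v\<close>, which gives the number of
  vertices at distance two.\<close>

lemma nb_sum:
  assumes "finite S" "v \<in> S"
  shows "(\<Sum>w\<in>nb S v. dg S w) + card (far S v) + 1 = card S"
proof -
  define N2 where "N2 w = nb S w - {v}" for w
  have fN: "finite (nb S v)" using assms by simp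
  have dj: "N2 x \<inter> N2 y = {}" if "x \<in> nb S v" "y \<in> nb S v" "x \<noteq> y" for x y
    using that nbs_meet[of v x y] unfolding N2_def by auto
  have c: "card (N2 w) + 1 = dg S w" if "w \<in> nb S v" for w
  proof -
    have "v \<in> nb S w" using that assms adj_sym by auto
    then show ?thesis using assms unfolding N2_def dg_def
      by (metis Suc_eq_plus1 card_Suc_Diff1 finite_nb)
  qed
  have cU: "card (\<Union>w\<in>nb S v. N2 w) = (\<Sum>w\<in>nb S v. card (N2 w))"
    using fN dj assms by (intro card_UN_disjoint) (auto simp: N2_def)
  have part: "S = {v} \<union> (nb S v \<union> ((\<Union>w\<in>nb S v. N2 w) \<union> far S v))"
    using assms by (auto simp: N2_def far_def)
  have d1: "(\<Union>w\<in>nb S v. N2 w) \<inter> far S v = {}" by (auto simp: N2_def far_def)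
  have d2: "nb S v \<inter> ((\<Union>w\<in>nb S v. N2 w) \<union> far S v) = {}"
    using nbs_nonadj[of v] by (auto simp: N2_def far_def)
  have d3: "{v} \<inter> (nb S v \<union> ((\<Union>w\<in>nb S v. N2 w) \<union> far S v)) = {}"
    using adj_irrefl by (auto simp: N2_def far_def)
  have f: "finite (\<Union>w\<in>nb S v. N2 w)" "finite (far S v)"
    using assms by (auto simp: N2_def far_def)
  have "card S = 1 + (card (nb S v) + (card (\<Union>w\<in>nb S v. N2 w) + card (far S v)))"
    apply (subst part)
    apply (subst card_Un_disjoint)
    using f fN d3 apply (simp_all)[3]
    apply (subst card_Un_disjoint)
    using f fN d2 apply (simp_all)[3]
    apply (subst card_Un_disjoint)
    using f fN d1 by simp_all
  moreover have "(\<Sum>w\<in>nb S v. dg S w) = (\<Sum>w\<in>nb S v. card (N2 w)) + card (nb S v)"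
  proof -
    have "(\<Sum>w\<in>nb S v. dg S w) = (\<Sum>w\<in>nb S v. card (N2 w) + 1)" using c by (intro sum.cong) auto
    then show ?thesis by (simp only: sum.distrib) simp
  qed
  ultimately show ?thesis using cU by simp
qed

lemma nb_sum_le:
  assumes "finite S" "v \<in> S"
  shows "(\<Sum>w\<in>nb S v. dg S w) + 1 \<le> card S"
  using nb_sum[OF assms] by linarith

lemma nb_sum_min:
  assumes "finite S" "v \<in> S" "\<And>w. w \<in> S \<Longrightarrow> k \<le> dg S w"
  shows "k * dg S v + 1 \<le> card S"
proof -
  have "(\<Sum>w\<in>nb S v. k) \<le> (\<Sum>w\<in>nb S v. dg S w)" using assms(3) by (intro sum_mono) auto
  then show ?thesis using nb_sum_le[OF assms(1,2)] by (simp add: dg_def mult.commute)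
qed

text \<open>Every ordered pair of distinct vertices of \<open>T\<close> is either an edge or has at most one common
  neighbour.\<close>

lemma pair_count:
  assumes "finite V" "finite T"
  shows "(\<Sum>v\<in>V. dg T v * (dg T v - 1)) + es T \<le> card T * (card T - 1)"
proof -
  \<comment> \<open>The absence of 4-cycles makes the sets \<open>P v\<close> disjoint, the absence
    of triangles keeps them apart from the adjacent pairs in \<open>Q\<close>.\<close>
  define P where "P v = {(x, y). x \<in> nb T v \<and> y \<in> nb T v \<and> x \<noteq> y}" for v
  define Q where "Q = {(x, y). x \<in> T \<and> y \<in> nb T x}"
  have off: "card {(x, y). x \<in> X \<and> y \<in> X \<and> x \<noteq> y} = card X * (card X - 1)" if "finite X" for X :: "'a set"
  proof -
    have "{(x, y). x \<in> X \<and> y \<in> X \<and> x \<noteq> y} = (SIGMA x:X. X - {x})" by auto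
    then show ?thesis using that by simp
  qed
  have cP: "card (P v) = dg T v * (dg T v - 1)" for v
    unfolding P_def dg_def using assms by (intro off) simp
  have Q': "Q = (SIGMA x:T. nb T x)" by (auto simp: Q_def)
  have cQ: "card Q = es T" unfolding Q' es_def dg_def using assms by (intro card_SigmaI) auto
  have fP: "finite (P v)" for v
    by (rule finite_subset[of _ "T \<times> T"]) (use assms in \<open>auto simp: P_def\<close>)
  have fQ: "finite Q" by (rule finite_subset[of _ "T \<times> T"]) (use assms in \<open>auto simp: Q_def\<close>)
  have dj: "P v \<inter> P w = {}" if "v \<noteq> w" for v w
    using that common_unique unfolding P_def by fastforce
  have djQ: "(\<Union>v\<in>V. P v) \<inter> Q = {}"
  proof -
    have False if "A v x" "A v y" "A x y" for v x y
      using that no_triangle[of v x y] adj_sym by blast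
    then show ?thesis by (auto simp: P_def Q_def)
  qed
  have "card ((\<Union>v\<in>V. P v) \<union> Q) = card (\<Union>v\<in>V. P v) + card Q"
    using assms fP fQ djQ by (intro card_Un_disjoint) auto
  moreover have "card (\<Union>v\<in>V. P v) = (\<Sum>v\<in>V. card (P v))"
    using assms fP dj by (intro card_UN_disjoint) auto
  moreover have "card ((\<Union>v\<in>V. P v) \<union> Q) \<le> card {(x, y). x \<in> T \<and> y \<in> T \<and> x \<noteq> y}"
  proof (intro card_mono)
    show "finite {(x, y). x \<in> T \<and> y \<in> T \<and> x \<noteq> y}"
      by (rule finite_subset[of _ "T \<times> T"]) (use assms in auto)
    show "(\<Union>v\<in>V. P v) \<union> Q \<subseteq> {(x, y). x \<in> T \<and> y \<in> T \<and> x \<noteq> y}"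
      using adj_neq by (auto simp: P_def Q_def)
  qed
  ultimately show ?thesis using off[OF assms(2)] cP cQ by simp
qed

text \<open>Both sides count the three-step paths between \<open>u\<close> and \<open>v\<close>, up to their common neighbours.\<close>

lemma far_exchange:
  assumes "finite S" "u \<in> S" "v \<in> S" "u \<noteq> v" "\<not> A u v"
  shows "dg S u + card (nb S v \<inter> far S u) = dg S v + card (nb S u \<inter> far S v)"
proof -
  define M where "M x y = {n \<in> nb S x. \<exists>m\<in>nb S y. A n m}" for x y
  define K where "K = nb S u \<inter> nb S v"
  have split: "dg S x = card (M x y) + card K + card (nb S x \<inter> far S y)"
    if xy: "{x, y} = {u, v}" for x y
  proof -
    have K: "K = nb S x \<inter> nb S y" and na: "x \<noteq> y" "\<not> A x y" "\<not> A y x" and S: "x \<in> S" "y \<in> S"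
      using xy assms by (auto simp: K_def doubleton_eq_iff adj_commute)
    have e: "nb S x = M x y \<union> (K \<union> (nb S x \<inter> far S y))"
      unfolding M_def K far_def using na S by (auto simp: adj_commute)
    have d1: "M x y \<inter> (K \<union> (nb S x \<inter> far S y)) = {}"
    proof -
      have False if "A x n" "A y n" "A y m" "A n m" for n m
        using that nbs_nonadj by blast
      then show ?thesis unfolding M_def K nb_def far_def using adj_sym by blast
    qed
    have d2: "K \<inter> (nb S x \<inter> far S y) = {}" unfolding K far_def by auto
    have f: "finite (M x y)" "finite K" "finite (nb S x \<inter> far S y)"
      using assms by (auto simp: M_def K)
    have "dg S x = card (M x y \<union> (K \<union> (nb S x \<inter> far S y)))" using e by (simp add: dg_def)
    also have "\<dots> = card (M x y) + (card K + card (nb S x \<inter> far S y))"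
      using f d1 d2 by (simp add: card_Un_disjoint)
    finally show ?thesis by simp
  qed
  \<comment> \<open>The edges between the neighbours of \<open>x\<close> and those of
    \<open>y\<close> form a matching: two neighbours of \<open>x\<close> with the same partner would
    close a 4-cycle.\<close>
  have le: "card (M x y) \<le> card (M y x)" if xy: "{x, y} = {u, v}" for x y
  proof -
    have na: "x \<noteq> y" using xy assms by (auto simp: doubleton_eq_iff)
    have "\<forall>n\<in>M x y. \<exists>m\<in>nb S y. A n m" by (auto simp: M_def)
    then obtain f where f: "\<And>n. n \<in> M x y \<Longrightarrow> f n \<in> nb S y \<and> A n (f n)" by metis
    have "inj_on f (M x y)"
    proof (rule inj_onI)
      fix a b assume ab: "a \<in> M x y" "b \<in> M x y" "f a = f b"
      have "A x a" "A x b" using ab by (auto simp: M_def)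
      moreover have "A (f a) a" "A (f a) b" using f[OF ab(1)] f[OF ab(2)] ab(3) adj_sym by auto
      moreover have "x \<noteq> f a"
        using f[OF ab(1)] xy assms by (auto simp: doubleton_eq_iff adj_commute)
      ultimately show "a = b" using common_unique by blast
    qed
    moreover have "f ` M x y \<subseteq> M y x"
    proof
      fix m assume "m \<in> f ` M x y"
      then obtain n where n: "n \<in> M x y" "m = f n" by auto
      then show "m \<in> M y x" using f[OF n(1)] adj_sym[of n m] unfolding M_def by auto
    qed
    ultimately show ?thesis using assms(1) by (intro card_inj_on_le) (auto simp: M_def)
  qed
  have "card (M u v) = card (M v u)" using le[of u v] le[of v u] by (simp add: insert_commute)
  then show ?thesis using split[of u v] split[of v u] by (simp add: insert_commute)
qed

lemma far_sym: "u \<in> far S v \<Longrightarrow> v \<in> S \<Longrightarrow> v \<in> far S u"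
  unfolding far_def by (auto simp: adj_commute)

lemma finite_far [simp]: "finite S \<Longrightarrow> finite (far S v)"
  by (simp add: far_def)

lemma boundD: "bound n m \<Longrightarrow> finite S \<Longrightarrow> card S = n \<Longrightarrow> es S \<le> 2 * m"
  by (simp add: bound_def)

text \<open>Averaging over the deletion of a single vertex.\<close>

lemma bound_step:
  assumes "bound n m" "finite S" "card S = Suc n"
  shows "es S * (n - 1) \<le> 2 * m * Suc n"
proof -
  have *: "es S \<le> 2 * m + 2 * dg S v" if "v \<in> S" for v
    using es_delete[OF assms(2) that] boundD[OF assms(1), of "S - {v}"] assms that by simp
  have "(\<Sum>v\<in>S. es S) \<le> (\<Sum>v\<in>S. 2 * m + 2 * dg S v)" using * by (rule sum_mono)
  then have "Suc n * es S \<le> Suc n * (2 * m) + 2 * es S"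
    using assms by (simp add: sum.distrib es_def sum_distrib_left)
  then show ?thesis by (cases n) (auto simp: algebra_simps)
qed

text \<open>A set with small degree sum and many inner edges cannot exist, since its deletion would
  leave too many edges behind. Lower bounds on \<open>es S\<close> from edges, paths and stars are
  fed into this inequality.\<close>

lemma bound_del:
  assumes "bound n m" "finite V" "S \<subseteq> V" "card V = n + card S"
  shows "es V + es S \<le> 2 * m + 2 * (\<Sum>v\<in>S. dg V v)"
proof -
  have "card (V - S) = n" using assms finite_subset[of S V] by (simp add: card_Diff_subset)
  then show ?thesis using deletion[of V S] boundD[of n m "V - S"] assms by simp
qed

lemma bound_min_deg:
  assumes "bound n m" "finite V" "v \<in> V" "card V = Suc n"
  shows "es V \<le> 2 * m + 2 * dg V v"
  using bound_del[OF assms(1,2), of "{v}"] assms by (simp add: es_insert es_def dg_insert adj_irrefl)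

text \<open>Summing \<open>nb_sum_le\<close> over all vertices counts the degree of \<open>w\<close>
  once for each neighbour of \<open>w\<close>.\<close>

lemma square_sum:
  assumes "finite S"
  shows "(\<Sum>v\<in>S. dg S v * dg S v) \<le> card S * (card S - 1)"
proof -
  have "(\<Sum>v\<in>S. \<Sum>w\<in>nb S v. dg S w) \<le> (\<Sum>v\<in>S. card S - 1)"
  proof (rule sum_mono)
    fix v assume "v \<in> S"
    then show "(\<Sum>w\<in>nb S v. dg S w) \<le> card S - 1" using nb_sum_le[OF assms, of v] by linarith
  qed
  moreover have "(\<Sum>v\<in>S. \<Sum>w\<in>nb S v. dg S w) = (\<Sum>v\<in>S. \<Sum>w\<in>S. if A v w then dg S w else 0)"
    using assms by (simp add: nb_def sum.inter_filter)
  moreover have "\<dots> = (\<Sum>w\<in>S. \<Sum>v\<in>S. if A v w then dg S w else 0)" by (rule sum.swap)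
  moreover have "\<dots> = (\<Sum>w\<in>S. dg S w * dg S w)"
  proof (rule sum.cong)
    fix w assume "w \<in> S"
    have "(\<Sum>v\<in>S. if A v w then dg S w else 0) = (\<Sum>v\<in>nb S w. dg S w)"
      unfolding nb_def adj_commute[of _ w] using assms by (rule sum.inter_filter[symmetric])
    then show "(\<Sum>v\<in>S. if A v w then dg S w else 0) = dg S w * dg S w" by (simp add: dg_def)
  qed simp
  ultimately show ?thesis by simp
qed

text \<open>An integer form of the Cauchy-Schwarz bound: (d - k)(d - k - 1) is never negative for
  integers, with equality exactly at the degrees \<open>k\<close> and \<open>k + 1\<close>. It is
  applied to every degree and combined with \<open>square_sum\<close>.\<close>

lemma cauchy:
  assumes "finite S"
  shows "(2 * k + 1) * es S \<le> k * (k + 1) * card S + card S * (card S - 1)"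
proof -
  have *: "(2 * k + 1) * d \<le> k * (k + 1) + d * d" for d :: nat
  proof (cases "d \<le> k")
    case True
    then obtain j where "k = d + j" using le_Suc_ex by blast
    then show ?thesis by (simp add: algebra_simps)
  next
    case False
    then obtain j where "d = k + 1 + j" by (metis Suc_eq_plus1 less_imp_Suc_add not_le add.assoc add.commute)
    then show ?thesis by (simp add: algebra_simps)
  qed
  have "(2 * k + 1) * es S = (\<Sum>v\<in>S. (2 * k + 1) * dg S v)" by (simp add: es_def sum_distrib_left)
  also have "\<dots> \<le> (\<Sum>v\<in>S. k * (k + 1) + dg S v * dg S v)" using *[of "dg S _"] by (intro sum_mono) blast
  also have "\<dots> = k * (k + 1) * card S + (\<Sum>v\<in>S. dg S v * dg S v)" by (simp add: sum.distrib mult.commute)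
  finally show ?thesis using square_sum[OF assms] by linarith
qed

end

section \<open>Edge bounds for up to 22 vertices\<close>

context girth5
begin

lemma es_next: "finite S \<Longrightarrow> \<not> es S \<le> 2 * m \<Longrightarrow> 2 * m + 2 \<le> es S"
  using even_es[of S] by (fastforce elim!: evenE)

lemma bound_cauchy:
  assumes "k * (k + 1) * n + n * (n - 1) < (2 * k + 1) * (2 * m + 2)"
  shows "bound n m"
  unfolding bound_def
proof (intro allI impI)
  fix S :: "'a set" assume S: "finite S" "card S = n"
  show "es S \<le> 2 * m"
  proof (rule ccontr)
    assume "\<not> es S \<le> 2 * m"
    then have "2 * m + 2 \<le> es S" by (rule es_next[OF S(1)])
    then have "(2 * k + 1) * (2 * m + 2) \<le> (2 * k + 1) * es S" by (rule mult_le_mono2)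
    then show False using cauchy[OF S(1), of k] S(2) assms by simp
  qed
qed

lemma bound_Suc:
  assumes "bound n m" "2 * m * Suc n < (2 * m' + 2) * (n - 1)" "n' = Suc n"
  shows "bound n' m'"
  unfolding bound_def
proof (intro allI impI)
  fix S :: "'a set" assume S: "finite S" "card S = n'"
  show "es S \<le> 2 * m'"
  proof (rule ccontr)
    assume "\<not> es S \<le> 2 * m'"
    then have "2 * m' + 2 \<le> es S" by (rule es_next[OF S(1)])
    then have "(2 * m' + 2) * (n - 1) \<le> es S * (n - 1)" by (rule mult_le_mono1)
    then show False using bound_step[OF assms(1) S(1)] S(2) assms by simp
  qed
qed

text \<open>To improve a bound by one, only graphs with exactly \<open>Suc m\<close> edges have to
  be excluded, and the exact number lets deletion inequalities force lower bounds on
  degrees.\<close>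

lemma bound_refine:
  assumes "bound n (Suc m)" "\<And>V. finite V \<Longrightarrow> card V = n \<Longrightarrow> es V = 2 * Suc m \<Longrightarrow> False"
  shows "bound n m"
  unfolding bound_def
proof (intro allI impI)
  fix S :: "'a set" assume S: "finite S" "card S = n"
  have "es S \<le> 2 * Suc m" using assms(1) S by (auto simp: bound_def)
  moreover have "es S \<noteq> 2 * Suc m" using assms(2) S by blast
  ultimately show "es S \<le> 2 * m" using es_next[OF S(1), of m] by force
qed

lemma es_le_max:
  assumes "finite S" "\<And>v. v \<in> S \<Longrightarrow> dg S v \<le> k"
  shows "es S \<le> k * card S"
  using sum_bounded_above[of S "dg S" k] assms by (simp add: es_def mult.commute)

lemma es_ge_min:
  assumes "finite S" "\<And>v. v \<in> S \<Longrightarrow> k \<le> dg S v"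
  shows "k * card S \<le> es S"
  using sum_bounded_below[of S k "dg S"] assms by (simp add: es_def mult.commute)

lemma es_pair: "A u w \<Longrightarrow> es {u, w} = 2"
  using adj_irrefl adj_neq[of u w] adj_sym[of u w] by (simp add: es_def dg_insert)

lemma es_path: "A a b \<Longrightarrow> A b c \<Longrightarrow> a \<noteq> c \<Longrightarrow> 4 \<le> es {a, b, c}"
  using adj_irrefl adj_neq[of a b] adj_neq[of b c] adj_sym[of a b] adj_sym[of b c]
  by (simp add: es_def dg_insert)

lemma es_star:
  assumes "finite X" "\<And>x. x \<in> X \<Longrightarrow> A a x"
  shows "2 * card X \<le> es (insert a X)"
proof -
  have "a \<notin> X" using assms(2) adj_irrefl by auto
  moreover have "dg X a = card X" using assms(2) unfolding dg_def by (metis (no_types, lifting) in_nb subsetI subset_antisym)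
  ultimately show ?thesis using es_insert[OF assms(1)] by simp
qed

lemma nb_partition:
  assumes "finite V" "V = S \<union> T" "S \<inter> T = {}"
  shows "dg V v = dg S v + dg T v"
  using assms dg_Un[of S T v] by simp

lemma two_degrees:
  assumes "finite V" "\<And>v. v \<in> V \<Longrightarrow> k \<le> dg V v \<and> dg V v \<le> Suc k"
  defines "P \<equiv> {v \<in> V. dg V v = Suc k}" and "Q \<equiv> {v \<in> V. dg V v = k}"
  shows "V = P \<union> Q" "P \<inter> Q = {}" "finite P" "finite Q" "card P + card Q = card V"
    "card P + k * card V = es V"
proof -
  show V: "V = P \<union> Q" using assms(2) by (force simp: P_def Q_def)
  show d: "P \<inter> Q = {}" by (auto simp: P_def Q_def)
  show f: "finite P" "finite Q" using assms(1) by (auto simp: P_def Q_def)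
  show c: "card P + card Q = card V" using V d f card_Un_disjoint by metis
  have "es V = (\<Sum>v\<in>P. dg V v) + (\<Sum>v\<in>Q. dg V v)"
    unfolding es_def by (subst V) (rule sum.union_disjoint[OF f d])
  also have "(\<Sum>v\<in>P. dg V v) = card P * Suc k" by (simp add: P_def)
  also have "(\<Sum>v\<in>Q. dg V v) = card Q * k" by (simp add: Q_def)
  finally show "card P + k * card V = es V" unfolding c[symmetric] by (simp add: algebra_simps)
qed

section \<open>The bounds from 10 to 22 vertices\<close>

lemma bound10: "bound 10 15"
  by (rule bound_cauchy[of 2]) simp

lemma bound11: "bound 11 16"
proof (rule bound_refine)
  show "bound 11 (Suc 16)" by (rule bound_cauchy[of 2]) simp
  fix V :: "'a set" assume V: "finite V" "card V = 11" "es V = 2 * Suc 16"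
  have min: "2 \<le> dg V v" if "v \<in> V" for v
    using bound_min_deg[OF bound10 V(1) that] V by simp
  show False
  proof (cases "\<exists>v\<in>V. dg V v = 2")
    case True
    then obtain v where v: "v \<in> V" "dg V v = 2" by blast
    define W where "W = V - {v}"
    have W: "finite W" "card W = 10" "es W = 30"
      using V v es_delete[OF V(1) v(1)] by (auto simp: W_def)
    \<comment> \<open>Ten vertices with 15 edges are tight for \<open>square_sum\<close> against (d
      - 3)^2 \<ge> 0, so all degrees are three, as in the Petersen graph.\<close>
    have cubic: "dg W u = 3" if u: "u \<in> W" for u
    proof (rule ccontr)
      assume n: "dg W u \<noteq> 3"
      have sq: "6 * d \<le> d * d + 9" "d \<noteq> 3 \<Longrightarrow> 6 * d < d * d + 9" for d :: nat
      proof -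
        consider "d < 3" | "d = 3" | j where "d = 4 + j"
          by (metis add.commute le_add_diff_inverse2 linorder_neqE_nat numeral_eq_Suc pred_numeral_simps(2) Suc_leI semiring_norm(26) semiring_norm(27))
        then have "6 * d \<le> d * d + 9 \<and> (d \<noteq> 3 \<longrightarrow> 6 * d < d * d + 9)"
        proof cases
          case 1
          then have "d \<in> {0, 1, 2}" by auto
          then show ?thesis by auto
        next
          case 3
          then show ?thesis by (simp add: algebra_simps)
        qed simp
        then show "6 * d \<le> d * d + 9" "d \<noteq> 3 \<Longrightarrow> 6 * d < d * d + 9" by auto
      qed
      have "(\<Sum>v\<in>W. 6 * dg W v) < (\<Sum>v\<in>W. dg W v * dg W v + 9)"
        using W(1) sq n u by (intro sum_strict_mono_ex1) auto
      then have "6 * es W < (\<Sum>v\<in>W. dg W v * dg W v) + 9 * card W"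
        by (simp add: sum.distrib es_def sum_distrib_left mult.commute)
      then show False using square_sum[OF W(1)] W by simp
    qed
    \<comment> \<open>A neighbour \<open>x\<close> of \<open>v\<close> has one neighbour of degree
      two and three of degree at least three, and 2 + 9 + 1 exceeds 11.\<close>
    have "nb V v \<noteq> {}" using v(2) by (auto simp: dg_def)
    then obtain x where "x \<in> nb V v" by blast
    then have x: "x \<in> V" "A v x" by simp_all
    then have xW: "x \<in> W" using adj_neq[of v x] by (auto simp: W_def)
    have ge: "3 \<le> dg V w" if "w \<in> W" for w
      using cubic[OF that] dg_mono[OF V(1), of W w] by (auto simp: W_def)
    have nbx: "nb V x = insert v (nb W x)" using x v adj_sym[of v x] by (auto simp: W_def)
    have "(\<Sum>w\<in>nb W x. 3) \<le> (\<Sum>w\<in>nb W x. dg V w)" using ge by (intro sum_mono) auto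
    then have "9 \<le> (\<Sum>w\<in>nb W x. dg V w)" using cubic[OF xW] by (simp add: dg_def)
    moreover have "(\<Sum>w\<in>nb V x. dg V w) = dg V v + (\<Sum>w\<in>nb W x. dg V w)"
      unfolding nbx using W(1) by (subst sum.insert) (auto simp: W_def)
    ultimately show False using nb_sum_le[OF V(1) x(1)] V v by simp
  next
    case False
    then have min3: "3 \<le> dg V v" if "v \<in> V" for v using min[OF that] that by (metis le_antisym not_less_eq_eq numeral_2_eq_2 numeral_3_eq_3)
    have "dg V v \<le> 3" if "v \<in> V" for v using nb_sum_min[OF V(1) that min3] V by simp
    then show False using es_le_max[OF V(1), of 3] V by simp
  qed
qed

lemma bound12: "bound 12 18"
proof (rule bound_refine)
  show "bound 12 (Suc 18)" by (rule bound_Suc[OF bound11]) auto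
  fix V :: "'a set" assume V: "finite V" "card V = 12" "es V = 2 * Suc 18"
  have min: "3 \<le> dg V v" if "v \<in> V" for v using bound_min_deg[OF bound11 V(1) that] V by simp
  have "dg V v \<le> 3" if "v \<in> V" for v using nb_sum_min[OF V(1) that min] V by simp
  then show False using es_le_max[OF V(1), of 3] V by simp
qed

lemma bound13: "bound 13 21"
  by (rule bound_Suc[OF bound12]) auto

text \<open>With 24 edges there are six vertices of degree four and eight of degree three. Deleting
  two adjacent ones of degree three would leave 19 edges on 12 vertices, so each of the eight
  supplies six ordered pairs in \<open>P\<close>, where there are only 30.\<close>

lemma bound14: "bound 14 23"
proof (rule bound_refine)
  show "bound 14 (Suc 23)" by (rule bound_Suc[OF bound13]) auto
  fix V :: "'a set" assume V: "finite V" "card V = 14" "es V = 2 * Suc 23"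
  have min: "3 \<le> dg V v" if "v \<in> V" for v using bound_min_deg[OF bound13 V(1) that] V by simp
  have max: "dg V v \<le> 4" if "v \<in> V" for v using nb_sum_min[OF V(1) that min] V by simp
  define P where "P = {v \<in> V. dg V v = Suc 3}"
  define Q where "Q = {v \<in> V. dg V v = 3}"
  have PQ: "V = P \<union> Q" "P \<inter> Q = {}" "finite P" "finite Q" "card P + card Q = card V"
    "card P + 3 * card V = es V"
    using two_degrees[OF V(1), of 3] min max unfolding P_def Q_def by auto
  have ind: "dg Q u = 0" if u: "u \<in> Q" for u
  proof (rule ccontr)
    assume "dg Q u \<noteq> 0"
    then obtain w where w: "w \<in> Q" "A u w" using dg_eq_0[OF PQ(4)] by auto
    show False using bound_del[OF bound12 V(1), of "{u, w}"] es_pair[OF w(2)] adj_neq[OF w(2)] u w V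
      by (auto simp: Q_def)
  qed
  have P3: "dg P u = 3" if u: "u \<in> Q" for u
    using nb_partition[OF V(1) PQ(1,2), of u] ind[OF u] u by (simp add: Q_def)
  have "(\<Sum>u\<in>Q. dg P u * (dg P u - 1)) \<le> (\<Sum>u\<in>V. dg P u * (dg P u - 1))"
    using V(1) by (intro sum_mono2) (auto simp: Q_def)
  moreover have "(\<Sum>u\<in>Q. dg P u * (dg P u - 1)) = 6 * card Q" using P3 by simp
  ultimately show False using pair_count[OF V(1) PQ(3)] PQ V by simp
qed

lemma bound15: "bound 15 26"
  by (rule bound_Suc[OF bound14]) auto

lemma subset_of_card:
  assumes "k \<le> dg S a"
  shows "\<exists>X\<subseteq>S. finite X \<and> card X = k \<and> (\<forall>x\<in>X. A a x)"
proof -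
  obtain X where "X \<subseteq> nb S a" "card X = k" "finite X"
    using obtain_subset_with_card_n[of k "nb S a"] assms by (auto simp: dg_def)
  then show ?thesis by (intro exI[of _ X]) auto
qed

text \<open>Deletion makes the vertices of degree three independent and allows a vertex of degree
  four at most two of them as neighbours. The neighbours of a vertex of degree five all have degree
  three, because their degrees sum to at most 15. Counting the edges at \<open>B\<close> then leaves
  at most one vertex of degree five, and the two cases need different arguments.\<close>

lemma bound16: "bound 16 28"
proof (rule bound_refine)
  show "bound 16 (Suc 28)" by (rule bound_Suc[OF bound15]) auto
  fix V :: "'a set" assume V: "finite V" "card V = 16" "es V = 2 * Suc 28"
  have min: "3 \<le> dg V v" if "v \<in> V" for v using bound_min_deg[OF bound15 V(1) that] V by simp
  have max: "dg V v \<le> 5" if "v \<in> V" for v using nb_sum_min[OF V(1) that min] V by simp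
  define B where "B = {v \<in> V. dg V v = 3}"
  define A4 where "A4 = {v \<in> V. dg V v = 4}"
  define F where "F = {v \<in> V. dg V v = 5}"
  have fin: "finite B" "finite A4" "finite F" using V(1) by (auto simp: B_def A4_def F_def)
  have part: "V = B \<union> (A4 \<union> F)" "B \<inter> (A4 \<union> F) = {}" "A4 \<inter> F = {}"
  proof -
    have "dg V v = 3 \<or> dg V v = 4 \<or> dg V v = 5" if "v \<in> V" for v using min[OF that] max[OF that] by linarith
    then show "V = B \<union> (A4 \<union> F)" by (auto simp: B_def A4_def F_def)
  qed (auto simp: B_def A4_def F_def)
  have dsum: "dg V v = dg B v + dg A4 v + dg F v" for v
    using nb_partition[OF V(1) part(1,2), of v] dg_Un[of A4 F v] fin part(3) by simp
  have card: "card B + card A4 + card F = 16"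
    using V(2) part fin by (simp add: card_Un_disjoint)
  have degsum: "3 * card B + 4 * card A4 + 5 * card F = 58"
  proof -
    have "es V = (\<Sum>v\<in>B. dg V v) + ((\<Sum>v\<in>A4. dg V v) + (\<Sum>v\<in>F. dg V v))"
      unfolding es_def using part fin by (metis finite_UnI sum.union_disjoint)
    then show ?thesis using V(3) by (simp add: B_def A4_def F_def)
  qed
  have ind: "\<not> A u w" if u: "u \<in> B" "w \<in> B" for u w
  proof
    assume "A u w"
    then show False using bound_del[OF bound14 V(1), of "{u, w}"] es_pair[of u w] adj_neq[of u w] u V
      by (auto simp: B_def)
  qed
  have B0: "dg B u = 0" if "u \<in> B" for u using ind[OF that] dg_eq_0[OF fin(1)] by blast
  have le2: "dg B a \<le> 2" if a: "a \<in> A4" for a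
  proof (rule ccontr)
    assume "\<not> dg B a \<le> 2"
    then obtain X where X: "X \<subseteq> B" "finite X" "card X = 3" "\<forall>x\<in>X. A a x" using subset_of_card[of 3 B a] by auto
    have aX: "a \<notin> X" using X(4) adj_irrefl by auto
    have "(\<Sum>v\<in>insert a X. dg V v) = dg V a + (\<Sum>v\<in>X. dg V v)" using X aX by simp
    also have "(\<Sum>v\<in>X. dg V v) = (\<Sum>v\<in>X. 3)" using X(1) by (intro sum.cong) (auto simp: B_def)
    finally have "(\<Sum>v\<in>insert a X. dg V v) = 13" using a X(3) by (simp add: A4_def)
    moreover have "insert a X \<subseteq> V" using a X(1) by (auto simp: A4_def B_def)
    ultimately show False
      using bound_del[OF bound12 V(1), of "insert a X"] es_star[OF X(2), of a] X aX V by auto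
  qed
  have F5: "dg B w = 5 \<and> far V w = {}" if w: "w \<in> F" for w
  proof -
    have c: "card (nb V w) = 5" using w by (simp add: F_def dg_def)
    have s: "(\<Sum>u\<in>nb V w. dg V u) + card (far V w) = 15" using nb_sum[OF V(1), of w] w V by (simp add: F_def)
    have "(\<Sum>u\<in>nb V w. 3) \<le> (\<Sum>u\<in>nb V w. dg V u)" using min by (intro sum_mono) auto
    then have e: "(\<Sum>u\<in>nb V w. dg V u) = (\<Sum>u\<in>nb V w. 3)" and f: "card (far V w) = 0" using c s by auto
    have "dg V u = 3" if "u \<in> nb V w" for u
      using sum_mono_inv[of "\<lambda>_. 3" "nb V w" "dg V" u] e min that V(1) by auto
    then have "nb B w = nb V w" by (auto simp: B_def)
    then show ?thesis using c f V(1) by (simp add: dg_def)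
  qed
  have count: "3 * card B \<le> 2 * card A4 + 5 * card F"
  proof -
    have "(\<Sum>u\<in>B. dg V u) = (\<Sum>u\<in>B. dg A4 u) + (\<Sum>u\<in>B. dg F u)"
      using B0 dsum by (simp add: sum.distrib)
    also have "\<dots> = (\<Sum>a\<in>A4. dg B a) + (\<Sum>a\<in>F. dg B a)" using cross_count fin by metis
    also have "\<dots> \<le> (\<Sum>a\<in>A4. 2) + (\<Sum>a\<in>F. 5)"
      using le2 F5 by (intro add_mono sum_mono) auto
    finally show ?thesis by (simp add: B_def)
  qed
  show False
  proof (cases "F = {}")
    case False
    then obtain w where w: "w \<in> F" by blast
    have "card F > 0" using w fin by (auto simp: card_gt_0_iff)
    then have "card B = 7" using count card degsum by linarith
    \<comment> \<open>Only five of the seven vertices in \<open>B\<close> are adjacent to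
      \<open>w\<close>. Another one has distance two from \<open>w\<close>, hence a neighbour that
      is itself in \<open>B\<close>, although \<open>B\<close> is independent.\<close>
    then have "\<not> B \<subseteq> nb V w" using F5[OF w] card_mono[of "nb B w" B] fin unfolding dg_def
      by (metis in_nb finite_nb le_less_trans less_irrefl_nat numeral_less_iff semiring_norm(76) semiring_norm(79) subsetD subsetI not_less semiring_norm(81))
    then obtain y where "y \<in> B" "y \<notin> nb V w" by blast
    then have y: "y \<in> B" "\<not> A w y" using part(1) by auto
    moreover have "y \<noteq> w" using y w by (auto simp: B_def F_def)
    ultimately obtain u where u: "u \<in> V" "A w u" "A u y" using F5[OF w] by (auto simp: far_def B_def)
    have "nb B w = nb V w"
      using F5[OF w] w V(1) by (intro card_subset_eq) (auto simp: dg_def F_def B_def)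
    then have "u \<in> B" using u by auto
    then show False using ind u y by blast
  next
    case True
    then have c: "card A4 = 10" "card B = 6" and VA: "V = B \<union> A4" "B \<inter> A4 = {}" using card degsum part by auto
    have d4: "dg A4 a + dg B a = 4" if "a \<in> A4" for a
      using nb_partition[OF V(1) VA, of a] that by (simp add: A4_def)
    have ge1: "1 \<le> dg B a" if a: "a \<in> A4" for a
    proof (rule ccontr)
      assume "\<not> 1 \<le> dg B a"
      then have n: "\<forall>u\<in>B. \<not> A a u" using dg_eq_0[OF fin(1), of a] by auto
      have "dg V u = 4" if "u \<in> nb V a" for u
      proof -
        have "u \<in> A4" using that n VA(1) by auto
        then show ?thesis by (simp add: A4_def)
      qed
      then have "(\<Sum>u\<in>nb V a. 4) \<le> (\<Sum>u\<in>nb V a. dg V u)" by (intro sum_mono) simp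
      moreover have "(\<Sum>u\<in>nb V a. 4) = (16::nat)" using a by (simp add: A4_def dg_def)
      ultimately show False using nb_sum_le[OF V(1), of a] a V by (simp add: A4_def)
    qed
    define U where "U = {a \<in> A4. dg B a = 1}"
    have t2: "dg B a = 2" if "a \<in> A4 - U" for a using that le2[of a] ge1[of a] by (auto simp: U_def)
    have fU: "finite U" "U \<subseteq> A4" using fin by (auto simp: U_def)
    \<comment> \<open>The 18 edges at \<open>B\<close> end in ten vertices, each of which takes one
      or two of them.\<close>
    have cU: "card U = 2"
    proof -
      have "(\<Sum>a\<in>A4. dg B a) = (\<Sum>b\<in>B. dg A4 b)" using cross_count fin by metis
      also have "\<dots> = (\<Sum>b\<in>B. 3)"
      proof (intro sum.cong refl)
        fix b assume b: "b \<in> B"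
        then have "dg V b = 3" by (simp add: B_def)
        then show "dg A4 b = 3" using B0[OF b] nb_partition[OF V(1) VA, of b] by linarith
      qed
      finally have 1: "(\<Sum>a\<in>A4. dg B a) = 18" using c by simp
      have "(\<Sum>a\<in>A4. dg B a) = (\<Sum>a\<in>U. dg B a) + (\<Sum>a\<in>A4 - U. dg B a)"
        using fU fin by (simp add: sum.subset_diff add.commute)
      also have "(\<Sum>a\<in>U. dg B a) = (\<Sum>a\<in>U. 1)" by (intro sum.cong) (auto simp: U_def)
      also have "(\<Sum>a\<in>A4 - U. dg B a) = (\<Sum>a\<in>A4 - U. 2)" using t2 by (intro sum.cong) auto
      also have "(\<Sum>a\<in>U. 1) + (\<Sum>a\<in>A4 - U. 2) = card U + 2 * card (A4 - U)" by simp
      also have "card (A4 - U) = 10 - card U" using fU c by (simp add: card_Diff_subset)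
      finally show ?thesis using 1 card_mono[OF fin(2) fU(2)] c by linarith
    qed
    have disj1: "nb B x \<inter> nb B y = {}" if "A x y" for x y
      using that nbs_nonadj[of x y] by auto
    have disj2: "nb B x \<inter> nb B y = {}" if "A z x" "A z y" "x \<noteq> y" "z \<in> A4" for x y z
    proof -
      have "z \<notin> B" using that(4) VA(2) by blast
      then show ?thesis using nbs_meet[OF that(1-3)] by auto
    qed
    \<comment> \<open>Three consecutive vertices have disjoint pairs of neighbours in
      \<open>B\<close> and use up all six; the fourth has to repeat the pair of the first, which
      closes a 4-cycle.\<close>
    have path: False if p: "A a1 a2" "A a2 a3" "A a3 a4" "a1 \<noteq> a3" "a2 \<noteq> a4"
      "a1 \<in> A4 - U" "a2 \<in> A4 - U" "a3 \<in> A4 - U" "a4 \<in> A4 - U" for a1 a2 a3 a4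
    proof -
      have T: "card (nb B a1) = 2" "card (nb B a2) = 2" "card (nb B a3) = 2" "card (nb B a4) = 2"
        using t2 p by (auto simp: dg_def)
      have d: "nb B a1 \<inter> nb B a2 = {}" "nb B a2 \<inter> nb B a3 = {}" "nb B a3 \<inter> nb B a4 = {}"
        "nb B a1 \<inter> nb B a3 = {}" "nb B a2 \<inter> nb B a4 = {}"
        using p disj1 disj2[of a2 a1 a3] disj2[of a3 a2 a4] adj_sym by auto
      have "card (nb B a1 \<union> nb B a2 \<union> nb B a3) = 6"
        using T d fin by (simp add: card_Un_disjoint Int_Un_distrib2)
      then have "nb B a1 \<union> nb B a2 \<union> nb B a3 = B" using c fin by (intro card_subset_eq) auto
      then have sub: "nb B a4 \<subseteq> nb B a1" using d nb_subset[of B a4] by blast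
      obtain z1 z2 where z: "z1 \<in> nb B a4" "z2 \<in> nb B a4" "z1 \<noteq> z2"
        using T(4) by (metis card_2_iff' )
      have "a1 \<noteq> a4" using p no_triangle by blast
      moreover have "A a1 z1" "A a1 z2" "A a4 z1" "A a4 z2" using z(1,2) sub by auto
      ultimately show False using common_unique z(3) by blast
    qed
    \<comment> \<open>Otherwise the three neighbours of \<open>u\<close> in \<open>A4\<close> lie
      outside \<open>U\<close>, their pairs exhaust \<open>B\<close>, and the neighbour of
      \<open>u\<close> in \<open>B\<close> closes a triangle.\<close>
    have adjU: "\<exists>v\<in>U. A u v" if u: "u \<in> U" for u
    proof (rule ccontr)
      assume n: "\<not> (\<exists>v\<in>U. A u v)"
      have d3: "card (nb A4 u) = 3" using d4[of u] u fU by (auto simp: U_def dg_def)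
      have "card (\<Union>a\<in>nb A4 u. nb B a) = (\<Sum>a\<in>nb A4 u. card (nb B a))"
      proof (rule card_UN_disjoint)
        have "u \<in> A4" using u fU by blast
        then show "\<forall>i\<in>nb A4 u. \<forall>j\<in>nb A4 u. i \<noteq> j \<longrightarrow> nb B i \<inter> nb B j = {}"
          using disj2[of u] by simp
      qed (use fin in auto)
      also have "\<dots> = (\<Sum>a\<in>nb A4 u. 2)" using n t2 by (intro sum.cong) (auto simp: dg_def)
      finally have "card (\<Union>a\<in>nb A4 u. nb B a) = 6" using d3 by simp
      then have UB: "(\<Union>a\<in>nb A4 u. nb B a) = B" using c fin by (intro card_subset_eq) auto
      have "nb B u \<noteq> {}" using u by (auto simp: U_def dg_def)
      then obtain b where b: "b \<in> nb B u" by blast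
      then have "b \<in> (\<Union>a\<in>nb A4 u. nb B a)" unfolding UB by simp
      with b obtain a where "a \<in> nb A4 u" "b \<in> nb B a" "b \<in> nb B u" by blast
      then show False using disj1[of u a] by auto
    qed
    obtain u v where uv: "U = {u, v}" "u \<noteq> v" using cU by (auto simp: card_2_iff)
    have Auv: "A u v" using adjU[of u] uv adj_irrefl by auto
    have uA: "u \<in> A4" "v \<in> A4" using uv fU by auto
    have "u \<in> U" "v \<in> U" using uv by simp_all
    then have "dg B u = 1" "dg B v = 1" unfolding U_def by simp_all
    then have du: "dg A4 u = 3" "dg A4 v = 3" using d4[OF uA(1)] d4[OF uA(2)] by simp_all
    define O1 where "O1 = A4 - U"
    define Bu where "Bu = nb O1 u"
    define Bv where "Bv = nb O1 v"
    define In where "In = O1 - (Bu \<union> Bv)"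
    have fO: "finite O1" "finite Bu" "finite Bv" "finite In" using fin by (auto simp: O1_def Bu_def Bv_def In_def)
    have dgU: "dg A4 x = dg O1 x + (if A x u then 1 else 0) + (if A x v then 1 else 0)" for x
    proof -
      have "A4 = O1 \<union> {u, v}" "O1 \<inter> {u, v} = {}" using uv fU by (auto simp: O1_def)
      then have "dg A4 x = dg O1 x + dg {u, v} x" using dg_Un[of O1 "{u, v}" x] fO by simp
      then show ?thesis using uv(2) by (simp add: dg_insert)
    qed
    have cB: "card Bu = 2" "card Bv = 2"
      using dgU[of u] dgU[of v] du Auv adj_irrefl adj_sym[of u v] by (auto simp: Bu_def Bv_def dg_def)
    have dBB: "Bu \<inter> Bv = {}" using nbs_nonadj[of u v] Auv by (auto simp: Bu_def Bv_def)
    have cO: "card O1 = 8" using c cU fU by (simp add: O1_def card_Diff_subset)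
    have cIn: "card In = 4"
      unfolding In_def using cO cB dBB fO by (subst card_Diff_subset) (auto simp: card_Un_disjoint Bu_def Bv_def)
    have dO: "dg A4 x = 2" if "x \<in> O1" for x using d4[of x] t2[of x] that by (auto simp: O1_def)
    have dIn: "dg O1 x = 2" if x: "x \<in> In" for x
    proof -
      have "x \<in> O1" "\<not> A u x" "\<not> A v x" using x by (auto simp: In_def Bu_def Bv_def)
      then show ?thesis using dgU[of x] dO[of x] adj_commute by auto
    qed
    have other: "\<exists>n\<in>O1. A x n \<and> n \<noteq> y" if "x \<in> In" for x y
    proof -
      have "card (nb O1 x) = 2" using dIn[OF that] by (simp add: dg_def)
      then obtain p q where "nb O1 x = {p, q}" "p \<noteq> q" by (auto simp: card_2_iff)
      then show ?thesis by (metis in_nb insertCI)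
    qed
    have indIn: "\<not> A x y" if xy: "x \<in> In" "y \<in> In" for x y
    proof
      assume a: "A x y"
      obtain n where n: "n \<in> O1" "A x n" "n \<noteq> y" using other[OF xy(1)] by blast
      obtain n' where n': "n' \<in> O1" "A y n'" "n' \<noteq> x" using other[OF xy(2)] by blast
      have "x \<in> O1" "y \<in> O1" using xy by (auto simp: In_def)
      then show False using path[of n x y n'] n n' a adj_sym unfolding O1_def by blast
    qed
    \<comment> \<open>Eight edges leave \<open>In\<close> for the four vertices of
      \<open>Bu \<union> Bv\<close>. Each of these has degree two in \<open>A4\<close> and spends
      one edge on \<open>u\<close> or \<open>v\<close>, so it can take only one.\<close>
    have "2 * card In = (\<Sum>x\<in>In. dg (Bu \<union> Bv) x)"
    proof -
      have "dg (Bu \<union> Bv) x = 2" if x: "x \<in> In" for x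
      proof -
        have "y \<in> Bu \<union> Bv" if "y \<in> O1" "A x y" for y using indIn[OF x, of y] that by (auto simp: In_def)
        then have "nb O1 x = nb (Bu \<union> Bv) x" by (auto simp: Bu_def Bv_def)
        then show ?thesis using dIn[OF x] by (simp add: dg_def)
      qed
      then show ?thesis by simp
    qed
    also have "\<dots> = (\<Sum>x\<in>Bu \<union> Bv. dg In x)" using cross_count fO by (meson finite_UnI)
    also have "\<dots> \<le> (\<Sum>x\<in>Bu \<union> Bv. 1)"
    proof (rule sum_mono)
      fix x assume x: "x \<in> Bu \<union> Bv"
      then have xO: "x \<in> O1" "A x u \<or> A x v" using adj_sym by (auto simp: Bu_def Bv_def)
      have "dg O1 x \<le> 1" using dgU[of x] dO[OF xO(1)] xO(2) by (auto split: if_splits)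
      moreover have "dg In x \<le> dg O1 x" using fO by (intro dg_mono) (auto simp: In_def)
      ultimately show "dg In x \<le> 1" by linarith
    qed
    also have "\<dots> = 4" using cB dBB fO by (simp add: card_Un_disjoint)
    finally show False using cIn by simp
  qed
qed

lemma bound17: "bound 17 31"
  by (rule bound_Suc[OF bound16]) auto

lemma bound18: "bound 18 34"
  by (rule bound_Suc[OF bound17]) auto

lemma bound19: "bound 19 38"
  by (rule bound_Suc[OF bound18]) auto

lemma bound20: "bound 20 41"
proof (rule bound_refine)
  show "bound 20 (Suc 41)" by (rule bound_Suc[OF bound19]) auto
  fix V :: "'a set" assume V: "finite V" "card V = 20" "es V = 2 * Suc 41"
  have min: "4 \<le> dg V v" if "v \<in> V" for v using bound_min_deg[OF bound19 V(1) that] V by simp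
  have "dg V v \<le> 4" if "v \<in> V" for v using nb_sum_min[OF V(1) that min] V by simp
  then show False using es_le_max[OF V(1), of 4] V by simp
qed

text \<open>Neighbour sums make the six vertices of degree five independent. A path of three
  vertices of degree four would, after deletion, leave 35 edges on 18 vertices; so \<open>Q\<close>
  induces at most a matching, and too few edges remain.\<close>

lemma bound21: "bound 21 44"
proof (rule bound_refine)
  show "bound 21 (Suc 44)" by (rule bound_Suc[OF bound20]) auto
  fix V :: "'a set" assume V: "finite V" "card V = 21" "es V = 2 * Suc 44"
  have min: "4 \<le> dg V v" if "v \<in> V" for v using bound_min_deg[OF bound20 V(1) that] V by simp
  have max: "dg V v \<le> 5" if "v \<in> V" for v using nb_sum_min[OF V(1) that min] V by simp
  define P where "P = {v \<in> V. dg V v = Suc 4}"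
  define Q where "Q = {v \<in> V. dg V v = 4}"
  have PQ: "V = P \<union> Q" "P \<inter> Q = {}" "finite P" "finite Q" "card P + card Q = card V"
    "card P + 4 * card V = es V"
    using two_degrees[OF V(1), of 4] min max unfolding P_def Q_def by auto
  have P0: "dg P a = 0" if a: "a \<in> P" for a
  proof (rule ccontr)
    assume "dg P a \<noteq> 0"
    then obtain w where w: "w \<in> P" "A a w" using dg_eq_0[OF PQ(3)] by auto
    have "(\<Sum>u\<in>nb V a. 4) < (\<Sum>u\<in>nb V a. dg V u)"
      using V(1) min w by (intro sum_strict_mono_ex1) (auto simp: P_def intro!: bexI[of _ w])
    then show False using nb_sum_le[OF V(1), of a] a V by (simp add: P_def dg_def)
  qed
  have Q1: "dg Q b \<le> 1" if b: "b \<in> Q" for b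
  proof (rule dg_le_1[OF PQ(4)], rule ccontr)
    fix x y assume xy: "x \<in> Q" "y \<in> Q" "A b x" "A b y" "x \<noteq> y"
    have "x \<noteq> b" "b \<noteq> y" using adj_neq[OF xy(3)] adj_neq[OF xy(4)] by auto
    then have "(\<Sum>v\<in>{x, b, y}. dg V v) = 12" "card {x, b, y} = 3"
      using xy(1,2,5) b by (simp_all add: Q_def)
    then show False using bound_del[OF bound18 V(1), of "{x, b, y}"] es_path[of x b y] xy b adj_sym V
      by (auto simp: Q_def)
  qed
  have "es P = 0" using P0 by (simp add: es_def)
  moreover have "es Q \<le> card Q" using es_le_max[OF PQ(4) Q1] by simp
  moreover have "(\<Sum>v\<in>P. dg Q v) = (\<Sum>v\<in>P. 5)"
  proof (intro sum.cong refl)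
    fix a assume a: "a \<in> P"
    then have "dg V a = 5" by (simp add: P_def)
    then show "dg Q a = 5" using P0[OF a] nb_partition[OF V(1) PQ(1,2), of a] by linarith
  qed
  ultimately show False using es_Un[OF PQ(3,4,2)] PQ V by simp
qed

text \<open>A graph all of whose components have at most three vertices and no cycle.\<close>

lemma es_small_components:
  assumes "finite S" "\<And>v. v \<in> S \<Longrightarrow> dg S v \<le> 2"
    and "\<And>u v. u \<in> S \<Longrightarrow> v \<in> S \<Longrightarrow> A u v \<Longrightarrow> dg S u = 2 \<Longrightarrow> dg S v \<le> 1"
  shows "3 * es S \<le> 4 * card S"
proof -
  define D where "D = {v \<in> S. dg S v = 2}"
  define M where "M = {v \<in> S. dg S v = 1}"
  have f: "finite D" "finite M" using assms(1) by (auto simp: D_def M_def)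
  have nD: "nb S u = nb M u" if u: "u \<in> D" for u
  proof -
    have "dg S v = 1" if "v \<in> S" "A u v" for v
    proof -
      have "dg S v \<noteq> 0" using that u adj_sym[of u v] dg_eq_0[OF assms(1), of v] by (auto simp: D_def)
      then show ?thesis using assms(3)[of u v] that u by (auto simp: D_def)
    qed
    then show ?thesis by (auto simp: M_def)
  qed
  have "2 * card D = (\<Sum>u\<in>D. dg M u)" using nD by (simp add: D_def dg_def)
  also have "\<dots> = (\<Sum>v\<in>M. dg D v)" using cross_count f by blast
  also have "\<dots> \<le> (\<Sum>v\<in>M. 1)"
  proof (rule sum_mono)
    fix v assume "v \<in> M"
    then show "dg D v \<le> 1" using dg_mono[OF assms(1), of D v] by (simp add: M_def D_def)
  qed
  finally have 1: "2 * card D \<le> card M" by simp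
  have "es S \<le> (\<Sum>v\<in>S. (if v \<in> D then 2 else 0) + (if v \<in> M then 1 else 0))"
    unfolding es_def
  proof (rule sum_mono)
    fix v assume "v \<in> S"
    then show "dg S v \<le> (if v \<in> D then 2 else 0) + (if v \<in> M then 1 else 0)"
      using assms(2)[of v] by (auto simp: D_def M_def)
  qed
  also have "\<dots> = 2 * card D + card M"
    using assms(1) by (simp add: sum.distrib sum.If_cases Int_absorb1 D_def M_def Int_def)
  finally have 2: "es S \<le> 2 * card D + card M" .
  have "card D + card M = card (D \<union> M)" using f by (subst card_Un_disjoint) (auto simp: D_def M_def)
  also have "\<dots> \<le> card S" using assms(1) by (intro card_mono) (auto simp: D_def M_def)
  finally show ?thesis using 1 2 by linarith
qed

text \<open>Four vertices of degree four cannot span three edges, which bounds \<open>es Q\<close>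
  through \<open>es_small_components\<close>. Pair counting among the eight vertices of degree five
  forces edges inside \<open>P\<close>, and by the degree sum each of these requires one more inside
  \<open>Q\<close>.\<close>

lemma bound22: "bound 22 47"
proof (rule bound_refine)
  show "bound 22 (Suc 47)" by (rule bound_Suc[OF bound21]) auto
  fix V :: "'a set" assume V: "finite V" "card V = 22" "es V = 2 * Suc 47"
  have min: "4 \<le> dg V v" if "v \<in> V" for v using bound_min_deg[OF bound21 V(1) that] V by simp
  have max: "dg V v \<le> 5" if "v \<in> V" for v using nb_sum_min[OF V(1) that min] V by simp
  define P where "P = {v \<in> V. dg V v = Suc 4}"
  define Q where "Q = {v \<in> V. dg V v = 4}"
  have PQ: "V = P \<union> Q" "P \<inter> Q = {}" "finite P" "finite Q" "card P + card Q = card V"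
    "card P + 4 * card V = es V"
    using two_degrees[OF V(1), of 4] min max unfolding P_def Q_def by auto
  have c: "card P = 8" "card Q = 14" using PQ V by auto
  have four: False if S: "S \<subseteq> Q" "card S = 4" "6 \<le> es S" for S
  proof -
    have "(\<Sum>v\<in>S. dg V v) = (\<Sum>v\<in>S. 4)" using S(1) by (intro sum.cong) (auto simp: Q_def)
    then show False using bound_del[OF bound18 V(1), of S] S V by (auto simp: Q_def)
  qed
  have Q2: "dg Q b \<le> 2" if b: "b \<in> Q" for b
  proof (rule ccontr)
    assume "\<not> dg Q b \<le> 2"
    then obtain X where X: "X \<subseteq> Q" "finite X" "card X = 3" "\<forall>x\<in>X. A b x" using subset_of_card[of 3 Q b] by auto
    have "b \<notin> X" using X(4) adj_irrefl by auto
    then show False using four[of "insert b X"] X b es_star[OF X(2), of b] by auto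
  qed
  have Qnb: "dg Q v \<le> 1" if uv: "u \<in> Q" "v \<in> Q" "A u v" "dg Q u = 2" for u v
  proof (rule ccontr)
    assume "\<not> dg Q v \<le> 1"
    then have "card (nb Q v) = 2" using Q2[OF uv(2)] by (simp add: dg_def)
    then obtain w where w: "w \<in> Q" "A v w" "w \<noteq> u" by (metis card_2_iff in_nb insertCI)
    have "card (nb Q u) = 2" using uv(4) by (simp add: dg_def)
    then obtain z where z: "z \<in> Q" "A u z" "z \<noteq> v" by (metis card_2_iff in_nb insertCI)
    have ne: "w \<noteq> v" "z \<noteq> u" "u \<noteq> v" "w \<noteq> z" using w z uv adj_neq no_triangle[of u v w] adj_sym by auto
    have "4 \<le> es {u, v, w}" using es_path[of u v w] uv w by auto
    moreover have "es (insert z {u, v, w}) = es {u, v, w} + 2 * dg {u, v, w} z"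
      using z w ne by (intro es_insert) auto
    moreover have "0 < dg {u, v, w} z" using adj_sym[OF z(2)] by (subst dg_pos) auto
    ultimately have "6 \<le> es (insert z {u, v, w})" by linarith
    moreover have "card (insert z {u, v, w}) = 4" using z w ne by auto
    ultimately show False using four[of "insert z {u, v, w}"] z w uv by auto
  qed
  have esQ: "3 * es Q \<le> 56" using es_small_components[OF PQ(4) Q2 Qnb] c by simp
  define m where "m = es P"
  have dP: "(\<Sum>v\<in>P. dg Q v) + m = 40"
  proof -
    have "(\<Sum>v\<in>P. dg Q v + dg P v) = (\<Sum>v\<in>P. 5)"
    proof (intro sum.cong refl)
      fix a assume "a \<in> P"
      then have "dg V a = 5" by (simp add: P_def)
      then show "dg Q a + dg P a = 5" using nb_partition[OF V(1) PQ(1,2), of a] by linarith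
    qed
    then show ?thesis using c by (simp add: sum.distrib m_def es_def)
  qed
  have cr: "(\<Sum>v\<in>Q. dg P v) = (\<Sum>v\<in>P. dg Q v)" using cross_count PQ by metis
  \<comment> \<open>This is (q - 2)(q - 3) \<ge> 0; the average number of neighbours in
    \<open>P\<close> lies between two and three.\<close>
  have sq: "4 * q \<le> q * (q - 1) + 6" for q :: nat
  proof (cases "q \<le> 4")
    case True
    then have "q \<in> {0, 1, 2, 3, 4}" by auto
    then show ?thesis by auto
  next
    case False
    then have "q * 4 \<le> q * (q - 1)" by (intro mult_le_mono2) simp
    then show ?thesis by linarith
  qed
  have "(\<Sum>v\<in>Q. 4 * dg P v) \<le> (\<Sum>v\<in>Q. dg P v * (dg P v - 1) + 6)" using sq by (rule sum_mono)
  then have "4 * (\<Sum>v\<in>Q. dg P v) \<le> (\<Sum>v\<in>Q. dg P v * (dg P v - 1)) + 84"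
    using c by (simp add: sum.distrib sum_distrib_left)
  moreover have "(\<Sum>v\<in>Q. dg P v * (dg P v - 1)) \<le> (\<Sum>v\<in>V. dg P v * (dg P v - 1))"
    using V(1) by (intro sum_mono2) (auto simp: Q_def)
  ultimately have m: "4 * (\<Sum>v\<in>Q. dg P v) + m \<le> 140"
    using pair_count[OF V(1) PQ(3)] c by (simp add: m_def)
  have "96 = m + es Q + 2 * (\<Sum>v\<in>P. dg Q v)" using es_Un[OF PQ(3,4,2)] PQ V by (simp add: m_def)
  then show False using m dP cr esQ by linarith
qed

end

section \<open>Edge bounds for 23 and 24 vertices\<close>

context girth5
begin

lemma es_insert_ge:
  assumes "finite S" "x \<notin> S" "k \<le> es S" "\<exists>y\<in>S. A x y"
  shows "k + 2 \<le> es (insert x S)"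
  using es_insert[OF assms(1,2)] dg_pos[OF assms(1), of x] assms(3,4) by simp

lemma no_square: "A a b \<Longrightarrow> A b c \<Longrightarrow> A c d \<Longrightarrow> A d a \<Longrightarrow> a \<noteq> c \<Longrightarrow> b \<noteq> d \<Longrightarrow> False"
  using common_unique[of a b d c] adj_sym by blast

lemma nb_disjoint_adj: "A x y \<Longrightarrow> nb S x \<inter> nb S y = {}"
  using nbs_nonadj[of x y] by auto

lemma nb_disjoint_two: "A z x \<Longrightarrow> A z y \<Longrightarrow> x \<noteq> y \<Longrightarrow> z \<notin> S \<Longrightarrow> nb S x \<inter> nb S y = {}"
  using nbs_meet[of z x y] by auto

lemma dg_le_1_common:
  assumes "finite S" "\<And>w. w \<in> S \<Longrightarrow> A b w" "a \<noteq> b"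
  shows "dg S a \<le> 1"
  using assms common_unique[of b _ _ a] by (intro dg_le_1) auto

lemma dg_Un3: "finite S \<Longrightarrow> finite T \<Longrightarrow> finite U \<Longrightarrow> S \<inter> T = {} \<Longrightarrow> (S \<union> T) \<inter> U = {} \<Longrightarrow>
    dg (S \<union> T \<union> U) v = dg S v + dg T v + dg U v"
  using dg_Un[of "S \<union> T" U v] dg_Un[of S T v] by simp

text \<open>In case of equality in the pair count every vertex of \<open>T\<close> reaches all of \<open>T\<close>.\<close>

lemma pair_count_tight:
  assumes "finite V" "T \<subseteq> V" "a \<in> T" "dg T a = 0"
    and "card T * (card T - 1) \<le> (\<Sum>v\<in>V. dg T v * (dg T v - 1)) + es T"
  shows "card T - 1 \<le> (\<Sum>b\<in>nb V a. dg T b - 1)"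
proof -
  define T' where "T' = T - {a}"
  have fT: "finite T" using assms finite_subset by blast
  have f: "finite T'" and cT: "card T = Suc (card T')" using fT assms(3) card_Suc_Diff1[of T a] by (auto simp: T'_def)
  have e: "es T = es T'" using es_delete[OF fT assms(3)] assms(4) by (simp add: T'_def)
  \<comment> \<open>Only at neighbours of \<open>a\<close> does the pair count change when
    \<open>a\<close> is removed. The pair bound for \<open>T'\<close> leaves the difference to
    them.\<close>
  have d: "dg T v * (dg T v - 1) = dg T' v * (dg T' v - 1) + (if A v a then 2 * (dg T v - 1) else 0)" for v
    using dg_cut[OF fT assms(3), of v] by (cases "dg T' v") (auto simp: T'_def)
  have "(\<Sum>v\<in>V. dg T v * (dg T v - 1)) = (\<Sum>v\<in>V. dg T' v * (dg T' v - 1)) + (\<Sum>v\<in>V. if A v a then 2 * (dg T v - 1) else 0)"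
    unfolding d by (rule sum.distrib)
  also have "(\<Sum>v\<in>V. if A v a then 2 * (dg T v - 1) else 0) = (\<Sum>v\<in>nb V a. 2 * (dg T v - 1))"
    unfolding nb_def adj_commute[of _ a] using assms(1) by (rule sum.inter_filter[symmetric])
  also have "\<dots> = 2 * (\<Sum>v\<in>nb V a. dg T v - 1)" by (simp add: sum_distrib_left)
  finally have "card T * (card T - 1) \<le> card T' * (card T' - 1) + 2 * (\<Sum>v\<in>nb V a. dg T v - 1)"
    using assms(5) pair_count[OF assms(1) f] e by linarith
  moreover have "card T * (card T - 1) = card T' * (card T' - 1) + 2 * card T'"
    unfolding cT by (cases "card T'") auto
  ultimately show ?thesis unfolding cT by simp
qed

lemma sum_levels:
  fixes f :: "'b \<Rightarrow> nat" and g :: "nat \<Rightarrow> nat"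
  assumes "finite S" "\<And>x. x \<in> S \<Longrightarrow> f x \<le> n"
  shows "(\<Sum>x\<in>S. g (f x)) = (\<Sum>i\<le>n. g i * card {x \<in> S. f x = i})"
proof -
  have "(\<Sum>x\<in>S. g (f x)) = (\<Sum>x\<in>S. \<Sum>i\<le>n. if f x = i then g i else 0)"
    using assms by (intro sum.cong) auto
  also have "\<dots> = (\<Sum>i\<le>n. \<Sum>x\<in>S. if f x = i then g i else 0)" by (rule sum.swap)
  also have "\<dots> = (\<Sum>i\<le>n. g i * card {x \<in> S. f x = i})"
    using assms(1) by (intro sum.cong) (auto simp: sum.If_cases Int_def mult.commute)
  finally show ?thesis .
qed

end

section \<open>A hypothetical graph with 23 vertices and 51 edges\<close>

locale crit23 = girth5 +
  fixes V :: "'a set"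
  assumes finV: "finite V" and card_V: "card V = 23" and es_V: "es V = 102"
begin

definition P :: "'a set" where "P = {v \<in> V. dg V v = 5}"
definition Q :: "'a set" where "Q = {v \<in> V. dg V v = 4}"

lemma deg_bounds: "v \<in> V \<Longrightarrow> 4 \<le> dg V v \<and> dg V v \<le> 5"
proof -
  assume v: "v \<in> V"
  have min: "4 \<le> dg V u" if "u \<in> V" for u using bound_min_deg[OF bound22 finV that] card_V es_V by simp
  show ?thesis using min[OF v] nb_sum_min[OF finV v min] card_V by simp
qed

lemma PQ: "V = P \<union> Q" "P \<inter> Q = {}" "finite P" "finite Q" "card P = 10" "card Q = 13"
proof -
  have "\<And>v. v \<in> V \<Longrightarrow> 4 \<le> dg V v \<and> dg V v \<le> Suc 4" using deg_bounds by simp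
  note t = two_degrees[OF finV this]
  show "V = P \<union> Q" "P \<inter> Q = {}" "finite P" "finite Q" "card P = 10" "card Q = 13"
    using t card_V es_V unfolding P_def Q_def by simp_all
qed

lemma in_P_V: "a \<in> P \<Longrightarrow> a \<in> V" and in_Q_V: "b \<in> Q \<Longrightarrow> b \<in> V"
  by (simp_all add: P_def Q_def)

lemma not_PQ: "a \<in> P \<Longrightarrow> b \<in> Q \<Longrightarrow> a \<noteq> b"
  using PQ(2) by blast

lemma not_P: "b \<in> Q \<Longrightarrow> b \<notin> P"
  using PQ(2) by blast

lemma dg_V: "dg V v = dg P v + dg Q v"
  by (rule nb_partition[OF finV PQ(1,2)])

lemma dg_P5: "a \<in> P \<Longrightarrow> dg P a + dg Q a = 5"
  using dg_V[of a] by (simp add: P_def)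

lemma dg_Q4: "b \<in> Q \<Longrightarrow> dg P b + dg Q b = 4"
  using dg_V[of b] by (simp add: Q_def)

text \<open>The degrees around \<open>a\<close> sum to 20 plus the number of its neighbours in
  \<open>P\<close>, and at most 22 is available.\<close>

lemma dg_PP: "a \<in> P \<Longrightarrow> dg P a \<le> 2"
proof -
  assume a: "a \<in> P"
  have "(\<Sum>w\<in>nb V a. dg V w) = (\<Sum>w\<in>nb V a. 4 + (if w \<in> P then 1 else 0))"
  proof (intro sum.cong refl)
    fix w assume "w \<in> nb V a"
    then show "dg V w = 4 + (if w \<in> P then 1 else 0)" using deg_bounds[of w] by (auto simp: P_def)
  qed
  also have "\<dots> = 4 * dg V a + card (nb V a \<inter> P)"
    using finV by (simp add: sum.distrib dg_def sum.If_cases)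
  also have "nb V a \<inter> P = nb P a" using in_P_V by auto
  finally have "(\<Sum>w\<in>nb V a. dg V w) = 20 + dg P a" using a by (simp add: dg_def P_def)
  then show ?thesis using nb_sum_le[OF finV in_P_V[OF a]] card_V by simp
qed

lemma sum_dg_PQ: "(\<Sum>v\<in>P. dg Q v) + es P = 50"
proof -
  have "(\<Sum>a\<in>P. dg Q a + dg P a) = (\<Sum>a\<in>P. 5)" using dg_P5 by (intro sum.cong) (simp_all add: add.commute)
  then show ?thesis using PQ(5) by (simp add: sum.distrib es_def)
qed

text \<open>Counting the edges at \<open>P\<close> and all 51 edges ties the two induced graphs
  together, so the case distinction can run over the edges inside \<open>P\<close> alone.\<close>

lemma es_Q: "es Q = es P + 2"
  using es_Un[OF PQ(3,4,2)] sum_dg_PQ es_V PQ(1) by simp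

text \<open>Deleting five such vertices with four inner edges would leave 51 - 16 = 35 edges on 18
  vertices. Hence components of \<open>Q\<close> have at most four vertices.\<close>

lemma five: "S \<subseteq> Q \<Longrightarrow> card S = 5 \<Longrightarrow> es S \<le> 6"
proof -
  assume S: "S \<subseteq> Q" "card S = 5"
  have "(\<Sum>v\<in>S. dg V v) = (\<Sum>v\<in>S. 4)" using S(1) by (intro sum.cong) (auto simp: Q_def)
  moreover have "S \<subseteq> V" using S(1) in_Q_V by blast
  ultimately show ?thesis using bound_del[OF bound18 finV, of S] S card_V es_V by simp
qed

text \<open>Four vertices with three edges are a whole component of \<open>Q\<close>, because one
  more neighbour would give five vertices with four edges.\<close>

lemma grow:
  assumes "S \<subseteq> Q" "card S = 4" "6 \<le> es S" "u \<in> S" "w \<in> Q" "A u w"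
  shows "w \<in> S"
proof (rule ccontr)
  assume w: "w \<notin> S"
  have f: "finite S" using assms(1) PQ(4) finite_subset by blast
  have "8 \<le> es (insert w S)" using es_insert_ge[OF f w assms(3)] assms(4) adj_sym[OF assms(6)] by auto
  then show False using five[of "insert w S"] assms w f by simp
qed

lemma dg_QQ: "b \<in> Q \<Longrightarrow> dg Q b \<le> 3"
proof (rule ccontr)
  assume b: "b \<in> Q" "\<not> dg Q b \<le> 3"
  then obtain X where X: "X \<subseteq> Q" "finite X" "card X = 4" "\<forall>x\<in>X. A b x"
    using subset_of_card[of 4 Q b] by auto
  have "b \<notin> X" using X(4) adj_irrefl by auto
  then show False using five[of "insert b X"] X b es_star[OF X(2), of b] by auto
qed

lemma star_leaf:
  assumes "b \<in> Q" "dg Q b = 3" "x \<in> Q" "A b x"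
  shows "dg Q x = 1"
proof -
  define S where "S = insert b (nb Q b)"
  have f: "finite (nb Q b)" using PQ(4) by simp
  have "b \<notin> nb Q b" using adj_irrefl by simp
  then have S: "S \<subseteq> Q" "card S = 4" "6 \<le> es S"
    using assms f es_star[OF f, of b] by (auto simp: S_def dg_def)
  have "nb Q x = {b}"
  proof
    show "nb Q x \<subseteq> {b}"
    proof
      fix y assume y: "y \<in> nb Q x"
      have "y \<in> S" using grow[OF S, of x y] y assms by (auto simp: S_def)
      then show "y \<in> {b}" using y nbs_nonadj[OF assms(4), of y] by (auto simp: S_def)
    qed
  qed (use assms adj_sym in auto)
  then show ?thesis by (simp add: dg_def)
qed

lemma path4_component:
  assumes "x1 \<in> Q" "x2 \<in> Q" "x3 \<in> Q" "x4 \<in> Q" "A x1 x2" "A x2 x3" "A x3 x4" "x1 \<noteq> x3" "x2 \<noteq> x4"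
  shows "nb Q x1 = {x2}" "nb Q x2 = {x1, x3}" "nb Q x3 = {x2, x4}" "nb Q x4 = {x3}" "x1 \<noteq> x4"
proof -
  have ne: "x1 \<noteq> x2" "x2 \<noteq> x3" "x3 \<noteq> x4" using adj_neq assms(5-7) by auto
  show n14: "x1 \<noteq> x4" using no_triangle[of x1 x2 x3] assms(5-7) by blast
  have s: "A x2 x1" "A x3 x2" "A x4 x3" using assms(5-7) adj_sym by auto
  have na: "\<not> A x1 x3" "\<not> A x2 x4" "\<not> A x1 x4"
    using nbs_nonadj[OF s(1) assms(6)] nbs_nonadj[OF s(2) assms(7)]
      no_square[of x1 x2 x3 x4] adj_sym[of x1 x4] assms(5-9) by auto
  define S where "S = {x1, x2, x3, x4}"
  have "es {x1, x2, x3} \<ge> 4" using es_path assms by blast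
  then have "6 \<le> es (insert x4 {x1, x2, x3})" using es_insert_ge[of "{x1, x2, x3}" x4 4] ne n14 assms(9) s(3) by auto
  moreover have "insert x4 {x1, x2, x3} = S" by (auto simp: S_def)
  ultimately have S: "S \<subseteq> Q" "card S = 4" "6 \<le> es S" using assms ne n14 by (auto simp: S_def)
  have sub: "nb Q u = {w \<in> S. A u w}" if "u \<in> S" for u
    using grow[OF S that] S(1) by auto
  show "nb Q x1 = {x2}" "nb Q x2 = {x1, x3}" "nb Q x3 = {x2, x4}" "nb Q x4 = {x3}"
    using sub[of x1] sub[of x2] sub[of x3] sub[of x4] na adj_irrefl s assms(5-7) adj_sym[of x3 x1]
      adj_sym[of x4 x2] adj_sym[of x4 x1] by (auto simp: S_def)
qed

text \<open>The pentagon through \<open>a\<close> has degree sum 21 and at least five inner edges;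
  deleting it would leave at least 35 edges on 18 vertices.\<close>

lemma no_pentagon:
  assumes "a \<in> P" "x1 \<in> Q" "x2 \<in> Q" "x3 \<in> Q" "x4 \<in> Q" "A x1 x2" "A x2 x3" "A x3 x4" "x1 \<noteq> x3" "x2 \<noteq> x4"
    "A a x1" "A a x4"
  shows False
proof -
  have ne: "x1 \<noteq> x2" "x2 \<noteq> x3" "x3 \<noteq> x4" "x1 \<noteq> x4" using adj_neq assms(6-8) path4_component[OF assms(2-10)] by auto
  define S where "S = {x1, x2, x3, x4}"
  have "es {x1, x2, x3} \<ge> 4" using es_path assms by blast
  then have "6 \<le> es (insert x4 {x1, x2, x3})"
    using es_insert_ge[of "{x1, x2, x3}" x4 4] ne assms(10) adj_sym[OF assms(8)] by auto
  moreover have "insert x4 {x1, x2, x3} = S" by (auto simp: S_def)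
  ultimately have S: "6 \<le> es S" "finite S" by (auto simp: S_def)
  have aS: "a \<notin> S" using not_P assms(1-5) by (auto simp: S_def)
  have "2 \<le> dg S a" using dg_two[of x1 S x4 a] ne assms(11,12) by (auto simp: S_def)
  then have e: "10 \<le> es (insert a S)" using es_insert[OF S(2) aS] S(1) by simp
  have "(\<Sum>v\<in>insert a S. dg V v) = 21" using assms(1-5) aS ne assms(9,10) S(2) by (simp add: S_def P_def Q_def)
  moreover have "insert a S \<subseteq> V" using assms(1-5) in_P_V in_Q_V by (auto simp: S_def)
  moreover have "card (insert a S) = 5" using aS S(2) ne assms(9,10) by (simp add: S_def)
  ultimately show False using bound_del[OF bound18 finV, of "insert a S"] e card_V es_V by simp
qed

section \<open>Counts by degree inside \<open>Q\<close> and inside \<open>P\<close>\<close>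

definition "N i = {b \<in> Q. dg Q b = i}"
definition "L i = {a \<in> P. dg P a = i}"

lemma finite_NL: "finite (N i)" "finite (L i)"
  using PQ by (auto simp: N_def L_def)

lemma N_counts:
  "card (N 0) + card (N 1) + card (N 2) + card (N 3) = 13"
  "card (N 1) + 2 * card (N 2) + 3 * card (N 3) = es P + 2"
proof -
  have f: "(\<Sum>b\<in>Q. g (dg Q b)) = g 0 * card (N 0) + g 1 * card (N 1) + g 2 * card (N 2) + g 3 * card (N 3)"
    for g :: "nat \<Rightarrow> nat"
    using sum_levels[OF PQ(4) dg_QQ, where g = g] by (simp add: N_def numeral_eq_Suc)
  show "card (N 0) + card (N 1) + card (N 2) + card (N 3) = 13" using f[of "\<lambda>_. 1"] PQ by simp
  show "card (N 1) + 2 * card (N 2) + 3 * card (N 3) = es P + 2" using f[of "\<lambda>i. i"] es_Q by (simp add: es_def)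
qed

lemma L_counts: "card (L 0) + card (L 1) + card (L 2) = 10" "card (L 1) + 2 * card (L 2) = es P"
proof -
  have f: "(\<Sum>b\<in>P. g (dg P b)) = g 0 * card (L 0) + g 1 * card (L 1) + g 2 * card (L 2)" for g :: "nat \<Rightarrow> nat"
    using sum_levels[OF PQ(3) dg_PP, where g = g] by (simp add: L_def numeral_eq_Suc)
  show "card (L 0) + card (L 1) + card (L 2) = 10" using f[of "\<lambda>_. 1"] PQ by simp
  show "card (L 1) + 2 * card (L 2) = es P" using f[of "\<lambda>i. i"] by (simp add: es_def)
qed

text \<open>A vertex with \<open>i\<close> neighbours in \<open>Q\<close> has 4 - i in
  \<open>P\<close> and so (4 - i)(3 - i) ordered pairs of them, none when \<open>i\<close> is three.
  In \<open>P\<close> only the vertices with two neighbours there contribute.\<close>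

lemma pairs_eq: "(\<Sum>v\<in>V. dg P v * (dg P v - 1)) =
    12 * card (N 0) + 6 * card (N 1) + 2 * card (N 2) + 2 * card (L 2)"
proof -
  have "(\<Sum>v\<in>V. dg P v * (dg P v - 1)) = (\<Sum>v\<in>P. dg P v * (dg P v - 1)) + (\<Sum>v\<in>Q. dg P v * (dg P v - 1))"
    by (subst PQ(1)) (rule sum.union_disjoint[OF PQ(3,4,2)])
  also have "(\<Sum>v\<in>P. dg P v * (dg P v - 1)) = 2 * card (L 2)"
    using sum_levels[OF PQ(3) dg_PP, where g = "\<lambda>i. i * (i - 1)"] by (simp add: L_def numeral_eq_Suc)
  also have "(\<Sum>v\<in>Q. dg P v * (dg P v - 1)) = (\<Sum>v\<in>Q. (4 - dg Q v) * (3 - dg Q v))"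
  proof (intro sum.cong refl)
    fix b assume "b \<in> Q"
    then have "dg P b = 4 - dg Q b" using dg_Q4[of b] by linarith
    then show "dg P b * (dg P b - 1) = (4 - dg Q b) * (3 - dg Q b)" by simp
  qed
  also have "\<dots> = 12 * card (N 0) + 6 * card (N 1) + 2 * card (N 2)"
    using sum_levels[OF PQ(4) dg_QQ, where g = "\<lambda>i. (4 - i) * (3 - i)"] by (simp add: N_def numeral_eq_Suc)
  finally show ?thesis by simp
qed

lemma pairs_le: "12 * card (N 0) + 6 * card (N 1) + 2 * card (N 2) + 2 * card (L 2) + es P \<le> 90"
  using pair_count[OF finV PQ(3)] pairs_eq PQ(5) by simp

lemma N2_nbrs: "b \<in> N 2 \<Longrightarrow> \<exists>x y. x \<in> Q \<and> y \<in> Q \<and> x \<noteq> y \<and> nb Q b = {x, y}"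
proof -
  assume "b \<in> N 2"
  then have "card (nb Q b) = 2" by (simp add: N_def dg_def)
  then obtain x y where "nb Q b = {x, y}" "x \<noteq> y" by (auto simp: card_2_iff)
  moreover from this have "x \<in> Q" "y \<in> Q" using nb_subset[of Q b] by auto
  ultimately show ?thesis by blast
qed

text \<open>Two adjacent vertices of degree two are the inner vertices of a path component, which
  \<open>path4_component\<close> describes completely.\<close>

lemma N2_N2: "b \<in> N 2 \<Longrightarrow> c \<in> N 2 \<Longrightarrow> A b c \<Longrightarrow>
    \<exists>x y. nb Q x = {b} \<and> nb Q b = {x, c} \<and> nb Q c = {b, y} \<and> nb Q y = {c} \<and> x \<in> Q \<and> y \<in> Q \<and> x \<noteq> c \<and> b \<noteq> y"
proof -
  assume bc: "b \<in> N 2" "c \<in> N 2" "A b c"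
  have Q: "b \<in> Q" "c \<in> Q" using bc by (auto simp: N_def)
  obtain x where x: "x \<in> Q" "A b x" "x \<noteq> c" using N2_nbrs[OF bc(1)] by (metis in_nb insertCI)
  obtain y where y: "y \<in> Q" "A c y" "y \<noteq> b" using N2_nbrs[OF bc(2)] by (metis in_nb insertCI)
  show ?thesis
    using path4_component[OF x(1) Q y(1) adj_sym[OF x(2)] bc(3) y(2) x(3)] x y by blast
qed

lemma N2_dg_N2: "b \<in> N 2 \<Longrightarrow> dg (N 2) b \<le> 1"
proof (rule dg_le_1)
  fix c c' assume b: "b \<in> N 2" "c \<in> N 2" "c' \<in> N 2" "A b c" "A b c'"
  obtain x where x: "nb Q b = {x, c}" "nb Q x = {b}" using N2_N2[OF b(1,2,4)] by blast
  have "c' \<in> nb Q b" using b by (simp add: N_def)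
  moreover have "c' \<noteq> x" using x(2) b(3) by (auto simp: N_def dg_def)
  ultimately show "c = c'" using x by blast
qed (rule finite_NL)

lemma N2_nb_N3: "b \<in> N 2 \<Longrightarrow> x \<in> Q \<Longrightarrow> A b x \<Longrightarrow> x \<in> N 1 \<or> x \<in> N 2"
proof -
  assume b: "b \<in> N 2" "x \<in> Q" "A b x"
  have "dg Q x \<noteq> 3" using star_leaf[of x b] b adj_sym[OF b(3)] by (auto simp: N_def)
  moreover have "dg Q x \<noteq> 0" using b adj_sym[OF b(3)] dg_eq_0[OF PQ(4), of x] by (auto simp: N_def)
  ultimately show ?thesis using dg_QQ[OF b(2)] b(2) by (auto simp: N_def)
qed

lemma N2_dg: "b \<in> N 2 \<Longrightarrow> dg (N 1) b + dg (N 2) b = 2"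
proof -
  assume b: "b \<in> N 2"
  have "nb Q b = nb (N 1 \<union> N 2) b" using N2_nb_N3[OF b] by (auto simp: N_def)
  then have "dg Q b = dg (N 1 \<union> N 2) b" by (simp add: dg_def)
  also have "\<dots> = dg (N 1) b + dg (N 2) b" by (rule dg_Un[OF finite_NL(1) finite_NL(1)]) (auto simp: N_def)
  finally show ?thesis using b by (simp add: N_def)
qed

text \<open>Leaves are counted by their neighbours: a vertex of degree two in \<open>Q\<close> has a
  leaf beside it, the centre of a star has three, and a leaf serves only one of them.\<close>

lemma N_ineq: "card (N 2) + 3 * card (N 3) \<le> card (N 1)"
proof -
  have "(\<Sum>b\<in>N 2. 1) \<le> (\<Sum>b\<in>N 2. dg (N 1) b)"
  proof (rule sum_mono)
    fix b assume "b \<in> N 2"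
    then show "1 \<le> dg (N 1) b" using N2_dg[of b] N2_dg_N2[of b] by linarith
  qed
  moreover have "(\<Sum>b\<in>N 3. 3) = (\<Sum>b\<in>N 3. dg (N 1) b)"
  proof (intro sum.cong refl)
    fix b assume b: "b \<in> N 3"
    then have "nb Q b = nb (N 1) b" using star_leaf[of b] by (auto simp: N_def)
    then show "3 = dg (N 1) b" using b by (simp add: N_def dg_def)
  qed
  moreover have "(\<Sum>b\<in>N 2. dg (N 1) b) + (\<Sum>b\<in>N 3. dg (N 1) b) = (\<Sum>x\<in>N 1. dg (N 2) x + dg (N 3) x)"
    using cross_count finite_NL by (simp add: sum.distrib)
  moreover have "\<dots> \<le> (\<Sum>x\<in>N 1. 1)"
  proof (rule sum_mono)
    fix x assume x: "x \<in> N 1"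
    have "dg (N 2) x + dg (N 3) x = dg (N 2 \<union> N 3) x"
      by (rule dg_Un[symmetric, OF finite_NL(1) finite_NL(1)]) (auto simp: N_def)
    also have "\<dots> \<le> dg Q x" by (rule dg_mono[OF PQ(4)]) (auto simp: N_def)
    finally show "dg (N 2) x + dg (N 3) x \<le> 1" using x by (simp add: N_def)
  qed
  ultimately show ?thesis by simp
qed

section \<open>Classes of \<open>P\<close> induced by components of \<open>Q\<close>\<close>

lemma card_nb_P: "b \<in> Q \<Longrightarrow> card (nb P b) = 4 - dg Q b"
  using dg_Q4[of b] by (simp add: dg_def)

text \<open>A star component uses up all of \<open>P\<close>, so the \<open>P\<close>-neighbour of its centre has no neighbour in \<open>P\<close>.\<close>

lemma star_isolated: "N 3 \<noteq> {} \<Longrightarrow> L 0 \<noteq> {}"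
proof -
  assume "N 3 \<noteq> {}"
  then obtain c where c: "c \<in> Q" "dg Q c = 3" by (auto simp: N_def)
  have "card (nb Q c) = 3" using c by (simp add: dg_def)
  then obtain x y z where xyz: "nb Q c = {x, y, z}" "x \<noteq> y" "x \<noteq> z" "y \<noteq> z" by (auto simp: card_3_iff)
  then have q: "x \<in> Q" "y \<in> Q" "z \<in> Q" "A c x" "A c y" "A c z" using nb_subset[of Q c] in_nb by auto
  then have "dg Q x = 1" "dg Q y = 1" "dg Q z = 1" using star_leaf[OF c] by auto
  then have cards: "card (nb P x) = 3" "card (nb P y) = 3" "card (nb P z) = 3" "card (nb P c) = 1"
    using card_nb_P q c by auto
  have cP: "c \<notin> P" using c not_P by blast
  have d: "nb P x \<inter> nb P y = {}" "nb P x \<inter> nb P z = {}" "nb P y \<inter> nb P z = {}"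
    "nb P c \<inter> nb P x = {}" "nb P c \<inter> nb P y = {}" "nb P c \<inter> nb P z = {}"
    using nb_disjoint_two[of c x y P] nb_disjoint_two[of c x z P] nb_disjoint_two[of c y z P]
      nb_disjoint_adj[of c x P] nb_disjoint_adj[of c y P] nb_disjoint_adj[of c z P] q xyz cP by auto
  have "card (nb P x \<union> nb P y \<union> nb P z \<union> nb P c) = 10"
    using d cards PQ(3) by (simp add: card_Un_disjoint Int_Un_distrib Int_Un_distrib2 Int_commute)
  then have P: "nb P x \<union> nb P y \<union> nb P z \<union> nb P c = P" using PQ(3,5) by (intro card_subset_eq) auto
  obtain a where a: "nb P c = {a}" using cards(4) by (auto simp: card_1_singleton_iff)
  have aP: "a \<in> P" "A c a" using a nb_subset[of P c] in_nb[of a P c] by auto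
  have "\<not> A a w" if w: "w \<in> P" for w
  proof
    assume aw: "A a w"
    have "w \<noteq> a" using aw adj_irrefl by auto
    then have "w \<notin> nb P c" using a by simp
    moreover have "w \<in> nb P x \<union> nb P y \<union> nb P z \<union> nb P c" using w by (simp only: P)
    ultimately obtain u where u: "u \<in> {x, y, z}" "A u w" by auto
    then have "A c u" "u \<in> Q" using q by auto
    then show False using no_square[of a w u c] aw u aP adj_sym[of u w] adj_sym[of c u] not_P[of u] w c not_P[of c] by blast
  qed
  then have "a \<in> L 0" using aP dg_eq_0[OF PQ(3)] by (auto simp: L_def)
  then show ?thesis by blast
qed

text \<open>An edge between a neighbour of \<open>r\<close> and one of \<open>s\<close> would close
  a 4-cycle. Such independent sets of size six are too large for the structure that path components
  impose on \<open>P\<close>.\<close>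

lemma K2_independent:
  assumes "r \<in> Q" "s \<in> Q" "A r s" "dg Q r = 1" "dg Q s = 1"
  defines "I \<equiv> nb P r \<union> nb P s"
  shows "I \<subseteq> P" "card I = 6" "\<And>x y. x \<in> I \<Longrightarrow> y \<in> I \<Longrightarrow> \<not> A x y"
proof -
  show "I \<subseteq> P" by (auto simp: I_def)
  show "card I = 6"
    unfolding I_def using card_nb_P[OF assms(1)] card_nb_P[OF assms(2)] assms(4,5) nb_disjoint_adj[OF assms(3)] PQ(3)
    by (simp add: card_Un_disjoint)
  have rs: False if "A r x" "A s y" "A x y" "x \<in> P" "y \<in> P" for x y
    using no_square[of r x y s] that adj_sym assms(1-3) not_P by blast
  fix x y assume "x \<in> I" "y \<in> I"
  then show "\<not> A x y" using nbs_nonadj[of r x y] nbs_nonadj[of s x y] rs[of x y] rs[of y x] adj_sym[of x y]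
    unfolding I_def by auto
qed

text \<open>The neighbourhoods of a path component with three vertices take 3 + 2 + 3 vertices of
  \<open>P\<close> and leave two in \<open>U\<close>. Every edge of \<open>P\<close> either matches
  \<open>T1\<close> with \<open>T3\<close> or meets \<open>U\<close>, where degrees are at most two;
  this allows 3 + 4 edges. The other claims exploit equality.\<close>

lemma P3_classes:
  assumes "b1 \<in> Q" "b2 \<in> Q" "b3 \<in> Q" "A b1 b2" "A b2 b3" "b1 \<noteq> b3" "dg Q b1 = 1" "dg Q b2 = 2" "dg Q b3 = 1"
  defines "T1 \<equiv> nb P b1" and "T2 \<equiv> nb P b2" and "T3 \<equiv> nb P b3" and "U \<equiv> P - (nb P b1 \<union> nb P b2 \<union> nb P b3)"
  shows "es P \<le> 14"
    and "es P = 14 \<Longrightarrow> a \<in> U \<Longrightarrow> dg P a = 2"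
    and "es P = 14 \<Longrightarrow> dg P a = 0 \<Longrightarrow> a \<in> P \<Longrightarrow> A a b2"
    and "es P = 14 \<Longrightarrow> L 0 = {} \<Longrightarrow> I \<subseteq> P \<Longrightarrow> (\<And>x y. x \<in> I \<Longrightarrow> y \<in> I \<Longrightarrow> \<not> A x y) \<Longrightarrow> card I \<le> 5"
proof -
  have fin: "finite T1" "finite T2" "finite T3" "finite U" using PQ(3) by (auto simp: T1_def T2_def T3_def U_def)
  have c: "card T1 = 3" "card T2 = 2" "card T3 = 3"
    using card_nb_P assms(1-3,7-9) by (auto simp: T1_def T2_def T3_def)
  have d: "T1 \<inter> T2 = {}" "T2 \<inter> T3 = {}" "T1 \<inter> T3 = {}"
    using nb_disjoint_adj[OF assms(4)] nb_disjoint_adj[OF assms(5)]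
      nb_disjoint_two[OF adj_sym[OF assms(4)] assms(5,6) not_P[OF assms(2)]] by (auto simp: T1_def T2_def T3_def)
  have dU: "(T1 \<union> T2 \<union> T3) \<inter> U = {}" by (auto simp: U_def T1_def T2_def T3_def)
  have P: "P = T1 \<union> T2 \<union> T3 \<union> U" unfolding U_def T1_def T2_def T3_def nb_def by blast
  have cU: "card U = 2"
  proof -
    have "card (T1 \<union> T2 \<union> T3) = 8" using c d fin by (simp add: card_Un_disjoint Int_Un_distrib2)
    moreover have "U = P - (T1 \<union> T2 \<union> T3)" by (simp add: U_def T1_def T2_def T3_def)
    moreover have "T1 \<union> T2 \<union> T3 \<subseteq> P" by (auto simp: T1_def T2_def T3_def)
    ultimately show ?thesis using PQ(3,5) fin by (simp add: card_Diff_subset)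
  qed
  have in1: "A b1 x" "x \<in> P" if "x \<in> T1" for x using that by (auto simp: T1_def)
  have in2: "A b2 x" "x \<in> P" if "x \<in> T2" for x using that by (auto simp: T2_def)
  have in3: "A b3 x" "x \<in> P" if "x \<in> T3" for x using that by (auto simp: T3_def)
  have n11: "\<not> A x y" if "x \<in> T1" "y \<in> T1" for x y using nbs_nonadj in1 that by blast
  have n22: "\<not> A x y" if "x \<in> T2" "y \<in> T2" for x y using nbs_nonadj in2 that by blast
  have n33: "\<not> A x y" if "x \<in> T3" "y \<in> T3" for x y using nbs_nonadj in3 that by blast
  have n12: "\<not> A x y" "\<not> A y x" if "x \<in> T1" "y \<in> T2" for x y
  proof -
    have "\<not> A x y"
      using no_square[of b1 x y b2] in1[OF that(1)] in2[OF that(2)] adj_sym[OF assms(4)] adj_sym[of b2 y]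
        not_PQ[of y b1] not_PQ[of x b2] assms(1,2) by auto
    then show "\<not> A x y" "\<not> A y x" using adj_sym[of y x] by auto
  qed
  have n23: "\<not> A x y" "\<not> A y x" if "x \<in> T2" "y \<in> T3" for x y
  proof -
    have "\<not> A x y"
      using no_square[of b2 x y b3] in2[OF that(1)] in3[OF that(2)] adj_sym[OF assms(5)] adj_sym[of b3 y]
        not_PQ[of y b2] not_PQ[of x b3] assms(2,3) by auto
    then show "\<not> A x y" "\<not> A y x" using adj_sym[of y x] by auto
  qed
  have dP: "dg P x = dg T1 x + dg T2 x + dg T3 x + dg U x" for x
    unfolding P using dg_Un[of "T1 \<union> T2 \<union> T3" U x] dg_Un3[of T1 T2 T3 x] fin d dU by (simp add: Int_Un_distrib2)
  have z: "dg T1 x = 0 \<and> dg T2 x = 0" if "x \<in> T1" for x using that n11 n12 dg_eq_0 fin by auto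
  have z2: "dg T1 x = 0 \<and> dg T2 x = 0 \<and> dg T3 x = 0" if "x \<in> T2" for x using that n22 n12 n23 dg_eq_0 fin by auto
  have z3: "dg T2 x = 0 \<and> dg T3 x = 0" if "x \<in> T3" for x using that n33 n23 dg_eq_0 fin by auto
  have le1: "dg T1 x \<le> 1" "dg T2 x \<le> 1" "dg T3 x \<le> 1" if "x \<in> P" for x
    using dg_le_1_common[OF fin(1) in1(1), of x] dg_le_1_common[OF fin(2) in2(1), of x] dg_le_1_common[OF fin(3) in3(1), of x]
      not_PQ that assms(1-3) by auto
  have t1: "dg P x = dg T3 x + dg U x" if "x \<in> T1" for x using dP[of x] z[OF that] by simp
  have t2: "dg P x = dg U x" if "x \<in> T2" for x using dP[of x] z2[OF that] by simp
  have t3: "dg P x = dg T1 x + dg U x" if "x \<in> T3" for x using dP[of x] z3[OF that] by simp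
  have sumP: "es P = (\<Sum>x\<in>T1. dg P x) + (\<Sum>x\<in>T2. dg P x) + (\<Sum>x\<in>T3. dg P x) + (\<Sum>x\<in>U. dg P x)"
  proof -
    have "es P = (\<Sum>x\<in>T1 \<union> T2 \<union> T3 \<union> U. dg P x)" unfolding es_def using P by simp
    then show ?thesis using fin d dU by (simp add: sum.union_disjoint Int_Un_distrib2)
  qed
  have crossU: "(\<Sum>x\<in>T1. dg U x) + (\<Sum>x\<in>T2. dg U x) + (\<Sum>x\<in>T3. dg U x) + es U = (\<Sum>x\<in>U. dg P x)"
    using cross_count[OF fin(1,4)] cross_count[OF fin(2,4)] cross_count[OF fin(3,4)]
    by (simp add: dP sum.distrib es_def)
  have s1: "(\<Sum>x\<in>T1. dg T3 x) \<le> 3" "(\<Sum>x\<in>T3. dg T1 x) \<le> 3" "(\<Sum>x\<in>U. dg P x) \<le> 4"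
    using sum_bounded_above[of T1 "dg T3" 1] sum_bounded_above[of T3 "dg T1" 1] sum_bounded_above[of U "dg P" 2]
      le1 in1 in3 c cU dg_PP by (auto simp: U_def)
  have "es P + es U = (\<Sum>x\<in>T1. dg T3 x) + (\<Sum>x\<in>T3. dg T1 x) + 2 * (\<Sum>x\<in>U. dg P x)"
    using sumP crossU t1 t2 t3 by (simp add: sum.distrib)
  note total = this
  show "es P \<le> 14" using total s1 by linarith
  assume e: "es P = 14"
  have eq1: "(\<Sum>x\<in>T1. dg T3 x) = 3" using e total s1 by linarith
  have eq2: "(\<Sum>x\<in>T3. dg T1 x) = 3" using e total s1 by linarith
  have eq3: "(\<Sum>x\<in>U. dg P x) = 4" using e total s1 by linarith
  have m1: "dg T3 x = 1" if "x \<in> T1" for x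
    using sum_mono_inv[of "dg T3" T1 "\<lambda>_. 1" x] eq1 le1 in1 c fin that by auto
  have m3: "dg T1 x = 1" if "x \<in> T3" for x
    using sum_mono_inv[of "dg T1" T3 "\<lambda>_. 1" x] eq2 le1 in3 c fin that by auto
  have mU: "dg P x = 2" if "x \<in> U" for x
    using sum_mono_inv[of "dg P" U "\<lambda>_. 2" x] eq3 dg_PP cU fin that by (auto simp: U_def)
  show "dg P a = 2" if "a \<in> U" using mU that .
  show "A a b2" if a: "dg P a = 0" "a \<in> P"
  proof -
    have "a \<notin> T1" "a \<notin> T3" "a \<notin> U" using a t1[of a] t3[of a] m1[of a] m3[of a] mU[of a] by auto
    then show ?thesis using a(2) P in2 adj_sym by blast
  qed
  show "card I \<le> 5" if L0: "L 0 = {}" and I: "I \<subseteq> P" "\<And>x y. x \<in> I \<Longrightarrow> y \<in> I \<Longrightarrow> \<not> A x y"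
  proof -
    have fI: "finite I" using I PQ(3) finite_subset by blast
    \<comment> \<open>Members of the independent set in \<open>X\<close> block as many vertices of
      \<open>Y\<close>. For \<open>T1\<close> against \<open>T3\<close> and \<open>T2\<close>
      against \<open>U\<close> this limits \<open>I\<close> to 3 + 2 vertices.\<close>
    have half: "card (I \<inter> X) \<le> card (Y - I)"
      if XY: "\<And>x. x \<in> X \<Longrightarrow> 1 \<le> dg Y x" "\<And>y. y \<in> Y \<Longrightarrow> dg X y \<le> 1" "finite X" "finite Y" for X Y
    proof -
      have "(\<Sum>x\<in>I \<inter> X. 1) \<le> (\<Sum>x\<in>I \<inter> X. dg (Y - I) x)"
      proof (rule sum_mono)
        fix x assume x: "x \<in> I \<inter> X"
        then obtain y where "y \<in> Y" "A x y" using XY(1)[of x] dg_pos[OF XY(4), of x] by auto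
        then show "1 \<le> dg (Y - I) x" using I(2)[of x y] x dg_pos[of "Y - I" x] XY(4) by fastforce
      qed
      also have "\<dots> = (\<Sum>y\<in>Y - I. dg (I \<inter> X) y)" using XY fI by (intro cross_count) auto
      also have "\<dots> \<le> (\<Sum>y\<in>Y - I. 1)"
      proof (rule sum_mono)
        fix y assume "y \<in> Y - I"
        then show "dg (I \<inter> X) y \<le> 1" using XY(2)[of y] dg_mono[OF XY(3), of "I \<inter> X" y] by auto
      qed
      finally show ?thesis by simp
    qed
    have "1 \<le> dg U x" if "x \<in> T2" for x
    proof -
      have "dg P x \<noteq> 0" using L0 in2[OF that] by (auto simp: L_def)
      then show ?thesis using t2[OF that] by simp
    qed
    then have h: "card (I \<inter> T1) \<le> card (T3 - I)" "card (I \<inter> T2) \<le> card (U - I)"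
      using half[of T1 T3] half[of T2 U] m1 le1(1) le1(2) in3 fin by (auto simp: U_def)
    have "I = (I \<inter> T1) \<union> (I \<inter> T2) \<union> (I \<inter> T3) \<union> (I \<inter> U)" using I(1) P by blast
    then have "card I = card ((I \<inter> T1) \<union> (I \<inter> T2) \<union> (I \<inter> T3) \<union> (I \<inter> U))" by simp
    also have "\<dots> \<le> card (I \<inter> T1) + card (I \<inter> T2) + card (I \<inter> T3) + card (I \<inter> U)"
      by (meson add_le_mono1 card_Un_le le_trans)
    also have "\<dots> \<le> (card (T3 - I) + card (T3 \<inter> I)) + (card (U - I) + card (U \<inter> I))"
      using h by (simp add: Int_commute)
    also have "\<dots> = card T3 + card U"
      using card_Int_Diff[OF fin(3), of I] card_Int_Diff[OF fin(4), of I] by simp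
    finally show ?thesis using c cU by simp
  qed
qed

end

context girth5
begin

text \<open>Five pairs cover \<open>I\<close>, and each contains at most one member of it. Allowing
  equal entries lets a single vertex occupy a pair.\<close>

lemma matching_independent:
  assumes "I \<subseteq> {x1, y1, x2, y2, x3, y3, x4, y4, x5, y5}"
    and "A x1 y1 \<or> x1 = y1" "A x2 y2 \<or> x2 = y2" "A x3 y3 \<or> x3 = y3" "A x4 y4 \<or> x4 = y4" "A x5 y5 \<or> x5 = y5"
    and "\<And>x y. x \<in> I \<Longrightarrow> y \<in> I \<Longrightarrow> \<not> A x y"
  shows "card I \<le> 5"
proof -
  have one: "card (I \<inter> {x, y}) \<le> 1" if "A x y \<or> x = y" for x y
  proof -
    have "I \<inter> {x, y} \<subseteq> {x} \<or> I \<inter> {x, y} \<subseteq> {y}" using that assms(7)[of x y] by auto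
    then show ?thesis using card_mono[of "{x}" "I \<inter> {x, y}"] card_mono[of "{y}" "I \<inter> {x, y}"] by auto
  qed
  have "I = (I \<inter> {x1, y1}) \<union> (I \<inter> {x2, y2}) \<union> (I \<inter> {x3, y3}) \<union> (I \<inter> {x4, y4}) \<union> (I \<inter> {x5, y5})"
    using assms(1) by blast
  then have "card I = card ((I \<inter> {x1, y1}) \<union> (I \<inter> {x2, y2}) \<union> (I \<inter> {x3, y3}) \<union> (I \<inter> {x4, y4}) \<union> (I \<inter> {x5, y5}))"
    by simp
  also have "\<dots> \<le> card (I \<inter> {x1, y1}) + card (I \<inter> {x2, y2}) + card (I \<inter> {x3, y3}) + card (I \<inter> {x4, y4}) + card (I \<inter> {x5, y5})"
    by (meson add_le_mono1 card_Un_le le_trans)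
  finally show ?thesis using one[OF assms(2)] one[OF assms(3)] one[OF assms(4)] one[OF assms(5)] one[OF assms(6)]
    by linarith
qed

end

section \<open>Path components and the shape of \<open>Q\<close>\<close>

context crit23
begin

lemma nb_eqD: "nb S v = T \<Longrightarrow> x \<in> T \<Longrightarrow> x \<in> S \<and> A v x"
  by auto

text \<open>The classes of a path component with four vertices have sizes 3, 2, 2, 3 and exhaust
  \<open>P\<close>; \<open>no_pentagon\<close> separates the outer two. Edges of \<open>P\<close>
  can only join \<open>T1\<close> to \<open>T3\<close>, \<open>T1\<close> to \<open>T4\<close> and
  \<open>T2\<close> to \<open>T4\<close>, at most 2, 3 and 2 of them, and equality determines all
  degrees between the classes.\<close>

lemma P4_classes:
  assumes b: "b1 \<in> Q" "b2 \<in> Q" "b3 \<in> Q" "b4 \<in> Q" "A b1 b2" "A b2 b3" "A b3 b4" "b1 \<noteq> b3" "b2 \<noteq> b4"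
  defines "T1 \<equiv> nb P b1" and "T2 \<equiv> nb P b2" and "T3 \<equiv> nb P b3" and "T4 \<equiv> nb P b4"
  shows "P = T1 \<union> T2 \<union> T3 \<union> T4" "card T1 = 3" "card T2 = 2" "card T3 = 2" "card T4 = 3"
    "T1 \<inter> T2 = {}" "T2 \<inter> T3 = {}" "T3 \<inter> T4 = {}" "T1 \<inter> T3 = {}" "T2 \<inter> T4 = {}" "T1 \<inter> T4 = {}"
    and "es P \<le> 14"
    and "\<And>a. a \<in> T1 \<Longrightarrow> dg P a = dg T3 a + dg T4 a"
    and "\<And>a. es P = 14 \<Longrightarrow> a \<in> T1 \<Longrightarrow> dg T4 a = 1"
    and "\<And>a. es P = 14 \<Longrightarrow> a \<in> T4 \<Longrightarrow> dg T1 a = 1"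
    and "\<And>a. es P = 14 \<Longrightarrow> a \<in> T2 \<Longrightarrow> dg T4 a = 1 \<and> dg P a = 1"
    and "\<And>a. es P = 14 \<Longrightarrow> a \<in> T3 \<Longrightarrow> dg T1 a = 1 \<and> dg P a = 1"
proof -
  note comp = path4_component[OF b]
  have fin: "finite T1" "finite T2" "finite T3" "finite T4" using PQ(3) by (auto simp: T1_def T2_def T3_def T4_def)
  have "dg Q b1 = 1" "dg Q b4 = 1" using comp(1,4) by (simp_all add: dg_def)
  moreover have "dg Q b2 = 2" "dg Q b3 = 2" using comp(2,3) b(8,9) by (simp_all add: dg_def)
  ultimately show c: "card T1 = 3" "card T2 = 2" "card T3 = 2" "card T4 = 3"
    using card_nb_P b(1-4) by (auto simp: T1_def T2_def T3_def T4_def)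
  have s: "A b2 b1" "A b3 b2" "A b4 b3" using b adj_sym by auto
  have bP: "b1 \<notin> P" "b2 \<notin> P" "b3 \<notin> P" "b4 \<notin> P" using b not_P by auto
  show d: "T1 \<inter> T2 = {}" "T2 \<inter> T3 = {}" "T3 \<inter> T4 = {}" "T1 \<inter> T3 = {}" "T2 \<inter> T4 = {}"
    using nb_disjoint_adj[OF b(5)] nb_disjoint_adj[OF b(6)] nb_disjoint_adj[OF b(7)]
      nb_disjoint_two[OF s(1) b(6,8) bP(2)] nb_disjoint_two[OF s(2) b(7,9) bP(3)]
    by (auto simp: T1_def T2_def T3_def T4_def)
  show d14: "T1 \<inter> T4 = {}"
    using no_pentagon[OF _ b] adj_sym by (fastforce simp: T1_def T4_def)
  have "T1 \<union> T2 \<union> T3 \<union> T4 \<subseteq> P" by (auto simp: T1_def T2_def T3_def T4_def)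
  moreover have "card (T1 \<union> T2 \<union> T3 \<union> T4) = 10"
    using c d d14 fin by (simp add: card_Un_disjoint Int_Un_distrib2)
  ultimately show P: "P = T1 \<union> T2 \<union> T3 \<union> T4" using PQ(3,5) by (metis card_subset_eq)
  have in1: "A b1 x" "x \<in> P" if "x \<in> T1" for x using that by (auto simp: T1_def)
  have in2: "A b2 x" "x \<in> P" if "x \<in> T2" for x using that by (auto simp: T2_def)
  have in3: "A b3 x" "x \<in> P" if "x \<in> T3" for x using that by (auto simp: T3_def)
  have in4: "A b4 x" "x \<in> P" if "x \<in> T4" for x using that by (auto simp: T4_def)
  have step: "\<not> A x y \<and> \<not> A y x" if "A u v" "A u x" "A v y" "u \<in> Q" "v \<in> Q" "x \<in> P" "y \<in> P" for u v x y
    using no_square[of u x y v] that adj_sym[of u v] adj_sym[of v y] adj_sym[of y x] not_PQ[of x v] not_PQ[of y u] by auto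
  have n: "\<not> A x y \<and> \<not> A y x" if "x \<in> T1 \<and> y \<in> T2 \<or> x \<in> T2 \<and> y \<in> T3 \<or> x \<in> T3 \<and> y \<in> T4" for x y
    using that step[OF b(5), of x y] step[OF b(6), of x y] step[OF b(7), of x y] in1 in2 in3 in4 b by blast
  have n0: "\<not> A x y" if "x \<in> T1 \<and> y \<in> T1 \<or> x \<in> T2 \<and> y \<in> T2 \<or> x \<in> T3 \<and> y \<in> T3 \<or> x \<in> T4 \<and> y \<in> T4" for x y
    using that nbs_nonadj[of b1 x y] nbs_nonadj[of b2 x y] nbs_nonadj[of b3 x y] nbs_nonadj[of b4 x y]
      in1(1) in2(1) in3(1) in4(1) by auto
  have dP: "dg P x = dg T1 x + dg T2 x + dg T3 x + dg T4 x" for x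
    unfolding P using dg_Un[of "T1 \<union> T2 \<union> T3" T4 x] dg_Un3[of T1 T2 T3 x] fin d d14 by (simp add: Int_Un_distrib2)
  have z1: "dg T1 x = 0 \<and> dg T2 x = 0" if "x \<in> T1" for x using that n n0 dg_eq_0 fin by auto
  have z2: "dg T1 x = 0 \<and> dg T2 x = 0 \<and> dg T3 x = 0" if "x \<in> T2" for x using that n n0 dg_eq_0 fin by auto
  have z3: "dg T2 x = 0 \<and> dg T3 x = 0 \<and> dg T4 x = 0" if "x \<in> T3" for x using that n n0 dg_eq_0 fin by auto
  have z4: "dg T3 x = 0 \<and> dg T4 x = 0" if "x \<in> T4" for x using that n n0 dg_eq_0 fin by auto
  show t1: "dg P x = dg T3 x + dg T4 x" if "x \<in> T1" for x using dP[of x] z1[OF that] by simp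
  have t2: "dg P x = dg T4 x" if "x \<in> T2" for x using dP[of x] z2[OF that] by simp
  have t3: "dg P x = dg T1 x" if "x \<in> T3" for x using dP[of x] z3[OF that] by simp
  have t4: "dg P x = dg T1 x + dg T2 x" if "x \<in> T4" for x using dP[of x] z4[OF that] by simp
  have le1: "dg T1 x \<le> 1" "dg T4 x \<le> 1" if "x \<in> P" for x
    using dg_le_1_common[OF fin(1) in1(1), of x] dg_le_1_common[OF fin(4) in4(1), of x] not_PQ that b by auto
  have "es P = (\<Sum>x\<in>T1. dg P x) + (\<Sum>x\<in>T2. dg P x) + (\<Sum>x\<in>T3. dg P x) + (\<Sum>x\<in>T4. dg P x)"
  proof -
    have "es P = (\<Sum>x\<in>T1 \<union> T2 \<union> T3 \<union> T4. dg P x)" unfolding es_def using P by simp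
    then show ?thesis using fin d d14 by (simp add: sum.union_disjoint Int_Un_distrib2)
  qed
  then have total: "es P = 2 * (\<Sum>x\<in>T3. dg T1 x) + 2 * (\<Sum>x\<in>T1. dg T4 x) + 2 * (\<Sum>x\<in>T2. dg T4 x)"
    using cross_count[OF fin(1,3)] cross_count[OF fin(1,4)] cross_count[OF fin(2,4)] t1 t2 t3 t4
    by (simp add: sum.distrib)
  have s1: "(\<Sum>x\<in>T3. dg T1 x) \<le> 2" "(\<Sum>x\<in>T1. dg T4 x) \<le> 3" "(\<Sum>x\<in>T2. dg T4 x) \<le> 2"
    using sum_bounded_above[of T3 "dg T1" 1] sum_bounded_above[of T1 "dg T4" 1] sum_bounded_above[of T2 "dg T4" 1]
      le1 in1 in2 in3 c by auto
  show "es P \<le> 14" using total s1 by linarith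
  show "dg T4 a = 1" if e: "es P = 14" "a \<in> T1" for a
  proof -
    have "(\<Sum>x\<in>T1. dg T4 x) = 3" using e(1) total s1 by linarith
    then show ?thesis using sum_mono_inv[of "dg T4" T1 "\<lambda>_. 1" a] le1 in1 c fin e(2) by auto
  qed
  show "dg T1 a = 1" if e: "es P = 14" "a \<in> T4" for a
  proof -
    have "(\<Sum>x\<in>T4. dg T1 x) = 3" using cross_count[OF fin(1,4)] e(1) total s1 by linarith
    then show ?thesis using sum_mono_inv[of "dg T1" T4 "\<lambda>_. 1" a] le1 in4 c fin e(2) by auto
  qed
  show "dg T4 a = 1 \<and> dg P a = 1" if e: "es P = 14" "a \<in> T2" for a
  proof -
    have "(\<Sum>x\<in>T2. dg T4 x) = 2" using e(1) total s1 by linarith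
    then show ?thesis using sum_mono_inv[of "dg T4" T2 "\<lambda>_. 1" a] le1 in2 c fin e(2) t2 by auto
  qed
  show "dg T1 a = 1 \<and> dg P a = 1" if e: "es P = 14" "a \<in> T3" for a
  proof -
    have "(\<Sum>x\<in>T3. dg T1 x) = 2" using e(1) total s1 by linarith
    then show ?thesis using sum_mono_inv[of "dg T1" T3 "\<lambda>_. 1" a] le1 in3 c fin e(2) t3 by auto
  qed
qed

text \<open>\<open>X\<close> consists of the centres of path components with three vertices,
  \<open>Y\<close> of the inner vertices of those with four, \<open>K\<close> of the vertices of
  isolated edges of \<open>Q\<close>.\<close>

definition "X = {c \<in> N 2. dg (N 2) c = 0}"
definition "Y = {c \<in> N 2. dg (N 2) c = 1}"
definition "K = {r \<in> N 1. dg (N 1) r = 1}"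

lemma XY: "N 2 = X \<union> Y" "X \<inter> Y = {}" "finite X" "finite Y" "card (N 2) = card X + card Y"
proof -
  show 1: "N 2 = X \<union> Y" using N2_dg_N2 by (force simp: X_def Y_def)
  show 2: "X \<inter> Y = {}" by (auto simp: X_def Y_def)
  show 3: "finite X" "finite Y" using finite_NL by (auto simp: X_def Y_def)
  show "card (N 2) = card X + card Y" using 1 2 3 card_Un_disjoint by metis
qed

lemma finite_K: "finite K"
  using finite_NL by (simp add: K_def)

text \<open>The two inner vertices of a path with four vertices are adjacent, so \<open>N 2\<close>
  induces a perfect matching on \<open>Y\<close>.\<close>

lemma even_Y: "even (card Y)"
proof -
  have "es (N 2) = (\<Sum>c\<in>N 2. if c \<in> Y then 1 else 0)"
    unfolding es_def
  proof (intro sum.cong refl)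
    fix c assume "c \<in> N 2"
    then have "c \<in> X \<or> c \<in> Y" using XY(1) by blast
    then show "dg (N 2) c = (if c \<in> Y then 1 else 0)" using XY(2) by (auto simp: X_def Y_def)
  qed
  also have "\<dots> = card (N 2 \<inter> Y)" using finite_NL by (simp add: sum.If_cases)
  also have "N 2 \<inter> Y = Y" using XY(1) by blast
  finally show ?thesis using even_es[OF finite_NL(1), of 2] by simp
qed

lemma X_path: "c \<in> X \<Longrightarrow> \<exists>x z. x \<in> Q \<and> z \<in> Q \<and> c \<in> Q \<and> A x c \<and> A c z \<and> x \<noteq> z \<and> dg Q x = 1 \<and> dg Q c = 2 \<and> dg Q z = 1
    \<and> nb Q c = {x, z}"
proof -
  assume c: "c \<in> X"
  then have c2: "c \<in> N 2" and c0: "dg (N 2) c = 0" by (auto simp: X_def)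
  obtain x z where xz: "x \<in> Q" "z \<in> Q" "x \<noteq> z" "nb Q c = {x, z}" using N2_nbrs[OF c2] by blast
  have "A c x" "A c z" using nb_eqD[OF xz(4), of x] nb_eqD[OF xz(4), of z] by simp_all
  moreover have "u \<in> N 1" if "u \<in> Q" "A c u" for u
    using N2_nb_N3[OF c2 that] c0 dg_eq_0[OF finite_NL(1), of 2 c] that(2) by auto
  ultimately show ?thesis using xz c2 adj_sym by (intro exI[of _ x] exI[of _ z]) (auto simp: N_def)
qed

lemma K_pair: "r \<in> K \<Longrightarrow> \<exists>s. s \<in> K \<and> A r s \<and> nb Q r = {s} \<and> nb Q s = {r} \<and> r \<in> Q \<and> s \<in> Q \<and> dg Q r = 1 \<and> dg Q s = 1"
proof -
  assume r: "r \<in> K"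
  then have "card (nb (N 1) r) = 1" by (simp add: K_def dg_def)
  then obtain s where s: "nb (N 1) r = {s}" by (auto simp: card_1_singleton_iff)
  have s': "s \<in> N 1" "A r s" using nb_eqD[OF s, of s] by simp_all
  have rQ: "r \<in> N 1" using r by (simp add: K_def)
  have one: "nb Q u = {w}" if "u \<in> N 1" "w \<in> N 1" "A u w" for u w
  proof -
    have "card (nb Q u) = 1" using that by (simp add: N_def dg_def)
    moreover have "w \<in> nb Q u" using that by (simp add: N_def)
    ultimately show ?thesis by (metis card_1_singletonE singletonD)
  qed
  have nr: "nb Q r = {s}" "nb Q s = {r}" using one[OF rQ s'] one[OF s'(1) rQ adj_sym[OF s'(2)]] by auto
  moreover have "nb (N 1) s = {r}" using nr(2) rQ s' adj_sym by (auto simp: N_def)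
  ultimately show ?thesis using s' rQ by (intro exI[of _ s]) (simp add: K_def dg_def N_def)
qed

text \<open>Without stars, leaves belong to paths or to isolated edges: two at each centre in
  \<open>X\<close>, one at each vertex of \<open>Y\<close>, and the vertices of \<open>K\<close>
  themselves.\<close>

lemma N1_count: "N 3 = {} \<Longrightarrow> card (N 1) = 2 * card X + card Y + card K"
proof -
  assume N3: "N 3 = {}"
  have d: "dg (N 1) r + dg (N 2) r = 1" if r: "r \<in> N 1" for r
  proof -
    have "x \<in> N 1 \<union> N 2" if "x \<in> Q" "A r x" for x
    proof -
      have "dg Q x \<noteq> 0" using r that adj_sym[of r x] dg_eq_0[OF PQ(4), of x] by (auto simp: N_def)
      then show ?thesis using N3 dg_QQ[OF that(1)] that(1) by (auto simp: N_def)
    qed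
    then have "nb Q r = nb (N 1 \<union> N 2) r" by (auto simp: N_def)
    then have "dg Q r = dg (N 1 \<union> N 2) r" by (simp add: dg_def)
    also have "\<dots> = dg (N 1) r + dg (N 2) r" by (rule dg_Un[OF finite_NL(1) finite_NL(1)]) (auto simp: N_def)
    finally show ?thesis using r by (simp add: N_def)
  qed
  have "(\<Sum>r\<in>N 1. dg (N 1) r) = (\<Sum>r\<in>N 1. if r \<in> K then 1 else 0)"
  proof (intro sum.cong refl)
    fix r assume "r \<in> N 1"
    then show "dg (N 1) r = (if r \<in> K then 1 else 0)" using d[of r] by (auto simp: K_def)
  qed
  also have "\<dots> = card (N 1 \<inter> K)" using finite_NL by (simp add: sum.If_cases)
  also have "N 1 \<inter> K = K" by (auto simp: K_def)
  finally have k: "(\<Sum>r\<in>N 1. dg (N 1) r) = card K" .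
  have "(\<Sum>r\<in>N 1. dg (N 2) r) = (\<Sum>c\<in>N 2. dg (N 1) c)" using cross_count finite_NL by blast
  also have "\<dots> = (\<Sum>c\<in>X. dg (N 1) c) + (\<Sum>c\<in>Y. dg (N 1) c)"
    by (subst XY(1)) (rule sum.union_disjoint[OF XY(3,4,2)])
  also have "(\<Sum>c\<in>X. dg (N 1) c) = (\<Sum>c\<in>X. 2)"
  proof (intro sum.cong refl)
    fix c assume "c \<in> X"
    then show "dg (N 1) c = 2" using N2_dg[of c] by (simp add: X_def)
  qed
  also have "(\<Sum>c\<in>Y. dg (N 1) c) = (\<Sum>c\<in>Y. 1)"
  proof (intro sum.cong refl)
    fix c assume "c \<in> Y"
    then show "dg (N 1) c = 1" using N2_dg[of c] by (simp add: Y_def)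
  qed
  finally have "(\<Sum>r\<in>N 1. dg (N 2) r) = 2 * card X + card Y" by simp
  moreover have "(\<Sum>r\<in>N 1. dg (N 1) r + dg (N 2) r) = card (N 1)" using d by simp
  ultimately show ?thesis using k by (simp add: sum.distrib)
qed

lemma Y_path: "c \<in> Y \<Longrightarrow> \<exists>x d y. x \<in> Q \<and> c \<in> Q \<and> d \<in> Q \<and> y \<in> Q \<and> d \<in> Y \<and> A x c \<and> A c d \<and> A d y \<and> x \<noteq> d \<and> c \<noteq> y
    \<and> x \<in> N 1 \<and> y \<in> N 1 \<and> nb Q x = {c} \<and> nb Q y = {d} \<and> nb (N 2) c = {d} \<and> nb (N 2) d = {c}"
proof -
  assume "c \<in> Y"
  then have c: "c \<in> N 2" "card (nb (N 2) c) = 1" by (auto simp: Y_def dg_def)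
  then obtain d where nd: "nb (N 2) c = {d}" by (auto simp: card_1_singleton_iff)
  have d: "d \<in> N 2" "A c d" using nb_eqD[OF nd, of d] by simp_all
  obtain x y where xy: "nb Q x = {c}" "nb Q c = {x, d}" "nb Q d = {c, y}" "nb Q y = {d}" "x \<in> Q" "y \<in> Q" "x \<noteq> d" "c \<noteq> y"
    using N2_N2[OF c(1) d] by blast
  have N1: "x \<in> N 1" "y \<in> N 1" using xy by (auto simp: N_def dg_def)
  have "c \<in> nb (N 2) d" using c d adj_sym by auto
  moreover have "u = w" if "u \<in> nb (N 2) d" "w \<in> nb (N 2) d" for u w
    using N2_dg_N2[OF d(1)] card_le_Suc0_iff_eq[of "nb (N 2) d"] finite_NL(1) that by (auto simp: dg_def)
  ultimately have nc: "nb (N 2) d = {c}" by blast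
  then have "d \<in> Y" using d by (simp add: Y_def dg_def)
  moreover have "A x c" "A d y" using nb_eqD[OF xy(1), of c] nb_eqD[OF xy(3), of y] by simp_all
  moreover have "c \<in> Q" "d \<in> Q" using c d by (simp_all add: N_def)
  ultimately show ?thesis using xy(1,4-8) N1 nd nc d(2) by blast
qed

text \<open>The counts leave five isolated edges and one path with three vertices in
  \<open>Q\<close>. The six vertices around an isolated edge are independent and need one edge each,
  which uses up the six edges of \<open>P\<close>. So the neighbour \<open>x\<close> of a vertex
  \<open>g\<close> with two neighbours in \<open>P\<close> is among these six, for every isolated
  edge.\<close>

lemma six_case: "es P \<noteq> 12"
proof
  assume e: "es P = 12"
  have N3: "card (N 3) = 0" using N_counts L_counts pairs_le e by linarith
  have n2: "card (N 2) = 1" using N_counts L_counts pairs_le e by linarith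
  have n1: "card (N 1) = 12" using N_counts n2 N3 e by linarith
  have L0: "card (L 0) = 0" using N_counts L_counts pairs_le e by linarith
  have L2: "card (L 2) = 2" using L_counts L0 e by linarith
  have "card Y \<le> 1" using XY(5) n2 by linarith
  then have Y0: "card Y = 0" using even_Y by (cases "card Y = 0") (auto simp: le_Suc_eq)
  then have X1: "card X = 1" using XY(5) n2 by linarith
  then have K10: "card K = 10" using N1_count n1 N3 Y0 finite_NL by simp
  have L0e: "L 0 = {}" using L0 finite_NL by simp
  have ge1: "1 \<le> dg P a" if "a \<in> P" for a
  proof -
    have "a \<notin> L 0" using L0e by simp
    then show ?thesis using that by (simp add: L_def)
  qed
  obtain g where g: "g \<in> P" "dg P g = 2" using L2 finite_NL by (metis (mono_tags, lifting) L_def card.empty mem_Collect_eq ex_in_conv zero_neq_numeral)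
  have "nb P g \<noteq> {}" using g by (auto simp: dg_def)
  then obtain x where "x \<in> nb P g" by blast
  then have x: "x \<in> P" "A g x" by simp_all
  have in_I: "A r x \<or> A s x" if rs: "r \<in> Q" "s \<in> Q" "A r s" "dg Q r = 1" "dg Q s = 1" for r s
  proof -
    define I where "I = nb P r \<union> nb P s"
    note I = K2_independent[OF rs, folded I_def]
    define J where "J = P - I"
    have f: "finite I" "finite J" "I \<inter> J = {}" "P = I \<union> J" using I(1) PQ(3) finite_subset by (auto simp: J_def)
    have "dg I v = 0" if "v \<in> I" for v using I(3)[OF that] dg_eq_0[OF f(1), of v] by blast
    then have "es I = 0" by (simp add: es_def)
    then have e2: "es J + 2 * (\<Sum>v\<in>I. dg J v) = 12" using es_Un[OF f(1-3)] f(4) e by simp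
    have d: "dg P v = dg J v" if "v \<in> I" for v
      using dg_Un[OF f(1-3), of v] dg_eq_0[OF f(1), of v] I(3)[OF that] f(4) by simp
    have "(\<Sum>v\<in>I. 1) \<le> (\<Sum>v\<in>I. dg J v)"
    proof (rule sum_mono)
      fix v assume "v \<in> I"
      then show "1 \<le> dg J v" using ge1[of v] d[of v] I(1) by auto
    qed
    then have "(\<Sum>v\<in>I. dg J v) = (\<Sum>v\<in>I. 1)" "es J = 0" using e2 I(2) by simp_all
    then have J0: "dg J v = 0" if "v \<in> J" for v using that f(2) by (simp add: es_def)
    have one: "dg J v = 1" if "v \<in> I" for v
      using sum_mono_inv[of "\<lambda>_. 1" I "dg J" v] \<open>(\<Sum>v\<in>I. dg J v) = (\<Sum>v\<in>I. 1)\<close> that ge1 d I(1) f(1)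
      by (metis subsetD)
    have "g \<notin> I" using one[of g] d[of g] g by auto
    then have "g \<in> J" using g by (simp add: J_def)
    then have "x \<notin> J" using J0[of g] dg_eq_0[OF f(2), of g] x by auto
    then show ?thesis using x by (auto simp: J_def I_def)
  qed
  define Z where "Z = nb K x"
  have fZ: "finite Z" using finite_K by (simp add: Z_def)
  \<comment> \<open>Each of the five isolated edges has an end in \<open>Z\<close>. Together with
    \<open>g\<close> this would give \<open>x\<close> six neighbours.\<close>
  have "K \<subseteq> Z \<union> (\<Union>z\<in>Z. nb Q z)"
  proof
    fix r assume r: "r \<in> K"
    obtain s where s: "s \<in> K" "A r s" "r \<in> Q" "s \<in> Q" "dg Q r = 1" "dg Q s = 1" using K_pair[OF r] by blast
    have "A x r \<or> A x s" using in_I[of r s] s adj_sym by blast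
    then show "r \<in> Z \<union> (\<Union>z\<in>Z. nb Q z)" using r s adj_sym[OF s(2)] by (auto simp: Z_def)
  qed
  then have "card K \<le> card (Z \<union> (\<Union>z\<in>Z. nb Q z))" using fZ PQ(4) by (intro card_mono) auto
  also have "\<dots> \<le> card Z + card (\<Union>z\<in>Z. nb Q z)" by (rule card_Un_le)
  also have "card (\<Union>z\<in>Z. nb Q z) \<le> (\<Sum>z\<in>Z. card (nb Q z))" using fZ by (rule card_UN_le)
  also have "\<dots> = (\<Sum>z\<in>Z. 1)"
  proof (intro sum.cong refl)
    fix z assume "z \<in> Z"
    then show "card (nb Q z) = 1" using K_pair[of z] by (auto simp: Z_def dg_def)
  qed
  finally have "5 \<le> card Z" using K10 by simp
  moreover have "card Z \<le> dg Q x" unfolding dg_def Z_def using PQ(4) by (intro card_mono) (auto simp: K_def N_def)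
  moreover have "0 < dg P x" using dg_pos[OF PQ(3), of x] g x adj_sym by auto
  ultimately show False using dg_P5[OF x(1)] by linarith
qed

text \<open>Path components allow only seven edges in \<open>P\<close>; without them the counts
  contradict each other.\<close>

lemma eight_case: "es P \<noteq> 16"
proof
  assume e: "es P = 16"
  have "N 2 = {}"
  proof (rule ccontr)
    assume "N 2 \<noteq> {}"
    then consider c where "c \<in> X" | c where "c \<in> Y" using XY(1) by blast
    then show False
    proof cases
      case 1
      obtain x z where "x \<in> Q" "c \<in> Q" "z \<in> Q" "A x c" "A c z" "x \<noteq> z" "dg Q x = 1" "dg Q c = 2" "dg Q z = 1"
        using X_path[OF 1] by blast
      from P3_classes(1)[OF this] show False using e by simp
    next
      case 2
      obtain x d y where "x \<in> Q" "c \<in> Q" "d \<in> Q" "y \<in> Q" "A x c" "A c d" "A d y" "x \<noteq> d" "c \<noteq> y"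
        using Y_path[OF 2] by blast
      from P4_classes(12)[OF this] show False using e by simp
    qed
  qed
  then have "card (N 2) = 0" by simp
  then show False using N_counts L_counts pairs_le e by linarith
qed

text \<open>Equality in \<open>P4_classes\<close> matches \<open>T1\<close> with \<open>T4\<close>
  and hangs the vertices of \<open>T3\<close> and \<open>T2\<close> on two matching edges each. If
  these were the same two edges, five disjoint edges would cover \<open>P\<close> and no independent
  set of size six could exist. So \<open>P\<close> is the path \<open>r1 p1 s1 q1\<close> together
  with the paths \<open>r2 p2 s2\<close> and \<open>p3 s3 q2\<close>.\<close>

lemma P4_names:
  assumes e: "es P = 14"
    and b: "b1 \<in> Q" "b2 \<in> Q" "b3 \<in> Q" "b4 \<in> Q" "A b1 b2" "A b2 b3" "A b3 b4" "b1 \<noteq> b3" "b2 \<noteq> b4"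
    and I: "I \<subseteq> P" "card I = 6" "\<And>x y. x \<in> I \<Longrightarrow> y \<in> I \<Longrightarrow> \<not> A x y"
  shows "\<exists>p1 p2 p3 s1 s2 s3 q1 q2 r1 r2. distinct [p1, p2, p3, s1, s2, s3, q1, q2, r1, r2] \<and>
    nb P b1 = {p1, p2, p3} \<and> nb P b4 = {s1, s2, s3} \<and> nb P b2 = {q1, q2} \<and> nb P b3 = {r1, r2} \<and>
    A p1 s1 \<and> A p2 s2 \<and> A p3 s3 \<and> A r1 p1 \<and> A r2 p2 \<and> A q1 s1 \<and> A q2 s3"
proof -
  define T1 T2 T3 T4 where T: "T1 = nb P b1" "T2 = nb P b2" "T3 = nb P b3" "T4 = nb P b4"
  note cl = P4_classes[OF b, folded T]
  have fin: "finite T1" "finite T2" "finite T3" "finite T4" using PQ(3) by (simp_all add: T)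
  have ex: "\<exists>y. y \<in> S \<and> A x y" if "dg S x = 1" "finite S" for S x using dg_pos[OF that(2), of x] that(1) by auto
  have uniq: "x = y" if "A x z" "A y z" "A b x" "A b y" "z \<noteq> b" for x y z b
    using common_unique[of z x y b] that adj_sym by blast
  obtain r1 r2 where r: "T3 = {r1, r2}" "r1 \<noteq> r2" using cl(4) by (auto simp: card_2_iff)
  obtain p1 where p1: "p1 \<in> T1" "A r1 p1" using cl(17)[OF e] ex[of T1 r1] r fin by auto
  obtain p2 where p2: "p2 \<in> T1" "A r2 p2" using cl(17)[OF e] ex[of T1 r2] r fin by auto
  have inb: "A b1 x \<and> x \<noteq> b1 \<and> x \<noteq> b2 \<and> x \<noteq> b3 \<and> x \<noteq> b4" if "x \<in> T1" for x using that b not_P by (auto simp: T)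
  have inb2: "A b2 x \<and> x \<noteq> b1 \<and> x \<noteq> b2 \<and> x \<noteq> b3 \<and> x \<noteq> b4" if "x \<in> T2" for x using that b not_P by (auto simp: T)
  have inb3: "A b3 x \<and> x \<noteq> b1 \<and> x \<noteq> b2 \<and> x \<noteq> b3 \<and> x \<noteq> b4" if "x \<in> T3" for x using that b not_P by (auto simp: T)
  have inb4: "A b4 x \<and> x \<noteq> b1 \<and> x \<noteq> b2 \<and> x \<noteq> b3 \<and> x \<noteq> b4" if "x \<in> T4" for x using that b not_P by (auto simp: T)
  have p12: "p1 \<noteq> p2" using uniq[of r1 p1 r2 b3] p1 p2 r inb[of p1] inb3[of r1] inb3[of r2] by auto
  have "card (T1 - {p1, p2}) = 1" using cl(2) p1 p2 p12 fin by (simp add: card_Diff_subset)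
  then obtain p3 where p3: "T1 - {p1, p2} = {p3}" by (auto simp: card_1_singleton_iff)
  then have p3': "p3 \<in> T1" "p3 \<noteq> p1" "p3 \<noteq> p2" and T1: "T1 = {p1, p2, p3}" using p1 p2 by auto
  obtain s1 where s1: "s1 \<in> T4" "A p1 s1" using cl(14)[OF e p1(1)] ex[of T4 p1] fin by auto
  obtain s2 where s2: "s2 \<in> T4" "A p2 s2" using cl(14)[OF e p2(1)] ex[of T4 p2] fin by auto
  obtain s3 where s3: "s3 \<in> T4" "A p3 s3" using cl(14)[OF e p3'(1)] ex[of T4 p3] fin by auto
  have sd: "s1 \<noteq> s2" "s1 \<noteq> s3" "s2 \<noteq> s3"
    using uniq[of p1 s1 p2 b1] uniq[of p1 s1 p3 b1] uniq[of p2 s2 p3 b1] inb[of p1] inb[of p2] inb[of p3] p1 p2 p3' p12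
      inb4[of s1] inb4[of s2] inb4[of s3] s1 s2 s3 by auto
  have T4: "T4 = {s1, s2, s3}"
    using s1 s2 s3 sd cl(5) fin by (intro card_subset_eq[symmetric]) auto
  obtain q q' where q: "T2 = {q, q'}" "q \<noteq> q'" using cl(3) by (auto simp: card_2_iff)
  obtain u where u: "u \<in> T4" "A q u" using cl(16)[OF e] ex[of T4 q] q fin by auto
  obtain u' where u': "u' \<in> T4" "A q' u'" using cl(16)[OF e] ex[of T4 q'] q fin by auto
  have uu: "u \<noteq> u'" using uniq[of q u q' b2] u u' q inb2[of q] inb2[of q'] inb4[of u] by auto
  have disj: "distinct [p1, p2, p3, s1, s2, s3, q, q', r1, r2]"
    using cl(6-11) T1 T4 q r p12 p3' sd by auto
  have notI: False if "I \<subseteq> {q, u, q', u', r1, p1, r2, p2, p3, s3}"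
    using matching_independent[OF that] u u' p1 p2 s3 I by auto
  have P: "P = {p1, p2, p3, q, q', r1, r2, s1, s2, s3}" using cl(1) T1 q r T4 by auto
  have "\<not> ({u, u'} = {s1, s2})" using notI I(1) unfolding P by blast
  then have "u = s3 \<or> u' = s3" using u u' uu T4 by auto
  then obtain q1 q2 w where w: "T2 = {q1, q2}" "q1 \<noteq> q2" "A q1 w" "A q2 s3" "w = s1 \<or> w = s2"
    using q u u' uu T4 by (metis doubleton_eq_iff insertE singletonD)
  have disj': "distinct [p1, p2, p3, s1, s2, s3, q1, q2, r1, r2]"
    using cl(6-11) T1 T4 w(1,2) r p12 p3' sd by auto
  show ?thesis
  proof (cases "w = s1")
    case True
    have "distinct [p1, p2, p3, s1, s2, s3, q1, q2, r1, r2] \<and>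
      nb P b1 = {p1, p2, p3} \<and> nb P b4 = {s1, s2, s3} \<and> nb P b2 = {q1, q2} \<and> nb P b3 = {r1, r2} \<and>
      A p1 s1 \<and> A p2 s2 \<and> A p3 s3 \<and> A r1 p1 \<and> A r2 p2 \<and> A q1 s1 \<and> A q2 s3"
      using True disj' T1[unfolded T] T4[unfolded T] w(1)[unfolded T] r(1)[unfolded T] w(3,4) s1(2) s2(2) s3(2) p1(2) p2(2)
      by (intro conjI) simp_all
    then show ?thesis by blast
  next
    case False
    \<comment> \<open>Exchanging the indices 1 and 2 gives the path with four vertices the index 1
      again.\<close>
    then have "w = s2" using w by simp
    moreover have "distinct [p2, p1, p3, s2, s1, s3, q1, q2, r2, r1]" using disj' by auto
    moreover have "nb P b1 = {p2, p1, p3}" "nb P b4 = {s2, s1, s3}" "nb P b3 = {r2, r1}"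
      using T1[unfolded T] T4[unfolded T] r(1)[unfolded T] by auto
    ultimately have "distinct [p2, p1, p3, s2, s1, s3, q1, q2, r2, r1] \<and>
      nb P b1 = {p2, p1, p3} \<and> nb P b4 = {s2, s1, s3} \<and> nb P b2 = {q1, q2} \<and> nb P b3 = {r2, r1} \<and>
      A p2 s2 \<and> A p1 s1 \<and> A p3 s3 \<and> A r2 p2 \<and> A r1 p1 \<and> A q1 s2 \<and> A q2 s3"
      using w(1)[unfolded T] w(3,4) s1(2) s2(2) s3(2) p1(2) p2(2) by (intro conjI) simp_all
    then show ?thesis by blast
  qed
qed

end

section \<open>Seven edges inside \<open>P\<close>\<close>

context crit23
begin

text \<open>The ten names are those of \<open>P4_names\<close>; \<open>r\<close>, \<open>s\<close> and \<open>r'\<close>, \<open>s'\<close> are two edge components,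
  and \<open>c\<close>, \<open>c'\<close> are the ends of the second path component.\<close>

lemma double_path_conflict:
  assumes names: "P = {p1, p2, p3, s1, s2, s3, q1, q2, r1, r2}"
    and adj: "A p1 s1" "A p2 s2" "A p3 s3" "A r1 p1" "A r2 p2" "A q1 s1" "A q2 s3"
    and b1: "A b1 p1" "A b1 p2" "A b1 p3" and b4: "A b4 s1" "A b4 s2" "A b4 s3"
    and Q: "b1 \<in> Q" "b4 \<in> Q" "r \<in> Q" "s \<in> Q" "r' \<in> Q" "s' \<in> Q"
    and dist: "distinct [p1, p2, p3, s1, s2, s3, q1, q2, r1, r2]" "distinct [b1, b4, r, s, r', s']"
    and K1: "A r p1" "\<And>x. x \<in> {r2, s2, q2, p3} \<Longrightarrow> A r x \<or> A s x"
    and K2: "A r' s1" "\<And>x. x \<in> {r2, s2, q2, p3} \<Longrightarrow> A r' x \<or> A s' x"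
    and C1: "c \<in> Q" "c \<notin> {b1, b4, r, s, r', s'}" "A c p1" "card (nb P c) = 3"
    and C2: "c' \<in> Q" "c' \<notin> {b1, b4, r, s, r', s'}" "A c' s1" "card (nb P c') = 3"
  shows False
proof -
  have ne: "x \<noteq> y" if "x \<in> P" "y \<in> Q" for x y using not_PQ that by blast
  have inP: "p1 \<in> P" "p2 \<in> P" "p3 \<in> P" "s1 \<in> P" "s2 \<in> P" "s3 \<in> P" "q1 \<in> P" "q2 \<in> P" "r1 \<in> P" "r2 \<in> P"
    unfolding names by simp_all
  have share: False if "A u x" "A u y" "A w x" "A w y" "x \<noteq> y" "u \<noteq> w" for u w x y
    using common_unique that by blast
  \<comment> \<open>The choices in \<open>K1\<close> and \<open>K2\<close> fixed here are forced,
    because the opposite choice closes a 4-cycle.\<close>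
  have p3r: "\<not> A r p3" using share[of b1 p1 p3 r] b1 K1(1) dist by auto
  then have p3s: "A s p3" using K1(2) by blast
  have "\<not> A s q2" using share[of s3 p3 q2 s] adj p3s adj_sym dist ne[OF inP(6) Q(4)] by auto
  then have q2r: "A r q2" using K1(2) by blast
  have s2r': "\<not> A r' s2" using share[of b4 s1 s2 r'] b4 K2(1) dist by auto
  then have s2s': "A s' s2" using K2(2) by blast
  have "\<not> A s' r2" using share[of p2 s2 r2 s'] adj s2s' adj_sym dist ne[OF inP(2) Q(6)] by auto
  then have r2r': "A r' r2" using K2(2) by blast
  have cne: "c \<noteq> b1" "c \<noteq> b4" "c \<noteq> r" "c \<noteq> s" "c \<noteq> r'" "c \<noteq> s'" using C1(2) by auto
  have c'ne: "c' \<noteq> b1" "c' \<noteq> b4" "c' \<noteq> r" "c' \<noteq> s" "c' \<noteq> r'" "c' \<noteq> s'" using C2(2) by auto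
  have cp: "\<not> A c r1" "\<not> A c s1" "\<not> A c p2" "\<not> A c p3" "\<not> A c q1" "\<not> A c q2"
    using nbs_nonadj[of c p1 r1] nbs_nonadj[of c p1 s1] share[of b1 p1 p2 c] share[of b1 p1 p3 c] share[of s1 p1 q1 c]
      share[of r p1 q2 c] C1(3) adj b1 K1(1) q2r adj_sym[of r1 p1] adj_sym[of p1 s1] adj_sym[of q1 s1] dist cne ne[OF inP(4) C1(1)] by auto
  have cs: "\<not> A c' p1" "\<not> A c' q1" "\<not> A c' s2" "\<not> A c' s3" "\<not> A c' r1" "\<not> A c' r2"
    using nbs_nonadj[of c' s1 p1] nbs_nonadj[of c' s1 q1] share[of b4 s1 s2 c'] share[of b4 s1 s3 c'] share[of p1 s1 r1 c']
      share[of r' s1 r2 c'] C2(3) adj b4 K2(1) r2r' adj_sym[of r1 p1] adj_sym[of p1 s1] adj_sym[of q1 s1] dist c'ne ne[OF inP(1) C2(1)] by auto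
  \<comment> \<open>Since \<open>p2\<close> is a common neighbour of \<open>r2\<close> and
    \<open>s2\<close>, they cannot both go to \<open>s\<close>. In either case \<open>c\<close> or
    \<open>c'\<close> is left with three possible neighbours in \<open>P\<close>, two of which it
    would share with \<open>b4\<close> or \<open>b1\<close>.\<close>
  have "A r r2 \<or> A r s2"
  proof (rule ccontr)
    assume "\<not> (A r r2 \<or> A r s2)"
    then have "A s r2" "A s s2" using K1(2) by auto
    then show False using share[of p2 r2 s2 s] adj adj_sym dist ne[OF inP(2) Q(4)] by auto
  qed
  then show False
  proof
    assume rr: "A r r2"
    have "\<not> A c r2" using share[of r p1 r2 c] rr K1(1) C1(3) dist cne by auto
    then have "nb P c \<subseteq> {p1, s2, s3}" using cp names by auto
    then have "nb P c = {p1, s2, s3}" using C1(4) dist by (intro card_subset_eq) auto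
    then have "A c s2" "A c s3" using nb_eqD[of P c] by simp_all
    then show False using share[of b4 s2 s3 c] b4 dist cne by auto
  next
    assume rs: "A r s2"
    have "\<not> A s' q2" using share[of r s2 q2 s'] rs q2r s2s' dist by auto
    then have "A r' q2" using K2(2) by blast
    then have "\<not> A c' q2" using share[of r' s1 q2 c'] K2(1) C2(3) dist c'ne by auto
    then have "nb P c' \<subseteq> {s1, p2, p3}" using cs names by auto
    then have "nb P c' = {s1, p2, p3}" using C2(4) dist by (intro card_subset_eq) auto
    then have "A c' p2" "A c' p3" using nb_eqD[of P c'] by simp_all
    then show False using share[of b1 p2 p3 c'] b1 dist c'ne by auto
  qed
qed

lemma end_classes:
  assumes "es P = 14" "b1 \<in> Q" "b2 \<in> Q" "b3 \<in> Q" "b4 \<in> Q" "A b1 b2" "A b2 b3" "A b3 b4" "b1 \<noteq> b3" "b2 \<noteq> b4"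
    and "a \<in> P" "dg P a = 2"
  shows "\<exists>c\<in>{b1, b4}. A c a \<and> card (nb P c) = 3"
proof -
  note cl = P4_classes[OF assms(2-10)]
  have "a \<in> nb P b1 \<union> nb P b2 \<union> nb P b3 \<union> nb P b4" using assms(11) cl(1) by simp
  moreover have "a \<notin> nb P b2" "a \<notin> nb P b3" using cl(16)[OF assms(1), of a] cl(17)[OF assms(1), of a] assms(12) by auto
  ultimately show ?thesis using cl(2,5) by auto
qed

lemma one_class:
  assumes b: "b1 \<in> Q" "b2 \<in> Q" "b3 \<in> Q" "b4 \<in> Q" "A b1 b2" "A b2 b3" "A b3 b4" "b1 \<noteq> b3" "b2 \<noteq> b4"
    and "a \<in> P"
  shows "dg {b1, b2, b3, b4} a = 1"
proof -
  note cl = P4_classes[OF b]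
  have ne: "b1 \<noteq> b2" "b2 \<noteq> b3" "b3 \<noteq> b4" "b1 \<noteq> b4" using adj_neq b(5-7) path4_component(5)[OF b] by auto
  have d: "dg {b1, b2, b3, b4} a = (if A a b1 then 1 else 0) + ((if A a b2 then 1 else 0) +
      ((if A a b3 then 1 else 0) + (if A a b4 then 1 else 0)))"
    using ne b(8,9) by (simp add: dg_insert)
  have iff: "a \<in> nb P x \<longleftrightarrow> A a x" for x using assms(10) adj_commute[of a x] by simp
  have "a \<in> nb P b1 \<union> nb P b2 \<union> nb P b3 \<union> nb P b4" using assms(10) cl(1) by simp
  then have "A a b1 \<or> A a b2 \<or> A a b3 \<or> A a b4" using iff by blast
  moreover have dj: "\<not> (A a u \<and> A a w)" if "nb P u \<inter> nb P w = {}" for u w using that iff[of u] iff[of w] by blast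
  ultimately show ?thesis
    unfolding d using dj[OF cl(6)] dj[OF cl(7)] dj[OF cl(8)] dj[OF cl(9)] dj[OF cl(10)] dj[OF cl(11)] by auto
qed

text \<open>Each of the three paths that form \<open>P\<close> contains at most two independent
  vertices, so six are optimal on all of them: the ends of the two short paths and one vertex on
  each outer edge of the long one. Every deviation is covered by five edges or single
  vertices.\<close>

lemma K2_ends:
  assumes names: "P = {p1, p2, p3, s1, s2, s3, q1, q2, r1, r2}"
    and adj: "A p1 s1" "A p2 s2" "A p3 s3" "A r1 p1" "A r2 p2" "A q1 s1" "A q2 s3"
    and I: "I \<subseteq> P" "card I = 6" and ind: "\<forall>x\<in>I. \<forall>y\<in>I. \<not> A x y"
  shows "p2 \<notin> I" "s3 \<notin> I" "{r2, s2, q2, p3} \<subseteq> I" "q1 \<in> I \<or> s1 \<in> I" "p1 \<in> I \<or> r1 \<in> I"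
proof -
  have m: "\<not> I \<subseteq> {x1, y1, x2, y2, x3, y3, x4, y4, x5, y5}"
    if "A x1 y1 \<or> x1 = y1" "A x2 y2 \<or> x2 = y2" "A x3 y3 \<or> x3 = y3" "A x4 y4 \<or> x4 = y4" "A x5 y5 \<or> x5 = y5"
    for x1 y1 x2 y2 x3 y3 x4 y4 x5 y5
    using matching_independent[of I x1 y1 x2 y2 x3 y3 x4 y4 x5 y5] that I(2) ind by auto
  have sub: "x \<in> {p1, p2, p3, s1, s2, s3, q1, q2, r1, r2}" if "x \<in> I" for x using that I(1) names by auto
  show p2: "p2 \<notin> I"
  proof
    assume "p2 \<in> I"
    then have "r2 \<notin> I" "s2 \<notin> I" using ind adj by auto
    then have "I \<subseteq> {q1, s1, r1, p1, q2, s3, p3, p3, p2, p2}" using sub by fastforce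
    then show False using m[of q1 s1 r1 p1 q2 s3 p3 p3 p2 p2] adj by auto
  qed
  show s3: "s3 \<notin> I"
  proof
    assume "s3 \<in> I"
    then have "q2 \<notin> I" "p3 \<notin> I" using ind adj by auto
    then have "I \<subseteq> {q1, s1, r1, p1, r2, p2, s2, s2, s3, s3}" using sub by fastforce
    then show False using m[of q1 s1 r1 p1 r2 p2 s2 s2 s3 s3] adj by auto
  qed
  have sub': "x \<in> {p1, p3, s1, s2, q1, q2, r1, r2}" if "x \<in> I" for x using sub[OF that] p2 s3 that by auto
  show "{r2, s2, q2, p3} \<subseteq> I"
  proof (rule ccontr)
    assume "\<not> {r2, s2, q2, p3} \<subseteq> I"
    then have "I \<subseteq> {q1, s1, r1, p1, s2, s2, q2, q2, p3, p3} \<or> I \<subseteq> {q1, s1, r1, p1, r2, r2, q2, q2, p3, p3} \<or>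
      I \<subseteq> {q1, s1, r1, p1, r2, r2, s2, s2, p3, p3} \<or> I \<subseteq> {q1, s1, r1, p1, r2, r2, s2, s2, q2, q2}"
      using sub' by fastforce
    then show False using m[of q1 s1 r1 p1 s2 s2 q2 q2 p3 p3] m[of q1 s1 r1 p1 r2 r2 q2 q2 p3 p3]
        m[of q1 s1 r1 p1 r2 r2 s2 s2 p3 p3] m[of q1 s1 r1 p1 r2 r2 s2 s2 q2 q2] adj by auto
  qed
  show "q1 \<in> I \<or> s1 \<in> I"
  proof (rule ccontr)
    assume "\<not> (q1 \<in> I \<or> s1 \<in> I)"
    then have "I \<subseteq> {r1, p1, r2, r2, s2, s2, q2, q2, p3, p3}" using sub' by fastforce
    then show False using m[of r1 p1 r2 r2 s2 s2 q2 q2 p3 p3] adj by auto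
  qed
  show "p1 \<in> I \<or> r1 \<in> I"
  proof (rule ccontr)
    assume "\<not> (p1 \<in> I \<or> r1 \<in> I)"
    then have "I \<subseteq> {q1, s1, r2, r2, s2, s2, q2, q2, p3, p3}" using sub' by fastforce
    then show False using m[of q1 s1 r2 r2 s2 s2 q2 q2 p3 p3] adj by auto
  qed
qed

text \<open>Here \<open>Q\<close> consists of two paths with four vertices, two isolated edges and
  an isolated vertex \<open>b0\<close>. A vertex of \<open>P\<close> has one neighbour on each path,
  and \<open>I\<close>, \<open>I'\<close> record whether it has one on the isolated edges; so its
  degree five decides whether it is adjacent to \<open>b0\<close>.\<close>

lemma two_paths_case:
  assumes e: "es P = 14" and c: "card Y = 4" "card K = 4" "card (N 0) = 1" "card X = 0" "card (N 3) = 0"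
  shows False
proof -
  have fQ: "finite Y" "finite K" using XY finite_K by auto
  obtain c1 where c1: "c1 \<in> Y" using c(1) by (metis card.empty ex_in_conv zero_neq_numeral)
  obtain x d y where P1: "x \<in> Q" "c1 \<in> Q" "d \<in> Q" "y \<in> Q" "A x c1" "A c1 d" "A d y" "x \<noteq> d" "c1 \<noteq> y"
    and P1': "d \<in> Y" "x \<in> N 1" "y \<in> N 1" "nb Q x = {c1}" "nb Q y = {d}" "nb (N 2) c1 = {d}" "nb (N 2) d = {c1}"
    using Y_path[OF c1] by blast
  have "card (Y - {c1, d}) = 2" using c c1 P1' fQ adj_neq[OF P1(6)] by (simp add: card_Diff_subset)
  then obtain c2 where c2: "c2 \<in> Y" "c2 \<noteq> c1" "c2 \<noteq> d" by (metis Diff_iff card.empty ex_in_conv insertCI zero_neq_numeral)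
  obtain x' d' y' where P2: "x' \<in> Q" "c2 \<in> Q" "d' \<in> Q" "y' \<in> Q" "A x' c2" "A c2 d'" "A d' y'" "x' \<noteq> d'" "c2 \<noteq> y'"
    and P2': "d' \<in> Y" "x' \<in> N 1" "y' \<in> N 1" "nb Q x' = {c2}" "nb Q y' = {d'}" "nb (N 2) c2 = {d'}" "nb (N 2) d' = {c2}"
    using Y_path[OF c2(1)] by blast
  obtain r where r: "r \<in> K" using c(2) by (metis card.empty ex_in_conv zero_neq_numeral)
  obtain s where s: "s \<in> K" "A r s" "nb Q r = {s}" "nb Q s = {r}" "r \<in> Q" "s \<in> Q" "dg Q r = 1" "dg Q s = 1"
    using K_pair[OF r] by blast
  have "card (K - {r, s}) = 2" using c r s fQ adj_neq[OF s(2)] by (simp add: card_Diff_subset)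
  then obtain r' where r': "r' \<in> K" "r' \<noteq> r" "r' \<noteq> s" by (metis Diff_iff card.empty ex_in_conv insertCI zero_neq_numeral)
  obtain s' where s': "s' \<in> K" "A r' s'" "nb Q r' = {s'}" "nb Q s' = {r'}" "r' \<in> Q" "s' \<in> Q" "dg Q r' = 1" "dg Q s' = 1"
    using K_pair[OF r'(1)] by blast
  obtain b0 where b0: "N 0 = {b0}" using c(3) by (auto simp: card_1_singleton_iff)
  have levels: "c1 \<in> N 2" "d \<in> N 2" "c2 \<in> N 2" "d' \<in> N 2" "r \<in> N 1" "s \<in> N 1" "r' \<in> N 1" "s' \<in> N 1" "b0 \<in> N 0"
    using c1 P1' c2 P2' r s r' s' b0 by (auto simp: Y_def K_def)
  have N12: "u \<noteq> w" if "u \<in> N i" "w \<in> N j" "i \<noteq> j" for u w i j using that by (auto simp: N_def)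
  have "s' \<noteq> r" using s'(4) s(3) r'(3) by auto
  moreover have "s' \<noteq> s" using s'(4) s(4) r'(2) by auto
  ultimately have ds: "s' \<noteq> r" "s' \<noteq> s" "s \<noteq> r" "s' \<noteq> r'" using adj_neq[OF s(2)] adj_neq[OF s'(2)] by auto
  have "d' \<noteq> c1" using P1'(6) P2'(7) c2(3) by auto
  moreover have "d' \<noteq> d" using P1'(7) P2'(7) c2(2) by auto
  ultimately have dd: "d' \<noteq> c1" "d' \<noteq> d" "d' \<noteq> c2" "d \<noteq> c1" using adj_neq[OF P2(6)] adj_neq[OF P1(6)] by auto
  have disjN: "N 1 \<inter> N 2 = {}" "b0 \<notin> N 1" "b0 \<notin> N 2" using levels(9) by (auto simp: N_def)
  have N1d: "distinct [x, y, x', y', r, s, r', s']"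
  proof -
    have "c1 \<notin> N 1" "d \<notin> N 1" "c2 \<notin> N 1" "d' \<notin> N 1" using levels(1-4) disjN by auto
    then have "nb Q u \<noteq> nb Q w" if "u \<in> {x, y, x', y'}" "w \<in> {r, s, r', s'}" for u w
      using that P1'(4,5) P2'(4,5) s(3,4) s'(3,4) levels(5-8) by (elim insertE) (auto dest: singleton_inject)
    moreover have "x \<noteq> y" "x' \<noteq> y'" "x \<noteq> x'" "x \<noteq> y'" "y \<noteq> x'" "y \<noteq> y'"
      using P1'(4,5) P2'(4,5) c2 dd by (auto dest: singleton_inject)
    ultimately show ?thesis using ds r' by auto
  qed
  have N2d: "distinct [c1, d, c2, d']" using dd c2 by auto
  have all: "distinct [x, c1, d, y, x', c2, d', y', r, s, r', s', b0]"
  proof -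
    have "set [x, y, x', y', r, s, r', s'] \<subseteq> N 1" "set [c1, d, c2, d'] \<subseteq> N 2"
      using P1'(2,3) P2'(2,3) levels by simp_all
    then have "distinct ([x, y, x', y', r, s, r', s'] @ [c1, d, c2, d'] @ [b0])"
      unfolding distinct_append using N1d N2d disjN by (intro conjI; (simp only: set_append)?) auto
    then show ?thesis by auto
  qed
  have b0Q: "b0 \<in> Q" using levels by (simp add: N_def)
  have Qeq: "Q = {x, c1, d, y} \<union> ({x', c2, d', y'} \<union> ({r, s} \<union> ({r', s'} \<union> {b0})))" (is "_ = ?R")
  proof -
    have "?R = set [x, c1, d, y, x', c2, d', y', r, s, r', s', b0]" by auto
    then have "card ?R = 13" using distinct_card[OF all] by simp
    moreover have "?R \<subseteq> Q" using P1 P2 s s' b0Q by auto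
    ultimately show ?thesis using PQ(4,6) by (metis card_subset_eq)
  qed
  define I where "I = nb P r \<union> nb P s"
  note I = K2_independent[OF s(5,6,2,7,8), folded I_def]
  define I' where "I' = nb P r' \<union> nb P s'"
  note I' = K2_independent[OF s'(5,6,2,7,8), folded I'_def]
  obtain p1 p2 p3 s1 s2 s3 q1 q2 r1 r2 where
    dist: "distinct [p1, p2, p3, s1, s2, s3, q1, q2, r1, r2]" and
    T: "nb P x = {p1, p2, p3}" "nb P y = {s1, s2, s3}" "nb P c1 = {q1, q2}" "nb P d = {r1, r2}" and
    adj: "A p1 s1" "A p2 s2" "A p3 s3" "A r1 p1" "A r2 p2" "A q1 s1" "A q2 s3"
    using P4_names[OF e P1 I] by blast
  note cl = P4_classes[OF P1]
  have names: "P = {p1, p2, p3, s1, s2, s3, q1, q2, r1, r2}" using cl(1) unfolding T by auto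
  have inP: "p1 \<in> P" "p2 \<in> P" "p3 \<in> P" "s1 \<in> P" "s2 \<in> P" "s3 \<in> P" "q1 \<in> P" "q2 \<in> P" "r1 \<in> P" "r2 \<in> P"
    unfolding names by simp_all
  have "\<forall>x\<in>I. \<forall>y\<in>I. \<not> A x y" using I(3) by blast
  note ends = K2_ends[OF names adj I(1,2) this]
  have "\<forall>x\<in>I'. \<forall>y\<in>I'. \<not> A x y" using I'(3) by blast
  note ends' = K2_ends[OF names adj I'(1,2) this]
  have rsI: "dg {r, s} a = (if a \<in> I then 1 else 0)" if "a \<in> P" for a
    using that nbs_nonadj[of a r s] s(2) all adj_sym by (auto simp: dg_insert I_def)
  have rsI': "dg {r', s'} a = (if a \<in> I' then 1 else 0)" if "a \<in> P" for a
    using that nbs_nonadj[of a r' s'] s'(2) all adj_sym by (auto simp: dg_insert I'_def)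
  have dQ: "dg Q a = 2 + (if a \<in> I then 1 else 0) + (if a \<in> I' then 1 else 0) + (if A a b0 then 1 else 0)" if a: "a \<in> P" for a
  proof -
    have "dg Q a = dg {x, c1, d, y} a + (dg {x', c2, d', y'} a + (dg {r, s} a + (dg {r', s'} a + dg {b0} a)))"
    proof -
      have i: "{x, c1, d, y} \<inter> ({x', c2, d', y'} \<union> ({r, s} \<union> ({r', s'} \<union> {b0}))) = {}"
        "{x', c2, d', y'} \<inter> ({r, s} \<union> ({r', s'} \<union> {b0})) = {}"
        "{r, s} \<inter> ({r', s'} \<union> {b0}) = {}" "{r', s'} \<inter> {b0} = {}"
        using all by auto
      show ?thesis
        unfolding Qeq using dg_Un[OF _ _ i(1), of a] dg_Un[OF _ _ i(2), of a] dg_Un[OF _ _ i(3), of a] dg_Un[OF _ _ i(4), of a] by simp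
    qed
    then show ?thesis using one_class[OF P1 a] one_class[OF P2 a] rsI[OF a] rsI'[OF a] by (simp add: dg_insert)
  qed
  have d2: "dg P a = 2" if "u \<in> P" "w \<in> P" "u \<noteq> w" "A a u" "A a w" "a \<in> P" for a u w
    using dg_two[OF that(1-5) PQ(3)] dg_PP[OF that(6)] by simp
  have t2: "dg P p1 = 2" "dg P s1 = 2" "dg P p2 = 2" "dg P s3 = 2"
    using d2[of r1 s1 p1] d2[of p1 q1 s1] d2[of r2 s2 p2] d2[of p3 q2 s3] inP dist adj adj_sym by auto
  have t1: "dg P q1 = 1" "dg P r1 = 1"
    using cl(16)[OF e, of q1] cl(17)[OF e, of r1] T by auto
  \<comment> \<open>The middle vertices of the short paths avoid \<open>I\<close> and
    \<open>I'\<close> but have three neighbours in \<open>Q\<close>; the third can only be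
    \<open>b0\<close>.\<close>
  have "A p2 b0" using dQ[OF inP(2)] dg_P5[OF inP(2)] t2(3) ends(1) ends'(1) by (cases "A p2 b0") simp_all
  moreover have "A s3 b0" using dQ[OF inP(6)] dg_P5[OF inP(6)] t2(4) ends(2) ends'(2) by (cases "A s3 b0") simp_all
  ultimately have b0p: "A p2 b0" "A s3 b0" by simp_all
  have bx: "b0 \<noteq> x" "b0 \<noteq> y" using all by auto
  have b0n: "\<not> A b0 p1" "\<not> A b0 s1"
    using common_unique[of b0 p1 p2 x] common_unique[of b0 s1 s3 y] nb_eqD[OF T(1)] nb_eqD[OF T(2)] b0p adj_sym bx dist by auto
  have b0e: "\<not> A a b0" if "a \<in> {r2, s2, q2, p3}" for a
  proof
    assume "A a b0"
    moreover have "a \<in> I" "a \<in> I'" "a \<in> P" using that ends(3) ends'(3) I(1) by auto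
    ultimately have "dg Q a = 5" using dQ[of a] by simp
    moreover have "dg P a \<noteq> 0" using that adj inP dg_eq_0[OF PQ(3), of a] adj_sym by auto
    ultimately show False using dg_P5[OF \<open>a \<in> P\<close>] by linarith
  qed
  have "nb P b0 \<subseteq> {p2, s3, q1, r1}"
    using b0n b0e[of r2] b0e[of s2] b0e[of q2] b0e[of p3] adj_sym[of b0 r2] adj_sym[of b0 s2] adj_sym[of b0 q2] adj_sym[of b0 p3]
    unfolding names by auto
  moreover have "card (nb P b0) = 4" using card_nb_P[OF b0Q] levels(9) by (simp add: N_def)
  ultimately have "nb P b0 = {p2, s3, q1, r1}" using dist by (intro card_subset_eq) auto
  then have b0q: "A q1 b0" "A r1 b0" using nb_eqD[of P b0] adj_sym by simp_all
  have nb0: "\<not> A p1 b0" "\<not> A s1 b0" using b0n adj_sym[of p1 b0] adj_sym[of s1 b0] by auto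
  \<comment> \<open>Degree five puts each vertex of the long path into exactly one of
    \<open>I\<close> and \<open>I'\<close>. As \<open>p1\<close> and \<open>s1\<close> are adjacent,
    they lie in different ones, which \<open>double_path_conflict\<close> excludes.\<close>
  have x1: "(q1 \<in> I) \<noteq> (q1 \<in> I')" using dQ[OF inP(7)] dg_P5[OF inP(7)] t1(1) b0q(1) by (cases "q1 \<in> I"; cases "q1 \<in> I'") simp_all
  have x2: "(r1 \<in> I) \<noteq> (r1 \<in> I')" using dQ[OF inP(9)] dg_P5[OF inP(9)] t1(2) b0q(2) by (cases "r1 \<in> I"; cases "r1 \<in> I'") simp_all
  have x3: "(p1 \<in> I) \<noteq> (p1 \<in> I')" using dQ[OF inP(1)] dg_P5[OF inP(1)] t2(1) nb0(1) by (cases "p1 \<in> I"; cases "p1 \<in> I'") simp_all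
  have x4: "(s1 \<in> I) \<noteq> (s1 \<in> I')" using dQ[OF inP(4)] dg_P5[OF inP(4)] t2(2) nb0(2) by (cases "s1 \<in> I"; cases "s1 \<in> I'") simp_all
  have psI: "\<not> (p1 \<in> I \<and> s1 \<in> I)" "\<not> (p1 \<in> I' \<and> s1 \<in> I')" using I(3)[of p1 s1] I'(3)[of p1 s1] adj(1) by auto
  obtain cp where cp: "cp \<in> {x', y'}" "A cp p1" "card (nb P cp) = 3"
    using end_classes[OF e P2 inP(1) t2(1)] by blast
  obtain cs where cs: "cs \<in> {x', y'}" "A cs s1" "card (nb P cs) = 3"
    using end_classes[OF e P2 inP(4) t2(2)] by blast
  have conflict: False
    if k: "{k, l} = {r, s} \<and> {k', l'} = {r', s'} \<or> {k, l} = {r', s'} \<and> {k', l'} = {r, s}" "A k p1" "A k' s1" for k l k' l'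
  proof (rule double_path_conflict[OF names adj, of x y k l k' l' cp cs])
    show "A x p1" "A x p2" "A x p3" "A y s1" "A y s2" "A y s3" using nb_eqD[OF T(1)] nb_eqD[OF T(2)] by simp_all
    show "x \<in> Q" "y \<in> Q" using P1 by simp_all
    show "k \<in> Q" "l \<in> Q" "k' \<in> Q" "l' \<in> Q" using k(1) s s' by (auto simp: doubleton_eq_iff)
    show "distinct [p1, p2, p3, s1, s2, s3, q1, q2, r1, r2]" by (rule dist)
    show "distinct [x, y, k, l, k', l']" using k(1) N1d by (auto simp: doubleton_eq_iff)
    show "A k p1" "A k' s1" using k by simp_all
    show "A k u \<or> A l u" if "u \<in> {r2, s2, q2, p3}" for u
      using that ends(3) ends'(3) k(1) by (fastforce simp: I_def I'_def doubleton_eq_iff)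
    show "A k' u \<or> A l' u" if "u \<in> {r2, s2, q2, p3}" for u
      using that ends(3) ends'(3) k(1) by (fastforce simp: I_def I'_def doubleton_eq_iff)
    show "cp \<in> Q" "cs \<in> Q" using cp(1) cs(1) P2 by auto
    show "cp \<notin> {x, y, k, l, k', l'}" "cs \<notin> {x, y, k, l, k', l'}"
      using cp(1) cs(1) k(1) N1d by (auto simp: doubleton_eq_iff)
    show "A cp p1" "card (nb P cp) = 3" "A cs s1" "card (nb P cs) = 3" using cp cs by simp_all
  qed
  consider "p1 \<in> I" "s1 \<in> I'" | "p1 \<in> I'" "s1 \<in> I" using x3 x4 psI by blast
  then show False
  proof cases
    case 1
    then have "A r p1 \<or> A s p1" "A r' s1 \<or> A s' s1" by (auto simp: I_def I'_def)
    then show False using conflict[of r s r' s'] conflict[of s r r' s'] conflict[of r s s' r'] conflict[of s r s' r']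
      by (auto simp: insert_commute)
  next
    case 2
    then have "A r' p1 \<or> A s' p1" "A r s1 \<or> A s s1" by (auto simp: I_def I'_def)
    then show False using conflict[of r' s' r s] conflict[of s' r' r s] conflict[of r' s' s r] conflict[of s' r' s r]
      by (auto simp: insert_commute)
  qed
qed

text \<open>A neighbour of \<open>b0\<close> with fewer than two neighbours in \<open>P\<close>
  would lie in a class of each of the four paths, which with \<open>b0\<close> makes five neighbours
  in \<open>Q\<close> and leaves none in \<open>P\<close>. So \<open>L 2\<close> is the
  neighbourhood of \<open>b0\<close>, and this independent set would meet eight edges of
  \<open>P\<close>, which has seven.\<close>

lemma four_P3_case:
  assumes e: "es P = 14" and c: "card X = 4" "card (N 0) = 1" "card Y = 0" and L: "L 0 = {}" "card (L 2) = 4"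
  shows False
proof -
  obtain b0 where b0: "N 0 = {b0}" using c(2) by (auto simp: card_1_singleton_iff)
  have b0Q: "b0 \<in> Q" "dg Q b0 = 0" using b0 by (auto simp: N_def)
  have sub: "nb P b0 \<subseteq> L 2"
  proof
    fix a assume a: "a \<in> nb P b0"
    show "a \<in> L 2"
    proof (rule ccontr)
      assume n: "a \<notin> L 2"
      have aP: "a \<in> P" "A b0 a" using a by auto
      have ex: "\<exists>z\<in>insert x (nb Q x). A a z" if x: "x \<in> X" for x
      proof (rule ccontr)
        assume nx: "\<not> ?thesis"
        obtain u w where uw: "u \<in> Q" "x \<in> Q" "w \<in> Q" "A u x" "A x w" "u \<noteq> w" "dg Q u = 1" "dg Q x = 2" "dg Q w = 1"
          "nb Q x = {u, w}" using X_path[OF x] by blast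
        have "a \<in> P - (nb P u \<union> nb P x \<union> nb P w)" using nx uw(10) aP adj_sym by auto
        then have "dg P a = 2" using P3_classes(2)[OF uw(1-9) e] by blast
        then show False using n aP by (simp add: L_def)
      qed
      then obtain f where f: "\<And>x. x \<in> X \<Longrightarrow> f x \<in> insert x (nb Q x) \<and> A a (f x)" by metis
      have fQ: "f x \<in> Q" if "x \<in> X" for x using f[OF that] that by (auto simp: X_def N_def)
      have star: "u = w" if uw: "u \<in> X" "w \<in> X" "z \<in> insert u (nb Q u)" "z \<in> insert w (nb Q w)" for u w z
      proof (rule ccontr)
        assume "u \<noteq> w"
        have QX: "u \<in> Q" "w \<in> Q" "u \<in> N 2" "w \<in> N 2" using uw by (auto simp: X_def N_def)
        have no: "\<not> A u w" "\<not> A w u" using uw(1,2) QX dg_eq_0[OF finite_NL(1), of 2] by (auto simp: X_def)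
        then have "A u z" "A w z" "z \<in> Q" using uw(3,4) \<open>u \<noteq> w\<close> by auto
        moreover obtain p q where "nb Q u = {p, q}" "dg Q p = 1" "dg Q q = 1" using X_path[OF uw(1)] by blast
        ultimately have "dg Q z = 1" using in_nb[of z Q u] by auto
        then show False using dg_two[of u Q w z] QX \<open>u \<noteq> w\<close> \<open>A u z\<close> \<open>A w z\<close> adj_sym PQ(4) by auto
      qed
      have inj: "inj_on f X" using star f by (intro inj_onI) metis
      have "b0 \<notin> f ` X"
      proof
        assume "b0 \<in> f ` X"
        then obtain x where x: "x \<in> X" "b0 = f x" by blast
        have "b0 \<noteq> x" using b0Q x(1) by (auto simp: X_def N_def)
        then have "A x b0" "x \<in> Q" using f[OF x(1)] x by (auto simp: X_def N_def)
        then show False using b0Q dg_eq_0[OF PQ(4), of b0] adj_sym by blast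
      qed
      then have "card (insert b0 (f ` X)) = 5" using c(1) card_image[OF inj] XY(3) by simp
      moreover have "insert b0 (f ` X) \<subseteq> nb Q a" using f fQ b0Q aP adj_sym by auto
      ultimately have "5 \<le> dg Q a" unfolding dg_def using card_mono[of "nb Q a"] PQ(4) by (metis finite_nb)
      moreover have "dg P a \<noteq> 0" using L(1) aP by (auto simp: L_def)
      ultimately show False using dg_P5[OF aP(1)] by linarith
    qed
  qed
  moreover have "card (nb P b0) = 4" using card_nb_P[OF b0Q(1)] b0Q by simp
  ultimately have eq: "nb P b0 = L 2" using L(2) finite_NL by (intro card_subset_eq) auto
  have "es P + es (L 2) = es (P - L 2) + 2 * (\<Sum>v\<in>L 2. dg P v)"
    by (rule deletion[OF PQ(3)]) (auto simp: L_def)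
  moreover have "(\<Sum>v\<in>L 2. dg P v) = 8" using L(2) by (simp add: L_def)
  moreover have "es (L 2) = 0"
  proof -
    have "A b0 v" if "v \<in> L 2" for v using nb_eqD[OF eq that] by simp
    then have "dg (L 2) v = 0" if "v \<in> L 2" for v
      using that nbs_nonadj[of b0 v] dg_eq_0[OF finite_NL(2), of 2 v] by blast
    then show ?thesis by (simp add: es_def)
  qed
  ultimately show False using e by linarith
qed

lemma fourteen_case: "es P \<noteq> 14"
proof
  assume e: "es P = 14"
  have L2: "card (L 2) = 4 + card (L 0)" using L_counts e by linarith
  have N3: "card (N 3) = 0"
  proof (cases "L 0 = {}")
    case True
    then have "N 3 = {}" using star_isolated by blast
    then show ?thesis by simp
  next
    case False
    then have "1 \<le> card (L 0)" using finite_NL(2)[of 0] by (simp add: Suc_le_eq card_gt_0_iff)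
    then show ?thesis using N_counts pairs_le e L2 by linarith
  qed
  have N3e: "N 3 = {}" using N3 finite_NL by simp
  have n0: "card (N 0) + 3 = card (N 2)" using N_counts e N3 by linarith
  have n2: "card (N 2) + card (L 0) \<le> 4" using N_counts pairs_le e L2 N3 by linarith
  have n1: "card (N 1) + 2 * card (N 2) = 16" using N_counts N3 e by linarith
  have cK: "card K + 2 * card X + card Y = card (N 1)" using N1_count[OF N3e] by simp
  \<comment> \<open>Equality in \<open>P4_classes\<close> gives every vertex a neighbour in
    \<open>P\<close>.\<close>
  have YL: "Y \<noteq> {} \<Longrightarrow> L 0 = {}"
  proof -
    assume "Y \<noteq> {}"
    then obtain c where "c \<in> Y" by blast
    then obtain x d y where P: "x \<in> Q" "c \<in> Q" "d \<in> Q" "y \<in> Q" "A x c" "A c d" "A d y" "x \<noteq> d" "c \<noteq> y"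
      using Y_path by blast
    note cl = P4_classes[OF P]
    show "L 0 = {}"
    proof (rule ccontr)
      assume "L 0 \<noteq> {}"
      then obtain a where a: "a \<in> P" "dg P a = 0" by (auto simp: L_def)
      have "a \<in> nb P x \<union> nb P c \<union> nb P d \<union> nb P y" using a cl(1) by simp
      moreover have "dg (nb P x) a \<le> dg P a" by (rule dg_mono[OF PQ(3)]) auto
      ultimately show False using cl(13)[of a] cl(14,15,16,17)[OF e, of a] a(2) by auto
    qed
  qed
  \<comment> \<open>An isolated edge supplies an independent set of size six, which a path with
    three vertices forbids under equality.\<close>
  have XK: False if XKL: "X \<noteq> {}" "K \<noteq> {}" "L 0 = {}"
  proof -
    obtain c where "c \<in> X" using XKL(1) by blast
    then obtain x z where xz: "x \<in> Q" "c \<in> Q" "z \<in> Q" "A x c" "A c z" "x \<noteq> z" "dg Q x = 1" "dg Q c = 2" "dg Q z = 1"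
      using X_path by blast
    obtain r where "r \<in> K" using XKL(2) by blast
    then obtain s where s: "r \<in> Q" "s \<in> Q" "A r s" "dg Q r = 1" "dg Q s = 1" using K_pair by blast
    note I = K2_independent[OF s]
    show False using P3_classes(4)[OF xz e XKL(3) I(1,3)] I(2) by simp
  qed
  have fin: "X \<noteq> {} \<longleftrightarrow> 0 < card X" "Y \<noteq> {} \<longleftrightarrow> 0 < card Y" "K \<noteq> {} \<longleftrightarrow> 0 < card K" "L 0 = {} \<longleftrightarrow> card (L 0) = 0"
    using XY finite_K finite_NL by (auto simp: card_gt_0_iff)
  obtain h where h: "card Y = 2 * h" using even_Y by blast
  have "card X + card Y = card (N 2)" using XY(5) by simp
  \<comment> \<open>The variables stand for the sizes of \<open>X\<close>, \<open>Y\<close>,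
    \<open>N 2\<close>, \<open>N 0\<close> and \<open>L 0\<close>.\<close>
  have cases: "x = 4 \<and> y = 0 \<and> n = 1 \<or> y = 4 \<and> x = 0 \<and> n = 1 \<or> x = 3 \<and> y = 0 \<or> 0 < x \<and> 0 < y"
    if "x + y = z" "y = 2 * h" "n + 3 = z" "z + l \<le> 4" for x y z n l :: nat
    using that by presburger
  from cases[OF \<open>card X + card Y = card (N 2)\<close> h n0 n2] show False
  proof (elim disjE conjE)
    assume 1: "card X = 4" "card Y = 0" "card (N 0) = 1"
    then have "card (L 0) = 0" using n2 n0 by linarith
    then show False using four_P3_case[OF e 1(1,3,2)] fin L2 by simp
  next
    assume 2: "card Y = 4" "card X = 0" "card (N 0) = 1"
    then have "card K = 4" using cK n1 n0 by linarith
    then show False using two_paths_case[OF e 2(1) _ 2(3,2) N3] by simp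
  next
    assume 3: "card X = 3" "card Y = 0"
    then have n2': "card (N 2) = 3" and K4: "card K = 4" using XY(5) cK n1 by simp_all
    have "card (L 0) \<noteq> 0" using XK fin 3 K4 by auto
    then have L1: "card (L 0) = 1" using n2 n2' by linarith
    obtain a where a: "a \<in> P" "dg P a = 0" using L1 by (metis (mono_tags, lifting) L_def card.empty ex_in_conv mem_Collect_eq zero_neq_one)
    have N0: "N 0 = {}" using n0 n2' finite_NL(1)[of 0] by simp
    have aX: "A a c" if cX: "c \<in> X" for c
    proof -
      obtain x z where xz: "x \<in> Q" "c \<in> Q" "z \<in> Q" "A x c" "A c z" "x \<noteq> z" "dg Q x = 1" "dg Q c = 2" "dg Q z = 1"
        using X_path[OF cX] by blast
      show ?thesis using P3_classes(3)[OF xz e a(2,1)] .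
    qed
    \<comment> \<open>The pair count is tight, so \<open>a\<close> must reach all nine other
      vertices of \<open>P\<close> through its five neighbours. The three centres in
      \<open>X\<close> reach one each, the remaining two neighbours at most two each.\<close>
    have tight: "card P * (card P - 1) \<le> (\<Sum>v\<in>V. dg P v * (dg P v - 1)) + es P"
      using pairs_eq e L2 L1 n1 n2' N0 PQ(5) by simp
    have "P \<subseteq> V" using PQ(1) by blast
    then have nine: "9 \<le> (\<Sum>b\<in>nb V a. dg P b - 1)"
      using pair_count_tight[OF finV _ a(1,2) tight] PQ(5) by simp
    have "\<not> A a w" if "w \<in> P" for w using a(2) that dg_eq_0[OF PQ(3), of a] by blast
    then have nbQ: "nb V a = nb Q a" unfolding nb_def using PQ(1) by blast
    have cQ: "card (nb Q a) = 5" using dg_P5[OF a(1)] a(2) by (simp add: dg_def)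
    have XQ: "X \<subseteq> nb Q a" using aX by (auto simp: X_def N_def)
    have "(\<Sum>b\<in>nb Q a. dg P b - 1) = (\<Sum>b\<in>X. dg P b - 1) + (\<Sum>b\<in>nb Q a - X. dg P b - 1)"
      using XQ PQ(4) by (simp add: sum.subset_diff[of X] add.commute)
    also have "(\<Sum>b\<in>X. dg P b - 1) = (\<Sum>b\<in>X. 1)"
    proof (intro sum.cong refl)
      fix b assume "b \<in> X"
      then show "dg P b - 1 = 1" using dg_Q4[of b] by (simp add: X_def N_def)
    qed
    also have "(\<Sum>b\<in>nb Q a - X. dg P b - 1) \<le> (\<Sum>b\<in>nb Q a - X. 2 :: nat)"
    proof (rule sum_mono)
      fix b assume b: "b \<in> nb Q a - X"
      then have "dg Q b \<noteq> 0" using N0 by (auto simp: N_def)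
      then show "dg P b - 1 \<le> 2" using dg_Q4[of b] b by simp
    qed
    also have "(\<Sum>b\<in>nb Q a - X. 2 :: nat) = 4"
      using XQ cQ 3(1) XY(3) by (simp add: card_Diff_subset)
    finally show False using nine nbQ 3(1) by simp
  next
    assume 4: "0 < card X" "0 < card Y"
    then have "card K > 0" using cK n1 n2 XY(5) n0 h by linarith
    then show False using XK YL fin 4 by auto
  qed
qed

text \<open>The pair count requires at least six edges inside \<open>P\<close>, the count of leaves
  allows at most eight.\<close>

lemma impossible: False
proof -
  obtain m where m: "es P = 2 * m" using even_es[OF PQ(3)] by blast
  have "12 \<le> es P" using N_counts L_counts pairs_le by linarith
  moreover have "es P \<le> 17" using N_counts N_ineq by linarith
  ultimately have "m = 6 \<or> m = 7 \<or> m = 8" using m by linarith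
  then show False using six_case fourteen_case eight_case m by auto
qed

end

context girth5
begin

lemma bound23: "bound 23 50"
proof (rule bound_refine)
  show "bound 23 (Suc 50)" by (rule bound_Suc[OF bound22]) auto
  fix V :: "'a set" assume V: "finite V" "card V = 23" "es V = 2 * Suc 50"
  interpret crit23 A V by unfold_locales (use V in simp_all)
  show False by (rule impossible)
qed

lemma bound24: "bound 24 54"
  by (rule bound_Suc[OF bound23]) auto

end

section \<open>A vertex of degree three\<close>

locale crit25 = girth5 +
  fixes V :: "'a set" and v :: 'a
  assumes finV: "finite V" and card_V: "card V = 25" and es_V: "es V = 114"
    and v_in: "v \<in> V" and dg_v: "dg V v = 3"
begin

text \<open>Deleting \<open>v\<close> and an adjacent vertex of degree at most four would leave at
  least 51 edges on 23 vertices.\<close>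

lemma nb_v_deg: "u \<in> V \<Longrightarrow> A v u \<Longrightarrow> 5 \<le> dg V u"
proof -
  assume u: "u \<in> V" "A v u"
  have "v \<noteq> u" using u(2) adj_neq by blast
  then show ?thesis using bound_del[OF bound23 finV, of "{v, u}"] es_pair[OF u(2)] u v_in dg_v card_V es_V by simp
qed

lemma deg_ge4: "u \<in> V \<Longrightarrow> u \<noteq> v \<Longrightarrow> 4 \<le> dg V u"
proof -
  assume u: "u \<in> V" "u \<noteq> v"
  show ?thesis
  proof (cases "A v u")
    case True
    then show ?thesis using nb_v_deg[OF u(1)] by simp
  next
    case False
    have "{v, u} \<subseteq> V" "card {v, u} = 2" using u v_in by auto
    then show ?thesis using bound_del[OF bound23 finV, of "{v, u}"] dg_v card_V es_V u(2) by simp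
  qed
qed

lemma deg_ge3: "u \<in> V \<Longrightarrow> 3 \<le> dg V u"
  using deg_ge4[of u] dg_v by (cases "u = v") auto

lemma nb_sum_25: "u \<in> V \<Longrightarrow> (\<Sum>w\<in>nb V u. dg V w) + card (far V u) = 24"
  using nb_sum[OF finV, of u] card_V by simp

lemma deg_le6: "u \<in> V \<Longrightarrow> dg V u \<le> 6"
proof -
  assume u: "u \<in> V"
  have "(\<Sum>w\<in>nb V u. 4) \<le> (\<Sum>w\<in>nb V u. dg V w + (if w = v then 1 else 0))"
  proof (rule sum_mono)
    fix w assume "w \<in> nb V u"
    then show "4 \<le> dg V w + (if w = v then 1 else 0)" using deg_ge4[of w] dg_v by auto
  qed
  also have "\<dots> \<le> (\<Sum>w\<in>nb V u. dg V w) + 1" using finV by (simp add: sum.distrib)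
  finally show ?thesis using nb_sum_25[OF u] by (simp add: dg_def)
qed

text \<open>Otherwise all neighbours of \<open>x\<close> have degree four and nothing is far from
  \<open>x\<close>; so some neighbour of \<open>x\<close> is adjacent to \<open>v\<close>, against
  \<open>nb_v_deg\<close>.\<close>

lemma deg6_adj: "x \<in> V \<Longrightarrow> dg V x = 6 \<Longrightarrow> A v x"
proof (rule ccontr)
  assume x: "x \<in> V" "dg V x = 6" "\<not> A v x"
  have ge: "4 \<le> dg V w" if "w \<in> nb V x" for w using that x(3) adj_sym deg_ge4[of w] by auto
  have "(\<Sum>w\<in>nb V x. 4) \<le> (\<Sum>w\<in>nb V x. dg V w)" using ge by (rule sum_mono)
  then have e: "(\<Sum>w\<in>nb V x. 4) = (\<Sum>w\<in>nb V x. dg V w)" and f: "card (far V x) = 0"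
    using nb_sum_25[OF x(1)] x(2) by (simp_all add: dg_def)
  have four: "dg V w = 4" if "w \<in> nb V x" for w
    using sum_mono_inv[OF e ge that] finV by simp
  have "v \<notin> far V x" using f finV by simp
  moreover have "v \<noteq> x" using x(2) dg_v by auto
  ultimately obtain u where u: "u \<in> V" "A x u" "A u v" using v_in x(3) adj_sym by (auto simp: far_def)
  then show False using four[of u] nb_v_deg[of u] adj_sym[of u v] by auto
qed

end

text \<open>Under \<open>six\<close> the degrees of the neighbours of \<open>x\<close> sum to 23, so there always is exactly one vertex
  \<open>out\<close> as in \<open>far_x\<close>.\<close>

locale outlier = crit25 +
  fixes x out :: 'a
  assumes x_in: "x \<in> V" and dg_x: "dg V x = 6" and far_x: "far V x = {out}"
    and six: "\<And>w z. w \<in> V \<Longrightarrow> dg V w = 6 \<Longrightarrow> z \<in> V \<Longrightarrow> A w z \<Longrightarrow> z \<noteq> v \<Longrightarrow> dg V z = 4"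
begin

section \<open>The graph outside a vertex of degree six and its neighbours\<close>

definition "Par = nb V x"
definition "L = V - insert x Par"
definition "C = {y \<in> L. dg L y = 3}"
definition "F = {y \<in> L. dg L y = 5}"
definition "W = nb L v"
text \<open>The children of one neighbour of \<open>x\<close> form a row. \<open>RM y\<close> holds
  the row mates of \<open>y\<close>, and \<open>W\<close> is the row of \<open>v\<close>.\<close>

definition "RM y = {z \<in> L. z \<noteq> y \<and> (\<exists>b\<in>Par. A b y \<and> A b z)}"

lemma v_Par: "v \<in> Par" "A x v"
  using deg6_adj[OF x_in dg_x] v_in adj_sym by (auto simp: Par_def)

lemma fin: "finite Par" "finite L" "finite C" "finite F" "finite W" "finite (RM y)"
  using finV by (auto simp: Par_def L_def C_def F_def W_def RM_def)

lemma CF_L: "C \<subseteq> L" "F \<subseteq> L" "W \<subseteq> L" "C \<inter> F = {}"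
  by (auto simp: C_def F_def W_def)

lemma L_V: "y \<in> L \<Longrightarrow> y \<in> V" and L_not: "y \<in> L \<Longrightarrow> y \<noteq> x" "y \<in> L \<Longrightarrow> \<not> A x y" "y \<in> L \<Longrightarrow> y \<notin> Par"
  by (auto simp: L_def Par_def)

lemma card_Par: "card Par = 6"
  using dg_x by (simp add: Par_def dg_def)

lemma x_Par: "x \<notin> Par"
  using adj_irrefl by (auto simp: Par_def)

lemma card_L: "card L = 18"
proof -
  have "card (insert x Par) = 7" using card_Par x_Par fin by simp
  moreover have "insert x Par \<subseteq> V" using x_in by (auto simp: Par_def)
  ultimately show ?thesis unfolding L_def using card_V fin by (simp add: card_Diff_subset)
qed

lemma Par_deg: "b \<in> Par \<Longrightarrow> b \<noteq> v \<Longrightarrow> dg V b = 4"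
  using six[OF x_in dg_x] by (auto simp: Par_def)

lemma Par_ind: "b \<in> Par \<Longrightarrow> b' \<in> Par \<Longrightarrow> \<not> A b b'"
  using nbs_nonadj[of x b b'] by (auto simp: Par_def)

text \<open>The value attains \<open>bound18\<close>, so \<open>L\<close> is an extremal graph on 18
  vertices.\<close>

lemma es_L: "es L = 68"
proof -
  have c: "insert x Par \<subseteq> V" using x_in by (auto simp: Par_def)
  have "dg Par b = 0" if "b \<in> Par" for b using Par_ind[OF that] dg_eq_0[OF fin(1)] by blast
  then have "es Par = 0" by (simp add: es_def)
  moreover have "nb Par x = Par" by (auto simp: Par_def)
  then have "dg Par x = 6" using card_Par by (simp add: dg_def)
  ultimately have "es (insert x Par) = 12" using es_insert[OF fin(1) x_Par] by simp
  moreover have "(\<Sum>b\<in>Par. dg V b) = 23"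
  proof -
    have "(\<Sum>b\<in>Par. dg V b) = dg V v + (\<Sum>b\<in>Par - {v}. dg V b)" using v_Par fin by (simp add: sum.remove)
    also have "(\<Sum>b\<in>Par - {v}. dg V b) = (\<Sum>b\<in>Par - {v}. 4)" using Par_deg by (intro sum.cong) auto
    finally show ?thesis using card_Par v_Par fin dg_v by simp
  qed
  ultimately show ?thesis using deletion[OF finV c] dg_x es_V x_Par fin by (simp add: L_def)
qed

lemma out_L: "out \<in> L" "\<And>b. b \<in> Par \<Longrightarrow> \<not> A b out"
  using far_x by (auto simp: far_def L_def Par_def)

lemma parent: "y \<in> L \<Longrightarrow> y \<noteq> out \<Longrightarrow> \<exists>b\<in>Par. A b y"
proof -
  assume y: "y \<in> L" "y \<noteq> out"
  then have "y \<notin> far V x" using far_x by simp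
  then show ?thesis using y L_V L_not by (auto simp: far_def Par_def)
qed

lemma parent_unique: "b \<in> Par \<Longrightarrow> b' \<in> Par \<Longrightarrow> A b y \<Longrightarrow> A b' y \<Longrightarrow> y \<in> L \<Longrightarrow> b = b'"
  using common_unique[of x b b' y] adj_sym L_not(1) by (auto simp: Par_def)

lemma dg_L: "y \<in> L \<Longrightarrow> dg V y = dg L y + (if y = out then 0 else 1)"
proof -
  assume y: "y \<in> L"
  have Ps: "insert x Par \<subseteq> V" using x_in by (auto simp: Par_def)
  have "dg V y = dg (insert x Par) y + dg L y" unfolding L_def by (rule dg_split[OF finV Ps])
  also have "dg (insert x Par) y = dg Par y" using dg_insert[OF fin(1) x_Par] L_not(2)[OF y] adj_sym by auto
  also have "dg Par y = (if y = out then 0 else 1)"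
  proof (cases "y = out")
    case True
    then show ?thesis using out_L(2) dg_eq_0[OF fin(1), of y] adj_sym by auto
  next
    case False
    then obtain b where b: "b \<in> Par" "A b y" using parent[OF y] by blast
    then have "dg Par y > 0" using dg_pos[OF fin(1), of y] adj_sym by blast
    moreover have "dg Par y \<le> 1" by (rule dg_le_1[OF fin(1)]) (use parent_unique y adj_sym in blast)
    ultimately show ?thesis using False by simp
  qed
  finally show ?thesis by simp
qed

lemma not_v: "y \<in> L \<Longrightarrow> y \<noteq> v"
  using v_Par L_not(3) by blast

lemma dg_L_ge: "y \<in> L \<Longrightarrow> 3 \<le> dg L y"
  using dg_L[of y] deg_ge4[OF L_V not_v, of y] by (auto split: if_splits)

lemma dg_L_le: "y \<in> L \<Longrightarrow> dg L y \<le> 5"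
proof -
  assume y: "y \<in> L"
  show ?thesis
  proof (cases "y = out")
    case True
    have "dg V y \<noteq> 6" using deg6_adj[OF L_V[OF y]] out_L(2)[OF v_Par(1)] True by blast
    then show ?thesis using dg_L[OF y] deg_le6[OF L_V[OF y]] True by simp
  next
    case False
    then show ?thesis using dg_L[OF y] deg_le6[OF L_V[OF y]] by simp
  qed
qed

lemma F_cases: "y \<in> F \<Longrightarrow> y \<in> W \<or> y = out"
  using dg_L[of y] deg6_adj[OF L_V, of y] by (auto simp: F_def W_def split: if_splits)

lemma C_notin: "y \<in> C \<Longrightarrow> y \<noteq> out \<and> y \<notin> W"
proof -
  assume y: "y \<in> C"
  then have L: "y \<in> L" and 3: "dg L y = 3" by (auto simp: C_def)
  have "y \<noteq> out" using dg_L[OF L] deg_ge4[OF L_V[OF L] not_v[OF L]] 3 by auto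
  moreover have "\<not> A v y" using dg_L[OF L] nb_v_deg[OF L_V[OF L]] 3 by (auto split: if_splits)
  ultimately show ?thesis by (simp add: W_def)
qed

text \<open>Deleting two adjacent vertices of degree three from \<open>L\<close> would leave 29
  edges on 16 vertices.\<close>

lemma C_ind: "c \<in> C \<Longrightarrow> c' \<in> C \<Longrightarrow> \<not> A c c'"
proof
  assume c: "c \<in> C" "c' \<in> C" "A c c'"
  have "c \<noteq> c'" using c(3) adj_neq by blast
  then show False using bound_del[OF bound16 fin(2), of "{c, c'}"] es_pair[OF c(3)] c card_L es_L by (simp add: C_def)
qed

lemma sum_nb_L: "(\<Sum>w\<in>nb L y. dg L w) + dg C y = 4 * dg L y + dg F y"
proof -
  have "(\<Sum>w\<in>nb L y. dg L w + (if w \<in> C then 1 else 0)) = (\<Sum>w\<in>nb L y. 4 + (if w \<in> F then 1 else 0))"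
  proof (intro sum.cong refl)
    fix w assume "w \<in> nb L y"
    then have "w \<in> L" by simp
    then show "dg L w + (if w \<in> C then 1 else 0) = 4 + (if w \<in> F then 1 else 0)"
      using dg_L_ge[of w] dg_L_le[of w] by (auto simp: C_def F_def)
  qed
  moreover have "nb L y \<inter> C = nb C y" "nb L y \<inter> F = nb F y" using CF_L by auto
  ultimately show ?thesis using fin by (simp add: sum.distrib dg_def sum.If_cases)
qed

text \<open>Inside \<open>L\<close> degrees are three, four or five, so neighbours in
  \<open>C\<close> make room for far vertices and neighbours in \<open>F\<close> take it away. A
  vertex of degree four without neighbours in \<open>F\<close> has one far vertex more than
  neighbours in \<open>C\<close>.\<close>

lemma far_L: "y \<in> L \<Longrightarrow> 4 * dg L y + dg F y + card (far L y) = 17 + dg C y"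
  using nb_sum[OF fin(2), of y] sum_nb_L[of y] card_L by linarith

lemma card_C: "card C = 4 + card F"
proof -
  have "(\<Sum>w\<in>L. dg L w + (if w \<in> C then 1 else 0)) = (\<Sum>w\<in>L. 4 + (if w \<in> F then 1 else 0))"
  proof (intro sum.cong refl)
    fix w assume "w \<in> L"
    then show "dg L w + (if w \<in> C then 1 else 0) = 4 + (if w \<in> F then 1 else 0)"
      using dg_L_ge[of w] dg_L_le[of w] by (auto simp: C_def F_def)
  qed
  moreover have "L \<inter> C = C" "L \<inter> F = F" using CF_L by auto
  ultimately show ?thesis using fin es_L card_L by (simp add: sum.distrib es_def[of L] sum.If_cases)
qed

text \<open>Row mates are not adjacent, and their only common neighbour is the parent, which lies
  outside \<open>L\<close>.\<close>

lemma RM_far: "RM y \<subseteq> far L y"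
proof
  fix z assume "z \<in> RM y"
  then obtain b where b: "z \<in> L" "z \<noteq> y" "b \<in> Par" "A b y" "A b z" by (auto simp: RM_def)
  have "\<not> A y z" using nbs_nonadj b(4,5) by blast
  moreover have "\<not> (A y u \<and> A u z)" if "u \<in> L" for u
    using nbs_meet[of b y z u] b adj_sym[of u z] that L_not(3)[of u] by auto
  ultimately show "z \<in> far L y" using b by (auto simp: far_def)
qed

lemma RM_eq: "b \<in> Par \<Longrightarrow> A b y \<Longrightarrow> y \<in> L \<Longrightarrow> RM y = nb L b - {y}"
proof -
  assume b: "b \<in> Par" "A b y" "y \<in> L"
  have "(\<exists>b'\<in>Par. A b' y \<and> A b' z) \<longleftrightarrow> A b z" for z
    using b parent_unique[OF b(1) _ b(2) _ b(3)] by blast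
  then show ?thesis by (auto simp: RM_def)
qed

lemma RM_sym: "z \<in> RM y \<Longrightarrow> y \<in> L \<Longrightarrow> y \<in> RM z"
  by (auto simp: RM_def)

lemma row_card: "b \<in> Par \<Longrightarrow> card (nb L b) + 1 = dg V b"
proof -
  assume b: "b \<in> Par"
  have "nb V b = insert x (nb L b)" using b Par_ind[OF b] x_in adj_sym by (auto simp: L_def Par_def)
  moreover have "x \<notin> nb L b" using L_not by auto
  ultimately show ?thesis using fin by (simp add: dg_def)
qed

lemma W_RM: "w \<in> W \<Longrightarrow> RM w = W - {w}"
  using RM_eq[OF v_Par(1)] by (auto simp: W_def)

lemma card_W: "card W = 2"
  using row_card[OF v_Par(1)] dg_v by (simp add: W_def)

lemma row_RM: "y \<in> L \<Longrightarrow> y \<noteq> out \<Longrightarrow> y \<notin> W \<Longrightarrow> card (RM y) = 2"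
proof -
  assume y: "y \<in> L" "y \<noteq> out" "y \<notin> W"
  obtain b where b: "b \<in> Par" "A b y" using parent[OF y(1,2)] by blast
  have "b \<noteq> v" using b y by (auto simp: W_def)
  then have "card (nb L b) = 3" using row_card[OF b(1)] Par_deg[OF b(1)] by simp
  then show ?thesis using RM_eq[OF b y(1)] b y fin by simp
qed

lemma RM_disjoint_W: "y \<in> L \<Longrightarrow> y \<notin> W \<Longrightarrow> RM y \<inter> W = {}"
proof -
  assume y: "y \<in> L" "y \<notin> W"
  have False if z: "z \<in> L" "b \<in> Par" "A b y" "A b z" "A v z" for z b
  proof -
    have "v = b" by (rule parent_unique[OF v_Par(1) z(2,5,4,1)])
    then have "A v y" using z(3) by simp
    then show False using y unfolding W_def by simp
  qed
  then show ?thesis unfolding RM_def W_def nb_def by blast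
qed

lemma out_RM: "out \<notin> RM y"
  using out_L(2) by (auto simp: RM_def)

lemma RM_nb_le1: "y \<in> L \<Longrightarrow> u \<in> L \<Longrightarrow> dg (RM y) u \<le> 1"
proof (cases "\<exists>b\<in>Par. A b y")
  case True
  assume y: "y \<in> L" and u: "u \<in> L"
  obtain b where b: "b \<in> Par" "A b y" using True by blast
  have "A b z" if "z \<in> RM y" for z using that RM_eq[OF b y] by simp
  moreover have "u \<noteq> b" using u L_not(3) b by auto
  ultimately show ?thesis using dg_le_1_common[of "RM y" b u] fin(6) by blast
next
  case False
  then have "RM y = {}" by (auto simp: RM_def)
  then show ?thesis by simp
qed

text \<open>The ordinary vertices: degree four in \<open>L\<close> and exactly two row
  mates.\<close>

definition "Yr = L - C - W - {out}"

lemma Yr_facts: "y \<in> Yr \<Longrightarrow> y \<in> L \<and> dg L y = 4 \<and> card (RM y) = 2 \<and> y \<notin> C \<and> y \<notin> W \<and> y \<noteq> out"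
  using dg_L_ge[of y] dg_L_le[of y] F_cases[of y] row_RM[of y] by (fastforce simp: Yr_def C_def F_def)

lemma fin_Yr: "finite Yr"
  using fin by (simp add: Yr_def)

lemma out_W: "out \<notin> W"
  using out_L(2)[OF v_Par(1)] by (simp add: W_def)

lemma Yr_disjoint: "Yr \<inter> (C \<union> (W \<union> {out})) = {}" "C \<inter> (W \<union> {out}) = {}" "W \<inter> {out} = {}"
  using C_notin out_W by (auto simp: Yr_def)

lemma card_Yr: "card Yr + card F = 11"
proof -
  have "L = Yr \<union> (C \<union> (W \<union> {out}))" using CF_L out_L by (auto simp: Yr_def)
  moreover have "card (Yr \<union> (C \<union> (W \<union> {out}))) = card Yr + (card C + (card W + 1))"
    using fin fin_Yr card_Un_disjoint[OF _ _ Yr_disjoint(1)] card_Un_disjoint[OF _ _ Yr_disjoint(2)]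
      card_Un_disjoint[OF _ _ Yr_disjoint(3)] by simp
  ultimately show ?thesis using card_L card_C card_W by simp
qed

lemma sum_dg_C: "3 * card C = (\<Sum>y\<in>Yr. dg C y) + (\<Sum>w\<in>W. dg C w) + dg C out"
proof -
  have "(\<Sum>c\<in>C. dg L c) = (\<Sum>y\<in>L. dg C y)" using cross_count fin by blast
  also have "\<dots> = (\<Sum>y\<in>Yr \<union> (C \<union> (W \<union> {out})). dg C y)"
    using CF_L out_L by (intro sum.cong) (auto simp: Yr_def)
  also have "\<dots> = (\<Sum>y\<in>Yr. dg C y) + ((\<Sum>y\<in>C. dg C y) + ((\<Sum>w\<in>W. dg C w) + dg C out))"
    using fin fin_Yr sum.union_disjoint[OF _ _ Yr_disjoint(1), of "dg C"]
      sum.union_disjoint[OF _ _ Yr_disjoint(2), of "dg C"] sum.union_disjoint[OF _ _ Yr_disjoint(3), of "dg C"] by simp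
  also have "(\<Sum>y\<in>C. dg C y) = 0" using C_ind dg_eq_0[OF fin(3)] by (intro sum.neutral) blast
  finally show ?thesis by (simp add: C_def)
qed

text \<open>Two row mates are already far from \<open>y\<close>, and \<open>far_L\<close> charges
  every far vertex beyond the first to a neighbour in \<open>C\<close>.\<close>

lemma Yr_ge: "y \<in> Yr \<Longrightarrow> 1 + dg F y \<le> dg C y"
proof -
  assume y: "y \<in> Yr"
  have "2 \<le> card (far L y)" using card_mono[OF finite_far[OF fin(2), of y] RM_far[of y]] Yr_facts[OF y] by simp
  then show ?thesis using far_L[of y] Yr_facts[OF y] by simp
qed

lemma Yr_far: "y \<in> Yr \<Longrightarrow> dg C y = 1 + dg F y \<Longrightarrow> far L y = RM y"
proof -
  assume y: "y \<in> Yr" "dg C y = 1 + dg F y"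
  have "card (far L y) = 2" using far_L[of y] Yr_facts[OF y(1)] y(2) by simp
  then show ?thesis using card_subset_eq[OF finite_far[OF fin(2), of y] RM_far[of y]] Yr_facts[OF y(1)] by simp
qed

lemma W_far: "w \<in> W \<Longrightarrow> dg L w = 4 \<Longrightarrow> dg C w = dg F w \<Longrightarrow> far L w = W - {w}"
proof -
  assume w: "w \<in> W" "dg L w = 4" "dg C w = dg F w"
  have "card (far L w) = 1" using far_L[of w] w CF_L(3) by auto
  then show ?thesis
    using card_subset_eq[OF finite_far[OF fin(2), of w] RM_far[of w]] W_RM[OF w(1)] card_W w(1) fin by simp
qed

lemma W_cases: "\<exists>w1 w2. W = {w1, w2} \<and> w1 \<noteq> w2"
  using card_W by (auto simp: card_2_iff)

lemma W_F: "w \<in> W \<Longrightarrow> w \<in> F \<or> dg L w = 4"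
  using C_notin[of w] dg_L_ge[of w] dg_L_le[of w] CF_L(3) by (fastforce simp: C_def F_def)

text \<open>A member of \<open>W\<close> with degree five in \<open>L\<close> has degree six in the
  whole graph, so \<open>six\<close> applies to its neighbours.\<close>

lemma W6: "w \<in> W \<Longrightarrow> w \<in> F \<Longrightarrow> nb L w \<subseteq> C \<union> ({out} - F)"
proof
  fix z assume w: "w \<in> W" "w \<in> F" and z: "z \<in> nb L w"
  have "dg V w = 6" using dg_L[of w] w out_W by (auto simp: F_def)
  then have 4: "dg V z = 4" using six[of w z] w z L_V not_v by (auto simp: F_def)
  show "z \<in> C \<union> ({out} - F)"
  proof (cases "z = out")
    case True
    then show ?thesis using dg_L[of z] 4 z by (auto simp: F_def)
  next
    case False
    then show ?thesis using dg_L[of z] 4 z by (auto simp: C_def)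
  qed
qed

lemma W_adj: "w1 \<in> W \<Longrightarrow> w2 \<in> W \<Longrightarrow> w1 \<noteq> w2 \<Longrightarrow> A w1 z \<Longrightarrow> A w2 z \<Longrightarrow> z \<in> L \<Longrightarrow> False"
  using nbs_meet[of v w1 w2 z] not_v by (auto simp: W_def)

lemma W_nonadj: "w1 \<in> W \<Longrightarrow> w2 \<in> W \<Longrightarrow> \<not> A w1 w2"
  using nbs_nonadj[of v w1 w2] by (auto simp: W_def)

lemma F_bound: "card F \<le> 3"
proof -
  have "F \<subseteq> insert out W" using F_cases by auto
  then show ?thesis using card_mono[of "insert out W" F] fin card_W out_W by simp
qed

end

section \<open>Vertices of degree five inside \<open>L\<close>\<close>

context outlier
begin

lemma RM_trans: "a \<in> RM t \<Longrightarrow> b \<in> RM t \<Longrightarrow> a \<noteq> b \<Longrightarrow> t \<in> L \<Longrightarrow> b \<in> RM a"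
proof -
  assume a: "a \<in> RM t" "b \<in> RM t" "a \<noteq> b" "t \<in> L"
  obtain p where p: "p \<in> Par" "A p t" "A p a" "a \<in> L" using a(1) by (auto simp: RM_def)
  then show ?thesis using a RM_eq[OF p(1,2) a(4)] RM_eq[OF p(1,3,4)] by auto
qed

lemma RM_L: "z \<in> RM y \<Longrightarrow> z \<in> L \<and> z \<noteq> y \<and> z \<noteq> out"
  using out_RM by (auto simp: RM_def)

lemma rainbow: "A u y \<Longrightarrow> A u z \<Longrightarrow> u \<in> L \<Longrightarrow> z \<in> RM y \<Longrightarrow> False"
  using RM_far[of y] adj_sym[of u y] by (auto simp: far_def)

lemma far_out: "u \<in> far L out \<Longrightarrow> out \<in> far L u"
  using far_sym[OF _ out_L(1)] by blast

lemma W_other: "w \<in> W \<Longrightarrow> \<exists>w1. W = {w, w1} \<and> w1 \<noteq> w"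
proof -
  assume w: "w \<in> W"
  then have "card (W - {w}) = 1" using card_W fin by simp
  then obtain w1 where "W - {w} = {w1}" by (auto simp: card_1_singleton_iff)
  then show ?thesis using w by blast
qed

text \<open>The ten distinct neighbours of the two vertices of \<open>W\<close> do not fit into
  \<open>C\<close> and \<open>out\<close>, at most seven vertices altogether.\<close>

lemma both_six: "\<not> W \<subseteq> F"
proof
  assume WF: "W \<subseteq> F"
  obtain w1 w2 where w: "W = {w1, w2}" "w1 \<noteq> w2" using W_cases by blast
  have "w1 \<in> W" "w2 \<in> W" using w by simp_all
  then have d: "nb L w1 \<inter> nb L w2 = {}" using W_adj[OF _ _ w(2)] unfolding nb_def by blast
  have "card (nb L w1 \<union> nb L w2) = 10"
    using d fin WF w by (subst card_Un_disjoint) (auto simp: F_def dg_def)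
  moreover have "nb L w1 \<union> nb L w2 \<subseteq> C \<union> ({out} - F)" using W6 WF w by auto
  ultimately have "10 \<le> card (C \<union> ({out} - F))" using fin card_mono[of "C \<union> ({out} - F)"] by (metis finite.emptyI finite_Diff finite_UnI finite_insert)
  also have "\<dots> \<le> card C + card ({out} - F)" by (rule card_Un_le)
  finally have 1: "10 \<le> card C + card ({out} - F)" .
  show False
  proof (cases "out \<in> F")
    case True
    then show False using 1 card_C F_bound by simp
  next
    case False
    then have "F \<subseteq> W" using F_cases by blast
    then have "card F \<le> 2" using card_mono[OF fin(5)] card_W by metis
    moreover have "card ({out} - F) \<le> 1" using card_mono[of "{out}" "{out} - F"] by auto
    ultimately show False using 1 card_C by linarith
  qed
qed

lemma far_RM: "card (far L y - RM y) = card (far L y) - card (RM y)"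
  using RM_far fin by (simp add: card_Diff_subset)

text \<open>By \<open>far_L\<close> the vertex \<open>out\<close> needs three neighbours in
  \<open>C\<close>. Five of the six vertices of \<open>C\<close> are adjacent to \<open>w\<close>,
  and of those it can take only one.\<close>

lemma one_six_out:
  assumes "w \<in> W" "w \<in> F" "(W - {w}) \<inter> F = {}" "out \<in> F"
  shows False
proof -
  have F: "F = {w, out}" using assms F_cases by auto
  have wo: "w \<noteq> out" using assms(1) out_W by auto
  have cC: "card C = 6" using card_C F wo by simp
  have sub: "nb L w \<subseteq> C" using W6[OF assms(1,2)] assms(4) by auto
  then have eq: "nb C w = nb L w" using CF_L(1) by auto
  then have c5: "card (nb C w) = 5" using assms(2) by (simp add: F_def dg_def)
  have "dg L out = 5" using assms(4) by (simp add: F_def)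
  then have "3 \<le> dg C out" using far_L[OF out_L(1)] by simp
  moreover have "dg C out = dg (nb C w) out + dg (C - nb C w) out" by (rule dg_split[OF fin(3)]) auto
  moreover have "dg (nb C w) out \<le> 1" using fin wo by (intro dg_le_1_common[of _ w]) auto
  moreover have "dg (C - nb C w) out \<le> card (C - nb C w)" using fin by (intro dg_le) auto
  moreover have "card (C - nb C w) = 1" using fin cC c5 nb_subset[of C w] by (simp add: card_Diff_subset)
  ultimately show False by linarith
qed

text \<open>The 15 edges at \<open>C\<close> are weighed against the demand for far vertices. If
  \<open>w\<close> is not adjacent to \<open>out\<close>, then \<open>w\<close> takes all of
  \<open>C\<close>, the other counts are minimal, and all of \<open>C\<close> is far from
  \<open>out\<close>, where one far vertex is allowed. Otherwise four neighbours of \<open>w\<close>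
  in \<open>C\<close> each need a far vertex in \<open>B\<close> beyond row mates, and only one is
  available.\<close>

lemma one_six:
  assumes w: "w \<in> W" "w \<in> F" "(W - {w}) \<inter> F = {}" "out \<notin> F"
  shows False
proof -
  have F: "F = {w}" using w F_cases by auto
  obtain w1 where w1: "W = {w, w1}" "w1 \<noteq> w" using W_other[OF w(1)] by blast
  have cC: "card C = 5" using card_C F by simp
  have cY: "card Yr = 10" using card_Yr F by simp
  have sub: "nb L w \<subseteq> C \<union> {out}" using W6[OF w(1,2)] by auto
  have c5: "card (nb L w) = 5" using w(2) by (simp add: F_def dg_def)
  have dF: "dg F y = (if A y w then 1 else 0)" for y unfolding F by (simp add: dg_insert)
  have YF: "dg F y = 0" if "y \<in> Yr" for y
  proof -
    have "\<not> A y w" using that sub Yr_facts[OF that] adj_sym[of y w] by auto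
    then show ?thesis by (simp add: dF)
  qed
  have w1F: "dg F w1 = 0" using W_nonadj[of w1 w] w1 by (simp add: dF)
  have dw1: "dg L w1 = 4" using W_F[of w1] w w1 by auto
  have do4: "dg L out = 4" using w(4) dg_L_le[OF out_L(1)] dg_L_ge[OF out_L(1)] C_notin[of out] out_L(1)
    by (fastforce simp: F_def C_def)
  have sum: "15 = (\<Sum>y\<in>Yr. dg C y) + dg C w1 + dg C w + dg C out" using sum_dg_C cC w1 by simp
  have Y1: "1 \<le> dg C y" if "y \<in> Yr" for y using Yr_ge[OF that] YF[OF that] by simp
  have ex: "card (far L y - RM y) + 1 = dg C y" if "y \<in> Yr" for y
    using far_L[of y] Yr_facts[OF that] YF[OF that] far_RM[of y] Y1[OF that] by simp
  have exw: "card (far L w1 - RM w1) = dg C w1"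
  proof -
    have "RM w1 = {w}" using W_RM[of w1] w1 by auto
    then show ?thesis using far_L[of w1] w1 CF_L(3) dw1 w1F far_RM[of w1] by simp
  qed
  define C4 where "C4 = nb C w"
  have fC4: "finite C4" using fin by (simp add: C4_def)
  have far4: "card (far L c) = 4" if "c \<in> C4" for c
  proof -
    have "c \<in> C" "A c w" using that adj_sym by (auto simp: C4_def)
    moreover from this have "dg C c = 0" using C_ind dg_eq_0[OF fin(3)] by blast
    ultimately show ?thesis using far_L[of c] dF[of c] by (simp add: C_def)
  qed
  have RM2: "card (RM c) = 2" if "c \<in> C" for c using row_RM[of c] C_notin[OF that] CF_L(1) that by blast
  have near: "u \<notin> far L c" if "c \<in> C4" "A w u" for u c
    using that w(1) CF_L(3) adj_sym[of w c] by (auto simp: far_def C4_def)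
  have type: "u \<in> RM c \<or> u = w1 \<or> u \<in> Yr \<or> u = out \<or> u \<in> C - C4" if "c \<in> C4" "u \<in> far L c" for u c
  proof -
    have "u \<in> L" "u \<noteq> w" using that adj_sym[of w c] by (auto simp: far_def C4_def)
    moreover have "\<not> A w u" using near that by blast
    ultimately show ?thesis using w1 by (auto simp: Yr_def C4_def)
  qed
  show False
  proof (cases "A w out")
    case False
    then have "nb L w \<subseteq> C" using sub by auto
    then have eq: "nb L w = C" using c5 cC fin by (intro card_subset_eq) auto
    then have C4: "C4 = C" using CF_L(1) by (auto simp: C4_def)
    have "dg C w = 5" using C4 cC by (simp add: C4_def dg_def)
    moreover have "(\<Sum>y\<in>Yr. 1) \<le> (\<Sum>y\<in>Yr. dg C y)" using Y1 by (rule sum_mono)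
    ultimately have e: "(\<Sum>y\<in>Yr. 1) = (\<Sum>y\<in>Yr. dg C y)" "dg C w1 = 0" "dg C out = 0" using sum cY by simp_all
    have one: "dg C y = 1" if "y \<in> Yr" for y using sum_mono_inv[OF e(1) Y1 that fin_Yr] by simp
    have "out \<in> far L c" if c: "c \<in> C" for c
    proof (rule ccontr)
      assume n: "out \<notin> far L c"
      have "far L c \<subseteq> RM c \<union> {w1}"
      proof
        fix u assume u: "u \<in> far L c"
        have "u \<in> RM c" if "u \<in> Yr"
        proof -
          have "c \<in> far L u" using far_sym[OF u] c CF_L(1) by blast
          then have "c \<in> RM u" using Yr_far[OF that] one[OF that] YF[OF that] by simp
          then show ?thesis using RM_sym Yr_facts[OF that] by blast
        qed
        then show "u \<in> RM c \<union> {w1}" using type[of c u] C4 c u n by auto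
      qed
      then have "card (far L c) \<le> card (RM c \<union> {w1})" using fin by (intro card_mono) auto
      also have "\<dots> \<le> card (RM c) + card {w1}" by (rule card_Un_le)
      finally show False using far4[of c] C4 c RM2[OF c] by simp
    qed
    then have "C \<subseteq> far L out" using far_sym CF_L(1) by blast
    then have "5 \<le> card (far L out)" using card_mono[of "far L out" C] fin cC by simp
    then show False using far_L[OF out_L(1)] do4 e(3) by simp
  next
    case True
    have "nb L w = insert out C4" using sub True out_L(1) CF_L(1) by (auto simp: C4_def)
    moreover have "out \<notin> C4" using C_notin by (auto simp: C4_def)
    ultimately have c4: "card C4 = 4" using c5 fC4 by simp
    have dw: "dg C w = 4" using c4 by (simp add: C4_def dg_def)
    have one5: "card (C - C4) = 1" using cC c4 fC4 by (subst card_Diff_subset) (auto simp: C4_def)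
    define B where "B = insert w1 Yr"
    have fB: "finite B" using fin_Yr by (simp add: B_def)
    have w1Y: "w1 \<notin> Yr" using w1 by (auto simp: Yr_def)
    \<comment> \<open>Of the four vertices far from \<open>c\<close> two are row mates and one may
      be the fifth vertex of \<open>C\<close>; \<open>out\<close> is excluded, since
      \<open>w\<close> is a common neighbour.\<close>
    have le: "1 \<le> card ((far L c - RM c) \<inter> B)" if c: "c \<in> C4" for c
    proof -
      have cC': "c \<in> C" using c by (simp add: C4_def)
      have "far L c \<subseteq> (RM c \<union> (C - C4)) \<union> ((far L c - RM c) \<inter> B)"
        using type[OF c] near[OF c True] by (auto simp: B_def)
      then have "card (far L c) \<le> card ((RM c \<union> (C - C4)) \<union> ((far L c - RM c) \<inter> B))"
        using fin fB by (intro card_mono) auto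
      also have "\<dots> \<le> card (RM c) + card (C - C4) + card ((far L c - RM c) \<inter> B)"
        by (meson add_le_mono1 card_Un_le le_trans)
      finally show ?thesis using far4[OF c] RM2[OF cC'] one5 by simp
    qed
    have "(\<Sum>c\<in>C4. 1) \<le> (\<Sum>c\<in>C4. card ((far L c - RM c) \<inter> B))" using le by (rule sum_mono)
    also have "\<dots> = (\<Sum>c\<in>C4. \<Sum>u\<in>B. if u \<in> far L c - RM c then 1 else 0)"
    proof -
      have "card (S \<inter> B) = (\<Sum>u\<in>B. if u \<in> S then 1 else 0)" for S
        using fB by (simp add: sum.If_cases Int_commute)
      then show ?thesis by (simp only:)
    qed
    also have "\<dots> = (\<Sum>u\<in>B. \<Sum>c\<in>C4. if u \<in> far L c - RM c then 1 else 0)" by (rule sum.swap)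
    also have "\<dots> \<le> (\<Sum>u\<in>B. card (far L u - RM u))"
    proof (rule sum_mono)
      fix u assume u: "u \<in> B"
      then have uL: "u \<in> L" using Yr_facts w1 CF_L(3) by (auto simp: B_def)
      have "(\<Sum>c\<in>C4. if u \<in> far L c - RM c then 1 else 0) = card {c \<in> C4. u \<in> far L c - RM c}"
        using fC4 by (simp add: sum.If_cases Int_def)
      also have "\<dots> \<le> card (far L u - RM u)"
      proof (rule card_mono)
        show "{c \<in> C4. u \<in> far L c - RM c} \<subseteq> far L u - RM u"
        proof
          fix c assume c: "c \<in> {c \<in> C4. u \<in> far L c - RM c}"
          then have "c \<in> L" using CF_L(1) by (auto simp: C4_def)
          then show "c \<in> far L u - RM u" using c far_sym[of u L c] RM_sym[of c u] uL by auto
        qed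
      qed (use fin in auto)
      finally show "(\<Sum>c\<in>C4. if u \<in> far L c - RM c then 1 else 0) \<le> card (far L u - RM u)" .
    qed
    also have "\<dots> = dg C w1 + (\<Sum>u\<in>Yr. card (far L u - RM u))"
      unfolding B_def using fin_Yr w1Y exw by simp
    finally have 4: "4 \<le> dg C w1 + (\<Sum>u\<in>Yr. card (far L u - RM u))" using c4 by simp
    have "(\<Sum>u\<in>Yr. card (far L u - RM u) + 1) = (\<Sum>u\<in>Yr. dg C u)" using ex by (intro sum.cong) auto
    then have "(\<Sum>u\<in>Yr. card (far L u - RM u)) + 10 = (\<Sum>u\<in>Yr. dg C u)" using cY by (simp only: sum.distrib) simp
    then show False using sum dw 4 by linarith
  qed
qed

lemma row_witness_card:
  assumes "\<And>b. b \<in> Par \<Longrightarrow> \<exists>z\<in>nb L b. A u z"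
  shows "6 \<le> dg L u"
proof -
  obtain f where f: "\<And>b. b \<in> Par \<Longrightarrow> f b \<in> nb L b \<and> A u (f b)" using assms by metis
  have "inj_on f Par"
  proof (rule inj_onI)
    fix b b' assume b: "b \<in> Par" "b' \<in> Par" "f b = f b'"
    then show "b = b'" using parent_unique[of b b' "f b"] f[of b] f[of b'] by simp
  qed
  then have "card (f ` Par) = 6" using card_Par card_image by metis
  moreover have "f ` Par \<subseteq> nb L u" using f by auto
  ultimately show ?thesis using card_mono[of "nb L u" "f ` Par"] fin by (simp add: dg_def)
qed

text \<open>The edges at \<open>C\<close> meet their demands exactly, so far sets in
  \<open>Yr\<close> and \<open>W\<close> consist of row mates only. As \<open>out\<close> has degree
  five, \<open>far_exchange\<close> with a vertex of degree four yields a neighbour of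
  \<open>out\<close> in the row of that vertex. Six rows would then give \<open>out\<close> degree
  six.\<close>

lemma no_six_out:
  assumes "W \<inter> F = {}" "out \<in> F"
  shows False
proof -
  have F: "F = {out}" using assms F_cases by auto
  have cC: "card C = 5" using card_C F by simp
  have cY: "card Yr = 10" using card_Yr F by simp
  have dF: "dg F y = dg {out} y" for y unfolding F by simp
  have do5: "dg L out = 5" using assms(2) by (simp add: F_def)
  have k3: "3 \<le> dg C out" using far_L[OF out_L(1)] do5 by simp
  have dW4: "dg L w = 4" if "w \<in> W" for w using W_F[OF that] assms(1) that by auto
  have W1: "dg F w \<le> dg C w" if "w \<in> W" for w
  proof -
    have "card (RM w) = 1" using W_RM[OF that] card_W that fin by simp
    then have "1 \<le> card (far L w)" using card_mono[OF finite_far[OF fin(2), of w] RM_far[of w]] by simp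
    then show ?thesis using far_L[of w] dW4[OF that] that CF_L(3) by auto
  qed
  have parts: "dg L out = dg Yr out + dg C out + dg W out"
  proof -
    have "nb L out = nb (Yr \<union> (C \<union> W)) out" using CF_L adj_irrefl by (auto simp: Yr_def)
    then have "dg L out = dg (Yr \<union> (C \<union> W)) out" by (simp add: dg_def)
    also have "\<dots> = dg Yr out + (dg C out + dg W out)"
      using Yr_disjoint fin fin_Yr by (subst dg_Un, simp, simp, blast, subst dg_Un) auto
    finally show ?thesis by simp
  qed
  have cr1: "(\<Sum>y\<in>Yr. dg F y) = dg Yr out" and cr2: "(\<Sum>y\<in>W. dg F y) = dg W out"
    unfolding dF using cross_count[OF fin_Yr, of "{out}"] cross_count[OF fin(5), of "{out}"] by simp_all
  have le1: "(\<Sum>y\<in>Yr. 1 + dg F y) \<le> (\<Sum>y\<in>Yr. dg C y)" using Yr_ge by (rule sum_mono)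
  have le2: "(\<Sum>w\<in>W. dg F w) \<le> (\<Sum>w\<in>W. dg C w)" using W1 by (rule sum_mono)
  have s1: "(\<Sum>y\<in>Yr. 1 + dg F y) = 10 + dg Yr out" using cY cr1 by (simp only: sum.distrib) simp
  have e1: "(\<Sum>y\<in>Yr. 1 + dg F y) = (\<Sum>y\<in>Yr. dg C y)" using le1 le2 s1 cr2 parts do5 sum_dg_C cC by linarith
  have e2: "(\<Sum>w\<in>W. dg F w) = (\<Sum>w\<in>W. dg C w)" using le1 le2 s1 cr2 parts do5 sum_dg_C cC by linarith
  have Yf: "far L y = RM y" if "y \<in> Yr" for y
    using Yr_far[OF that] sum_mono_inv[OF e1 Yr_ge that fin_Yr] by simp
  have Wf: "far L w = W - {w}" if "w \<in> W" for w
    using W_far[OF that dW4[OF that]] sum_mono_inv[OF e2 W1 that fin(5)] by simp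
  have ex: "\<exists>z\<in>far L y. A out z" if "y \<in> L" "y \<noteq> out" "\<not> A out y" "dg L y = 4" for y
  proof -
    have "5 + card (nb L y \<inter> far L out) = 4 + card (nb L out \<inter> far L y)"
      using far_exchange[OF fin(2) out_L(1) that(1) that(2)[symmetric] that(3)] do5 that(4) by simp
    then have "nb L out \<inter> far L y \<noteq> {}" by auto
    then show ?thesis by auto
  qed
  have "\<exists>z\<in>nb L b. A out z" if b: "b \<in> Par" for b
  proof (cases "b = v")
    case True
    obtain w where w: "w \<in> W" using card_W by (metis card.empty ex_in_conv zero_neq_numeral)
    show ?thesis
    proof (cases "A out w")
      case True
      then show ?thesis using w \<open>b = v\<close> by (auto simp: W_def)
    next
      case False
      then have "\<exists>z\<in>W - {w}. A out z" using ex[of w] Wf[OF w] dW4[OF w] w out_W CF_L(3) by auto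
      then show ?thesis using \<open>b = v\<close> by (auto simp: W_def)
    qed
  next
    case False
    show ?thesis
    proof (rule ccontr)
      assume n: "\<not> ?thesis"
      have nW: "z \<notin> W" if "z \<in> nb L b" for z
        using parent_unique[OF v_Par(1) b, of z] that False by (auto simp: W_def)
      have noY: "z \<notin> Yr" if z: "z \<in> nb L b" for z
      proof
        assume y: "z \<in> Yr"
        then have "\<exists>u\<in>RM z. A out u" using ex[of z] Yr_facts[OF y] Yf[OF y] n z by auto
        then show False using RM_eq[OF b, of z] z n by auto
      qed
      \<comment> \<open>A row without a neighbour of \<open>out\<close> consists of three vertices
        of \<open>C\<close>; that leaves \<open>out\<close> only two neighbours in \<open>C\<close>,
        but it has three.\<close>
      have "nb L b \<subseteq> C"
      proof
        fix z assume z: "z \<in> nb L b"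
        have "z \<noteq> out" using z out_L(2)[OF b] by auto
        then show "z \<in> C" using nW[OF z] noY[OF z] z by (auto simp: Yr_def)
      qed
      moreover have "card (nb L b) = 3" using row_card[OF b] Par_deg[OF b False] by simp
      moreover have "nb C out \<subseteq> C - nb L b" using n by auto
      ultimately have "dg C out \<le> 5 - 3"
        unfolding dg_def using card_mono[of "C - nb L b" "nb C out"] fin cC card_Diff_subset[of "nb L b" C] by simp
      then show False using k3 by simp
    qed
  qed
  then show False using row_witness_card[of out] do5 by simp
qed

end

section \<open>All degrees inside \<open>L\<close> at most four\<close>

locale outlier4 = outlier +
  assumes WF: "W \<inter> F = {}" and out4: "out \<notin> F"
begin

lemma F0: "F = {}"
  using F_cases WF out4 by blast

lemma card_C4: "card C = 4" and card_Yr11: "card Yr = 11"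
  using card_C card_Yr F0 by simp_all

lemma dgF: "dg F y = 0"
  by (simp add: F0)

lemma dg4: "y \<in> L \<Longrightarrow> y \<notin> C \<Longrightarrow> dg L y = 4"
  using dg_L_ge[of y] dg_L_le[of y] F0 by (fastforce simp: C_def F_def)

lemma dgC3: "y \<in> C \<Longrightarrow> dg L y = 3" and dgCC: "y \<in> C \<Longrightarrow> dg C y = 0"
  using C_ind dg_eq_0[OF fin(3)] by (auto simp: C_def)

lemma far_non_C: "y \<in> L \<Longrightarrow> y \<notin> C \<Longrightarrow> card (far L y) = 1 + dg C y"
  using far_L[of y] dg4[of y] by (simp add: dgF)

lemma far_C: "c \<in> C \<Longrightarrow> card (far L c) = 5"
  using far_L[of c] dgC3[of c] dgCC[of c] CF_L(1) by (auto simp: dgF)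

text \<open>\<open>Yr\<close> takes at least eleven of these twelve edges, so one is to spare. It is
  shown to end neither in \<open>out\<close> nor in \<open>W\<close>, and then not in
  \<open>Yr\<close> either.\<close>

lemma sum12: "12 = (\<Sum>y\<in>Yr. dg C y) + (\<Sum>w\<in>W. dg C w) + dg C out"
  using sum_dg_C card_C4 by simp

lemma out_not_C: "out \<notin> C"
  using C_notin by blast

lemma W_not_C: "w \<in> W \<Longrightarrow> w \<notin> C"
  using C_notin by blast

lemma Yr1: "y \<in> Yr \<Longrightarrow> 1 \<le> dg C y"
  using Yr_ge[of y] by (simp add: dgF)

lemma Yr_tight: "y \<in> Yr \<Longrightarrow> dg C y = 1 \<Longrightarrow> far L y = RM y"
  using Yr_far[of y] by (simp add: dgF)

lemma W_tight: "w \<in> W \<Longrightarrow> dg C w = 0 \<Longrightarrow> far L w = W - {w}"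
  using W_far[of w] dg4[of w] W_not_C[of w] CF_L(3) dgF by auto

lemma L_cases: "y \<in> L \<Longrightarrow> y \<in> Yr \<or> y \<in> C \<or> y \<in> W \<or> y = out"
  by (auto simp: Yr_def)

lemma Yr_sum: "11 \<le> (\<Sum>y\<in>Yr. dg C y)"
proof -
  have "(\<Sum>y\<in>Yr. 1) \<le> (\<Sum>y\<in>Yr. dg C y)" using Yr1 by (rule sum_mono)
  then show ?thesis using card_Yr11 by simp
qed

lemma all_one: "(\<Sum>y\<in>Yr. dg C y) = 11 \<Longrightarrow> y \<in> Yr \<Longrightarrow> dg C y = 1"
  using sum_mono_inv[of "\<lambda>_. 1" Yr "dg C" y] Yr1 fin_Yr card_Yr11 by simp

lemma exchange: "u \<in> L \<Longrightarrow> w \<in> L \<Longrightarrow> u \<noteq> w \<Longrightarrow> \<not> A u w \<Longrightarrow>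
    dg L u + card (nb L w \<inter> far L u) = dg L w + card (nb L u \<inter> far L w)"
  using far_exchange[OF fin(2)] .

text \<open>The vertex \<open>u\<close> is joined to every vertex of \<open>C\<close> by at most one path of length two.\<close>

lemma reach:
  assumes "u \<in> L" "u \<notin> C"
  shows "(\<Sum>y\<in>nb L u. dg C y) \<le> 4"
    and "(\<Sum>y\<in>nb L u. dg C y) = 4 \<Longrightarrow> c \<in> C \<Longrightarrow> c \<notin> far L u"
    and "nb C u = {} \<Longrightarrow> far L u \<inter> C = {} \<Longrightarrow> (\<Sum>y\<in>nb L u. dg C y) = 4"
proof -
  have cr: "(\<Sum>y\<in>nb L u. dg C y) = (\<Sum>c\<in>C. dg (nb L u) c)" using cross_count fin by (meson finite_nb)
  have le: "dg (nb L u) c \<le> 1" if "c \<in> C" for c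
    using that assms(2) fin by (intro dg_le_1_common[of _ u]) auto
  show "(\<Sum>y\<in>nb L u. dg C y) \<le> 4"
    using sum_bounded_above[of C "dg (nb L u)" 1] le cr card_C4 by simp
  show "c \<notin> far L u" if "(\<Sum>y\<in>nb L u. dg C y) = 4" "c \<in> C"
  proof -
    have "dg (nb L u) c = 1"
      using sum_mono_inv[of "dg (nb L u)" C "\<lambda>_. 1" c] le cr card_C4 that fin by simp
    then have "0 < dg (nb L u) c" by simp
    then obtain y where "y \<in> L" "A u y" "A c y" using dg_pos[of "nb L u" c] fin by auto
    then show ?thesis using adj_sym[of c y] by (auto simp: far_def)
  qed
  show "(\<Sum>y\<in>nb L u. dg C y) = 4" if n: "nb C u = {}" "far L u \<inter> C = {}"
  proof -
    have "dg (nb L u) c = 1" if c: "c \<in> C" for c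
    proof -
      have "c \<in> L" "c \<noteq> u" "\<not> A u c" "c \<notin> far L u" using c n assms CF_L(1) by auto
      then obtain y where "y \<in> L" "A u y" "A y c" by (auto simp: far_def)
      then have "0 < dg (nb L u) c" using dg_pos[of "nb L u" c] fin adj_sym[of y c] by auto
      then show ?thesis using le[OF c] by simp
    qed
    then show ?thesis using cr card_C4 by simp
  qed
qed

text \<open>With the spare edge at \<open>out\<close>, the other far sets are minimal and both
  vertices far from \<open>out\<close> lie in \<open>C\<close>. At least two neighbours of
  \<open>out\<close> in \<open>Yr\<close> lead to two more vertices of \<open>C\<close>, and
  \<open>c1\<close> is a fifth; but \<open>C\<close> has four.\<close>

lemma out_no_C: "dg C out = 0"
proof (rule ccontr)
  assume "dg C out \<noteq> 0"
  then have "1 \<le> dg C out" by simp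
  have k1: "dg C out = 1" using \<open>1 \<le> dg C out\<close> sum12 Yr_sum by linarith
  have k2: "(\<Sum>w\<in>W. dg C w) = 0" using \<open>1 \<le> dg C out\<close> sum12 Yr_sum by linarith
  have k3: "(\<Sum>y\<in>Yr. dg C y) = 11" using \<open>1 \<le> dg C out\<close> sum12 Yr_sum by linarith
  note k = k1 k2 k3
  have one: "dg C y = 1" if "y \<in> Yr" for y using all_one[OF k(3) that] .
  have W0: "dg C w = 0" if "w \<in> W" for w using k(2) that fin by simp
  have card2: "card (far L out) = 2" using far_non_C[OF out_L(1) out_not_C] k(1) by simp
  have farC: "far L out \<subseteq> C"
  proof
    fix u assume u: "u \<in> far L out"
    then have ou: "out \<in> far L u" by (rule far_out)
    have "u \<in> L" "u \<noteq> out" using u by (auto simp: far_def)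
    moreover have "u \<notin> Yr" using ou Yr_tight one out_RM by blast
    moreover have "u \<notin> W" using ou W_tight W0 out_W by blast
    ultimately show "u \<in> C" using L_cases by blast
  qed
  obtain c1 where c1: "nb C out = {c1}" using k(1) by (auto simp: dg_def card_1_singleton_iff)
  then have c1': "c1 \<in> C" "A out c1" using in_nb[of c1 C out] by auto
  define T where "T = nb Yr out"
  have fT: "finite T" using fin_Yr by (simp add: T_def)
  have "nb L out \<subseteq> T \<union> ({c1} \<union> nb W out)"
  proof
    fix z assume z: "z \<in> nb L out"
    then have "z \<noteq> out" using adj_irrefl by auto
    moreover have "z \<in> C \<Longrightarrow> z \<in> nb C out" using z by simp
    ultimately show "z \<in> T \<union> ({c1} \<union> nb W out)" using L_cases[of z] z c1 by (auto simp: T_def)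
  qed
  then have "card (nb L out) \<le> card (T \<union> ({c1} \<union> nb W out))" using fT fin by (intro card_mono) auto
  also have "\<dots> \<le> card T + (1 + card (nb W out))"
    using card_Un_le[of T "{c1} \<union> nb W out"] card_Un_le[of "{c1}" "nb W out"] by simp
  finally have "4 \<le> card T + (1 + dg W out)" using dg4[OF out_L(1) out_not_C] by (simp add: dg_def)
  moreover have "dg W out \<le> 1"
    using not_v[OF out_L(1)] fin by (intro dg_le_1_common[of _ v]) (auto simp: W_def)
  ultimately have T2: "2 \<le> card T" by linarith
  have "\<exists>c. nb C y = {c}" if "y \<in> T" for y
    using one[of y] that by (auto simp: T_def dg_def card_1_singleton_iff)
  then obtain g where g: "\<And>y. y \<in> T \<Longrightarrow> nb C y = {g y}" by metis
  have gC: "g y \<in> C \<and> A y (g y)" if "y \<in> T" for y using g[OF that] in_nb[of "g y" C y] by auto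
  have inj: "inj_on g T"
  proof (rule inj_onI)
    fix y z assume yz: "y \<in> T" "z \<in> T" "g y = g z"
    have "out \<noteq> g y" using gC[OF yz(1)] out_not_C by blast
    then show "y = z" using common_unique[of out y z "g y"] yz gC[of y] gC[of z] adj_sym by (auto simp: T_def)
  qed
  have "g ` T \<inter> far L out = {}" using gC Yr_facts by (fastforce simp: T_def far_def)
  moreover have "c1 \<notin> g ` T" using gC nbs_nonadj[OF c1'(2)] adj_sym by (fastforce simp: T_def)
  moreover have "c1 \<notin> far L out" using c1'(2) by (auto simp: far_def)
  ultimately have "card (insert c1 (g ` T \<union> far L out)) = Suc (card T + 2)"
    using fT fin card2 card_image[OF inj] by (simp add: card_Un_disjoint)
  moreover have "insert c1 (g ` T \<union> far L out) \<subseteq> C" using c1' gC farC by auto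
  ultimately show False using card_mono[OF fin(3)] T2 card_C4 by (metis Suc_eq_plus1 add_le_mono le_trans not_less_eq_eq numeral_Bit0 order_refl numeral_eq_Suc)
qed

lemma Yr_two:
  assumes "\<And>w. w \<in> W \<Longrightarrow> dg C w = 0"
  shows "\<exists>s\<in>Yr. dg C s = 2 \<and> (\<forall>y\<in>Yr - {s}. dg C y = 1)"
proof -
  have s: "(\<Sum>y\<in>Yr. dg C y) = 12" using sum12 assms out_no_C by simp
  have "\<exists>s\<in>Yr. dg C s \<noteq> 1"
  proof (rule ccontr)
    assume "\<not> ?thesis"
    then have "(\<Sum>y\<in>Yr. dg C y) = (\<Sum>y\<in>Yr. 1)" by (intro sum.cong) auto
    then show False using s card_Yr11 by simp
  qed
  then obtain s where s': "s \<in> Yr" "2 \<le> dg C s" using Yr1 by fastforce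
  have "(\<Sum>y\<in>Yr. dg C y) = dg C s + (\<Sum>y\<in>Yr - {s}. dg C y)" using s' fin_Yr by (simp add: sum.remove)
  moreover have "(\<Sum>y\<in>Yr - {s}. 1) \<le> (\<Sum>y\<in>Yr - {s}. dg C y)" using Yr1 by (intro sum_mono) auto
  moreover have c10: "(\<Sum>y\<in>Yr - {s}. 1 :: nat) = 10" using s' fin_Yr card_Yr11 by simp
  ultimately have d: "dg C s = 2" using s s'(2) by linarith
  have "(\<Sum>y\<in>Yr. dg C y) = dg C s + (\<Sum>y\<in>Yr - {s}. dg C y)" using s' fin_Yr by (simp add: sum.remove)
  then have e: "(\<Sum>y\<in>Yr - {s}. 1) = (\<Sum>y\<in>Yr - {s}. dg C y)" using c10 s d by linarith
  have "dg C y = 1" if "y \<in> Yr - {s}" for y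
    using sum_mono_inv[OF e _ that] Yr1 fin_Yr by fastforce
  then show ?thesis using s'(1) d by blast
qed

text \<open>Let the spare edge join \<open>w2\<close> to \<open>c\<close>. Exchange between
  \<open>c\<close> and \<open>w1\<close> makes \<open>w1\<close> adjacent to \<open>out\<close> and
  to a row mate of \<open>c\<close>; exchange between \<open>c\<close> and \<open>out\<close> makes
  \<open>out\<close> adjacent to a row mate as well. Counting the five vertices far from
  \<open>c\<close> puts the second row mate into \<open>C\<close>, so both times it is the same one,
  and a triangle arises.\<close>

lemma W_no_C: "w2 \<in> W \<Longrightarrow> dg C w2 = 0"
proof (rule ccontr)
  assume w2: "w2 \<in> W" "dg C w2 \<noteq> 0"
  obtain w1 where w1: "W = {w2, w1}" "w1 \<noteq> w2" using W_other[OF w2(1)] by blast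
  have k: "dg C w2 = 1" "dg C w1 = 0" "(\<Sum>y\<in>Yr. dg C y) = 11" using sum12 Yr_sum w1 w2(2) by (simp_all split: if_splits)
  have one: "dg C y = 1" if "y \<in> Yr" for y using all_one[OF k(3) that] .
  have w1L: "w1 \<in> W" "w1 \<in> L" "w2 \<in> L" using w1 CF_L(3) by auto
  have far1: "far L w1 = {w2}" using W_tight[OF w1L(1) k(2)] w1 by auto
  have w1C: "\<not> A w1 c" if "c \<in> C" for c using k(2) dg_eq_0[OF fin(3)] that by blast
  have oC: "\<not> A out c" if "c \<in> C" for c using out_no_C dg_eq_0[OF fin(3)] that by blast
  obtain c where "nb C w2 = {c}" using k(1) by (auto simp: dg_def card_1_singleton_iff)
  then have c: "c \<in> C" "A w2 c" using in_nb[of c C w2] by auto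
  have cL: "c \<in> L" "c \<noteq> w1" "c \<noteq> out" using c CF_L(1) C_notin[OF c(1)] w1L by auto
  have RMc: "card (RM c) = 2" using row_RM[OF cL(1,3)] C_notin[OF c(1)] by simp
  have kind: "z \<in> RM c \<or> z = out" if "z \<in> far L c" "z \<notin> C" for z
  proof -
    have zL: "z \<in> L" using that by (auto simp: far_def)
    have cz: "c \<in> far L z" using far_sym[OF that(1) cL(1)] .
    have "z \<in> RM c" if "z \<in> Yr" using Yr_tight[OF that one[OF that]] cz RM_sym zL by blast
    moreover have "z \<noteq> w2" using c(2) adj_sym that(1) by (auto simp: far_def)
    moreover have "z \<noteq> w1" using cz far1 w2(1) c(1) C_notin by auto
    ultimately show ?thesis using L_cases[OF zL] that(2) w1 by blast
  qed
  have e1: "card (nb L w1 \<inter> far L c) = 2"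
  proof -
    have "nb L c \<inter> far L w1 = {w2}" using far1 c(2) adj_sym w1L by auto
    then have "3 + card (nb L w1 \<inter> far L c) = 4 + 1"
      using exchange[OF cL(1) w1L(2) cL(2)] w1C[OF c(1)] adj_sym[of c w1] dgC3[OF c(1)] dg4[OF w1L(2)] W_not_C[OF w1L(1)] by auto
    then show ?thesis by simp
  qed
  have sub: "z \<in> nb (RM c) w1 \<union> {out}" if "z \<in> nb L w1 \<inter> far L c" for z
  proof -
    have "A w1 z" "z \<in> far L c" using that by auto
    then show ?thesis using kind[of z] w1C[of z] by auto
  qed
  have "dg (RM c) w1 \<le> 1" by (rule RM_nb_le1[OF cL(1) w1L(2)])
  then have cl: "card (nb (RM c) w1) \<le> 1" by (simp add: dg_def)
  have o: "A w1 out \<and> out \<in> far L c"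
  proof (rule ccontr)
    assume "\<not> ?thesis"
    then have "z \<in> nb (RM c) w1" if "z \<in> nb L w1 \<inter> far L c" for z using sub[OF that] that by auto
    then have "nb L w1 \<inter> far L c \<subseteq> nb (RM c) w1" by blast
    then show False using card_mono[of "nb (RM c) w1" "nb L w1 \<inter> far L c"] fin cl e1 by simp
  qed
  obtain y0 where y0: "y0 \<in> RM c" "A w1 y0"
  proof -
    have "\<not> nb L w1 \<inter> far L c \<subseteq> {out}" using card_mono[of "{out}" "nb L w1 \<inter> far L c"] e1 by auto
    then obtain z where "z \<in> nb L w1 \<inter> far L c" "z \<noteq> out" by blast
    then show ?thesis using that[of z] sub[of z] by auto
  qed
  have "card (far L out) = 1" using far_non_C[OF out_L(1) out_not_C] out_no_C by simp
  moreover have "c \<in> far L out" using far_sym[OF conjunct2[OF o] cL(1)] .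
  ultimately have fo: "far L out = {c}" by (metis card_1_singletonE singletonD)
  have nco: "\<not> A c out" using oC[OF c(1)] adj_sym by blast
  have "3 + card (nb L out \<inter> far L c) = 4 + card (nb L c \<inter> far L out)"
    using exchange[OF cL(1) out_L(1) cL(3) nco] dgC3[OF c(1)] dg4[OF out_L(1) out_not_C] by simp
  then have "nb L out \<inter> far L c \<noteq> {}" by auto
  then obtain z where "z \<in> nb L out" "z \<in> far L c" by blast
  then have z: "A out z" "z \<in> far L c" "z \<in> L" by simp_all
  have "z \<noteq> out" using z(1) adj_irrefl by auto
  then have zR: "z \<in> RM c" "z \<notin> C" using kind[OF z(2)] z(1) oC by auto
  have Cfar: "C - {c} \<subseteq> far L c"
  proof
    fix c' assume c': "c' \<in> C - {c}"
    have "\<not> (A c u \<and> A u c')" if u: "u \<in> L" for u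
    proof
      assume a: "A c u \<and> A u c'"
      have "2 \<le> dg C u" using dg_two[of c C c' u] c c' a adj_sym fin by auto
      then have "u \<notin> Yr" "u \<notin> C" "u \<notin> W" "u \<noteq> out" using one dgCC k w1 out_no_C by auto
      then show False using L_cases[OF u] by blast
    qed
    then show "c' \<in> far L c" using c' C_ind[OF c(1)] CF_L(1) by (auto simp: far_def)
  qed
  have "RM c \<inter> C \<noteq> {}"
  proof
    assume "RM c \<inter> C = {}"
    then have "card (RM c \<union> (C - {c})) = 5" using RMc fin card_C4 c(1) by (subst card_Un_disjoint) auto
    moreover have "out \<notin> RM c \<union> (C - {c})" using out_RM out_not_C by blast
    ultimately have "card (insert out (RM c \<union> (C - {c}))) = 6" using fin by simp
    moreover have "insert out (RM c \<union> (C - {c})) \<subseteq> far L c" using o RM_far Cfar by auto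
    ultimately show False
      using card_mono[OF finite_far[OF fin(2), of c], of "insert out (RM c \<union> (C - {c}))"] far_C[OF c(1)] by simp
  qed
  then obtain c' where c': "c' \<in> RM c" "c' \<in> C" by blast
  have "y0 \<notin> C" using y0 w1C by blast
  then have "y0 = z" using RMc zR y0(1) c' by (metis card_2_iff' )
  then show False using nbs_nonadj[of w1 out y0] o y0 z(1) by blast
qed

text \<open>The spare edge is at \<open>s\<close> in \<open>Yr\<close>. A vertex whose four
  neighbours lie in \<open>Yr\<close> cannot be adjacent to \<open>s\<close>, because it would reach
  some vertex of \<open>C\<close> twice. So \<open>s\<close> is avoided by \<open>W\<close> and
  \<open>out\<close> and becomes the only vertex far from \<open>out\<close>; this finally forces
  five neighbours on \<open>s\<close>.\<close>

lemma impossible4: False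
proof -
  obtain s where s: "s \<in> Yr" "dg C s = 2" "\<And>y. y \<in> Yr - {s} \<Longrightarrow> dg C y = 1" using Yr_two[OF W_no_C] by blast
  have sL: "s \<in> L" "dg L s = 4" using Yr_facts[OF s(1)] by auto
  have farY: "far L y = RM y" if "y \<in> Yr" "y \<noteq> s" for y using Yr_tight[OF that(1)] s(3) that by simp
  have farW: "far L w = W - {w}" if "w \<in> W" for w using W_tight[OF that W_no_C[OF that]] .
  have wC: "\<not> A w c" if "w \<in> W" "c \<in> C" for w c using W_no_C[OF that(1)] dg_eq_0[OF fin(3)] that by blast
  have oC: "\<not> A out c" if "c \<in> C" for c using out_no_C dg_eq_0[OF fin(3)] that by blast
  have WL: "w \<in> L" "dg L w = 4" if "w \<in> W" for w using that CF_L(3) dg4 W_not_C by auto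
  have nbY: "nb L u \<subseteq> Yr" if "u = out \<and> nb W out = {} \<or> u \<in> W \<and> \<not> A u out" for u
  proof
    fix z assume z: "z \<in> nb L u"
    have "z \<notin> C" using z that oC wC by auto
    moreover have "z \<noteq> out" using z that adj_irrefl by auto
    moreover have "z \<notin> W" using z that W_nonadj by auto
    ultimately show "z \<in> Yr" using z L_cases by auto
  qed
  have no_s: "\<not> A u s" if u: "u \<in> L" "u \<notin> C" "dg L u = 4" "nb L u \<subseteq> Yr" for u
  proof
    assume "A u s"
    then have sn: "s \<in> nb L u" using sL by simp
    have f: "finite (nb L u)" using fin by simp
    have "(\<Sum>y\<in>nb L u. dg C y) = dg C s + (\<Sum>y\<in>nb L u - {s}. dg C y)" using sn f by (simp add: sum.remove)
    also have "(\<Sum>y\<in>nb L u - {s}. dg C y) = (\<Sum>y\<in>nb L u - {s}. 1)" using u(4) s(3) by (intro sum.cong) auto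
    also have "\<dots> = 3" using sn f u(3) by (simp add: dg_def)
    finally show False using reach(1)[OF u(1,2)] s(2) by simp
  qed
  \<comment> \<open>Exchange would make \<open>w\<close> adjacent to a row mate of each of the four
    neighbours of \<open>w'\<close>. These lie in different rows, and \<open>out\<close> would be a
    fifth neighbour.\<close>
  have Wout: "\<not> A w out" if w: "w \<in> W" for w
  proof
    assume wo: "A w out"
    obtain w' where w': "W = {w, w'}" "w' \<noteq> w" using W_other[OF w] by blast
    have w'W: "w' \<in> W" using w' by simp
    have w'o: "\<not> A w' out" using W_adj[OF w w'W w'(2)[symmetric] wo] out_L(1) by blast
    have sub: "nb L w' \<subseteq> Yr" using nbY w'W w'o by blast
    have ns: "\<not> A w' s" using no_s WL[OF w'W] W_not_C[OF w'W] sub by blast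
    have "\<exists>z\<in>RM y. A w z" if y: "y \<in> nb L w'" for y
    proof -
      have yY: "y \<in> Yr" "y \<noteq> s" "y \<in> L" using y sub ns by auto
      have nwy: "\<not> A y w" using W_adj[OF w w'W w'(2)[symmetric], of y] y adj_sym by auto
      have "y \<noteq> w" using yY Yr_facts w by blast
      have "nb L y \<inter> far L w = {w'}" using farW[OF w] w' y adj_sym WL[OF w'W] by auto
      then have "card (nb L w \<inter> RM y) = 1"
        using exchange[OF yY(3) WL(1)[OF w] \<open>y \<noteq> w\<close> nwy] farY[OF yY(1,2)] WL[OF w] Yr_facts[OF yY(1)] by simp
      then have "nb L w \<inter> RM y \<noteq> {}" by auto
      then show ?thesis by auto
    qed
    then obtain f where f: "\<And>y. y \<in> nb L w' \<Longrightarrow> f y \<in> RM y \<and> A w (f y)" by metis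
    have inj: "inj_on f (nb L w')"
    proof (rule inj_onI)
      fix y z assume yz: "y \<in> nb L w'" "z \<in> nb L w'" "f y = f z"
      have L: "y \<in> L" "z \<in> L" "f y \<in> L" using yz f RM_L by auto
      have "y \<in> RM (f y)" "z \<in> RM (f y)" using f[OF yz(1)] f[OF yz(2)] yz(3) RM_sym L by auto
      then have "y \<noteq> z \<Longrightarrow> z \<in> RM y" using RM_trans[of y "f y" z] L by blast
      then show "y = z" using rainbow[of w' y z] yz WL[OF w'W] by auto
    qed
    have fL: "f y \<in> nb L w \<and> f y \<noteq> out" if "y \<in> nb L w'" for y
      using f[OF that] RM_L[of "f y" y] by simp
    then have "insert out (f ` nb L w') \<subseteq> nb L w" using wo out_L(1) by auto
    then have "card (insert out (f ` nb L w')) \<le> dg L w" unfolding dg_def using fin by (intro card_mono) auto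
    moreover have "out \<notin> f ` nb L w'" using fL by blast
    ultimately show False using fin card_image[OF inj] WL[OF w] WL[OF w'W] by (simp add: dg_def)
  qed
  have Wsub: "nb L w \<subseteq> Yr" if "w \<in> W" for w using nbY Wout that by blast
  have Ws: "\<not> A w s" if "w \<in> W" for w using no_s WL[OF that] W_not_C[OF that] Wsub[OF that] by blast
  have step: "\<exists>z\<in>RM c. z \<in> Yr \<and> A w z" if w: "w \<in> W" and c: "c \<in> C" for w c
  proof -
    obtain w' where w': "W = {w, w'}" "w' \<noteq> w" using W_other[OF w] by blast
    have cL: "c \<in> L" "c \<noteq> w" "\<not> A c w" using c w CF_L(1) W_not_C[OF w] wC[OF w c] adj_sym[of c w] by auto
    have "3 + card (nb L w \<inter> far L c) = 4 + card (nb L c \<inter> far L w)"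
      using exchange[OF cL(1) WL(1)[OF w] cL(2,3)] dgC3[OF c] WL[OF w] by simp
    then have "nb L w \<inter> far L c \<noteq> {}" by auto
    then obtain z where z: "z \<in> nb L w" "z \<in> far L c" by blast
    have "z \<in> Yr" "z \<noteq> s" using z(1) Wsub[OF w] Ws[OF w] by auto
    then have "c \<in> RM z" using farY far_sym[OF z(2) cL(1)] by simp
    then show ?thesis using RM_sym \<open>z \<in> Yr\<close> z(1) by auto
  qed
  \<comment> \<open>Both vertices of \<open>W\<close> are adjacent to a row mate of \<open>c\<close>
    in \<open>Yr\<close>, and they have no common neighbour in \<open>L\<close>; this accounts for
    both row mates.\<close>
  have RMC: "RM c \<subseteq> Yr" if c: "c \<in> C" for c
  proof -
    obtain w w' where w: "W = {w, w'}" "w \<noteq> w'" using W_cases by blast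
    obtain z where z: "z \<in> RM c" "z \<in> Yr" "A w z" using step[of w c] w c by auto
    obtain z' where z': "z' \<in> RM c" "z' \<in> Yr" "A w' z'" using step[of w' c] w c by auto
    have "z \<noteq> z'" using W_adj[of w w' z] w z z' RM_L by auto
    moreover have "card (RM c) = 2" using row_RM[of c] C_notin[OF c] c CF_L(1) by blast
    ultimately have "RM c = {z, z'}" using z(1) z'(1) fin by (intro card_subset_eq[symmetric]) auto
    then show ?thesis using z z' by simp
  qed
  have mate: "\<exists>a\<in>RM t. a \<in> Yr" if t: "t \<in> Yr" for t
  proof -
    have tL: "t \<in> L" "t \<notin> W" "card (RM t) = 2" using Yr_facts[OF t] by auto
    obtain a b where ab: "RM t = {a, b}" "a \<noteq> b" using tL(3) by (auto simp: card_2_iff)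
    have "a \<notin> W" "b \<notin> W" using RM_disjoint_W[OF tL(1,2)] ab by auto
    then have "a \<in> Yr \<or> a \<in> C" "b \<in> Yr \<or> b \<in> C" using L_cases RM_L[of a t] RM_L[of b t] ab by auto
    moreover have "a \<in> C \<Longrightarrow> b \<in> Yr" using RMC[of a] RM_trans[of a t b] ab tL(1) by auto
    ultimately show ?thesis using ab by auto
  qed
  have "\<not> A out w" if "w \<in> W" for w using Wout[OF that] adj_sym[of out w] by blast
  then have oW: "nb W out = {}" by auto
  have osub: "nb L out \<subseteq> Yr" using nbY oW by blast
  have o4: "dg L out = 4" using dg4[OF out_L(1) out_not_C] .
  have os: "\<not> A out s" using no_s[OF out_L(1) out_not_C o4 osub] .
  have "(\<Sum>y\<in>nb L out. dg C y) = (\<Sum>y\<in>nb L out. 1)"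
  proof (intro sum.cong refl)
    fix y assume y: "y \<in> nb L out"
    then have "y \<in> Yr - {s}" using osub os by auto
    then show "dg C y = 1" by (rule s(3))
  qed
  then have "(\<Sum>y\<in>nb L out. dg C y) = 4" using o4 by (simp add: dg_def)
  then have oCfar: "far L out \<inter> C = {}" using reach(2)[OF out_L(1) out_not_C] by blast
  have "card (far L out) = 1" using far_non_C[OF out_L(1) out_not_C] out_no_C by simp
  then obtain f0 where f0: "far L out = {f0}" by (auto simp: card_1_singleton_iff)
  have "f0 = s"
  proof (rule ccontr)
    assume n: "f0 \<noteq> s"
    have fL: "f0 \<in> L" "f0 \<noteq> out" using f0 by (auto simp: far_def)
    have ofar: "out \<in> far L f0" using far_out f0 by blast
    have "f0 \<notin> W" using farW ofar out_W by blast
    moreover have "f0 \<notin> Yr" using farY n ofar out_RM by blast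
    ultimately show False using L_cases[OF fL(1)] fL(2) oCfar f0 by blast
  qed
  then have fo: "far L out = {s}" using f0 by simp
  obtain a where a: "\<And>t. t \<in> nb L out \<Longrightarrow> a t \<in> RM t \<and> a t \<in> Yr" using mate osub by (metis subsetD)
  \<comment> \<open>The neighbour \<open>t\<close> of \<open>out\<close> is far from its row mate
    \<open>a t\<close>; exchange then requires a neighbour of \<open>a t\<close> far from
    \<open>out\<close>, and that is \<open>s\<close>.\<close>
  have as: "A (a t) s" if t: "t \<in> nb L out" "a t \<noteq> s" for t
  proof -
    have tL: "t \<in> L" "A out t" using t by auto
    have aL: "a t \<in> Yr" "a t \<in> L" "a t \<noteq> out" "t \<in> RM (a t)" using a[OF t(1)] RM_L[of "a t" t] RM_sym[of "a t" t] tL(1) by auto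
    have no: "\<not> A (a t) out"
      using rainbow[of out t "a t"] tL(2) out_L(1) a[OF t(1)] adj_sym by blast
    have "card (nb L out \<inter> RM (a t)) = card (nb L (a t) \<inter> {s})"
      using exchange[OF aL(2) out_L(1) aL(3) no] farY[OF aL(1) t(2)] fo o4 Yr_facts[OF aL(1)] by simp
    moreover have "nb L out \<inter> RM (a t) \<noteq> {}" using t(1) aL(4) by blast
    ultimately have "nb L (a t) \<inter> {s} \<noteq> {}" using fin by (metis card_eq_0_iff card.empty finite_Int finite_nb)
    then show ?thesis by auto
  qed
  have inj: "inj_on a (nb L out)"
  proof (rule inj_onI)
    fix y z assume yz: "y \<in> nb L out" "z \<in> nb L out" "a y = a z"
    have L: "y \<in> L" "z \<in> L" "a y \<in> L" using yz a RM_L by auto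
    have "y \<in> RM (a y)" "z \<in> RM (a y)" using a[OF yz(1)] a[OF yz(2)] yz(3) RM_sym L by auto
    then have "y \<noteq> z \<Longrightarrow> z \<in> RM y" using RM_trans[of y "a y" z] L by blast
    then show "y = z" using rainbow[of out y z] yz out_L(1) by auto
  qed
  define T where "T = a ` nb L out - {s}"
  have "card (a ` nb L out) = 4" using card_image[OF inj] o4 by (simp add: dg_def)
  then have T3: "3 \<le> card T" "finite T" using fin by (auto simp: T_def card_Diff_singleton_if)
  have Tsub: "T \<subseteq> nb L s" using as a RM_L adj_sym by (fastforce simp: T_def)
  have "T \<inter> nb C s = {}" using a Yr_facts by (fastforce simp: T_def)
  then have "card (T \<union> nb C s) = card T + 2" using T3 fin s(2) by (simp add: card_Un_disjoint dg_def)
  moreover have "card (T \<union> nb C s) \<le> dg L s" unfolding dg_def using Tsub CF_L(1) fin by (intro card_mono) auto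
  ultimately show False using T3 sL by linarith
qed

end

context outlier
begin

lemma impossible_outlier: False
proof -
  consider w where "w \<in> W" "w \<in> F" | "W \<inter> F = {}" by blast
  then show False
  proof cases
    case 1
    have "(W - {w}) \<inter> F = {}"
    proof (rule ccontr)
      assume "(W - {w}) \<inter> F \<noteq> {}"
      then have "W \<subseteq> F" using W_other[OF 1(1)] 1 by auto
      then show False using both_six by blast
    qed
    then show False using one_six[OF 1] one_six_out[OF 1] by auto
  next
    case 2
    show False
    proof (cases "out \<in> F")
      case True
      then show False using no_six_out[OF 2] by blast
    next
      case False
      interpret outlier4 A V v x out by unfold_locales (use 2 False in auto)
      show False by (rule impossible4)
    qed
  qed
qed

end

section \<open>Infeasible grid patterns\<close>

text \<open>A mark in the row \<open>Top\<close> stands for degree six in the whole graph, elsewhere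
  for degree four.\<close>

datatype lit = Edge bool nat nat | Mark bool nat

datatype row = Top | Row1 | Row2 | Row3 | Row4

datatype colour = Blank | Col1 | Col2 | Col3 | Col4

type_synonym cell = "nat \<times> row \<times> colour"

fun holds :: "(nat \<Rightarrow> nat \<Rightarrow> bool) \<Rightarrow> (nat \<Rightarrow> bool) \<Rightarrow> lit \<Rightarrow> bool" where
  "holds e m (Edge b i j) = (if b then e i j else \<not> e i j)"
| "holds e m (Mark b i) = (if b then m i else \<not> m i)"

text \<open>The case of one literal avoids a trailing \<open>False\<close> in the propositions
  handed to \<open>sat\<close>.\<close>

fun disj :: "(nat \<Rightarrow> nat \<Rightarrow> bool) \<Rightarrow> (nat \<Rightarrow> bool) \<Rightarrow> lit list \<Rightarrow> bool" where
  "disj e m [] = False"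
| "disj e m [l] = holds e m l"
| "disj e m (l # ls) = (holds e m l \<or> disj e m ls)"

fun conjs :: "(nat \<Rightarrow> nat \<Rightarrow> bool) \<Rightarrow> (nat \<Rightarrow> bool) \<Rightarrow> lit list list \<Rightarrow> bool" where
  "conjs e m [] = True"
| "conjs e m (l # ls) = (disj e m l \<and> conjs e m ls)"

lemma disj_iff: "disj e m ls \<longleftrightarrow> (\<exists>l\<in>set ls. holds e m l)"
  by (induction e m ls rule: disj.induct) auto

lemma conjs_iff: "conjs e m ls \<longleftrightarrow> (\<forall>l\<in>set ls. disj e m l)"
  by (induction ls) auto

text \<open>Vertices in one row share a parent, and vertices of one colour share a neighbour among
  the children of \<open>a\<close>. So incompatible vertices can neither be adjacent nor have a
  common neighbour in the grid. Blank vertices have no neighbour among these children.\<close>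

fun compat :: "cell \<Rightarrow> cell \<Rightarrow> bool" where
  "compat (i, r, k) (j, s, l) \<longleftrightarrow> r \<noteq> s \<and> (k \<noteq> l \<or> k = Blank)"

fun nonedge :: "cell \<Rightarrow> cell \<Rightarrow> lit" where
  "nonedge (i, _) (j, _) = Edge False i j"

section \<open>Generation of the clauses\<close>

fun pairs :: "'b list \<Rightarrow> ('b \<times> 'b) list" where
  "pairs [] = []"
| "pairs (x # xs) = map (Pair x) xs @ pairs xs"

fun subl :: "nat \<Rightarrow> 'b list \<Rightarrow> 'b list list" where
  "subl 0 xs = [ [] ]"
| "subl (Suc n) [] = []"
| "subl (Suc n) (x # xs) = map ((#) x) (subl n xs) @ subl (Suc n) xs"

fun splits :: "'b list \<Rightarrow> 'b list \<Rightarrow> ('b list \<times> 'b \<times> 'b list) list" where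
  "splits us [] = []"
| "splits us (x # xs) = (us, x, xs) # splits (us @ [x]) xs"

text \<open>The indices of an edge are kept increasing, so that every pair has only one atom.\<close>

definition near :: "bool \<Rightarrow> cell list \<times> cell \<times> cell list \<Rightarrow> (lit \<times> cell) list" where
  "near b s = (case s of (us, v, ws) \<Rightarrow>
     map (\<lambda>w. (Edge b (fst w) (fst v), w)) (filter (compat v) us) @
     map (\<lambda>w. (Edge b (fst v) (fst w), w)) (filter (compat v) ws))"

text \<open>Four vertices carry three possible 4-cycles. Opposite corners have a common neighbour,
  so incompatible ones are already covered by \<open>rain\<close>, and pairwise compatible vertices
  suffice.\<close>

fun quads :: "cell \<Rightarrow> cell list \<Rightarrow> lit list list" where
  "quads v [] = []"
| "quads v (x # xs) = (let ys = filter (compat x) xs in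
     concat (map (\<lambda>(y, z). [
        [nonedge v x, nonedge x y, nonedge y z, nonedge v z],
        [nonedge v x, nonedge x z, nonedge y z, nonedge v y],
        [nonedge v y, nonedge x y, nonedge x z, nonedge v z]])
       (filter (\<lambda>(y, z). compat y z) (pairs ys)))) @ quads v xs"

definition tris :: "cell \<Rightarrow> cell list \<Rightarrow> lit list list" where
  "tris v xs = map (\<lambda>(x, y). [nonedge v x, nonedge v y, nonedge x y])
     (filter (\<lambda>(x, y). compat x y) (pairs xs))"

definition rain :: "(lit \<times> cell) list \<Rightarrow> lit list list" where
  "rain n = map (\<lambda>((a, x), (b, y)). [a, b]) (filter (\<lambda>((a, x), (b, y)). \<not> compat x y) (pairs n))"

text \<open>Each list holds at most one neighbour of the vertex in question: vertices of one colour
  exclude each other, blank ones stand alone. \<open>lanes\<close> does the same by rows.\<close>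

definition slots :: "(lit \<times> cell) list \<Rightarrow> (lit \<times> cell) list list" where
  "slots n = map (\<lambda>c. filter (\<lambda>w. snd (snd (snd w)) = c) n) [Col1, Col2, Col3, Col4]
     @ map (\<lambda>w. [w]) (filter (\<lambda>w. snd (snd (snd w)) = Blank) n)"

definition lanes :: "(lit \<times> cell) list \<Rightarrow> (lit \<times> cell) list list" where
  "lanes n = map (\<lambda>r. filter (\<lambda>w. fst (snd (snd w)) = r) n) [Top, Row1, Row2, Row3, Row4]"

text \<open>At least \<open>d\<close> of n slots are occupied iff every choice of n + 1 - d slots
  contains an occupied one. The literals \<open>e\<close> state the exceptions.\<close>

definition atleast :: "nat \<Rightarrow> lit list \<Rightarrow> (lit \<times> cell) list list \<Rightarrow> lit list list" where
  "atleast d e ss = (let ts = filter (\<lambda>s. s \<noteq> []) ss in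
     map (\<lambda>S. e @ map fst (concat S)) (subl (Suc (length ts) - d) ts))"

text \<open>A coloured vertex has one neighbour outside the grid more than a blank one, hence three
  against four. A mark raises the demand by one in the row \<open>Top\<close> and lowers it by one
  elsewhere.\<close>

definition degs :: "cell \<Rightarrow> (lit \<times> cell) list \<Rightarrow> lit list list" where
  "degs v n = (case v of (i, r, k) \<Rightarrow>
     let d = (if k = Blank then 4 else 3); cs = slots n; rs = lanes n in
     if r = Top
     then atleast d [] cs @ atleast d [] rs @ atleast (Suc d) [Mark False i] cs @ atleast (Suc d) [Mark False i] rs
     else atleast d [Mark True i] cs @ atleast d [Mark True i] rs @ atleast (d - 1) [] cs @ atleast (d - 1) [] rs)"

text \<open>Two vertices of degree four can have a common neighbour in the grid only if it has
  degree six, that is, a marked vertex of the row \<open>Top\<close>.\<close>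

definition marked :: "(lit \<times> cell) list \<Rightarrow> cell \<Rightarrow> lit list list" where
  "marked n v = map (\<lambda>((a, x), (b, y)). [Mark False (fst x), Mark False (fst y), a, b] @
        (if fst (snd v) = Top then [Mark True (fst v)] else []))
     (filter (\<lambda>((a, x), (b, y)). fst (snd x) \<noteq> Top \<and> fst (snd y) \<noteq> Top \<and> compat x y) (pairs n))"

definition markind :: "cell \<Rightarrow> cell list \<Rightarrow> lit list list" where
  "markind v xs = map (\<lambda>x. [Mark False (fst v), Mark False (fst x), nonedge v x])
     (filter (\<lambda>x. fst (snd v) \<noteq> Top \<and> fst (snd x) \<noteq> Top) xs)"

definition block :: "cell list \<times> cell \<times> cell list \<Rightarrow> lit list list" where
  "block s = (case s of (us, v, ws) \<Rightarrow> let n = near False s; xs = filter (compat v) ws in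
     rain n @ tris v xs @ quads v xs @ degs v (near True s) @ marked n v @ markind v xs)"

definition system :: "cell list \<Rightarrow> lit list list" where
  "system p = concat (map block (splits [] p))"

definition cells :: "colour list \<Rightarrow> cell list" where
  "cells p = zip [0..<14] (zip [Top, Top, Row1, Row1, Row1, Row2, Row2, Row2,
     Row3, Row3, Row3, Row4, Row4, Row4] p)"

section \<open>Soundness of the clauses\<close>

lemma pairs_in: "(x, y) \<in> set (pairs xs) \<Longrightarrow> x \<in> set xs \<and> y \<in> set xs"
  by (induction xs) auto

lemma pairs_distinct: "distinct (map f xs) \<Longrightarrow> (x, y) \<in> set (pairs xs) \<Longrightarrow> f x \<noteq> f y"
proof (induction xs)
  case (Cons a xs)
  then show ?case using pairs_in[of x y xs] by auto
qed simp

lemma splits_append: "(us, v, ws) \<in> set (splits as xs) \<Longrightarrow> as @ xs = us @ v # ws"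
  by (induction as xs rule: splits.induct) auto

lemma subl_length: "S \<in> set (subl n xs) \<Longrightarrow> (\<forall>s\<in>set S. P s) \<Longrightarrow> n \<le> length (filter P xs)"
proof (induction n xs arbitrary: S rule: subl.induct)
  case (3 n x xs)
  show ?case
  proof (cases "S \<in> set (subl (Suc n) xs)")
    case True
    then show ?thesis using "3.IH"(2)[of S] "3.prems" by auto
  next
    case False
    then obtain S' where "S = x # S'" "S' \<in> set (subl n xs)" using "3.prems" by auto
    then show ?thesis using "3.IH"(1)[of S'] "3.prems" by auto
  qed
qed auto

lemma card_slots:
  assumes "\<And>s x y. s \<in> set ss \<Longrightarrow> x \<in> set s \<Longrightarrow> y \<in> set s \<Longrightarrow> P x \<Longrightarrow> P y \<Longrightarrow> x = y"
  shows "card {x. P x \<and> (\<exists>s\<in>set ss. x \<in> set s)} \<le> length (filter (\<lambda>s. \<exists>x\<in>set s. P x) ss)"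
  using assms
proof (induction ss)
  case (Cons s ss)
  let ?U = "\<lambda>ss. {x. P x \<and> (\<exists>s\<in>set ss. x \<in> set s)}"
  have f: "finite (?U ss)" by (rule finite_subset[of _ "\<Union>s\<in>set ss. set s"]) auto
  have e: "?U (s # ss) = {x \<in> set s. P x} \<union> ?U ss" by auto
  have IH: "card (?U ss) \<le> length (filter (\<lambda>s. \<exists>x\<in>set s. P x) ss)"
    using Cons.prems by (intro Cons.IH) (meson list.set_intros(2))
  have c: "card (?U (s # ss)) \<le> card {x \<in> set s. P x} + card (?U ss)"
    unfolding e by (rule card_Un_le)
  show ?case
  proof (cases "\<exists>x\<in>set s. P x")
    case True
    then obtain x where x: "x \<in> set s" "P x" by blast
    then have "{x \<in> set s. P x} = {x}" using Cons.prems[of s] by auto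
    then show ?thesis using c IH True by simp
  next
    case False
    then have "{x \<in> set s. P x} = {}" by auto
    then have "card {x \<in> set s. P x} = 0" by simp
    moreover have "length (filter (\<lambda>s. \<exists>x\<in>set s. P x) (s # ss)) = length (filter (\<lambda>s. \<exists>x\<in>set s. P x) ss)"
      using False by auto
    ultimately show ?thesis using c IH by linarith
  qed
qed simp

text \<open>A false clause exhibits n + 1 - d empty slots out of n, and the remaining d - 1 slots
  hold at most one neighbour each.\<close>

lemma atleast_holds:
  fixes ss :: "(lit \<times> cell) list list"
  assumes slot: "\<And>s x y. s \<in> set ss \<Longrightarrow> x \<in> set s \<Longrightarrow> y \<in> set s \<Longrightarrow> holds e m (fst x) \<Longrightarrow>
        holds e m (fst y) \<Longrightarrow> x = y"
    and deg: "(\<forall>l\<in>set ls. \<not> holds e m l) \<Longrightarrow> d \<le> card {x. holds e m (fst x) \<and> (\<exists>s\<in>set ss. x \<in> set s)}"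
    and cl: "c \<in> set (atleast d ls ss)"
  shows "disj e m c"
proof (rule ccontr)
  assume n: "\<not> disj e m c"
  define ts where "ts = filter (\<lambda>s. s \<noteq> []) ss"
  define H :: "(lit \<times> cell) list \<Rightarrow> bool" where "H = (\<lambda>s. \<exists>x\<in>set s. holds e m (fst x))"
  obtain S where S: "S \<in> set (subl (Suc (length ts) - d) ts)" "c = ls @ map fst (concat S)"
    using cl by (auto simp: atleast_def Let_def ts_def)
  have "\<forall>s\<in>set S. \<not> H s" using n S(2) by (auto simp: disj_iff H_def)
  then have a: "Suc (length ts) - d \<le> length (filter (\<lambda>s. \<not> H s) ts)" using S(1) by (intro subl_length)
  have "\<forall>l\<in>set ls. \<not> holds e m l" using n S(2) by (auto simp: disj_iff)
  then have "d \<le> card {x. holds e m (fst x) \<and> (\<exists>s\<in>set ss. x \<in> set s)}" by (rule deg)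
  also have "{x. holds e m (fst x) \<and> (\<exists>s\<in>set ss. x \<in> set s)} = {x. holds e m (fst x) \<and> (\<exists>s\<in>set ts. x \<in> set s)}"
    by (auto simp: ts_def)
  also have "card \<dots> \<le> length (filter H ts)"
    unfolding H_def using slot by (intro card_slots) (auto simp: ts_def)
  finally show False using a sum_length_filter_compl[of H ts] by linarith
qed

lemma system_sound:
  fixes e :: "nat \<Rightarrow> nat \<Rightarrow> bool" and m :: "nat \<Rightarrow> bool" and p :: "cell list"
  defines "E v w \<equiv> e (fst v) (fst w)"
  assumes dist: "distinct p"
    and sym: "\<And>i j. e i j = e j i"
    and K: "\<And>v x. v \<in> set p \<Longrightarrow> x \<in> set p \<Longrightarrow> E v x \<Longrightarrow> compat v x"
    and R: "\<And>v x y. v \<in> set p \<Longrightarrow> x \<in> set p \<Longrightarrow> y \<in> set p \<Longrightarrow> E v x \<Longrightarrow> E v y \<Longrightarrow> x \<noteq> y \<Longrightarrow> compat x y"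
    and T: "\<And>v x y. v \<in> set p \<Longrightarrow> x \<in> set p \<Longrightarrow> y \<in> set p \<Longrightarrow> E v x \<Longrightarrow> E v y \<Longrightarrow> E x y \<Longrightarrow> False"
    and Q: "\<And>v x y z. v \<in> set p \<Longrightarrow> x \<in> set p \<Longrightarrow> y \<in> set p \<Longrightarrow> z \<in> set p \<Longrightarrow> E v x \<Longrightarrow> E x y \<Longrightarrow>
          E y z \<Longrightarrow> E v z \<Longrightarrow> v \<noteq> y \<Longrightarrow> x \<noteq> z \<Longrightarrow> False"
    and DT: "\<And>i k. (i, Top, k) \<in> set p \<Longrightarrow>
          (if k = Blank then 4 else 3) + (if m i then 1 else 0) \<le> card {w \<in> set p. E (i, Top, k) w}"
    and DR: "\<And>i r k. (i, r, k) \<in> set p \<Longrightarrow> r \<noteq> Top \<Longrightarrow>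
          (if k = Blank then 4 else 3) - (if m i then 1 else 0) \<le> card {w \<in> set p. E (i, r, k) w}"
    and M: "\<And>v x y. v \<in> set p \<Longrightarrow> x \<in> set p \<Longrightarrow> y \<in> set p \<Longrightarrow> E v x \<Longrightarrow> E v y \<Longrightarrow> x \<noteq> y \<Longrightarrow>
          fst (snd x) \<noteq> Top \<Longrightarrow> fst (snd y) \<noteq> Top \<Longrightarrow> m (fst x) \<Longrightarrow> m (fst y) \<Longrightarrow>
          fst (snd v) = Top \<and> m (fst v)"
    and I: "\<And>x y. x \<in> set p \<Longrightarrow> y \<in> set p \<Longrightarrow> fst (snd x) \<noteq> Top \<Longrightarrow> fst (snd y) \<noteq> Top \<Longrightarrow>
          m (fst x) \<Longrightarrow> m (fst y) \<Longrightarrow> E x y \<Longrightarrow> False"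
  shows "conjs e m (system p)"
proof -
  have ne: "holds e m (nonedge v w) \<longleftrightarrow> \<not> E v w" for v w by (cases v; cases w) (simp add: E_def)
  have Es: "E v w \<longleftrightarrow> E w v" for v w unfolding E_def by (rule sym)
  have "disj e m c" if c: "c \<in> set (system p)" for c
  proof -
    obtain us v ws where s: "(us, v, ws) \<in> set (splits [] p)"
      and c': "c \<in> set (rain (near False (us, v, ws))) \<or> c \<in> set (tris v (filter (compat v) ws)) \<or>
        c \<in> set (quads v (filter (compat v) ws)) \<or> c \<in> set (degs v (near True (us, v, ws))) \<or>
        c \<in> set (marked (near False (us, v, ws)) v) \<or> c \<in> set (markind v (filter (compat v) ws))"
    proof -
      obtain t where t: "t \<in> set (splits [] p)" "c \<in> set (block t)" using c by (auto simp: system_def)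
      obtain us v ws where "t = (us, v, ws)" using prod_cases3 by blast
      then show ?thesis using that[of us v ws] t by (simp add: block_def Let_def)
    qed
    have p: "p = us @ v # ws" using splits_append[OF s] by simp
    have vp: "v \<in> set p" and dws: "distinct ws" "v \<notin> set us" "v \<notin> set ws"
      using p dist by auto
    have near: "w \<in> set p \<and> compat v w \<and> (holds e m l \<longleftrightarrow> (E v w = b))"
      if "(l, w) \<in> set (near b (us, v, ws))" for b l w
      using that sym[of "fst v" "fst w"] by (auto simp: near_def p E_def split: if_splits)
    have dnear: "distinct (map snd (near b (us, v, ws)))" for b
      using dist unfolding near_def p by (auto simp: o_def distinct_map)
    have near_all: "\<exists>l. (l, w) \<in> set (near b (us, v, ws))" if "w \<in> set p" "compat v w" for b w
    proof -
      have "w \<in> set us \<or> w \<in> set ws" using that by (cases v) (auto simp: p)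
      then show ?thesis using that(2) by (force simp: near_def)
    qed
    have near_fun: "l = l'" if "(l, w) \<in> set (near b (us, v, ws))" "(l', w) \<in> set (near b (us, v, ws))" for b l l' w
      using dnear[of b] that by (metis distinct_map inj_onD prod.inject snd_conv)
    consider (rain) "c \<in> set (rain (near False (us, v, ws)))"
      | (tris) "c \<in> set (tris v (filter (compat v) ws))"
      | (quads) "c \<in> set (quads v (filter (compat v) ws))"
      | (degs) "c \<in> set (degs v (near True (us, v, ws)))"
      | (marked) "c \<in> set (marked (near False (us, v, ws)) v)"
      | (markind) "c \<in> set (markind v (filter (compat v) ws))"
      using c' by blast
    then show ?thesis
    proof cases
      case rain
      then obtain a x b y where xy: "((a, x), (b, y)) \<in> set (pairs (near False (us, v, ws)))"
        "\<not> compat x y" "c = [a, b]" by (auto simp: rain_def)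
      have "x \<noteq> y" using pairs_distinct[OF dnear xy(1)] by simp
      moreover have "x \<in> set p" "y \<in> set p" "holds e m a \<longleftrightarrow> \<not> E v x" "holds e m b \<longleftrightarrow> \<not> E v y"
        using near[of a x False] near[of b y False] pairs_in[OF xy(1)] by auto
      ultimately show ?thesis using R[OF vp, of x y] xy(2,3) by auto
    next
      case tris
      then obtain x y where xy: "(x, y) \<in> set (pairs (filter (compat v) ws))"
        "c = [nonedge v x, nonedge v y, nonedge x y]" by (auto simp: tris_def)
      then have "x \<in> set p" "y \<in> set p" using pairs_in[OF xy(1)] p by auto
      then show ?thesis using T[OF vp, of x y] xy(2) ne by auto
    next
      case quads
      have "disj e m c" if "c \<in> set (quads v xs)" "set xs \<subseteq> set ws" "distinct xs" for xs
        using that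
      proof (induction xs)
        case (Cons x xs)
        show ?case
        proof (cases "c \<in> set (quads v xs)")
          case True
          then show ?thesis using Cons by auto
        next
          case False
          then obtain y z where yz: "(y, z) \<in> set (pairs (filter (compat x) xs))"
            "c \<in> {[nonedge v x, nonedge x y, nonedge y z, nonedge v z],
                  [nonedge v x, nonedge x z, nonedge y z, nonedge v y],
                  [nonedge v y, nonedge x y, nonedge x z, nonedge v z]}"
            using Cons.prems(1) by (auto simp: Let_def)
          have "y \<noteq> z" using pairs_distinct[of id "filter (compat x) xs" y z] yz(1) Cons.prems(3) by simp
          moreover have "y \<in> set xs" "z \<in> set xs" using pairs_in[OF yz(1)] by auto
          ultimately have d: "v \<noteq> x" "v \<noteq> y" "v \<noteq> z" "x \<noteq> y" "x \<noteq> z" "y \<noteq> z"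
            "x \<in> set p" "y \<in> set p" "z \<in> set p"
            using Cons.prems dws p by auto
          show ?thesis
            using yz(2) d Q[OF vp, of x y z] Q[OF vp, of x z y] Q[OF vp, of y x z] Es[of z y] Es[of y x]
            by (elim insertE) (auto simp: ne)
        qed
      qed simp
      then show ?thesis using quads dws by auto
    next
      case marked
      then obtain a x b y where xy: "((a, x), (b, y)) \<in> set (pairs (near False (us, v, ws)))"
        "fst (snd x) \<noteq> Top" "fst (snd y) \<noteq> Top"
        "c = [Mark False (fst x), Mark False (fst y), a, b] @ (if fst (snd v) = Top then [Mark True (fst v)] else [])"
        by (auto simp: marked_def)
      have "x \<noteq> y" using pairs_distinct[OF dnear xy(1)] by simp
      moreover have "x \<in> set p" "y \<in> set p" "holds e m a \<longleftrightarrow> \<not> E v x" "holds e m b \<longleftrightarrow> \<not> E v y"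
        using near[of a x False] near[of b y False] pairs_in[OF xy(1)] by auto
      ultimately show ?thesis using M[OF vp, of x y] xy(2-4) by (auto simp: disj_iff)
    next
      case markind
      then obtain x where x: "x \<in> set ws" "fst (snd v) \<noteq> Top" "fst (snd x) \<noteq> Top"
        "c = [Mark False (fst v), Mark False (fst x), nonedge v x]" by (auto simp: markind_def)
      then show ?thesis using I[OF vp, of x] p ne by auto
    next
      case degs
      define n where "n = near True (us, v, ws)"
      obtain i r k where v: "v = (i, r, k)" using prod_cases3 by blast
      define d where "d = (if k = Blank then 4 else 3::nat)"
      have one: "x = y" if "x \<in> set n" "y \<in> set n" "\<not> compat (snd x) (snd y)" "holds e m (fst x)" "holds e m (fst y)" for x y
      proof -
        have "snd x = snd y" using that R[OF vp, of "snd x" "snd y"] near[of "fst x" "snd x" True]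
            near[of "fst y" "snd y" True] unfolding n_def by auto
        then show ?thesis using that near_fun[of "fst x" "snd x" True "fst y"] unfolding n_def
          by (metis prod.collapse)
      qed
      have cardn: "card {w \<in> set p. E v w} \<le> card {x. holds e m (fst x) \<and> (\<exists>s\<in>set ss. x \<in> set s)}"
        if ss: "(\<Union>s\<in>set ss. set s) = set n" for ss
      proof -
        have eq: "{x. holds e m (fst x) \<and> (\<exists>s\<in>set ss. x \<in> set s)} = {x \<in> set n. holds e m (fst x)}"
          using ss by auto
        have "{w \<in> set p. E v w} \<subseteq> snd ` {x \<in> set n. holds e m (fst x)}"
        proof
          fix w assume w: "w \<in> {w \<in> set p. E v w}"
          then obtain l where l: "(l, w) \<in> set n" using near_all[of w True] K[OF vp, of w] unfolding n_def by auto
          then have "holds e m l" using near[of l w True] w unfolding n_def by auto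
          then show "w \<in> snd ` {x \<in> set n. holds e m (fst x)}" using l by force
        qed
        then have "card {w \<in> set p. E v w} \<le> card (snd ` {x \<in> set n. holds e m (fst x)})"
          by (intro card_mono) auto
        also have "\<dots> \<le> card {x \<in> set n. holds e m (fst x)}" by (intro card_image_le) auto
        finally show ?thesis unfolding eq .
      qed
      have us: "(\<Union>s\<in>set (slots n). set s) = set n"
      proof -
        have "x \<in> (\<Union>s\<in>set (slots n). set s)" if "x \<in> set n" for x
          using that by (cases "snd (snd (snd x))") (auto simp: slots_def)
        then show ?thesis by (auto simp: slots_def)
      qed
      have ul: "(\<Union>s\<in>set (lanes n). set s) = set n"
      proof -
        have "x \<in> (\<Union>s\<in>set (lanes n). set s)" if "x \<in> set n" for x
          using that by (cases "fst (snd (snd x))") (auto simp: lanes_def)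
        then show ?thesis by (auto simp: lanes_def)
      qed
      have ss: "x = y" if "s \<in> set (slots n)" "x \<in> set s" "y \<in> set s" "holds e m (fst x)" "holds e m (fst y)" for s x y
      proof (cases "s \<in> (\<lambda>w. [w]) ` set n")
        case True then show ?thesis using that by auto
      next
        case False
        then have "x \<in> set n" "y \<in> set n" "snd (snd (snd x)) = snd (snd (snd y))" "snd (snd (snd x)) \<noteq> Blank"
          using that by (auto simp: slots_def)
        then show ?thesis using one[of x y] that by (cases "snd x"; cases "snd y") auto
      qed
      have sl: "x = y" if "s \<in> set (lanes n)" "x \<in> set s" "y \<in> set s" "holds e m (fst x)" "holds e m (fst y)" for s x y
      proof -
        have "x \<in> set n" "y \<in> set n" "fst (snd (snd x)) = fst (snd (snd y))"
          using that by (auto simp: lanes_def)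
        then show ?thesis using one[of x y] that by (cases "snd x"; cases "snd y") auto
      qed
      have at: "disj e m c" if "c \<in> set (atleast d' ls (slots n)) \<or> c \<in> set (atleast d' ls (lanes n))"
        "(\<forall>l\<in>set ls. \<not> holds e m l) \<Longrightarrow> d' \<le> card {w \<in> set p. E v w}" for d' ls
      proof -
        have "(\<forall>l\<in>set ls. \<not> holds e m l) \<Longrightarrow> d' \<le> card {x. holds e m (fst x) \<and> (\<exists>s\<in>set (slots n). x \<in> set s)}"
          using that(2) cardn[OF us] by linarith
        moreover have "(\<forall>l\<in>set ls. \<not> holds e m l) \<Longrightarrow> d' \<le> card {x. holds e m (fst x) \<and> (\<exists>s\<in>set (lanes n). x \<in> set s)}"
          using that(2) cardn[OF ul] by linarith
        ultimately show ?thesis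
          using that(1) atleast_holds[where ss = "slots n" and ls = ls and d = d' and c = c, OF ss]
            atleast_holds[where ss = "lanes n" and ls = ls and d = d' and c = c, OF sl]
          by auto
      qed
      show ?thesis
      proof (cases "r = Top")
        case True
        then have c4: "c \<in> set (atleast d [] (slots n)) \<or> c \<in> set (atleast d [] (lanes n)) \<or>
          c \<in> set (atleast (Suc d) [Mark False i] (slots n)) \<or> c \<in> set (atleast (Suc d) [Mark False i] (lanes n))"
          using degs v by (auto simp: degs_def n_def d_def Let_def)
        have "d + (if m i then 1 else 0) \<le> card {w \<in> set p. E v w}"
          using DT[of i k] vp v True by (simp add: d_def)
        then show ?thesis using c4 at[of d "[]"] at[of "Suc d" "[Mark False i]"] by (auto split: if_splits)
      next
        case False
        then have c4: "c \<in> set (atleast d [Mark True i] (slots n)) \<or> c \<in> set (atleast d [Mark True i] (lanes n)) \<or>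
          c \<in> set (atleast (d - 1) [] (slots n)) \<or> c \<in> set (atleast (d - 1) [] (lanes n))"
          using degs v by (auto simp: degs_def n_def d_def Let_def)
        have "d - (if m i then 1 else 0) \<le> card {w \<in> set p. E v w}"
          using DR[of i r k] vp v False by (simp add: d_def)
        then show ?thesis using c4 at[of "d - 1" "[]"] at[of d "[Mark True i]"] by (auto split: if_splits)
      qed
    qed
  qed
  then show ?thesis by (simp add: conjs_iff)
qed

section \<open>Refutation of the single patterns\<close>

lemmas clause_simps = conjs.simps disj.simps holds.simps if_True if_False simp_thms

text \<open>\<open>code_simp\<close> evaluates the clause list, \<open>clause_simps\<close> turn it
  into a propositional formula over the atoms \<open>e i j\<close> and \<open>m i\<close>, and
  \<open>sat\<close> refutes that formula.\<close>

lemma unsat1: "\<not> conjs e m (system (cells [Col1, Col2, Blank, Blank, Col2, Col1, Col3, Col4,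
    Col1, Col3, Col4, Col2, Col3, Col4]))"
  by (rule notI) (code_simp, simp only: clause_simps, sat)

lemma unsat2: "\<not> conjs e m (system (cells [Col1, Col2, Blank, Blank, Col4, Col1, Col2, Col3,
    Col1, Col3, Col4, Col2, Col3, Col4]))"
  by (rule notI) (code_simp, simp only: clause_simps, sat)

lemma unsat3: "\<not> conjs e m (system (cells [Col1, Col2, Blank, Col1, Col2, Blank, Col3, Col4,
    Col1, Col3, Col4, Col2, Col3, Col4]))"
  by (rule notI) (code_simp, simp only: clause_simps, sat)

lemma unsat4: "\<not> conjs e m (system (cells [Col1, Col2, Blank, Col1, Col2, Col1, Col3, Col4,
    Col2, Col3, Col4, Col2, Col3, Col4]))"
  by (rule notI) (code_simp, simp only: clause_simps, sat)

lemma unsat5: "\<not> conjs e m (system (cells [Col1, Col2, Blank, Col1, Col3, Blank, Col2, Col4,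
    Col1, Col3, Col4, Col2, Col3, Col4]))"
  by (rule notI) (code_simp, simp only: clause_simps, sat)

lemma unsat6: "\<not> conjs e m (system (cells [Col1, Col2, Blank, Col1, Col4, Blank, Col2, Col3,
    Col1, Col3, Col4, Col2, Col3, Col4]))"
  by (rule notI) (code_simp, simp only: clause_simps, sat)

lemma unsat7: "\<not> conjs e m (system (cells [Col1, Col2, Blank, Col1, Col4, Col1, Col2, Col3,
    Col2, Col3, Col4, Col2, Col3, Col4]))"
  by (rule notI) (code_simp, simp only: clause_simps, sat)

lemma unsat8: "\<not> conjs e m (system (cells [Col1, Col2, Blank, Col2, Col3, Blank, Col2, Col4,
    Col1, Col3, Col4, Col1, Col3, Col4]))"
  by (rule notI) (code_simp, simp only: clause_simps, sat)

lemma unsat9: "\<not> conjs e m (system (cells [Col1, Col2, Blank, Col2, Col4, Blank, Col3, Col4,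
    Col1, Col2, Col3, Col1, Col3, Col4]))"
  by (rule notI) (code_simp, simp only: clause_simps, sat)

lemma unsat10: "\<not> conjs e m (system (cells [Col1, Col2, Blank, Col2, Col4, Col1, Col2, Col3,
    Col1, Col3, Col4, Col2, Col3, Col4]))"
  by (rule notI) (code_simp, simp only: clause_simps, sat)

lemma unsat11: "\<not> conjs e m (system (cells [Col1, Col2, Blank, Col2, Col4, Col1, Col3, Col4,
    Col1, Col3, Col4, Col2, Col3, Col4]))"
  by (rule notI) (code_simp, simp only: clause_simps, sat)

lemma unsat12: "\<not> conjs e m (system (cells [Col1, Col2, Blank, Col3, Col4, Blank, Col3, Col4,
    Col1, Col2, Col3, Col1, Col2, Col4]))"
  by (rule notI) (code_simp, simp only: clause_simps, sat)

lemma unsat13: "\<not> conjs e m (system (cells [Col1, Col2, Blank, Col3, Col4, Col1, Col2, Col3,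
    Col1, Col2, Col4, Col2, Col3, Col4]))"
  by (rule notI) (code_simp, simp only: clause_simps, sat)

lemma unsat14: "\<not> conjs e m (system (cells [Col1, Col2, Blank, Col3, Col4, Col1, Col2, Col4,
    Col1, Col3, Col4, Col2, Col3, Col4]))"
  by (rule notI) (code_simp, simp only: clause_simps, sat)

lemma unsat15: "\<not> conjs e m (system (cells [Col1, Col2, Col1, Col2, Col3, Col1, Col2, Col4,
    Col1, Col3, Col4, Col2, Col3, Col4]))"
  by (rule notI) (code_simp, simp only: clause_simps, sat)

lemma unsat16: "\<not> conjs e m (system (cells [Col1, Col2, Col1, Col2, Col4, Col1, Col3, Col4,
    Col2, Col3, Col4, Col2, Col3, Col4]))"
  by (rule notI) (code_simp, simp only: clause_simps, sat)

lemma unsat17: "\<not> conjs e m (system (cells [Col1, Col2, Col1, Col3, Col4, Col1, Col3, Col4,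
    Col2, Col3, Col4, Col2, Col3, Col4]))"
  by (rule notI) (code_simp, simp only: clause_simps, sat)

lemma unsat18: "\<not> conjs e m (system (cells [Blank, Col1, Blank, Col1, Col4, Col1, Col2, Col3,
    Col2, Col3, Col4, Col2, Col3, Col4]))"
  by (rule notI) (code_simp, simp only: clause_simps, sat)

lemma unsat19: "\<not> conjs e m (system (cells [Blank, Col1, Blank, Col3, Col4, Col1, Col2, Col3,
    Col1, Col2, Col4, Col2, Col3, Col4]))"
  by (rule notI) (code_simp, simp only: clause_simps, sat)

lemma unsat20: "\<not> conjs e m (system (cells [Blank, Col1, Col1, Col2, Col3, Col1, Col2, Col4,
    Col1, Col3, Col4, Col2, Col3, Col4]))"
  by (rule notI) (code_simp, simp only: clause_simps, sat)

lemma unsat21: "\<not> conjs e m (system (cells [Blank, Col1, Col1, Col2, Col4, Col1, Col3, Col4,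
    Col2, Col3, Col4, Col2, Col3, Col4]))"
  by (rule notI) (code_simp, simp only: clause_simps, sat)

lemma unsat22: "\<not> conjs e m (system (cells [Blank, Blank, Col1, Col2, Col3, Col1, Col2, Col4,
    Col1, Col3, Col4, Col2, Col3, Col4]))"
  by (rule notI) (code_simp, simp only: clause_simps, sat)

section \<open>Enumeration of the colourings up to symmetry\<close>

fun colour_of :: "nat \<Rightarrow> colour" where
  "colour_of k = (if k = 0 then Blank else if k = 1 then Col1 else if k = 2 then Col2 else if k = 3 then Col3 else Col4)"

definition patterns :: "nat list list" where
  "patterns = [[1, 2, 0, 0, 2, 1, 3, 4, 1, 3, 4, 2, 3, 4],
     [1, 2, 0, 0, 4, 1, 2, 3, 1, 3, 4, 2, 3, 4],
     [1, 2, 0, 1, 2, 0, 3, 4, 1, 3, 4, 2, 3, 4],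
     [1, 2, 0, 1, 2, 1, 3, 4, 2, 3, 4, 2, 3, 4],
     [1, 2, 0, 1, 3, 0, 2, 4, 1, 3, 4, 2, 3, 4],
     [1, 2, 0, 1, 4, 0, 2, 3, 1, 3, 4, 2, 3, 4],
     [1, 2, 0, 1, 4, 1, 2, 3, 2, 3, 4, 2, 3, 4],
     [1, 2, 0, 2, 3, 0, 2, 4, 1, 3, 4, 1, 3, 4],
     [1, 2, 0, 2, 4, 0, 3, 4, 1, 2, 3, 1, 3, 4],
     [1, 2, 0, 2, 4, 1, 2, 3, 1, 3, 4, 2, 3, 4],
     [1, 2, 0, 2, 4, 1, 3, 4, 1, 3, 4, 2, 3, 4],
     [1, 2, 0, 3, 4, 0, 3, 4, 1, 2, 3, 1, 2, 4],
     [1, 2, 0, 3, 4, 1, 2, 3, 1, 2, 4, 2, 3, 4],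
     [1, 2, 0, 3, 4, 1, 2, 4, 1, 3, 4, 2, 3, 4],
     [1, 2, 1, 2, 3, 1, 2, 4, 1, 3, 4, 2, 3, 4],
     [1, 2, 1, 2, 4, 1, 3, 4, 2, 3, 4, 2, 3, 4],
     [1, 2, 1, 3, 4, 1, 3, 4, 2, 3, 4, 2, 3, 4],
     [0, 1, 0, 1, 4, 1, 2, 3, 2, 3, 4, 2, 3, 4],
     [0, 1, 0, 3, 4, 1, 2, 3, 1, 2, 4, 2, 3, 4],
     [0, 1, 1, 2, 3, 1, 2, 4, 1, 3, 4, 2, 3, 4],
     [0, 1, 1, 2, 4, 1, 3, 4, 2, 3, 4, 2, 3, 4],
     [0, 0, 1, 2, 3, 1, 2, 4, 1, 3, 4, 2, 3, 4]]"

lemma patterns_unsat: "p \<in> set patterns \<Longrightarrow> \<not> conjs e m (system (cells (map colour_of p)))"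
proof -
  have "\<forall>p\<in>set patterns. \<not> conjs e m (system (cells (map colour_of p)))"
    unfolding patterns_def list.set ball_simps list.map
    by (simp add: unsat1 unsat2 unsat3 unsat4 unsat5 unsat6 unsat7 unsat8 unsat9 unsat10 unsat11
      unsat12 unsat13 unsat14 unsat15 unsat16 unsat17 unsat18 unsat19 unsat20 unsat21 unsat22)
  then show "p \<in> set patterns \<Longrightarrow> \<not> conjs e m (system (cells (map colour_of p)))" by blast
qed

text \<open>Rows up to the order of their vertices. Only the blank 0 may repeat, because two
  vertices of a row with the same colour would close a 4-cycle.\<close>

definition row_codes :: "nat list list" where
  "row_codes = [[0, 0, 0], [0, 0, 1], [0, 0, 2], [0, 0, 3], [0, 0, 4], [0, 1, 2], [0, 1, 3], [0, 1, 4], [0, 2, 3], [0, 2, 4], [0, 3, 4], [1, 2, 3], [1, 2, 4], [1, 3, 4], [2, 3, 4]]"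

text \<open>The colours present in the row \<open>Top\<close> are ranked first, so they are 1, or 1
  and 2.\<close>

definition top_codes :: "nat list list" where
  "top_codes = [[0, 0], [0, 1], [1, 2]]"

text \<open>A row read as a number in base five, used to sort the four interchangeable rows.\<close>

definition weight :: "nat list \<Rightarrow> nat" where
  "weight = foldl (\<lambda>a x. 5 * a + x) 0"

definition occ :: "nat \<Rightarrow> nat list \<Rightarrow> nat" where
  "occ k xs = length (filter (\<lambda>x. x = k) xs)"

text \<open>A key that orders the colours lexicographically by absence from the row
  \<open>Top\<close>, size of the class, and number of blanks in the rows where the colour occurs.
  In the relevant cases sizes are at most four and blanks at most two, so the places 100, 10 and 1
  do not interfere.\<close>

definition rank :: "nat list \<Rightarrow> nat list list \<Rightarrow> nat \<Rightarrow> nat" where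
  "rank w rs k = (if k \<in> set w then 0 else 100) + 10 * occ k (w @ concat rs) +
     sum_list (map (\<lambda>r. if k \<in> set r then occ 0 r else 0) rs)"

definition admissible :: "nat list \<Rightarrow> nat list list \<Rightarrow> bool" where
  "admissible w rs \<longleftrightarrow> list_all (\<lambda>k. occ k (w @ concat rs) = 3 \<or> occ k (w @ concat rs) = 4) [1, 2, 3, 4] \<and>
     rank w rs 1 \<le> rank w rs 2 \<and> rank w rs 2 \<le> rank w rs 3 \<and> rank w rs 3 \<le> rank w rs 4"

text \<open>Rows are put in front, heaviest first, so that finished lists are sorted. Four classes
  of at least three vertices leave at most two blanks among 14 vertices.\<close>

fun extend :: "nat \<Rightarrow> nat list \<Rightarrow> nat list list \<Rightarrow> nat list list list" where
  "extend 0 w rs = [rs]"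
| "extend (Suc n) w rs = concat (map (\<lambda>r. if (rs = [] \<or> weight (hd rs) \<ge> weight r) \<and>
     occ 0 (w @ concat (r # rs)) \<le> 2 then extend n w (r # rs) else []) row_codes)"

lemma extend_complete:
  "set ss \<subseteq> set row_codes \<Longrightarrow> occ 0 (w @ concat (ss @ rs)) \<le> 2 \<Longrightarrow>
   sorted (map weight (ss @ rs)) \<Longrightarrow> ss @ rs \<in> set (extend (length ss) w rs)"
proof (induction ss arbitrary: rs rule: rev_induct)
  case (snoc r ss)
  have "(rs = [] \<or> weight (hd rs) \<ge> weight r) \<and> occ 0 (w @ concat (r # rs)) \<le> 2"
    using snoc.prems by (cases rs) (auto simp: sorted_append occ_def)
  moreover have "ss @ r # rs \<in> set (extend (length ss) w (r # rs))"
    using snoc.IH[of "r # rs"] snoc.prems by simp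
  moreover have "r \<in> set row_codes" using snoc.prems by simp
  ultimately show ?case by auto
qed simp

lemma admissible_patterns:
  "list_all (\<lambda>w. list_all (\<lambda>rs. admissible w rs \<longrightarrow> w @ concat rs \<in> set patterns) (extend 4 w [])) top_codes"
  by code_simp

lemma admissible_unsat:
  assumes "w \<in> set top_codes" "set rs \<subseteq> set row_codes" "length rs = 4" "occ 0 (w @ concat rs) \<le> 2"
    "sorted (map weight rs)" "admissible w rs"
  shows "\<not> conjs e m (system (cells (map colour_of (w @ concat rs))))"
proof -
  have "rs \<in> set (extend 4 w [])" using extend_complete[of rs w "[]"] assms by simp
  then have "w @ concat rs \<in> set patterns"
    using admissible_patterns assms(1,6) by (simp add: list_all_iff)
  then show ?thesis by (rule patterns_unsat)
qed

section \<open>The second neighbourhood of a vertex of degree six\<close>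

lemma occ_eq_card: "distinct xs \<Longrightarrow> occ k (map f xs) = card {x \<in> set xs. f x = k}"
proof -
  assume "distinct xs"
  have "occ k (map f xs) = length (filter (\<lambda>x. f x = k) xs)" by (simp add: occ_def filter_map o_def)
  also have "\<dots> = card (set (filter (\<lambda>x. f x = k) xs))" using \<open>distinct xs\<close> by (metis distinct_card distinct_filter)
  finally show ?thesis by simp
qed

lemma occ_total: "set xs \<subseteq> {..4} \<Longrightarrow> length xs = occ 0 xs + occ 1 xs + occ 2 xs + occ 3 xs + occ 4 xs"
proof (induction xs)
  case (Cons x xs)
  then have "x = 0 \<or> x = 1 \<or> x = 2 \<or> x = 3 \<or> x = 4" by auto
  then show ?case using Cons by (auto simp: occ_def)
qed (simp add: occ_def)

lemma sorted_list_of_finite: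
  fixes f :: "'b \<Rightarrow> nat"
  assumes "finite S"
  shows "\<exists>xs. set xs = S \<and> distinct xs \<and> sorted (map f xs) \<and> length xs = card S"
proof -
  obtain xs where "set xs = S" "distinct xs" using finite_distinct_list[OF assms] by blast
  then show ?thesis by (intro exI[of _ "sort_key f xs"]) (auto simp: distinct_card)
qed

lemma row_code_in:
  assumes "x \<le> y" "y \<le> z" "z \<le> (4::nat)" "x = y \<Longrightarrow> x = 0" "y = z \<Longrightarrow> y = 0"
  shows "[x, y, z] \<in> set row_codes"
proof -
  have "z = 0 \<or> z = 1 \<or> z = 2 \<or> z = 3 \<or> z = 4" using assms(3) by arith
  moreover have "y = 0 \<or> y = 1 \<or> y = 2 \<or> y = 3 \<or> y = 4" using assms(2,3) by arith
  moreover have "x = 0 \<or> x = 1 \<or> x = 2 \<or> x = 3 \<or> x = 4" using assms(1-3) by arith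
  ultimately show ?thesis using assms by (elim disjE) (simp_all add: row_codes_def)
qed

lemma index14: "i < 14 \<Longrightarrow> i \<in> {0, 1, 2, 3, 4, 5, 6, 7, 8, 9, 10, 11, 12, 13 :: nat}"
  unfolding insert_iff empty_iff by arith

definition row_index :: "row list" where
  "row_index = [Top, Top, Row1, Row1, Row1, Row2, Row2, Row2, Row3, Row3, Row3, Row4, Row4, Row4]"

lemma length_row_index: "length row_index = 14"
  by (simp add: row_index_def)

lemma cells_iff: "length p = 14 \<Longrightarrow> (i, r, k) \<in> set (cells p) \<longleftrightarrow> i < 14 \<and> r = row_index ! i \<and> k = p ! i"
proof -
  assume l: "length p = 14"
  have u: "[0..<14] ! n = n" if "n < 14" for n :: nat using nth_upt[of 0 n 14] that by simp
  have "(i, r, k) \<in> set (cells p) \<longleftrightarrow> (\<exists>n<14. (i, r, k) = ([0..<14] ! n, zip row_index p ! n))"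
    unfolding cells_def row_index_def[symmetric] set_zip using l length_row_index by auto
  also have "\<dots> \<longleftrightarrow> (\<exists>n<14. (i, r, k) = (n, row_index ! n, p ! n))"
    using u l length_row_index by (metis nth_zip)
  finally show ?thesis by auto
qed

lemma distinct_cells: "distinct (cells p)"
  unfolding cells_def by (rule distinct_zipI1) simp

context girth5
begin

text \<open>The vertices at distance two from a vertex \<open>x\<close> of degree six that has a neighbour \<open>a\<close> of degree
  five, apart from the children \<open>Ks\<close> of \<open>a\<close>: they form the five rows \<open>W\<close> and \<open>R b\<close>, where \<open>b\<close> runs
  over the four neighbours of degree four, and are coloured by their neighbours in \<open>Ks\<close>.\<close>

lemma grid_impossible:
  fixes W Bs Ks C X :: "'a set" and R :: "'a \<Rightarrow> 'a set" and v a :: 'a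
  defines "Lr \<equiv> W \<union> (\<Union>b\<in>Bs. R b)"
  assumes fin: "finite W" "finite Bs" "finite Ks" "\<And>b. b \<in> Bs \<Longrightarrow> finite (R b)"
    and cards: "card W = 2" "card Bs = 4" "card Ks = 4" "\<And>b. b \<in> Bs \<Longrightarrow> card (R b) = 3"
    and par: "\<And>w. w \<in> W \<Longrightarrow> A v w" "\<And>b y. b \<in> Bs \<Longrightarrow> y \<in> R b \<Longrightarrow> A b y"
    and disj: "\<And>b b'. b \<in> Bs \<Longrightarrow> b' \<in> Bs \<Longrightarrow> b \<noteq> b' \<Longrightarrow> R b \<inter> R b' = {}" "\<And>b. b \<in> Bs \<Longrightarrow> R b \<inter> W = {}"
    and out: "v \<notin> Lr" "Bs \<inter> Lr = {}" "Ks \<inter> Lr = {}" "a \<notin> Lr"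
    and vB: "v \<notin> Bs" and KB: "v \<notin> Ks" "Bs \<inter> Ks = {}"
    and aK: "\<And>k. k \<in> Ks \<Longrightarrow> A a k"
    and cls: "\<And>k. k \<in> Ks \<Longrightarrow> dg Lr k = 3 \<or> dg Lr k = 4"
    and degW: "\<And>w. w \<in> W \<Longrightarrow> 4 + (if w \<in> X then 1 else 0) \<le> dg Lr w + (if \<exists>k\<in>Ks. A w k then 1 else 0)"
    and degR: "\<And>b y. b \<in> Bs \<Longrightarrow> y \<in> R b \<Longrightarrow>
          4 \<le> dg Lr y + (if \<exists>k\<in>Ks. A y k then 1 else 0) + (if y \<in> C then 1 else 0)"
    and CX: "C \<subseteq> (\<Union>b\<in>Bs. R b)" "X \<subseteq> W"
    and ind: "\<And>c c'. c \<in> C \<Longrightarrow> c' \<in> C \<Longrightarrow> \<not> A c c'"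
    and two: "\<And>y c c'. y \<in> Lr \<Longrightarrow> c \<in> C \<Longrightarrow> c' \<in> C \<Longrightarrow> c \<noteq> c' \<Longrightarrow> A y c \<Longrightarrow> A y c' \<Longrightarrow> y \<in> X"
  shows False
proof -
  define unc where "unc y \<longleftrightarrow> (\<forall>k\<in>Ks. \<not> A y k)" for y
  \<comment> \<open>The graph version of \<open>rank\<close>, available before colours have numbers;
    numbering \<open>Ks\<close> in the order of this key makes the colouring admissible.\<close>
  define \<kappa> where "\<kappa> k = (if \<exists>w\<in>W. A w k then 0 else 100) + 10 * dg Lr k +
    (\<Sum>b\<in>Bs. if \<exists>y\<in>R b. A y k then card {y \<in> R b. unc y} else 0)" for k
  obtain ks where ks: "set ks = Ks" "distinct ks" "sorted (map \<kappa> ks)" "length ks = 4"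
    using sorted_list_of_finite[OF fin(3), of \<kappa>] cards(3) by auto
  obtain k1 k2 k3 k4 where kl: "ks = [k1, k2, k3, k4]"
    using ks(4) by (auto simp: numeral_eq_Suc length_Suc_conv)
  have kin: "k1 \<in> Ks" "k2 \<in> Ks" "k3 \<in> Ks" "k4 \<in> Ks" and kdist: "distinct [k1, k2, k3, k4]"
    and Kset: "Ks = {k1, k2, k3, k4}" using ks kl by auto
  have kord: "\<kappa> k1 \<le> \<kappa> k2" "\<kappa> k2 \<le> \<kappa> k3" "\<kappa> k3 \<le> \<kappa> k4" using ks(3) kl by auto
  \<comment> \<open>The last branch also serves all other indices, so \<open>kk n\<close> is in
    \<open>Ks\<close> for every \<open>n\<close>.\<close>
  define kk where "kk n = (if n = 1 then k1 else if n = 2 then k2 else if n = 3 then k3 else k4)" for n :: nat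
  define cn :: "'a \<Rightarrow> nat" where
    "cn y = (if A y k1 then 1 else if A y k2 then 2 else if A y k3 then 3 else if A y k4 then 4 else 0)" for y
  have uniq: "k = k'" if "y \<in> Lr" "k \<in> Ks" "k' \<in> Ks" "A y k" "A y k'" for y k k'
  proof -
    have "a \<noteq> y" using that out(4) by blast
    then show ?thesis using common_unique[of a k k' y] aK that by blast
  qed
  have cn4: "cn y \<le> 4" for y by (simp add: cn_def)
  have cn0: "cn y = 0 \<longleftrightarrow> unc y" for y unfolding cn_def unc_def Kset by auto
  have cnk: "cn y = n \<longleftrightarrow> A y (kk n)" if "y \<in> Lr" "n \<in> {1, 2, 3, 4}" for y n
    using that(2) uniq[OF that(1), of k1 k2] uniq[OF that(1), of k1 k3] uniq[OF that(1), of k1 k4]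
      uniq[OF that(1), of k2 k3] uniq[OF that(1), of k2 k4] uniq[OF that(1), of k3 k4] kin kdist
    unfolding cn_def kk_def by auto
  have same_colour: "\<exists>k\<in>Ks. A y k \<and> A z k" if "y \<in> Lr" "z \<in> Lr" "cn y = cn z" "cn y \<noteq> 0" for y z
  proof -
    have "cn y \<in> {1, 2, 3, 4}" using cn4[of y] that(4) by auto
    then have "A y (kk (cn y))" "A z (kk (cn y))" "kk (cn y) \<in> Ks"
      using cnk[OF that(1), of "cn y"] cnk[OF that(2), of "cn y"] that(3) kin by (auto simp: kk_def)
    then show ?thesis by blast
  qed
  have WL: "w \<in> W \<Longrightarrow> w \<in> Lr" and RL: "b \<in> Bs \<Longrightarrow> y \<in> R b \<Longrightarrow> y \<in> Lr" for w b y by (auto simp: Lr_def)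
  have finL: "finite Lr" using fin by (simp add: Lr_def)
  define r where "r b = (SOME xs. set xs = R b \<and> distinct xs \<and> sorted (map cn xs) \<and> length xs = 3)" for b
  have r: "set (r b) = R b \<and> distinct (r b) \<and> sorted (map cn (r b)) \<and> length (r b) = 3" if "b \<in> Bs" for b
    unfolding r_def using sorted_list_of_finite[OF fin(4)[OF that], of cn] unfolding cards(4)[OF that] by (rule someI_ex)
  obtain ws where ws: "set ws = W" "distinct ws" "sorted (map cn ws)" "length ws = 2"
    using sorted_list_of_finite[OF fin(1), of cn] cards(1) by auto
  obtain bs where bs: "set bs = Bs" "distinct bs" "sorted (map (\<lambda>b. weight (map cn (r b))) bs)" "length bs = 4"
    using sorted_list_of_finite[OF fin(2), of "\<lambda>b. weight (map cn (r b))"] cards(2) by auto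
  obtain w0 w1 where wl: "ws = [w0, w1]" using ws(4) by (auto simp: numeral_eq_Suc length_Suc_conv)
  obtain b1 b2 b3 b4 where bl: "bs = [b1, b2, b3, b4]" using bs(4) by (auto simp: numeral_eq_Suc length_Suc_conv)
  have bB: "b1 \<in> Bs" "b2 \<in> Bs" "b3 \<in> Bs" "b4 \<in> Bs" using bs(1) bl by auto
  have bdist: "distinct [b1, b2, b3, b4]" using bs(2) bl by simp
  have ex3: "\<exists>x y z. r b = [x, y, z]" if "b \<in> Bs" for b
    using r[OF that] by (auto simp: numeral_eq_Suc length_Suc_conv)
  obtain y1 y2 y3 where r1: "r b1 = [y1, y2, y3]" using ex3[OF bB(1)] by blast
  obtain y4 y5 y6 where r2: "r b2 = [y4, y5, y6]" using ex3[OF bB(2)] by blast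
  obtain y7 y8 y9 where r3: "r b3 = [y7, y8, y9]" using ex3[OF bB(3)] by blast
  obtain u1 u2 u3 where r4: "r b4 = [u1, u2, u3]" using ex3[OF bB(4)] by blast
  define vs where "vs = [w0, w1, y1, y2, y3, y4, y5, y6, y7, y8, y9, u1, u2, u3]"
  define ps where "ps = [v, v, b1, b1, b1, b2, b2, b2, b3, b3, b3, b4, b4, b4]"
  have vs_eq: "vs = ws @ concat (map r bs)" by (simp add: vs_def wl bl r1 r2 r3 r4)
  have Rs: "R b1 = {y1, y2, y3}" "R b2 = {y4, y5, y6}" "R b3 = {y7, y8, y9}" "R b4 = {u1, u2, u3}"
    using r[OF bB(1)] r[OF bB(2)] r[OF bB(3)] r[OF bB(4)] r1 r2 r3 r4 by simp_all
  have Ws: "W = {w0, w1}" using ws(1) wl by simp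
  have Lset: "Lr = set vs" unfolding Lr_def bs(1)[symmetric] bl vs_def Ws by (simp add: Rs) blast
  have vdist: "distinct vs"
  proof -
    have "distinct (concat (map r bs))"
      unfolding distinct_concat_iff
    proof (intro conjI allI impI)
      have "inj_on r (set bs)"
      proof (rule inj_onI)
        fix b b' assume b: "b \<in> set bs" "b' \<in> set bs" "r b = r b'"
        then have "R b = R b'" "R b \<noteq> {}" using r[of b] r[of b'] bs(1) by auto
        then show "b = b'" using disj(1)[of b b'] b bs(1) by auto
      qed
      then show "distinct (removeAll [] (map r bs))" using bs(2) by (simp add: distinct_map distinct_removeAll)
      show "distinct ys" if "ys \<in> set (map r bs)" for ys using that r bs(1) by auto
      show "set ys \<inter> set zs = {}" if "ys \<in> set (map r bs) \<and> zs \<in> set (map r bs) \<and> ys \<noteq> zs" for ys zs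
        using that r bs(1) disj(1) by fastforce
    qed
    moreover have "set ws \<inter> set (concat (map r bs)) = {}" using ws(1) r bs(1) disj(2) by fastforce
    ultimately show ?thesis unfolding vs_eq using ws(2) by simp
  qed
  have lvs: "length vs = 14" by (simp add: vs_def)
  define q where "q = map cn vs"
  define rs where "rs = map (\<lambda>b. map cn (r b)) bs"
  have q_eq: "q = map cn ws @ concat rs" by (simp add: q_def vs_eq rs_def map_concat o_def)
  have same_row: "x = y" if "u \<notin> Lr" "A u x" "A u y" "A z x" "A z y" "z \<in> Lr" for u x y z
    using common_unique[of u x y z] that by blast
  have Rrow: "map cn (r b) \<in> set row_codes" if b: "b \<in> Bs" for b
  proof -
    obtain x y z where xyz: "r b = [x, y, z]" using ex3[OF b] by blast
    have s: "cn x \<le> cn y" "cn y \<le> cn z" "distinct [x, y, z]" "x \<in> R b" "y \<in> R b" "z \<in> R b" using r[OF b] xyz by auto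
    have z: "cn p = 0" if pt: "p \<in> R b" "t \<in> R b" "p \<noteq> t" "cn p = cn t" for p t
    proof (rule ccontr)
      assume "cn p \<noteq> 0"
      then obtain k where k: "k \<in> Ks" "A p k" "A t k" using same_colour[OF RL[OF b pt(1)] RL[OF b pt(2)] pt(4)] by blast
      have "k \<noteq> b" using k(1) b KB(2) by blast
      then show False using common_unique[of k p t b] k par(2)[OF b pt(1)] par(2)[OF b pt(2)] pt(3) adj_sym by blast
    qed
    show ?thesis
      using row_code_in[of "cn x" "cn y" "cn z"] s cn4 z[of x y] z[of y z] xyz by auto
  qed
  have hit: "(\<exists>w\<in>W. A w (kk n)) \<longleftrightarrow> n = cn w0 \<or> n = cn w1" if "n \<in> {1, 2, 3, 4}" for n
    using cnk[OF WL that, of w0] cnk[OF WL that, of w1] Ws by auto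
  have \<kappa>_small: "\<kappa> k < 100" if "k \<in> Ks" "\<exists>w\<in>W. A w k" for k
  proof -
    have "(\<Sum>b\<in>Bs. if \<exists>y\<in>R b. A y k then card {y \<in> R b. unc y} else 0) \<le> (\<Sum>b\<in>Bs. 3)"
    proof (rule sum_mono)
      fix b assume b: "b \<in> Bs"
      have "card {y \<in> R b. unc y} \<le> card (R b)" using fin(4)[OF b] by (intro card_mono) auto
      then show "(if \<exists>y\<in>R b. A y k then card {y \<in> R b. unc y} else 0) \<le> 3" using cards(4)[OF b] by simp
    qed
    then show ?thesis using cls[OF that(1)] that(2) cards(2) unfolding \<kappa>_def by auto
  qed
  \<comment> \<open>The penalty 100 outweighs everything else, so the colours that occur in
    \<open>W\<close> precede the others.\<close>
  have down: "\<exists>w\<in>W. A w k" if "\<kappa> k \<le> \<kappa> k'" "k' \<in> Ks" "\<exists>w\<in>W. A w k'" for k k'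
  proof (rule ccontr)
    assume "\<not> ?thesis"
    then have "100 \<le> \<kappa> k" by (simp add: \<kappa>_def)
    then show False using \<kappa>_small[OF that(2,3)] that(1) by simp
  qed
  have tops: "map cn ws \<in> set top_codes"
  proof -
    have o: "cn w0 \<le> cn w1" using ws(3) wl by simp
    have ne: "cn w0 = 0" if eq: "cn w0 = cn w1"
    proof (rule ccontr)
      assume "cn w0 \<noteq> 0"
      then obtain k where k: "k \<in> Ks" "A w0 k" "A w1 k" using same_colour[OF WL WL eq] Ws by blast
      have "w0 \<noteq> w1" using ws(2) wl by simp
      moreover have "k \<noteq> v" using k(1) KB(1) by blast
      ultimately show False using common_unique[of k w0 w1 v] k par(1) Ws adj_sym by blast
    qed
    have h: "2 = cn w0 \<or> 2 = cn w1 \<Longrightarrow> 1 = cn w0 \<or> 1 = cn w1"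
      "3 = cn w0 \<or> 3 = cn w1 \<Longrightarrow> 2 = cn w0 \<or> 2 = cn w1"
      "4 = cn w0 \<or> 4 = cn w1 \<Longrightarrow> 3 = cn w0 \<or> 3 = cn w1"
      using hit[of 1] hit[of 2] hit[of 3] hit[of 4] down[OF kord(1) kin(2)] down[OF kord(2) kin(3)] down[OF kord(3) kin(4)]
      by (simp_all add: kk_def)
    have "cn w0 = 0 \<and> cn w1 = 0 \<or> cn w0 = 0 \<and> cn w1 = 1 \<or> cn w0 = 1 \<and> cn w1 = 2"
      using o ne h cn4[of w1] by presburger
    then show ?thesis unfolding wl top_codes_def by auto
  qed
  have occ_k: "occ n q = dg Lr (kk n)" if "n \<in> {1, 2, 3, 4}" for n
  proof -
    have "{y \<in> set vs. cn y = n} = nb Lr (kk n)"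
      unfolding Lset[symmetric] using cnk[OF _ that] adj_sym by fastforce
    then show ?thesis using occ_eq_card[OF vdist, of n cn] by (simp add: q_def dg_def)
  qed
  have kkK: "kk n \<in> Ks" for n using kin by (simp add: kk_def)
  have rank_k: "rank (map cn ws) rs n = \<kappa> (kk n)" if n: "n \<in> {1, 2, 3, 4}" for n
  proof -
    have "n \<in> set (map cn ws) \<longleftrightarrow> (\<exists>w\<in>W. A w (kk n))" using hit[OF n] wl by auto
    moreover have "sum_list (map (\<lambda>r. if n \<in> set r then occ 0 r else 0) rs) =
      (\<Sum>b\<in>Bs. if \<exists>y\<in>R b. A y (kk n) then card {y \<in> R b. unc y} else 0)"
    proof -
      have "sum_list (map (\<lambda>r. if n \<in> set r then occ 0 r else 0) rs) =
        (\<Sum>b\<in>Bs. if n \<in> set (map cn (r b)) then occ 0 (map cn (r b)) else 0)"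
        unfolding rs_def map_map o_def bs(1)[symmetric] using bs(2) by (rule sum_list_distinct_conv_sum_set)
      also have "\<dots> = (\<Sum>b\<in>Bs. if \<exists>y\<in>R b. A y (kk n) then card {y \<in> R b. unc y} else 0)"
      proof (intro sum.cong refl)
        fix b assume b: "b \<in> Bs"
        have "n \<in> set (map cn (r b)) \<longleftrightarrow> (\<exists>y\<in>R b. A y (kk n))"
          using cnk[OF RL[OF b] n] r[OF b] by (auto simp: image_iff)
        moreover have "occ 0 (map cn (r b)) = card {y \<in> R b. unc y}"
          using occ_eq_card[of "r b" 0 cn] r[OF b] cn0 by simp
        ultimately show "(if n \<in> set (map cn (r b)) then occ 0 (map cn (r b)) else 0) =
          (if \<exists>y\<in>R b. A y (kk n) then card {y \<in> R b. unc y} else 0)" by simp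
      qed
      finally show ?thesis .
    qed
    ultimately show ?thesis unfolding rank_def \<kappa>_def q_eq[symmetric] occ_k[OF n] by simp
  qed
  have cls4: "occ n q = 3 \<or> occ n q = 4" if "n \<in> {1, 2, 3, 4}" for n using occ_k[OF that] cls[OF kkK] by simp
  have adm: "admissible (map cn ws) rs"
    unfolding admissible_def q_eq[symmetric] using cls4 rank_k kord by (simp add: kk_def)
  have lq: "length q = 14" by (simp add: q_def lvs)
  have "set q \<subseteq> {..4}" using cn4 by (auto simp: q_def)
  then have "14 = occ 0 q + occ 1 q + occ 2 q + occ 3 q + occ 4 q" using occ_total[of q] lq by simp
  then have zeros: "occ 0 q \<le> 2" using cls4[of 1] cls4[of 2] cls4[of 3] cls4[of 4] by auto
  define e where "e i j \<longleftrightarrow> i < 14 \<and> j < 14 \<and> A (vs ! i) (vs ! j)" for i j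
  \<comment> \<open>One predicate can mark both sets, because \<open>X\<close> lies inside
    \<open>W\<close> and \<open>C\<close> outside.\<close>
  define m where "m i \<longleftrightarrow> vs ! i \<in> C \<union> X" for i
  define p where "p = cells (map colour_of q)"
  have unsat: "\<not> conjs e m (system p)"
    unfolding p_def q_eq
  proof (rule admissible_unsat)
    show "set rs \<subseteq> set row_codes" using Rrow bs(1) by (auto simp: rs_def)
    show "length rs = 4" by (simp add: rs_def bs(4))
    show "occ 0 (map cn ws @ concat rs) \<le> 2" using zeros q_eq by simp
    show "sorted (map weight rs)" using bs(3) by (simp add: rs_def o_def)
  qed (rule tops adm)+
  have idx: "row_index ! i = Top \<and> vs ! i \<in> W \<and> ps ! i = v \<or> row_index ! i = Row1 \<and> vs ! i \<in> R b1 \<and> ps ! i = b1 \<or>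
      row_index ! i = Row2 \<and> vs ! i \<in> R b2 \<and> ps ! i = b2 \<or> row_index ! i = Row3 \<and> vs ! i \<in> R b3 \<and> ps ! i = b3 \<or>
      row_index ! i = Row4 \<and> vs ! i \<in> R b4 \<and> ps ! i = b4" if "i < 14" for i
    using index14[OF that] by (elim insertE) (simp_all add: vs_def row_index_def ps_def Ws Rs)
  have inL: "vs ! i \<in> Lr" if "i < 14" for i using that lvs Lset by auto
  have top: "vs ! i \<in> W" if "i < 14" "row_index ! i = Top" for i using idx[OF that(1)] that(2) by auto
  have rowR: "\<exists>b\<in>Bs. vs ! i \<in> R b" if "i < 14" "row_index ! i \<noteq> Top" for i using idx[OF that(1)] that(2) bB by auto
  have parent: "A (ps ! i) (vs ! i)" "ps ! i \<notin> Lr" if "i < 14" for i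
    using idx[OF that] par bB out(1,2) by auto
  have psrow: "ps ! i = ps ! j" if "i < 14" "j < 14" "row_index ! i = row_index ! j" for i j
    using idx[OF that(1)] idx[OF that(2)] that(3) by auto
  have cellD: "fst x < 14" "fst (snd x) = row_index ! fst x" "snd (snd x) = colour_of (cn (vs ! fst x))" if "x \<in> set p" for x
    using that cells_iff[of "map colour_of q" "fst x" "fst (snd x)" "snd (snd x)"] lq lvs unfolding p_def q_def by auto
  have cellI: "(i, row_index ! i, colour_of (cn (vs ! i))) \<in> set p" if "i < 14" for i
    using that cells_iff[of "map colour_of q"] lq lvs unfolding p_def q_def by auto
  have cell_eq: "x = y" if "x \<in> set p" "y \<in> set p" "fst x = fst y" for x y
    using cellD[OF that(1)] cellD[OF that(2)] that(3) by (simp add: prod_eq_iff)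
  have vs_inj: "vs ! i = vs ! j \<longleftrightarrow> i = j" if "i < 14" "j < 14" for i j
    using nth_eq_iff_index_eq[OF vdist] that lvs by simp
  have colour_inj: "colour_of x = colour_of y \<longleftrightarrow> x = y" if "x \<le> 4" "y \<le> 4" for x y
    using that by auto
  have colour_blank: "colour_of x = Blank \<longleftrightarrow> x = 0" for x by simp
  \<comment> \<open>The witness is the common parent for cells in one row, and the common neighbour
    in \<open>Ks\<close> for cells of one colour.\<close>
  have clash: "\<exists>u. u \<notin> Lr \<and> A u (vs ! fst x) \<and> A u (vs ! fst y)" if xy: "x \<in> set p" "y \<in> set p" "\<not> compat x y" for x y
  proof (cases "row_index ! fst x = row_index ! fst y")
    case True
    then show ?thesis using psrow[OF cellD(1)[OF xy(1)] cellD(1)[OF xy(2)]] parent cellD(1)[OF xy(1)] cellD(1)[OF xy(2)] by metis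
  next
    case False
    moreover have "compat x y \<longleftrightarrow> fst (snd x) \<noteq> fst (snd y) \<and> (snd (snd x) \<noteq> snd (snd y) \<or> snd (snd x) = Blank)"
      by (cases x; cases y) simp
    ultimately have "colour_of (cn (vs ! fst x)) = colour_of (cn (vs ! fst y)) \<and> colour_of (cn (vs ! fst x)) \<noteq> Blank"
      using xy(3) cellD[OF xy(1)] cellD[OF xy(2)] by metis
    then have "cn (vs ! fst x) = cn (vs ! fst y) \<and> cn (vs ! fst x) \<noteq> 0"
      using colour_inj[OF cn4 cn4] colour_blank by blast
    then obtain k where "k \<in> Ks" "A (vs ! fst x) k" "A (vs ! fst y) k"
      using same_colour[OF inL[OF cellD(1)[OF xy(1)]] inL[OF cellD(1)[OF xy(2)]]] by blast
    then show ?thesis using out(3) adj_sym by blast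
  qed
  have cardE: "card {w \<in> set p. e i (fst w)} = dg Lr (vs ! i)" if i: "i < 14" for i
  proof -
    have "bij_betw (\<lambda>w. vs ! fst w) {w \<in> set p. e i (fst w)} (nb Lr (vs ! i))"
      unfolding bij_betw_def
    proof
      show "inj_on (\<lambda>w. vs ! fst w) {w \<in> set p. e i (fst w)}"
        using cell_eq vs_inj cellD(1) by (intro inj_onI) blast
      show "(\<lambda>w. vs ! fst w) ` {w \<in> set p. e i (fst w)} = nb Lr (vs ! i)"
      proof
        show "(\<lambda>w. vs ! fst w) ` {w \<in> set p. e i (fst w)} \<subseteq> nb Lr (vs ! i)" using inL by (auto simp: e_def)
        show "nb Lr (vs ! i) \<subseteq> (\<lambda>w. vs ! fst w) ` {w \<in> set p. e i (fst w)}"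
        proof
          fix y assume y: "y \<in> nb Lr (vs ! i)"
          then obtain j where j: "j < 14" "y = vs ! j" using Lset lvs by (auto simp: in_set_conv_nth)
          then have "e i j" using y i by (simp add: e_def)
          then show "y \<in> (\<lambda>w. vs ! fst w) ` {w \<in> set p. e i (fst w)}" using cellI[OF j(1)] j(2) by force
        qed
      qed
    qed
    then show ?thesis using bij_betw_same_card by (fastforce simp: dg_def)
  qed
  have mC: "vs ! i \<in> C" if "i < 14" "row_index ! i \<noteq> Top" "m i" for i
    using rowR[OF that(1,2)] that(3) CX(2) disj(2) by (auto simp: m_def)
  have CW: "C \<inter> W = {}" using CX(1) disj(2) by blast
  have mX: "m i \<longleftrightarrow> vs ! i \<in> X" if "i < 14" "row_index ! i = Top" for i
    using top[OF that] CW by (auto simp: m_def)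
  have mC': "m i \<longleftrightarrow> vs ! i \<in> C" if "i < 14" "row_index ! i \<noteq> Top" for i
    using mC[OF that] by (auto simp: m_def)
  have blank: "colour_of (cn y) = Blank \<longleftrightarrow> \<not> (\<exists>k\<in>Ks. A y k)" for y using colour_blank cn0 unc_def by blast
  have "conjs e m (system p)"
  proof (rule system_sound)
    show "distinct p" unfolding p_def by (rule distinct_cells)
    show "e i j = e j i" for i j using adj_commute[of "vs ! i" "vs ! j"] by (auto simp: e_def)
    show "compat x y" if xy: "x \<in> set p" "y \<in> set p" "e (fst x) (fst y)" for x y
      using clash[OF xy(1,2)] xy(3) nbs_nonadj by (auto simp: e_def)
    show "compat x y" if xy: "z \<in> set p" "x \<in> set p" "y \<in> set p" "e (fst z) (fst x)" "e (fst z) (fst y)" "x \<noteq> y" for z x y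
    proof (rule ccontr)
      assume "\<not> compat x y"
      then obtain u where u: "u \<notin> Lr" "A u (vs ! fst x)" "A u (vs ! fst y)" using clash[OF xy(2,3)] by blast
      have "vs ! fst x = vs ! fst y"
        using same_row[OF u, of "vs ! fst z"] xy(4,5) inL cellD(1)[OF xy(1)] by (auto simp: e_def)
      then show False using vs_inj[OF cellD(1)[OF xy(2)] cellD(1)[OF xy(3)]] cell_eq[OF xy(2,3)] xy(6) by blast
    qed
    show False if "e (fst z) (fst x)" "e (fst z) (fst y)" "e (fst x) (fst y)" for z x y :: cell
      using that(3) nbs_nonadj[of "vs ! fst z" "vs ! fst x" "vs ! fst y"] that(1,2) unfolding e_def by blast
    show False if xy: "z \<in> set p" "x \<in> set p" "y \<in> set p" "t \<in> set p" "e (fst z) (fst x)" "e (fst x) (fst y)"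
      "e (fst y) (fst t)" "e (fst z) (fst t)" "z \<noteq> y" "x \<noteq> t" for z x y t
    proof -
      have "vs ! fst z \<noteq> vs ! fst y" using vs_inj cellD(1) cell_eq xy by blast
      moreover have "vs ! fst x \<noteq> vs ! fst t" using vs_inj cellD(1) cell_eq xy by blast
      ultimately show False
        using no_square[of "vs ! fst z" "vs ! fst x" "vs ! fst y" "vs ! fst t"] xy(5-8) adj_sym by (auto simp: e_def)
    qed
    show "(if k = Blank then 4 else 3) + (if m i then 1 else 0) \<le> card {w \<in> set p. e (fst (i, Top, k)) (fst w)}"
      if ik: "(i, Top, k) \<in> set p" for i k
    proof -
      have i: "i < 14" "row_index ! i = Top" "k = colour_of (cn (vs ! i))" using cellD[OF ik] by simp_all
      show ?thesis using degW[OF top[OF i(1,2)]] cardE[OF i(1)] blank[of "vs ! i"] i(3) mX[OF i(1,2)]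
        by (auto split: if_splits simp del: colour_of.simps)
    qed
    show "(if k = Blank then 4 else 3) - (if m i then 1 else 0) \<le> card {w \<in> set p. e (fst (i, r, k)) (fst w)}"
      if ik: "(i, r, k) \<in> set p" "r \<noteq> Top" for i r k
    proof -
      have i: "i < 14" "row_index ! i \<noteq> Top" "k = colour_of (cn (vs ! i))" using cellD[OF ik(1)] ik(2) by simp_all
      obtain b where "b \<in> Bs" "vs ! i \<in> R b" using rowR[OF i(1,2)] by blast
      then show ?thesis using degR[of b "vs ! i"] cardE[OF i(1)] blank[of "vs ! i"] i(3) mC'[OF i(1,2)]
        by (auto split: if_splits simp del: colour_of.simps)
    qed
    show "fst (snd z) = Top \<and> m (fst z)"
      if xy: "z \<in> set p" "x \<in> set p" "y \<in> set p" "e (fst z) (fst x)" "e (fst z) (fst y)" "x \<noteq> y"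
        "fst (snd x) \<noteq> Top" "fst (snd y) \<noteq> Top" "m (fst x)" "m (fst y)" for z x y
    proof -
      have "vs ! fst x \<in> C" "vs ! fst y \<in> C" using mC cellD xy by auto
      moreover have "vs ! fst x \<noteq> vs ! fst y" using vs_inj cellD(1) cell_eq xy by blast
      moreover have "vs ! fst z \<in> Lr" using inL cellD(1)[OF xy(1)] by blast
      ultimately have X: "vs ! fst z \<in> X" using two[of "vs ! fst z" "vs ! fst x" "vs ! fst y"] xy(4,5) by (auto simp: e_def)
      then have "vs ! fst z \<in> W" using CX(2) by blast
      then have "row_index ! fst z = Top" using rowR[OF cellD(1)[OF xy(1)]] disj(2) by blast
      then show ?thesis using X cellD(2)[OF xy(1)] by (simp add: m_def)
    qed
    show False if xy: "x \<in> set p" "y \<in> set p" "fst (snd x) \<noteq> Top" "fst (snd y) \<noteq> Top" "m (fst x)" "m (fst y)"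
      "e (fst x) (fst y)" for x y
    proof -
      have "vs ! fst x \<in> C" "vs ! fst y \<in> C" using mC cellD xy by auto
      then show False using ind xy(7) by (auto simp: e_def)
    qed
  qed
  then show False using unsat by blast
qed

end

text \<open>The neighbours of \<open>x\<close> other than \<open>v\<close> and \<open>a\<close> turn out to have degree four, and no vertex has
  distance at least three from \<open>x\<close>.\<close>

locale heavy_child = crit25 +
  fixes x a :: 'a
  assumes x_in: "x \<in> V" and dg_x: "dg V x = 6"
    and a_in: "a \<in> V" "A x a" "a \<noteq> v" "dg V a \<noteq> 4"
begin

section \<open>The grid around \<open>x\<close>\<close>

definition "Par = nb V x"
definition "Bs = Par - {v, a}"
definition "R b = nb V b - {x}"
definition "Lr = R v \<union> (\<Union>b\<in>Bs. R b)"
definition "C = {y \<in> (\<Union>b\<in>Bs. R b). dg V y = 4}"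

lemma fin: "finite Par" "finite Bs" "finite (R b)" "finite Lr"
  using finV by (auto simp: Par_def Bs_def R_def Lr_def)

lemma v_Par: "v \<in> Par" and a_Par: "a \<in> Par" and x_Par: "x \<notin> Par"
  using deg6_adj[OF x_in dg_x] v_in adj_sym a_in adj_irrefl by (auto simp: Par_def)

lemma Bs_Par: "Bs \<subseteq> Par" "v \<notin> Bs" "a \<notin> Bs"
  by (auto simp: Bs_def)

lemma card_Bs: "card Bs = 4"
proof -
  have "card Par = 6" using dg_x by (simp add: Par_def dg_def)
  moreover have "{v, a} \<subseteq> Par" using v_Par a_Par by simp
  ultimately show ?thesis unfolding Bs_def using a_in(3) by (simp add: card_Diff_subset)
qed

text \<open>With 3 for \<open>v\<close>, at least 5 for \<open>a\<close> and at least 4 for each of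
  the others, the neighbours of \<open>x\<close> already reach the maximal sum 24.\<close>

lemma Par_degs: "dg V a = 5" "b \<in> Bs \<Longrightarrow> dg V b = 4" "far V x = {}"
proof -
  have Pe: "Par = insert v (insert a Bs)" using v_Par a_Par by (auto simp: Bs_def)
  have "(\<Sum>w\<in>Par. dg V w) = dg V v + (dg V a + (\<Sum>w\<in>Bs. dg V w))"
    unfolding Pe using fin(2) Bs_Par a_in(3) by simp
  then have s: "3 + (dg V a + (\<Sum>w\<in>Bs. dg V w)) + card (far V x) = 24"
    using nb_sum_25[OF x_in] dg_v by (simp add: Par_def)
  have ge: "4 \<le> dg V w" if "w \<in> Bs" for w using that deg_ge4[of w] by (auto simp: Bs_def Par_def)
  have "(\<Sum>w\<in>Bs. 4) \<le> (\<Sum>w\<in>Bs. dg V w)" using ge by (rule sum_mono)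
  then have 16: "16 \<le> (\<Sum>w\<in>Bs. dg V w)" using card_Bs by simp
  have "5 \<le> dg V a" using deg_ge4[OF a_in(1,3)] a_in(4) by simp
  then have e: "dg V a = 5" "(\<Sum>w\<in>Bs. dg V w) = (\<Sum>w\<in>Bs. 4)" "card (far V x) = 0"
    using s 16 card_Bs by simp_all
  then show "dg V a = 5" "far V x = {}" using finV by simp_all
  show "dg V b = 4" if "b \<in> Bs" using sum_mono_inv[OF e(2)[symmetric] ge that fin(2)] by simp
qed

lemma parent: "y \<in> V \<Longrightarrow> y \<noteq> x \<Longrightarrow> y \<notin> Par \<Longrightarrow> \<exists>b\<in>Par. y \<in> R b"
proof -
  assume y: "y \<in> V" "y \<noteq> x" "y \<notin> Par"
  have "y \<notin> far V x" using Par_degs(3) by simp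
  then show ?thesis using y by (auto simp: far_def Par_def R_def)
qed

lemma parent_unique: "b \<in> Par \<Longrightarrow> b' \<in> Par \<Longrightarrow> y \<in> R b \<Longrightarrow> y \<in> R b' \<Longrightarrow> b = b'"
  using common_unique[of x b b' y] adj_sym by (auto simp: Par_def R_def)

lemma R_facts: "b \<in> Par \<Longrightarrow> y \<in> R b \<Longrightarrow> y \<in> V \<and> A b y \<and> y \<noteq> x \<and> y \<notin> Par"
  using nbs_nonadj[of x b y] by (auto simp: Par_def R_def)

lemma Lr_row: "y \<in> Lr \<Longrightarrow> \<exists>b\<in>insert v Bs. y \<in> R b"
  by (auto simp: Lr_def)

lemma Lr_facts: "y \<in> Lr \<Longrightarrow> y \<in> V \<and> y \<noteq> x \<and> y \<notin> Par"
  using Lr_row[of y] R_facts Bs_Par v_Par by blast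

lemma card_R: "b \<in> Par \<Longrightarrow> card (R b) = dg V b - 1"
  using x_in adj_sym finV by (simp add: R_def dg_def Par_def)

lemma Ks_Lr: "R a \<inter> Lr = {}"
proof -
  have False if y: "y \<in> R a" "b \<in> insert v Bs" "y \<in> R b" for y b
  proof -
    have "b \<in> Par" "b \<noteq> a" using y(2) Bs_Par v_Par a_in(3) by auto
    then show False using parent_unique[OF a_Par _ y(1,3)] by blast
  qed
  then show ?thesis using Lr_row by blast
qed

lemma one_parent: "y \<in> R b \<Longrightarrow> b \<in> Par \<Longrightarrow> dg (insert x Par) y = 1"
proof -
  assume y: "y \<in> R b" "b \<in> Par"
  have yf: "A b y" "y \<noteq> x" "y \<notin> Par" "y \<in> V" using R_facts[OF y(2,1)] by auto
  have "\<not> A y x" using yf adj_sym by (auto simp: Par_def)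
  moreover have "A y b' \<longleftrightarrow> b' = b" if "b' \<in> Par" for b'
    using parent_unique[OF that y(2) _ y(1)] yf adj_sym by (auto simp: R_def)
  ultimately have "nb (insert x Par) y = {b}" using y(2) by auto
  then show ?thesis by (simp add: dg_def)
qed

lemma dg_parts: "y \<in> R b \<Longrightarrow> b \<in> Par \<Longrightarrow> dg V y = 1 + dg (R a) y + dg Lr y"
proof -
  assume y: "y \<in> R b" "b \<in> Par"
  have "V = insert x Par \<union> (R a \<union> Lr)"
  proof
    show "V \<subseteq> insert x Par \<union> (R a \<union> Lr)"
    proof
      fix z assume z: "z \<in> V"
      show "z \<in> insert x Par \<union> (R a \<union> Lr)"
      proof (cases "z \<in> insert x Par")
        case False
        then obtain b' where "b' \<in> Par" "z \<in> R b'" using parent[OF z] by auto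
        then show ?thesis by (cases "b' = a \<or> b' = v") (auto simp: Lr_def Bs_def)
      qed blast
    qed
    show "insert x Par \<union> (R a \<union> Lr) \<subseteq> V"
      using x_in R_facts[OF a_Par] Lr_facts by (auto simp: Par_def)
  qed
  moreover have "insert x Par \<inter> (R a \<union> Lr) = {}" using R_facts[OF a_Par] Lr_facts by blast
  ultimately have "dg V y = dg (insert x Par) y + dg (R a \<union> Lr) y" using nb_partition[OF finV] by blast
  also have "dg (R a \<union> Lr) y = dg (R a) y + dg Lr y" by (rule dg_Un[OF fin(3,4) Ks_Lr])
  finally show ?thesis using one_parent[OF y] by simp
qed

lemma dg_Ks: "y \<in> Lr \<Longrightarrow> dg (R a) y = (if \<exists>k\<in>R a. A y k then 1 else 0)"
proof -
  assume y: "y \<in> Lr"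
  have "y \<noteq> a" using Lr_facts[OF y] a_Par by blast
  then have "dg (R a) y \<le> 1"
    by (intro dg_le_1[OF fin(3)]) (use common_unique[of a _ _ y] in \<open>auto simp: R_def\<close>)
  moreover have "0 < dg (R a) y \<longleftrightarrow> (\<exists>k\<in>R a. A y k)" by (rule dg_pos[OF fin(3)])
  ultimately show ?thesis by auto
qed

lemma dg_Lr: "y \<in> Lr \<Longrightarrow> dg V y = 1 + (if \<exists>k\<in>R a. A y k then 1 else 0) + dg Lr y"
proof -
  assume y: "y \<in> Lr"
  obtain b where "b \<in> Par" "y \<in> R b" using Lr_row[OF y] v_Par Bs_Par by blast
  then show ?thesis using dg_parts[of y b] dg_Ks[OF y] by simp
qed

lemma not_v: "y \<in> Lr \<Longrightarrow> y \<noteq> v" "k \<in> R a \<Longrightarrow> k \<noteq> v"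
  using v_Par by (blast dest: Lr_facts, blast dest: R_facts[OF a_Par])

text \<open>One neighbour is \<open>a\<close>, the others are in the grid. Degree six is impossible,
  since it would make \<open>k\<close> a neighbour of \<open>v\<close> and so give it two
  parents.\<close>

lemma Ks_deg: "k \<in> R a \<Longrightarrow> dg Lr k = 3 \<or> dg Lr k = 4"
proof -
  assume k: "k \<in> R a"
  have kf: "k \<in> V" "A a k" "k \<noteq> x" using R_facts[OF a_Par k] by auto
  have "dg (R a) k = 0"
    using dg_eq_0[OF fin(3)] nbs_nonadj[OF kf(2)] by (auto simp: R_def)
  then have e: "dg V k = 1 + dg Lr k" using dg_parts[OF k a_Par] by simp
  have "dg V k \<noteq> 6"
  proof
    assume "dg V k = 6"
    then have "k \<in> R v" using deg6_adj[OF kf(1)] kf by (simp add: R_def)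
    then show False using parent_unique[OF v_Par a_Par _ k] a_in(3) by blast
  qed
  then show ?thesis using e deg_le6[OF kf(1)] deg_ge4[OF kf(1) not_v(2)[OF k]] by auto
qed

text \<open>A star with five edges and degree sum 25; together with a few vertices of the grid it is
  the set to be deleted.\<close>

definition "Core = insert x (insert v Bs)"

lemma Core: "finite Core" "card Core = 6" "Core \<subseteq> V" "10 \<le> es Core" "(\<Sum>u\<in>Core. dg V u) = 25"
proof -
  have n: "x \<notin> insert v Bs" "v \<notin> Bs" using x_Par v_Par Bs_Par by auto
  show "finite Core" "card Core = 6" using fin(2) card_Bs n by (simp_all add: Core_def)
  show "Core \<subseteq> V" using x_in v_in Bs_Par by (auto simp: Core_def Par_def)
  have "2 * card (insert v Bs) \<le> es Core" unfolding Core_def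
    by (rule es_star) (use fin(2) v_Par Bs_Par in \<open>auto simp: Par_def\<close>)
  then show "10 \<le> es Core" using fin(2) card_Bs n by simp
  have "(\<Sum>u\<in>Bs. dg V u) = (\<Sum>u\<in>Bs. 4)" using Par_degs(2) by (rule sum.cong[OF refl])
  then show "(\<Sum>u\<in>Core. dg V u) = 25" using fin(2) card_Bs n dg_x dg_v by (simp add: Core_def)
qed

lemma C_facts: "c \<in> C \<Longrightarrow> c \<in> Lr \<and> c \<in> V \<and> c \<notin> Core \<and> dg V c = 4"
  using Lr_facts[of c] v_Par Bs_Par by (auto simp: C_def Core_def Lr_def)

lemma Core_nb: "y \<in> Lr \<Longrightarrow> \<exists>b\<in>Core. A y b"
  using Lr_row[of y] R_facts[of _ y] v_Par Bs_Par adj_sym unfolding Core_def by blast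

text \<open>\<open>Core\<close> with two adjacent vertices of \<open>C\<close> has eight vertices,
  at least eight edges and degree sum 33; its deletion would leave at least 32 edges on 17
  vertices.\<close>

lemma C_ind: "c \<in> C \<Longrightarrow> c' \<in> C \<Longrightarrow> \<not> A c c'"
proof
  assume c: "c \<in> C" "c' \<in> C" "A c c'"
  have cf: "c \<in> V" "c \<notin> Core" "dg V c = 4" "c \<in> Lr" "c' \<in> V" "c' \<notin> Core" "dg V c' = 4" "c' \<in> Lr"
    using C_facts[OF c(1)] C_facts[OF c(2)] by auto
  have ne: "c \<noteq> c'" using c(3) adj_neq by blast
  have fi: "finite (insert c Core)" "c' \<notin> insert c Core" using Core(1) ne cf by auto
  have "0 < dg Core c" "0 < dg Core c'" using Core_nb[OF cf(4)] Core_nb[OF cf(8)] dg_pos[OF Core(1)] by auto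
  moreover have "dg (insert c Core) c' = 1 + dg Core c'" using dg_insert[OF Core(1) cf(2)] c(3) adj_sym by auto
  ultimately have "16 \<le> es (insert c' (insert c Core))"
    using es_insert[OF fi] es_insert[OF Core(1) cf(2)] Core(4) by simp
  moreover have "insert c' (insert c Core) \<subseteq> V" using Core(3) cf by simp
  moreover have "card (insert c' (insert c Core)) = 8" using fi Core(1,2) cf(2) by simp
  moreover have "(\<Sum>u\<in>insert c' (insert c Core). dg V u) = 33" using fi Core(1,5) cf by simp
  ultimately show False
    using bound_del[OF bound17 finV, of "insert c' (insert c Core)"] card_V es_V by simp
qed

text \<open>\<open>Core\<close> with \<open>c\<close>, \<open>c'\<close> and \<open>y\<close> has
  nine vertices and at least ten edges. If \<open>y\<close> has degree d, at least 34 - d edges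
  remain on 16 vertices, so d is at least six; then \<open>y\<close> is adjacent to
  \<open>v\<close>.\<close>

lemma C_two: "y \<in> Lr \<Longrightarrow> c \<in> C \<Longrightarrow> c' \<in> C \<Longrightarrow> c \<noteq> c' \<Longrightarrow> A y c \<Longrightarrow> A y c' \<Longrightarrow> y \<in> R v \<and> dg V y = 6"
proof -
  assume c: "y \<in> Lr" "c \<in> C" "c' \<in> C" "c \<noteq> c'" "A y c" "A y c'"
  have cf: "c \<in> V" "c \<notin> Core" "dg V c = 4" "c \<in> Lr" "c' \<in> V" "c' \<notin> Core" "dg V c' = 4" "c' \<in> Lr"
    using C_facts[OF c(2)] C_facts[OF c(3)] by auto
  have yf: "y \<in> V" "y \<notin> Core" "y \<noteq> c" "y \<noteq> c'" "y \<noteq> x"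
    using Lr_facts[OF c(1)] v_Par Bs_Par c adj_neq by (auto simp: Core_def)
  let ?T = "insert c' (insert c Core)"
  have fi: "finite (insert c Core)" "c' \<notin> insert c Core" "finite ?T" "y \<notin> ?T" using Core(1) c(4) cf yf by auto
  have "0 < dg Core c" "0 < dg Core c'" "0 < dg Core y"
    using Core_nb[OF cf(4)] Core_nb[OF cf(8)] Core_nb[OF c(1)] dg_pos[OF Core(1)] by auto
  moreover have "dg Core c' \<le> dg (insert c Core) c'" using dg_mono[OF fi(1)] by blast
  moreover have "dg ?T y = 2 + dg Core y"
    using dg_insert[OF fi(1,2)] dg_insert[OF Core(1) cf(2)] c(5,6) by simp
  ultimately have "20 \<le> es (insert y ?T)"
    using es_insert[OF fi(3,4)] es_insert[OF fi(1,2)] es_insert[OF Core(1) cf(2)] Core(4) by linarith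
  moreover have "insert y ?T \<subseteq> V" using Core(3) cf yf by simp
  moreover have "card (insert y ?T) = 9" using fi Core(1,2) cf(2) by simp
  moreover have "(\<Sum>u\<in>insert y ?T. dg V u) = 33 + dg V y" using fi Core(1,5) cf by simp
  ultimately have "6 \<le> dg V y"
    using bound_del[OF bound16 finV, of "insert y ?T"] card_V es_V by simp
  then have "dg V y = 6" using deg_le6[OF yf(1)] by simp
  then show ?thesis using deg6_adj[OF yf(1)] yf by (simp add: R_def)
qed

lemma impossible: False
proof (rule grid_impossible[where W = "R v" and Bs = Bs and Ks = "R a" and R = R and v = v and a = a
      and C = C and X = "{w \<in> R v. dg V w = 6}"])
  show "finite (R v)" by (rule fin)
  show "finite Bs" by (rule fin)
  show "finite (R a)" by (rule fin)
  show "finite (R b)" for b by (rule fin)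
  show "card (R v) = 2" using card_R[OF v_Par] dg_v by simp
  show "card Bs = 4" by (rule card_Bs)
  show "card (R a) = 4" using card_R[OF a_Par] Par_degs(1) by simp
  show "card (R b) = 3" if "b \<in> Bs" for b using card_R[of b] Par_degs(2)[OF that] Bs_Par that by auto
  show "A v w" if "w \<in> R v" for w using that by (simp add: R_def)
  show "A b y" if "y \<in> R b" for b y using that by (simp add: R_def)
  show "R b \<inter> R b' = {}" if "b \<in> Bs" "b' \<in> Bs" "b \<noteq> b'" for b b'
    using parent_unique[of b b'] that Bs_Par(1) by blast
  show "R b \<inter> R v = {}" if "b \<in> Bs" for b using parent_unique[OF _ v_Par, of b] that Bs_Par by blast
  show "v \<notin> R v \<union> \<Union> (R ` Bs)" using not_v(1)[of v] by (auto simp: Lr_def)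
  show "Bs \<inter> (R v \<union> \<Union> (R ` Bs)) = {}" using Lr_facts Bs_Par(1) unfolding Lr_def by blast
  show "R a \<inter> (R v \<union> \<Union> (R ` Bs)) = {}" using Ks_Lr unfolding Lr_def by blast
  show "a \<notin> R v \<union> \<Union> (R ` Bs)" using Lr_facts[of a] a_Par unfolding Lr_def by blast
  show "v \<notin> Bs" by (rule Bs_Par)
  show "v \<notin> R a" using not_v(2) by blast
  show "Bs \<inter> R a = {}" using R_facts[OF a_Par] Bs_Par(1) by blast
  show "A a k" if "k \<in> R a" for k using that by (simp add: R_def)
  show "dg (R v \<union> \<Union> (R ` Bs)) k = 3 \<or> dg (R v \<union> \<Union> (R ` Bs)) k = 4" if "k \<in> R a" for k
    using Ks_deg[OF that] unfolding Lr_def .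
  show "4 + (if w \<in> {w \<in> R v. dg V w = 6} then 1 else 0) \<le>
      dg (R v \<union> \<Union> (R ` Bs)) w + (if \<exists>k\<in>R a. A w k then 1 else 0)" if w: "w \<in> R v" for w
  proof -
    have "w \<in> Lr" "5 \<le> dg V w" using w nb_v_deg[of w] by (auto simp: Lr_def R_def)
    then show ?thesis using dg_Lr[of w] w unfolding Lr_def[symmetric] by (auto split: if_splits)
  qed
  show "4 \<le> dg (R v \<union> \<Union> (R ` Bs)) y + (if \<exists>k\<in>R a. A y k then 1 else 0) + (if y \<in> C then 1 else 0)"
    if y: "b \<in> Bs" "y \<in> R b" for b y
  proof -
    have yL: "y \<in> Lr" using y by (auto simp: Lr_def)
    have "4 \<le> dg V y" using deg_ge4[of y] Lr_facts[OF yL] not_v(1)[OF yL] by blast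
    moreover have "y \<in> C \<longleftrightarrow> dg V y = 4" using y by (auto simp: C_def)
    ultimately show ?thesis using dg_Lr[OF yL] unfolding Lr_def[symmetric] by simp
  qed
  show "C \<subseteq> \<Union> (R ` Bs)" by (auto simp: C_def)
  show "{w \<in> R v. dg V w = 6} \<subseteq> R v" by blast
  show "\<not> A c c'" if "c \<in> C" "c' \<in> C" for c c' using C_ind[OF that] .
  show "y \<in> {w \<in> R v. dg V w = 6}"
    if "y \<in> R v \<union> \<Union> (R ` Bs)" "c \<in> C" "c' \<in> C" "c \<noteq> c'" "A y c" "A y c'" for y c c'
    using C_two[of y c c'] that unfolding Lr_def by blast
qed

end

context crit25
begin

lemma deg_le5: "u \<in> V \<Longrightarrow> dg V u \<le> 5"
proof (rule ccontr)
  assume u: "u \<in> V" "\<not> dg V u \<le> 5"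
  then have u6: "dg V u = 6" using deg_le6[OF u(1)] by simp
  have six: "dg V z = 4" if z: "w \<in> V" "dg V w = 6" "z \<in> V" "A w z" "z \<noteq> v" for w z
  proof (rule ccontr)
    assume "dg V z \<noteq> 4"
    then interpret heavy_child A V v w z by unfold_locales (use z in auto)
    show False by (rule impossible)
  qed
  have vu: "v \<in> nb V u" using deg6_adj[OF u(1) u6] v_in adj_sym by simp
  have "(\<Sum>w\<in>nb V u. dg V w) = dg V v + (\<Sum>w\<in>nb V u - {v}. dg V w)" using vu finV by (simp add: sum.remove)
  also have "(\<Sum>w\<in>nb V u - {v}. dg V w) = (\<Sum>w\<in>nb V u - {v}. 4)" using six[OF u(1) u6] by (intro sum.cong) auto
  also have "\<dots> = 20" using vu finV u6 by (simp add: dg_def)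
  finally have "card (far V u) = 1" using nb_sum_25[OF u(1)] dg_v by simp
  then obtain out where fo: "far V u = {out}" by (auto simp: card_1_singleton_iff)
  interpret outlier A V v u out
  proof unfold_locales
    show "u \<in> V" "dg V u = 6" "far V u = {out}" using u u6 fo by simp_all
    show "dg V z = 4" if "w \<in> V" "dg V w = 6" "z \<in> V" "A w z" "z \<noteq> v" for w z using that by (rule six)
  qed
  show False by (rule impossible_outlier)
qed

end

section \<open>Degrees in the extremal graphs\<close>

locale extremal25 = girth5 +
  fixes V :: "'a set"
  assumes finV: "finite V" and card_V: "card V = 25" and es_V: "es V = 114"
begin

text \<open>Exactly what the centre of a star \<open>[4, 4, 4, 3, 3]\<close> has to satisfy.\<close>

definition rich :: "'a \<Rightarrow> bool" where
  "rich a \<longleftrightarrow> a \<in> V \<and> dg V a = 5 \<and> (\<forall>u\<in>nb V a. 4 \<le> dg V u) \<and> 3 \<le> card {u \<in> nb V a. 5 \<le> dg V u}"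

lemma deg_ge3: "u \<in> V \<Longrightarrow> 3 \<le> dg V u"
  using bound_min_deg[OF bound24 finV, of u] card_V es_V by simp

lemma ex_deg_le4: "\<exists>u\<in>V. dg V u \<le> 4"
proof (rule ccontr)
  assume "\<not> ?thesis"
  then have "5 \<le> dg V u" if "u \<in> V" for u using that by fastforce
  then show False using es_ge_min[OF finV, of 5] card_V es_V by simp
qed

lemma ex_deg_ge5: "\<exists>u\<in>V. 5 \<le> dg V u"
proof (rule ccontr)
  assume "\<not> ?thesis"
  then have "dg V u \<le> 4" if "u \<in> V" for u using that by fastforce
  then show False using es_le_max[OF finV, of 4] card_V es_V by simp
qed

lemma deg3_max: "v \<in> V \<Longrightarrow> dg V v = 3 \<Longrightarrow> u \<in> V \<Longrightarrow> dg V u \<le> 5"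
proof -
  assume v: "v \<in> V" "dg V v = 3" and u: "u \<in> V"
  interpret crit25 A V v by unfold_locales (use v finV card_V es_V in auto)
  show ?thesis by (rule deg_le5[OF u])
qed

text \<open>There are 15 vertices of degree five and nine of degree four. Without a rich vertex the
  twelve vertices in \<open>P'\<close> have three neighbours in \<open>Q\<close> each and use up all
  72 ordered pairs of \<open>Q\<close>. So a neighbour \<open>y\<close> of \<open>v\<close> has at
  most one neighbour in \<open>Q\<close>, hence at least three in \<open>P'\<close>, and the
  vertices of \<open>Q\<close> reached from \<open>y\<close> would number more than nine.\<close>

lemma deg3_rich:
  assumes v: "v \<in> V" "dg V v = 3"
  shows "\<exists>a. rich a"
proof (rule ccontr)
  assume no: "\<not> ?thesis"
  interpret crit25 A V v by unfold_locales (use v finV card_V es_V in auto)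
  define P where "P = {u \<in> V. dg V u = 5}"
  define Q where "Q = {u \<in> V. dg V u = 4}"
  define N where "N = nb V v"
  define P' where "P' = P - N"
  have fin: "finite P" "finite Q" "finite N" "finite P'" using finV by (auto simp: P_def Q_def N_def P'_def)
  have degs: "dg V u = 5 \<or> dg V u = 4" if "u \<in> V" "u \<noteq> v" for u
    using deg_le5[OF that(1)] deg_ge4[OF that] by auto
  have Vpart: "V = insert v (P \<union> Q)" using degs v by (auto simp: P_def Q_def)
  have dis: "v \<notin> P \<union> Q" "P \<inter> Q = {}" using v by (auto simp: P_def Q_def)
  have NP: "N \<subseteq> P" using nb_v_deg degs adj_irrefl by (force simp: N_def P_def)
  have cN: "card N = 3" using v by (simp add: N_def dg_def)
  have cPQ: "card P + card Q = 24"
    using card_V Vpart dis fin card_Un_disjoint[OF fin(1,2) dis(2)] card_insert_disjoint[of "P \<union> Q" v] by simp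
  have "es V = dg V v + ((\<Sum>u\<in>P. dg V u) + (\<Sum>u\<in>Q. dg V u))"
    unfolding es_def by (subst Vpart) (use dis fin in \<open>simp add: sum.union_disjoint\<close>)
  then have "5 * card P + 4 * card Q = 111" using es_V v by (simp add: P_def Q_def)
  then have cP: "card P = 15" and cQ: "card Q = 9" using cPQ by simp_all
  have cP': "card P' = 12" unfolding P'_def using NP cN cP fin by (simp add: card_Diff_subset)
  have dgs: "dg V u = (if A u v then 1 else 0) + (dg P u + dg Q u)" for u
    by (subst Vpart) (use dis fin in \<open>simp add: dg_insert dg_Un\<close>)
  have many: "3 \<le> dg Q a" if a: "a \<in> P'" for a
  proof (rule ccontr)
    assume few: "\<not> ?thesis"
    have av: "a \<in> V" "dg V a = 5" "\<not> A a v" using a adj_sym by (auto simp: P'_def P_def N_def)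
    have "nb P a = {u \<in> nb V a. 5 \<le> dg V u}" using deg_le5 by (fastforce simp: P_def)
    moreover have "3 \<le> dg P a" using few dgs[of a] av by simp
    moreover have "4 \<le> dg V u" if "u \<in> nb V a" for u using that deg_ge4[of u] av(3) by auto
    ultimately have "rich a" using av by (simp add: rich_def dg_def)
    then show False using no by blast
  qed
  obtain y where y: "y \<in> N" using cN by fastforce
  have yf: "y \<in> V" "A v y" "dg V y = 5" "y \<in> P" "y \<notin> Q" "y \<notin> P'" using y NP dis by (auto simp: N_def P_def P'_def)
  have "(\<Sum>w\<in>P'. 6) \<le> (\<Sum>w\<in>P'. dg Q w * (dg Q w - 1))"
  proof (rule sum_mono)
    fix w assume "w \<in> P'"
    then have "3 * 2 \<le> dg Q w * (dg Q w - 1)" using mult_le_mono[of 3 "dg Q w" 2 "dg Q w - 1"] many[of w] by simp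
    then show "6 \<le> dg Q w * (dg Q w - 1)" by simp
  qed
  moreover have "(\<Sum>w\<in>insert y P'. dg Q w * (dg Q w - 1)) \<le> (\<Sum>w\<in>V. dg Q w * (dg Q w - 1))"
    using yf by (intro sum_mono2[OF finV]) (auto simp: P'_def P_def)
  moreover have "(\<Sum>w\<in>V. dg Q w * (dg Q w - 1)) \<le> 72" using pair_count[OF finV fin(2)] cQ by simp
  moreover have "(\<Sum>w\<in>insert y P'. dg Q w * (dg Q w - 1)) =
      dg Q y * (dg Q y - 1) + (\<Sum>w\<in>P'. dg Q w * (dg Q w - 1))"
    by (rule sum.insert[OF fin(4) yf(6)])
  moreover have "(\<Sum>w\<in>P'. 6) = (72 :: nat)" using cP' by simp
  ultimately have "dg Q y * (dg Q y - 1) = 0" by linarith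
  then have q1: "dg Q y \<le> 1" by auto
  have "dg P y = dg P' y"
  proof -
    have "nb P y = nb P' y" using nbs_nonadj[OF yf(2)] by (auto simp: P'_def N_def)
    then show ?thesis by (simp add: dg_def)
  qed
  then have s4: "dg P' y + dg Q y = 4" using dgs[of y] yf adj_sym[OF yf(2)] by simp
  define S where "S = insert y (Q \<union> nb P' y)"
  have fS: "finite S" using fin by (simp add: S_def)
  have disj: "Q \<inter> nb P' y = {}" "y \<notin> Q \<union> nb P' y" using dis yf adj_irrefl by (auto simp: P'_def)
  have cS: "card S = 10 + dg P' y" unfolding S_def using disj fin cQ
    by (simp add: card_Un_disjoint dg_def)
  have nbS: "nb S y = nb P' y \<union> nb Q y" using adj_irrefl by (auto simp: S_def)
  have "(\<Sum>w\<in>nb P' y. 4) \<le> (\<Sum>w\<in>nb P' y. dg S w)"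
  proof (rule sum_mono)
    fix w assume w: "w \<in> nb P' y"
    have "dg (insert y Q) w \<le> dg S w" by (rule dg_mono[OF fS]) (auto simp: S_def)
    moreover have "dg (insert y Q) w = 1 + dg Q w" using dg_insert[OF fin(2) yf(5)] w adj_sym by auto
    ultimately show "4 \<le> dg S w" using many[of w] w by simp
  qed
  moreover have "(\<Sum>w\<in>nb Q y. 1) \<le> (\<Sum>w\<in>nb Q y. dg S w)"
  proof (rule sum_mono)
    fix w assume "w \<in> nb Q y"
    then have "\<exists>u\<in>S. A w u" using adj_sym by (auto simp: S_def)
    then show "1 \<le> dg S w" using dg_pos[OF fS] by (simp add: Suc_le_eq)
  qed
  moreover have "(\<Sum>w\<in>nb S y. dg S w) = (\<Sum>w\<in>nb P' y. dg S w) + (\<Sum>w\<in>nb Q y. dg S w)"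
    unfolding nbS by (rule sum.union_disjoint) (use fin disj in auto)
  ultimately have "4 * dg P' y + dg Q y \<le> (\<Sum>w\<in>nb S y. dg S w)" by (simp add: dg_def)
  moreover have "(\<Sum>w\<in>nb S y. dg S w) + 1 \<le> card S" by (rule nb_sum_le[OF fS]) (simp add: S_def)
  ultimately show False using cS s4 q1 by simp
qed

text \<open>Without a rich vertex \<open>P\<close> induces degrees at most two but has at least 13
  edges on 14 vertices, so it contains a path \<open>a1\<close>, ..., \<open>a5\<close> whose three
  inner vertices have degree two in \<open>P\<close>. Their nine neighbours in \<open>Q\<close>
  leave two vertices \<open>R\<close>, and both \<open>a1\<close> and \<open>a5\<close> must be
  adjacent to all of \<open>R\<close>, which closes a 4-cycle.\<close>

lemma deg4_rich:
  assumes deg: "\<And>u. u \<in> V \<Longrightarrow> 4 \<le> dg V u \<and> dg V u \<le> 5"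
  shows "\<exists>a. rich a"
proof (rule ccontr)
  assume no: "\<not> ?thesis"
  define P where "P = {u \<in> V. dg V u = 5}"
  define Q where "Q = {u \<in> V. dg V u = 4}"
  have PQ: "V = P \<union> Q" "P \<inter> Q = {}" "finite P" "finite Q" "card P + card Q = 25" "card P + 100 = 114"
    using two_degrees[OF finV, of 4] deg card_V es_V by (simp_all add: P_def Q_def)
  have cP: "card P = 14" and cQ: "card Q = 11" using PQ(5,6) by simp_all
  have dgs: "dg V u = dg P u + dg Q u" for u using nb_partition[OF finV PQ(1,2)] .
  have few: "dg P a \<le> 2" if a: "a \<in> P" for a
  proof (rule ccontr)
    assume many: "\<not> ?thesis"
    have "nb P a = {u \<in> nb V a. 5 \<le> dg V u}" using deg by (fastforce simp: P_def)
    then have "rich a" using many a deg by (simp add: rich_def dg_def P_def)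
    then show False using no by blast
  qed
  have degP: "dg P u + dg Q u = 5" if "u \<in> P" for u
    using that unfolding dgs[symmetric] by (simp add: P_def)
  have degQ: "dg P u + dg Q u = 4" if "u \<in> Q" for u
    using that unfolding dgs[symmetric] by (simp add: Q_def)
  have "(\<Sum>u\<in>P. dg P u + dg Q u) = 70" using cP degP by simp
  then have p70: "es P + (\<Sum>u\<in>P. dg Q u) = 70" by (simp add: es_def sum.distrib)
  have "(\<Sum>u\<in>Q. dg P u + dg Q u) = 44" using cQ degQ by simp
  then have "(\<Sum>u\<in>Q. dg P u) \<le> 44" by (simp add: sum.distrib)
  then have esP: "26 \<le> es P" using p70 cross_count[OF PQ(3,4)] by simp
  define B where "B = {u \<in> P. dg P u \<le> 1}"
  have fB: "finite B" "B \<subseteq> P" using PQ(3) by (auto simp: B_def)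
  have "(\<Sum>u\<in>P. dg P u + (if u \<in> B then 1 else 0)) \<le> (\<Sum>u\<in>P. 2)"
    using few by (intro sum_mono) (auto simp: B_def)
  moreover have "P \<inter> B = B" using fB by blast
  ultimately have "es P + card B \<le> 28" using PQ(3) cP by (simp add: sum.distrib es_def sum.If_cases)
  then have cB: "card B \<le> 2" using esP by simp
  \<comment> \<open>Each vertex of \<open>B\<close> accounts for itself and at most one neighbour,
    so \<open>B\<close> could dominate at most four of the 14 vertices.\<close>
  have "\<exists>a\<in>P. a \<notin> B \<and> dg B a = 0"
  proof (rule ccontr)
    assume n: "\<not> ?thesis"
    have "(\<Sum>a\<in>P. 1) \<le> (\<Sum>a\<in>P. dg B a + (if a \<in> B then 1 else 0))"
      using n by (intro sum_mono) (auto simp: Suc_le_eq)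
    then have "14 \<le> (\<Sum>a\<in>P. dg B a) + card B"
      using PQ(3) cP \<open>P \<inter> B = B\<close> by (simp add: sum.distrib sum.If_cases)
    moreover have "(\<Sum>a\<in>P. dg B a) = (\<Sum>a\<in>B. dg P a)" by (rule cross_count[OF PQ(3) fB(1)])
    moreover have "(\<Sum>a\<in>B. dg P a) \<le> (\<Sum>a\<in>B. 1)" by (intro sum_mono) (simp add: B_def)
    ultimately show False using cB by simp
  qed
  then obtain a3 where a3: "a3 \<in> P" "a3 \<notin> B" "dg B a3 = 0" by blast
  have two: "dg P a = 2" if "a \<in> P" "a \<notin> B" for a using that few[of a] by (simp add: B_def)
  obtain a2 a4 where "nb P a3 = {a2, a4}" "a2 \<noteq> a4" using two[OF a3(1,2)] by (auto simp: dg_def card_2_iff)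
  then have a24: "a2 \<in> P" "A a3 a2" "a4 \<in> P" "A a3 a4" "a2 \<noteq> a4" by auto
  have nB: "a2 \<notin> B" "a4 \<notin> B" using a3(3) dg_eq_0[OF fB(1)] a24 by auto
  have other: "\<exists>b\<in>P. A a b \<and> b \<noteq> a3" if a: "a \<in> P" "a \<notin> B" for a
  proof -
    obtain b b' where b: "nb P a = {b, b'}" "b \<noteq> b'" using two[OF a] by (auto simp: dg_def card_2_iff)
    then have "b \<in> nb P a" "b' \<in> nb P a" by simp_all
    then show ?thesis using b(2) by auto
  qed
  obtain a1 where a1: "a1 \<in> P" "A a2 a1" "a1 \<noteq> a3" using other[OF a24(1) nB(1)] by blast
  obtain a5 where a5: "a5 \<in> P" "A a4 a5" "a5 \<noteq> a3" using other[OF a24(3) nB(2)] by blast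
  have ne: "a1 \<noteq> a5" using common_unique[of a2 a3 a1 a4] a24 a1 a5 adj_sym by blast
  have q3: "card (nb Q a) = 3" if "a \<in> P" "a \<notin> B" for a
    using dgs[of a] two[OF that] that by (simp add: P_def dg_def)
  have q3': "3 \<le> card (nb Q a)" if "a \<in> P" for a using dgs[of a] few[OF that] that by (simp add: P_def dg_def)
  have adj0: "nb Q a \<inter> nb Q b = {}" if "A a b" for a b
    using nbs_nonadj[OF that] by auto
  have com0: "nb Q a \<inter> nb Q b = {}" if "A c a" "A c b" "a \<noteq> b" "c \<in> P" for a b c
    using nbs_meet[OF that(1-3)] PQ(2) that(4) unfolding nb_def by blast
  define R where "R = Q - (nb Q a2 \<union> nb Q a3 \<union> nb Q a4)"
  have d: "nb Q a2 \<inter> nb Q a3 = {}" "nb Q a3 \<inter> nb Q a4 = {}" "nb Q a2 \<inter> nb Q a4 = {}"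
    using adj0[OF a24(2)] adj0[OF a24(4)] com0[OF a24(2,4,5) a3(1)] by auto
  have "card (nb Q a2 \<union> nb Q a3 \<union> nb Q a4) = 9"
    using q3[OF a24(1) nB(1)] q3[OF a24(3) nB(2)] q3[OF a3(1,2)] d PQ(4) by (simp add: card_Un_disjoint Int_Un_distrib2)
  moreover have "nb Q a2 \<union> nb Q a3 \<union> nb Q a4 \<subseteq> Q" by auto
  ultimately have cR: "card R = 2" unfolding R_def using cQ PQ(4) by (subst card_Diff_subset) auto
  \<comment> \<open>Of its at least three neighbours in \<open>Q\<close>, \<open>e\<close> shares
    none with \<open>b\<close> or \<open>a3\<close> and at most one with \<open>c\<close>; the other
    two fill \<open>R\<close>.\<close>
  have R_sub: "R \<subseteq> nb Q e" if e: "e \<in> P" "A b e" "A a3 b" "A a3 c" "e \<noteq> a3" "b \<in> P" "c \<in> P" "b \<noteq> c"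
      "R = Q - (nb Q b \<union> nb Q a3 \<union> nb Q c)" for b c e
  proof -
    have "e \<noteq> c" using nbs_nonadj[OF e(3,4)] e(2) by blast
    then have "dg (nb Q c) e \<le> 1"
      using common_unique[of c _ _ e] PQ(4) by (intro dg_le_1) auto
    moreover have "nb (nb Q c) e = nb Q e \<inter> nb Q c" by auto
    ultimately have one: "card (nb Q e \<inter> nb Q c) \<le> 1" by (simp add: dg_def)
    have "nb Q b \<inter> nb Q e = {}" "nb Q a3 \<inter> nb Q e = {}"
      using adj0[OF e(2)] com0[OF adj_sym[OF e(3)] e(2) e(5)[symmetric] e(6)] by auto
    then have "nb Q e = (nb Q e \<inter> nb Q c) \<union> (nb Q e \<inter> R)" unfolding e(9) by auto
    then have "card (nb Q e) \<le> card (nb Q e \<inter> nb Q c) + card (nb Q e \<inter> R)" by (metis card_Un_le)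
    then have "card R \<le> card (nb Q e \<inter> R)" using one q3'[OF e(1)] cR by simp
    then have "nb Q e \<inter> R = R" by (intro card_seteq) (auto simp: R_def PQ(4))
    then show ?thesis by blast
  qed
  have "R \<subseteq> nb Q a1" by (rule R_sub[of a1 a2 a4]) (use a1 a24 in \<open>auto simp: R_def\<close>)
  moreover have "R \<subseteq> nb Q a5" by (rule R_sub[of a5 a4 a2]) (use a5 a24 in \<open>auto simp: R_def\<close>)
  moreover obtain r r' where "R = {r, r'}" "r \<noteq> r'" using cR by (auto simp: card_2_iff)
  ultimately show False using common_unique[of a1 r r' a5] ne by auto
qed

lemma deg4_max:
  assumes deg: "\<And>u. u \<in> V \<Longrightarrow> 4 \<le> dg V u"
  shows "u \<in> V \<Longrightarrow> dg V u \<le> 6"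
  using nb_sum_min[OF finV, of u 4] deg card_V by simp

text \<open>All neighbours of a vertex of degree six have degree four. With k such vertices there
  are 6k edges into the 11 + k vertices of \<open>Q\<close>; the pair count, made linear by (d -
  1)(d - 2) \<ge> 0, gives 12k \<le> k(k - 1) + 22 + 2k. This fails for k from 3 to 7, and the
  degree sum excludes larger k.\<close>

lemma card_deg6:
  assumes deg: "\<And>u. u \<in> V \<Longrightarrow> 4 \<le> dg V u"
  shows "card {u \<in> V. dg V u = 6} \<le> 2"
proof -
  define D where "D = {u \<in> V. dg V u = 6}"
  define P where "P = {u \<in> V. dg V u = 5}"
  define Q where "Q = {u \<in> V. dg V u = 4}"
  have fin: "finite D" "finite P" "finite Q" using finV by (auto simp: D_def P_def Q_def)
  have Vp: "V = D \<union> (P \<union> Q)"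
  proof -
    have "dg V u = 4 \<or> dg V u = 5 \<or> dg V u = 6" if "u \<in> V" for u
      using deg[OF that] deg4_max[OF deg that] by auto
    then show ?thesis by (auto simp: D_def P_def Q_def)
  qed
  have dis: "P \<inter> Q = {}" "D \<inter> (P \<union> Q) = {}" by (auto simp: D_def P_def Q_def)
  have c: "card D + (card P + card Q) = 25"
    using card_V by (subst (asm) Vp) (use dis fin in \<open>simp add: card_Un_disjoint\<close>)
  have "es V = (\<Sum>u\<in>D. dg V u) + ((\<Sum>u\<in>P. dg V u) + (\<Sum>u\<in>Q. dg V u))"
    unfolding es_def by (subst Vp) (use dis fin in \<open>simp add: sum.union_disjoint\<close>)
  then have s: "6 * card D + (5 * card P + 4 * card Q) = 114" using es_V by (simp add: D_def P_def Q_def)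
  have nbD: "dg Q x = 6" if x: "x \<in> D" for x
  proof -
    have xV: "x \<in> V" "dg V x = 6" using x by (auto simp: D_def)
    have ge: "4 \<le> dg V w" if "w \<in> nb V x" for w using that deg by auto
    have "(\<Sum>w\<in>nb V x. 4) \<le> (\<Sum>w\<in>nb V x. dg V w)" using ge by (rule sum_mono)
    then have e: "(\<Sum>w\<in>nb V x. 4) = (\<Sum>w\<in>nb V x. dg V w)"
      using nb_sum_le[OF finV xV(1)] xV(2) card_V by (simp add: dg_def)
    have "dg V w = 4" if "w \<in> nb V x" for w
      using sum_mono_inv[OF e ge that] finV by simp
    then have "nb Q x = nb V x" by (auto simp: Q_def)
    then show ?thesis using xV by (simp add: dg_def)
  qed
  have "(\<Sum>q\<in>Q. dg D q) = 6 * card D" using cross_count[OF fin(3,1)] nbD by simp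
  moreover have "(\<Sum>q\<in>Q. 2 * dg D q) \<le> (\<Sum>q\<in>Q. dg D q * (dg D q - 1) + 2)"
  proof (rule sum_mono)
    fix q
    have "2 * d \<le> d * (d - 1) + 2" for d :: nat
    proof (cases "d \<le> 2")
      case True
      then have "d = 0 \<or> d = 1 \<or> d = 2" by arith
      then show ?thesis by auto
    next
      case False
      then have "d * 2 \<le> d * (d - 1)" by (intro mult_le_mono2) simp
      then show ?thesis by linarith
    qed
    then show "2 * dg D q \<le> dg D q * (dg D q - 1) + 2" .
  qed
  moreover have "(\<Sum>q\<in>Q. dg D q * (dg D q - 1)) \<le> card D * (card D - 1)"
    using pair_count[OF fin(3,1)] by simp
  moreover have "(\<Sum>q\<in>Q. 2 * dg D q) = 2 * (\<Sum>q\<in>Q. dg D q)" by (simp add: sum_distrib_left)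
  moreover have "(\<Sum>q\<in>Q. dg D q * (dg D q - 1) + 2) = (\<Sum>q\<in>Q. dg D q * (dg D q - 1)) + 2 * card Q"
    by (subst sum.distrib) simp
  ultimately have k: "12 * card D \<le> card D * (card D - 1) + 2 * card Q" by linarith
  have cQ: "card Q = 11 + card D" "card D \<le> 7" using c s by simp_all
  have "card D \<le> 2"
  proof (rule ccontr)
    assume "\<not> ?thesis"
    then have "card D = 3 \<or> card D = 4 \<or> card D = 5 \<or> card D = 6 \<or> card D = 7" using cQ(2) by arith
    then show False using k cQ(1) by auto
  qed
  then show ?thesis by (simp add: D_def)
qed

end

section \<open>Stars\<close>

lemma is_cycle_3:
  assumes "distinct [x, y, z]" "{x, y} \<in> E" "{y, z} \<in> E" "{z, x} \<in> E"
  shows "is_cycle E [x, y, z]"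
proof -
  have "{[x, y, z] ! i, [x, y, z] ! (Suc i mod 3)} \<in> E" if "i < 3" for i
  proof -
    have "i = 0 \<or> i = 1 \<or> i = 2" using that by arith
    then show ?thesis using assms(2-4) by (elim disjE) simp_all
  qed
  then show ?thesis using assms(1) by (simp add: is_cycle_def)
qed

lemma is_cycle_4:
  assumes "distinct [x, y, z, w]" "{x, y} \<in> E" "{y, z} \<in> E" "{z, w} \<in> E" "{w, x} \<in> E"
  shows "is_cycle E [x, y, z, w]"
proof -
  have "{[x, y, z, w] ! i, [x, y, z, w] ! (Suc i mod 4)} \<in> E" if "i < 4" for i
  proof -
    have "i = 0 \<or> i = 1 \<or> i = 2 \<or> i = 3" using that by arith
    then show ?thesis using assms(2-5) by (elim disjE) simp_all
  qed
  then show ?thesis using assms(1) by (simp add: is_cycle_def)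
qed

lemma simple_graph_girth5:
  assumes "simple_graph V E" "girth_at_least_5 E"
  shows "girth5 (\<lambda>x y. {x, y} \<in> E)"
proof
  have irr: "{x, x} \<notin> E" for x using assms(1) by (force simp: simple_graph_def)
  then have ne: "x \<noteq> y" if "{x, y} \<in> E" for x y using that by auto
  have no: "\<not> is_cycle E c" if "length c = 3 \<or> length c = 4" for c
    using assms(2) that by (auto simp: girth_at_least_5_def)
  show "{y, x} \<in> E" if "{x, y} \<in> E" for x y using that by (simp add: insert_commute)
  show "{x, x} \<notin> E" for x by (rule irr)
  show False if "{x, y} \<in> E" "{y, z} \<in> E" "{z, x} \<in> E" for x y z
  proof -
    have "is_cycle E [x, y, z]"
      using ne[OF that(1)] ne[OF that(2)] ne[OF that(3)] by (intro is_cycle_3 that) simp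
    then show False using no[of "[x, y, z]"] by simp
  qed
  show "u = w" if "{x, u} \<in> E" "{x, w} \<in> E" "{y, u} \<in> E" "{y, w} \<in> E" "x \<noteq> y" for x u w y
  proof (rule ccontr)
    assume "u \<noteq> w"
    then have "is_cycle E [x, u, y, w]"
      using that ne[OF that(1)] ne[OF that(2)] ne[OF that(3)] ne[OF that(4)]
      by (intro is_cycle_4) (simp_all add: insert_commute)
    then show False using no[of "[x, u, y, w]"] by simp
  qed
qed

lemma handshake:
  assumes "simple_graph V E" "finite E"
  shows "(\<Sum>v\<in>V. degree E v) = 2 * card E"
proof -
  have "degree E v = card {e \<in> E. v \<in> e}" for v
  proof -
    have "bij_betw (\<lambda>w. {v, w}) (neighbours E v) {e \<in> E. v \<in> e}"
      unfolding bij_betw_def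
    proof
      show "inj_on (\<lambda>w. {v, w}) (neighbours E v)" by (auto simp: inj_on_def doubleton_eq_iff)
      show "(\<lambda>w. {v, w}) ` neighbours E v = {e \<in> E. v \<in> e}"
      proof
        show "{e \<in> E. v \<in> e} \<subseteq> (\<lambda>w. {v, w}) ` neighbours E v"
        proof
          fix e assume e: "e \<in> {e \<in> E. v \<in> e}"
          then have "card e = 2" using assms(1) by (simp add: simple_graph_def)
          then obtain p q where "e = {p, q}" by (auto simp: card_2_iff)
          then have "e = {v, if v = p then q else p}" using e by auto
          then show "e \<in> (\<lambda>w. {v, w}) ` neighbours E v" using e by (auto simp: neighbours_def)
        qed
      qed (auto simp: neighbours_def)
    qed
    then show ?thesis by (simp add: degree_def bij_betw_same_card)
  qed
  moreover have "(\<Sum>v\<in>V. card {e \<in> E. v \<in> e}) = 2 * card E"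
  proof (rule sum_multicount)
    show "finite V" using assms(1) by (simp add: simple_graph_def)
    show "\<forall>e\<in>E. card {v \<in> V. v \<in> e} = 2"
    proof
      fix e assume "e \<in> E"
      then have "e \<subseteq> V" "card e = 2" using assms(1) by (simp_all add: simple_graph_def)
      moreover from this have "{v \<in> V. v \<in> e} = e" by blast
      ultimately show "card {v \<in> V. v \<in> e} = 2" by simp
    qed
  qed (rule assms(2))
  ultimately show ?thesis by simp
qed

lemma has_star_5_44433:
  assumes "a \<in> V" "degree E a = 5" "\<And>u. u \<in> neighbours E a \<Longrightarrow> 4 \<le> degree E u"
    and "3 \<le> card {u \<in> neighbours E a. 5 \<le> degree E u}"
  shows "has_star V E 5 [4, 4, 4, 3, 3]"
proof -
  obtain Y where Y: "Y \<subseteq> {u \<in> neighbours E a. 5 \<le> degree E u}" "card Y = 3"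
    using obtain_subset_with_card_n[OF assms(4)] by metis
  have f: "finite (neighbours E a)" using assms(2) card_ge_0_finite by (force simp: degree_def)
  have YN: "Y \<subseteq> neighbours E a" using Y(1) by blast
  have "card (neighbours E a - Y) = 2"
    using card_Diff_subset[OF finite_subset[OF YN f] YN] Y(2) assms(2) by (simp add: degree_def)
  then obtain s t where st: "neighbours E a - Y = {s, t}" "s \<noteq> t" by (auto simp: card_2_iff)
  obtain p q r where pqr: "Y = {p, q, r}" "p \<noteq> q" "q \<noteq> r" "p \<noteq> r" using Y(2) by (auto simp: card_3_iff)
  have "set [p, q, r, s, t] = neighbours E a" using st(1) YN pqr(1) by auto
  moreover have "distinct [p, q, r, s, t]" using st pqr by auto
  moreover have "list_all2 (\<lambda>k w. k + 1 \<le> degree E w) [4, 4, 4, 3, 3] [p, q, r, s, t]"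
  proof -
    have "5 \<le> degree E p" "5 \<le> degree E q" "5 \<le> degree E r" using Y(1) pqr(1) by auto
    moreover have "4 \<le> degree E s" using assms(3)[of s] st(1) by blast
    moreover have "4 \<le> degree E t" using assms(3)[of t] st(1) by blast
    ultimately show ?thesis by simp
  qed
  ultimately show ?thesis unfolding has_star_def using assms(1,2) by (intro conjI bexI[of _ a] exI[of _ "[p, q, r, s, t]"]) simp_all
qed

lemma has_star_replicate:
  assumes "a \<in> V" "degree E a = n" "0 < n" "\<And>u. u \<in> neighbours E a \<Longrightarrow> k < degree E u"
  shows "has_star V E n (replicate n k)"
proof -
  have "finite (neighbours E a)" using assms(2,3) card_ge_0_finite[of "neighbours E a"] by (simp add: degree_def)
  then obtain ns where ns: "set ns = neighbours E a" "distinct ns" using finite_distinct_list by blast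
  then have "length ns = n" using assms(2) distinct_card[OF ns(2)] by (simp add: degree_def)
  then have "list_all2 (\<lambda>k w. k + 1 \<le> degree E w) (replicate n k) ns"
    using ns(1) assms(4) nth_mem[of _ ns] by (fastforce simp: list_all2_conv_all_nth Suc_le_eq)
  then show ?thesis unfolding has_star_def using assms(1,2) ns by auto
qed

theorem theorem7:
  fixes V :: "'a set" and E :: "'a set set"
  assumes "simple_graph V E"
    and "girth_at_least_5 E"
    and "card V = 25"
    and "card E = 57"
  shows "(min_degree V E, max_degree V E) \<in> {(3, 5), (4, 5), (4, 6)} \<and>
    ((min_degree V E, max_degree V E) \<in> {(3, 5), (4, 5)} \<longrightarrow>
      has_star V E 5 [4, 4, 4, 4, 3] \<or>
      (\<not> has_star V E 5 [4, 4, 4, 4, 3] \<and> has_star V E 5 [4, 4, 4, 3, 3])) \<and>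
    ((min_degree V E, max_degree V E) = (4, 6) \<longrightarrow>
      1 \<le> deg_count V E 6 \<and> deg_count V E 6 \<le> 2 \<and>
      has_star V E 6 [3, 3, 3, 3, 3, 3])"
proof -
  interpret girth5 "\<lambda>x y. {x, y} \<in> E" by (rule simple_graph_girth5[OF assms(1,2)])
  have finV: "finite V" using assms(1) by (simp add: simple_graph_def)
  have finE: "finite E" using assms(4) card_ge_0_finite by force
  have nbE: "neighbours E u = nb V u" for u
    using assms(1) by (auto simp: neighbours_def simple_graph_def)
  then have dgE: "degree E u = dg V u" for u by (simp add: degree_def dg_def)
  have "es V = 114" using handshake[OF assms(1) finE] assms(4) by (simp add: dgE es_def)
  then interpret extremal25 "\<lambda>x y. {x, y} \<in> E" V using finV assms(3) by unfold_locales
  define D where "D = degree E ` V"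
  have D: "finite D" "D \<noteq> {}" using finV assms(3) by (auto simp: D_def)
  have inD: "dg V u \<in> D" if "u \<in> V" for u using that by (simp add: D_def dgE[symmetric])
  have Dex: "\<exists>u\<in>V. dg V u = d" if "d \<in> D" for d using that dgE by (auto simp: D_def)
  have mm: "min_degree V E = Min D" "max_degree V E = Max D" by (simp_all add: min_degree_def max_degree_def D_def)
  have lo: "Min D \<le> dg V u" and hi: "dg V u \<le> Max D" if "u \<in> V" for u using D(1) inD[OF that] by simp_all
  obtain vmin where vmin: "vmin \<in> V" "dg V vmin = Min D" using Dex[OF Min_in[OF D]] by blast
  obtain vmax where vmax: "vmax \<in> V" "dg V vmax = Max D" using Dex[OF Max_in[OF D]] by blast
  have m34: "Min D = 3 \<or> Min D = 4"
  proof -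
    obtain u where "u \<in> V" "dg V u \<le> 4" using ex_deg_le4 by blast
    then show ?thesis using lo[of u] deg_ge3[OF vmin(1)] vmin(2) by linarith
  qed
  have M5: "5 \<le> Max D"
  proof -
    obtain u where "u \<in> V" "5 \<le> dg V u" using ex_deg_ge5 by blast
    then show ?thesis using hi[of u] by linarith
  qed
  \<comment> \<open>This settles the disjunction whether or not the larger star is present.\<close>
  have star5: "has_star V E 5 [4, 4, 4, 3, 3]" if "\<exists>a. rich a"
  proof -
    obtain a where "rich a" using \<open>\<exists>a. rich a\<close> by blast
    then show ?thesis using has_star_5_44433[of a V E] unfolding rich_def nbE dgE by blast
  qed
  show ?thesis
  proof (cases "Min D = 3")
    case True
    then have v3: "dg V vmin = 3" using vmin(2) by simp
    have "Max D = 5" using deg3_max[OF vmin(1) v3 vmax(1)] vmax(2) M5 by simp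
    then show ?thesis using True star5[OF deg3_rich[OF vmin(1) v3]] by (simp add: mm)
  next
    case False
    then have 4: "Min D = 4" using m34 by simp
    then have ge4: "4 \<le> dg V u" if "u \<in> V" for u using lo[OF that] by simp
    have M6: "Max D \<le> 6" using deg4_max[OF ge4 vmax(1)] vmax(2) by simp
    show ?thesis
    proof (cases "Max D = 5")
      case True
      have "\<exists>a. rich a" by (rule deg4_rich) (use ge4 hi True in auto)
      then show ?thesis using 4 True star5 by (simp add: mm)
    next
      case False
      then have 6: "Max D = 6" using M5 M6 by simp
      have "has_star V E 6 (replicate 6 3)"
        by (rule has_star_replicate[of vmax]) (use vmax 6 ge4 in \<open>auto simp: nbE dgE Suc_le_eq[symmetric]\<close>)
      then have "has_star V E 6 [3, 3, 3, 3, 3, 3]" by (simp add: numeral_eq_Suc)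
      moreover have "deg_count V E 6 \<le> 2" using card_deg6[OF ge4] by (simp add: deg_count_def dgE)
      moreover have "0 < deg_count V E 6"
        unfolding deg_count_def using vmax 6 finV by (auto simp: card_gt_0_iff dgE)
      ultimately show ?thesis using 4 6 by (simp add: mm)
    qed
  qed
qed

end
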